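(* Let $\tau>0$, $-\tau=a_N<\dots<a_1<a_0=0$, and let $X$ be an $(\mathcal F_t)$-weak Dirichlet process with finite quadratic variation, with local martingale part $M$. Let $F:[0,T]\times C([-\tau,0])\to\mathbb R$ be continuous, such that for every $(t,\eta)$ the Fréchet derivative $DF(t,\eta)$ with respect to $\eta$ exists with values in $\mathcal D_a([-\tau,0])\oplus L^2([-\tau,0])$ and $DF:[0,T]\times C([-\tau,0])\to\mathcal D_a([-\tau,0])\oplus L^2([-\tau,0])$ is continuous. Then $(F(t,X_t(\cdot)))_{t\in[0,T]}$ is an $(\mathcal F_t)$-weak Dirichlet process with martingale part $$\bar M^F_t=F(0,X_0(\cdot))+\int_0^tD^{\delta_0}F(s,X_s(\cdot))\,dM_s.$$
   Context: Fix a probability space with filtration $(\mathcal F_t)$ satisfying the usual conditions and $T>0$; processes on $[0,T]$ are extended by $X_t=X_0$ for $t\le0$, $X_t=X_T$ for $t\ge T$. For real processes $X,Y$ with $X$ continuous, $[X,Y]^{\epsilon}_t=\int_0^t\frac{(X_{s+\epsilon}-X_s)(Y_{s+\epsilon}-Y_s)}{\epsilon}ds$; $X,Y$ admit a covariation $[X,Y]$ if for each $t$ the limit in probability exists and has a continuous modification; finite quadratic variation means $[X,X]$ exists. An adapted process $A$ is $(\mathcal F_t)$-martingale orthogonal if $[A,N]=0$ for every continuous $(\mathcal F_t)$-local martingale $N$. A continuous real process is $(\mathcal F_t)$-weak Dirichlet if it equals $M+A$ with $M$ a continuous $(\mathcal F_t)$-local martingale (its martingale part) and $A$ martingale orthogonal,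 $A_0=0$. Window process: $X_t(y)=X_{t+y}$, $y\in[-\tau,0]$. $\mathcal D_a([-\tau,0])=\{\sum_{i=0}^N\lambda_i\delta_{a_i}\}$, $L^2([-\tau,0])$ identified with measures $g(x)dx$; their direct sum is a Hilbert subspace of $\mathcal M([-\tau,0])$. $D^{\delta_0}F(t,\eta):=DF(t,\eta)(\{0\})$. *)

theory Defs
  imports "HOL-Probability.Probability"
begin

definition usual_filtration :: "'a measure \<Rightarrow> real \<Rightarrow> (real \<Rightarrow> 'a measure) \<Rightarrow> bool" where
  "usual_filtration M T Fi \<longleftrightarrow>
     (\<forall>t\<in>{0..T}. subalgebra M (Fi t)) \<and>
     (\<forall>s t. 0 \<le> s \<longrightarrow> s \<le> t \<longrightarrow> t \<le> T \<longrightarrow> sets (Fi s) \<subseteq> sets (Fi t)) \<and>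
     (\<forall>t\<in>{0..<T}. sets (Fi t) = (\<Inter>s\<in>{t<..T}. sets (Fi s))) \<and>
     (\<forall>A. A \<subseteq> space M \<and> (\<exists>N\<in>null_sets M. A \<subseteq> N) \<longrightarrow> A \<in> sets (Fi 0))"

definition ext_proc :: "real \<Rightarrow> (real \<Rightarrow> 'a \<Rightarrow> real) \<Rightarrow> real \<Rightarrow> 'a \<Rightarrow> real" where
  "ext_proc T X t = X (max 0 (min t T))"

definition cont_proc :: "'a measure \<Rightarrow> real \<Rightarrow> (real \<Rightarrow> 'a \<Rightarrow> real) \<Rightarrow> bool" where
  "cont_proc M T X \<longleftrightarrow> (\<forall>\<omega>\<in>space M. continuous_on {0..T} (\<lambda>t. X t \<omega>))"

definition adapted :: "real \<Rightarrow> (real \<Rightarrow> 'a measure) \<Rightarrow> (real \<Rightarrow> 'a \<Rightarrow> real) \<Rightarrow> bool" where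
  "adapted T Fi X \<longleftrightarrow> (\<forall>t\<in>{0..T}. X t \<in> borel_measurable (Fi t))"

definition tendsto_in_prob :: "'a measure \<Rightarrow> (real \<Rightarrow> 'a \<Rightarrow> real) \<Rightarrow> ('a \<Rightarrow> real) \<Rightarrow> bool" where
  "tendsto_in_prob M f g \<longleftrightarrow> g \<in> borel_measurable M \<and>
     (\<forall>\<^sub>F e in at_right 0. f e \<in> borel_measurable M) \<and>
     (\<forall>\<delta>>0. ((\<lambda>e. measure M {\<omega>\<in>space M. \<delta> < \<bar>f e \<omega> - g \<omega>\<bar>}) \<longlongrightarrow> 0) (at_right 0))"

definition tendsto_in_prob_seq :: "'a measure \<Rightarrow> (nat \<Rightarrow> 'a \<Rightarrow> real) \<Rightarrow> ('a \<Rightarrow> real) \<Rightarrow> bool" where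
  "tendsto_in_prob_seq M f g \<longleftrightarrow> g \<in> borel_measurable M \<and>
     (\<forall>\<^sub>F n in sequentially. f n \<in> borel_measurable M) \<and>
     (\<forall>\<delta>>0. ((\<lambda>n. measure M {\<omega>\<in>space M. \<delta> < \<bar>f n \<omega> - g \<omega>\<bar>}) \<longlongrightarrow> 0) sequentially)"

definition cov_eps :: "real \<Rightarrow> (real \<Rightarrow> 'a \<Rightarrow> real) \<Rightarrow> (real \<Rightarrow> 'a \<Rightarrow> real) \<Rightarrow> real \<Rightarrow> real \<Rightarrow> 'a \<Rightarrow> real" where
  "cov_eps T X Y e t \<omega> =
     (LBINT s=0..t. (ext_proc T X (s + e) \<omega> - ext_proc T X s \<omega>) *
                     (ext_proc T Y (s + e) \<omega> - ext_proc T Y s \<omega>) / e)"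

definition is_covariation :: "'a measure \<Rightarrow> real \<Rightarrow> (real \<Rightarrow> 'a \<Rightarrow> real) \<Rightarrow> (real \<Rightarrow> 'a \<Rightarrow> real)
      \<Rightarrow> (real \<Rightarrow> 'a \<Rightarrow> real) \<Rightarrow> bool" where
  "is_covariation M T X Y C \<longleftrightarrow> cont_proc M T C \<and>
     (\<forall>t\<in>{0..T}. tendsto_in_prob M (\<lambda>e. cov_eps T X Y e t) (C t))"

definition finite_quadratic_variation :: "'a measure \<Rightarrow> real \<Rightarrow> (real \<Rightarrow> 'a \<Rightarrow> real) \<Rightarrow> bool" where
  "finite_quadratic_variation M T X \<longleftrightarrow> (\<exists>C. is_covariation M T X X C)"

definition stopping_time_on :: "'a measure \<Rightarrow> real \<Rightarrow> (real \<Rightarrow> 'a measure) \<Rightarrow> ('a \<Rightarrow> real) \<Rightarrow> bool" where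
  "stopping_time_on M T Fi \<sigma> \<longleftrightarrow> (\<forall>\<omega>\<in>space M. \<sigma> \<omega> \<in> {0..T}) \<and>
     (\<forall>t\<in>{0..T}. {\<omega>\<in>space M. \<sigma> \<omega> \<le> t} \<in> sets (Fi t))"

definition martingale_on :: "'a measure \<Rightarrow> real \<Rightarrow> (real \<Rightarrow> 'a measure) \<Rightarrow> (real \<Rightarrow> 'a \<Rightarrow> real) \<Rightarrow> bool" where
  "martingale_on M T Fi N \<longleftrightarrow> adapted T Fi N \<and> (\<forall>t\<in>{0..T}. integrable M (N t)) \<and>
     (\<forall>s t. 0 \<le> s \<longrightarrow> s \<le> t \<longrightarrow> t \<le> T \<longrightarrow>
        (AE \<omega> in M. real_cond_exp M (Fi s) (N t) \<omega> = N s \<omega>))"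

definition local_martingale_on :: "'a measure \<Rightarrow> real \<Rightarrow> (real \<Rightarrow> 'a measure) \<Rightarrow> (real \<Rightarrow> 'a \<Rightarrow> real) \<Rightarrow> bool" where
  "local_martingale_on M T Fi N \<longleftrightarrow> adapted T Fi N \<and>
     (\<exists>\<sigma> :: nat \<Rightarrow> 'a \<Rightarrow> real.
        (\<forall>n. stopping_time_on M T Fi (\<sigma> n)) \<and>
        (\<forall>\<omega>\<in>space M. mono (\<lambda>n. \<sigma> n \<omega>)) \<and>
        (AE \<omega> in M. \<exists>n. \<sigma> n \<omega> = T) \<and>
        (\<forall>n. martingale_on M T Fi (\<lambda>t \<omega>. N (min t (\<sigma> n \<omega>)) \<omega> - N 0 \<omega>)))"

definition cont_local_martingale :: "'a measure \<Rightarrow> real \<Rightarrow> (real \<Rightarrow> 'a measure) \<Rightarrow> (real \<Rightarrow> 'a \<Rightarrow> real) \<Rightarrow> bool" where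
  "cont_local_martingale M T Fi N \<longleftrightarrow> cont_proc M T N \<and> local_martingale_on M T Fi N"

definition martingale_orthogonal :: "'a measure \<Rightarrow> real \<Rightarrow> (real \<Rightarrow> 'a measure) \<Rightarrow> (real \<Rightarrow> 'a \<Rightarrow> real) \<Rightarrow> bool" where
  "martingale_orthogonal M T Fi A \<longleftrightarrow> adapted T Fi A \<and>
     (\<forall>N. cont_local_martingale M T Fi N \<longrightarrow> is_covariation M T A N (\<lambda>t \<omega>. 0))"

definition weak_dirichlet_mp :: "'a measure \<Rightarrow> real \<Rightarrow> (real \<Rightarrow> 'a measure) \<Rightarrow> (real \<Rightarrow> 'a \<Rightarrow> real)
      \<Rightarrow> (real \<Rightarrow> 'a \<Rightarrow> real) \<Rightarrow> bool" where
  "weak_dirichlet_mp M T Fi X Mp \<longleftrightarrow> cont_proc M T X \<and> cont_local_martingale M T Fi Mp \<and>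
     (\<forall>\<omega>\<in>space M. X 0 \<omega> - Mp 0 \<omega> = 0) \<and>
     martingale_orthogonal M T Fi (\<lambda>t \<omega>. X t \<omega> - Mp t \<omega>)"

text \<open>Stochastic (Ito) integral of a continuous adapted integrand H against a continuous local
  martingale N, as a continuous process I with I_t the limit in probability of the left-point
  Riemann sums along any sequence of partitions of [0,t] with mesh tending to 0.\<close>
definition is_partition :: "real \<Rightarrow> nat \<Rightarrow> (nat \<Rightarrow> real) \<Rightarrow> bool" where
  "is_partition t k p \<longleftrightarrow> p 0 = 0 \<and> p k = t \<and> (\<forall>i<k. p i < p (Suc i))"

definition is_stoch_integral :: "'a measure \<Rightarrow> real \<Rightarrow> (real \<Rightarrow> 'a \<Rightarrow> real) \<Rightarrow> (real \<Rightarrow> 'a \<Rightarrow> real)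
      \<Rightarrow> (real \<Rightarrow> 'a \<Rightarrow> real) \<Rightarrow> bool" where
  "is_stoch_integral M T H N I \<longleftrightarrow> cont_proc M T I \<and>
     (\<forall>t\<in>{0..T}. \<forall>(k :: nat \<Rightarrow> nat) (p :: nat \<Rightarrow> nat \<Rightarrow> real).
        (\<forall>n. is_partition t (k n) (p n)) \<and>
        (\<forall>e>0. \<forall>\<^sub>F n in sequentially. \<forall>i<k n. p n (Suc i) - p n i < e) \<longrightarrow>
        tendsto_in_prob_seq M
          (\<lambda>n \<omega>. \<Sum>i<k n. H (p n i) \<omega> * (N (p n (Suc i)) \<omega> - N (p n i) \<omega>)) (I t))"

text \<open>C([-\<tau>,0]) with the sup norm is modelled isometrically as the closed subspace of
  bounded continuous functions on the real line that are constant outside [-\<tau>,0]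
  (extension by \<eta>(-\<tau>) to the left and \<eta>(0) to the right).\<close>
definition clamp :: "real \<Rightarrow> real \<Rightarrow> real" where
  "clamp \<tau> x = max (-\<tau>) (min x 0)"

definition Cpath :: "real \<Rightarrow> (real \<Rightarrow>\<^sub>C real) set" where
  "Cpath \<tau> = {\<eta>. \<forall>x. apply_bcontfun \<eta> x = apply_bcontfun \<eta> (clamp \<tau> x)}"

definition window :: "real \<Rightarrow> real \<Rightarrow> (real \<Rightarrow> 'a \<Rightarrow> real) \<Rightarrow> real \<Rightarrow> 'a \<Rightarrow> (real \<Rightarrow>\<^sub>C real)" where
  "window \<tau> T X t \<omega> = Bcontfun (\<lambda>y. ext_proc T X (t + clamp \<tau> y) \<omega>)"

text \<open>Element of \<open>D_a \<oplus> L^2\<close> given by coefficients l_0..l_N (of the Dirac masses at a_i)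
  and a density g; its action on a path h.\<close>
definition Da_L2_apply :: "real \<Rightarrow> nat \<Rightarrow> (nat \<Rightarrow> real) \<Rightarrow> (nat \<Rightarrow> real) \<Rightarrow> (real \<Rightarrow> real)
      \<Rightarrow> (real \<Rightarrow>\<^sub>C real) \<Rightarrow> real" where
  "Da_L2_apply \<tau> N a l g h =
     (\<Sum>i\<le>N. l i * apply_bcontfun h (a i)) + (LINT x:{-\<tau>..0}|lborel. g x * apply_bcontfun h x)"

definition in_L2 :: "real \<Rightarrow> (real \<Rightarrow> real) \<Rightarrow> bool" where
  "in_L2 \<tau> g \<longleftrightarrow> g \<in> borel_measurable lborel \<and> set_integrable lborel {-\<tau>..0} (\<lambda>x. (g x)\<^sup>2)"

definition Da_L2_dist2 :: "real \<Rightarrow> nat \<Rightarrow> (nat \<Rightarrow> real) \<Rightarrow> (real \<Rightarrow> real) \<Rightarrow> (nat \<Rightarrow> real) \<Rightarrow> (real \<Rightarrow> real) \<Rightarrow> real" where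
  "Da_L2_dist2 \<tau> N l g l' g' =
     (\<Sum>i\<le>N. (l i - l' i)\<^sup>2) + (LINT x:{-\<tau>..0}|lborel. (g x - g' x)\<^sup>2)"

end

theory Submission
  imports Defs
begin

text \<open>
  Let \<open>N\<close> be a continuous local martingale. The increment of \<open>F(t, X_t)\<close> over \<open>[s, s + e]\<close> is split by freezing
  the path of \<open>X\<close> at time \<open>s\<close>. Along the frozen path the increment is known at time \<open>s\<close> and uniformly small, so
  by orthogonality of martingale increments its product with the increment of \<open>N\<close> does not contribute to
  the covariation. Unfreezing changes the window only on \<open>[-e, 0]\<close>: of the Dirac masses it sees only the one at
  \<open>0\<close>, and the \<open>L^2\<close> part is of order \<open>sqrt e\<close>. By the mean value theorem what remains is the coefficient of
  \<open>\<delta>_0\<close> times the increment of \<open>X\<close>, up to an error that finite quadratic variation makes negligible.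
  Since \<open>[X - M, N] = 0\<close>, only the coefficient times the increment of \<open>M\<close> survives, and the stochastic integral
  compensates it.

  The stochastic integral is constructed as a limit of Riemann sums. All estimates on it come from one
  \<open>L^2\<close> bound for martingale transforms whose weights are truncated at a given modulus of continuity of the
  integrand, which holds off an event of small probability; no bracket process is needed.
\<close>

section \<open>Bounded martingales and martingale transforms\<close>

text \<open>The modulus of continuity of a path is random and looks into the future, so it cannot
  enter the weights of a martingale transform. Cutting the weights at a constant keeps them adapted
  and bounded for every outcome; this is why events of small probability are given up before any L2
  bound is used, and why the localising bound is fixed before the truncation level, which is divided
  by it.

  The regularised covariation integrates products of overlapping increments, divided by
  \<open>e\<close>. Absolute values leave no room there: a uniformly small factor times an increment
  of \<open>N\<close> need not vanish. Orthogonality is recovered by averaging over sums along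
  meshes of step \<open>e\<close>. A factor that is not adapted must instead be small relative to
  |increment of X| + sqrt e, because only then does it meet quantities that stay tight.

  Balls of C([-\<tau>,0]) are not compact, so continuity of \<open>DF\<close> alone gives no
  uniformity. Along one path, however, the windows and the segments joining frozen to unfrozen
  windows form compact sets, and every pathwise estimate lives on these.\<close>

lemma mono_upto:
  fixes p :: "nat \<Rightarrow> real"
  assumes "\<And>i. i < k \<Longrightarrow> p i \<le> p (Suc i)" "i \<le> k"
  shows "p i \<le> p k"
  using assms(2) by (induction k rule: dec_induct) (use assms in \<open>auto intro: order_trans\<close>)

lemma floor_approx: "(\<lambda>n. real_of_int \<lfloor>real (Suc n) * x\<rfloor> / real (Suc n)) \<longlonglongrightarrow> x"
proof (rule real_tendsto_sandwich)
  show "(\<lambda>n. x - 1 / real (Suc n)) \<longlonglongrightarrow> x"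
    using tendsto_diff[OF tendsto_const LIMSEQ_inverse_real_of_nat, of x] by (simp add: inverse_eq_divide)
  show "\<forall>\<^sub>F n in sequentially. x - 1 / real (Suc n) \<le> real_of_int \<lfloor>real (Suc n) * x\<rfloor> / real (Suc n)"
  proof (rule always_eventually, rule allI)
    fix n
    have "real (Suc n) * x - 1 \<le> real_of_int \<lfloor>real (Suc n) * x\<rfloor>" by linarith
    then have "(real (Suc n) * x - 1) / real (Suc n) \<le> real_of_int \<lfloor>real (Suc n) * x\<rfloor> / real (Suc n)"
      by (rule divide_right_mono) simp
    then show "x - 1 / real (Suc n) \<le> real_of_int \<lfloor>real (Suc n) * x\<rfloor> / real (Suc n)"
      by (simp add: diff_divide_distrib)
  qed
  show "\<forall>\<^sub>F n in sequentially. real_of_int \<lfloor>real (Suc n) * x\<rfloor> / real (Suc n) \<le> x"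
  proof (rule always_eventually, rule allI)
    fix n
    have "real_of_int \<lfloor>real (Suc n) * x\<rfloor> \<le> real (Suc n) * x" by linarith
    then show "real_of_int \<lfloor>real (Suc n) * x\<rfloor> / real (Suc n) \<le> x"
      by (subst pos_divide_le_eq) (auto simp: mult.commute)
  qed
qed simp

locale filtered_space = prob_space M for M :: "'a measure" +
  fixes Fi :: "real \<Rightarrow> 'a measure" and T :: real
  assumes T_pos: "0 < T" and usual: "usual_filtration M T Fi"
begin

text \<open>Clamping the time gives a filtration on the whole line, so shifted times such as
  \<open>s + e\<close> need no range conditions. Outside [0,T] it is constant, like the extended
  processes.\<close>

definition G :: "real \<Rightarrow> 'a measure" where
  "G t = Fi (max 0 (min t T))"

lemma subalg_G: "subalgebra M (G t)"
  using usual T_pos unfolding usual_filtration_def G_def by auto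

lemma space_G [simp]: "space (G t) = space M"
  using subalg_G[of t] by (simp add: subalgebra_def)

lemma sets_G_mono: "s \<le> t \<Longrightarrow> sets (G s) \<subseteq> sets (G t)"
  using usual T_pos unfolding usual_filtration_def G_def by (auto simp: min_def max_def)

lemma sets_G_M: "A \<in> sets (G s) \<Longrightarrow> A \<in> sets M"
  using subalg_G[of s] by (auto simp: subalgebra_def)

lemma meas_G_mono: "f \<in> borel_measurable (G s) \<Longrightarrow> s \<le> t \<Longrightarrow> f \<in> borel_measurable (G t)"
  by (rule measurable_from_subalg[of "G t" "G s"]) (simp_all add: subalgebra_def sets_G_mono)

lemma meas_G_M: "f \<in> borel_measurable (G s) \<Longrightarrow> f \<in> borel_measurable M"
  by (rule measurable_from_subalg[OF subalg_G])

text \<open>Completeness of the filtration lets an almost sure limit be redefined on its exceptional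
  set without losing adaptedness.\<close>

lemma null_G:
  assumes "A \<subseteq> space M" "N \<in> null_sets M" "A \<subseteq> N"
  shows "A \<in> sets (G t)"
proof -
  have "A \<in> sets (Fi 0)" using usual assms unfolding usual_filtration_def by blast
  then have "A \<in> sets (G 0)" using T_pos by (simp add: G_def)
  then have "A \<in> sets (G (max 0 t))" using sets_G_mono[of 0 "max 0 t"] by auto
  moreover have "G (max 0 t) = G t" by (simp add: G_def max_def min_def)
  ultimately show ?thesis by simp
qed

lemma integrable_bdd:
  fixes f :: "'a \<Rightarrow> real"
  assumes "f \<in> borel_measurable M" "\<And>\<omega>. \<omega> \<in> space M \<Longrightarrow> \<bar>f \<omega>\<bar> \<le> C"
  shows "integrable M f"
  by (rule integrable_const_bound[of _ C]) (use assms in auto)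

lemma integrable_bdd_mult:
  fixes f g :: "'a \<Rightarrow> real"
  assumes "f \<in> borel_measurable M" "\<And>\<omega>. \<omega> \<in> space M \<Longrightarrow> \<bar>f \<omega>\<bar> \<le> C"
    and "g \<in> borel_measurable M" "\<And>\<omega>. \<omega> \<in> space M \<Longrightarrow> \<bar>g \<omega>\<bar> \<le> D"
  shows "integrable M (\<lambda>\<omega>. f \<omega> * g \<omega>)"
  by (rule integrable_bdd[of _ "C * D"])
    (use assms in \<open>auto simp: abs_mult intro!: mult_mono intro: order_trans[OF abs_ge_zero]\<close>)

lemma expectation_square_add:
  fixes f g :: "'a \<Rightarrow> real"
  assumes "f \<in> borel_measurable M" "\<And>\<omega>. \<omega> \<in> space M \<Longrightarrow> \<bar>f \<omega>\<bar> \<le> C"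
    and "g \<in> borel_measurable M" "\<And>\<omega>. \<omega> \<in> space M \<Longrightarrow> \<bar>g \<omega>\<bar> \<le> D"
    and "expectation (\<lambda>\<omega>. f \<omega> * g \<omega>) = 0"
  shows "expectation (\<lambda>\<omega>. (f \<omega> + g \<omega>)\<^sup>2) = expectation (\<lambda>\<omega>. (f \<omega>)\<^sup>2) + expectation (\<lambda>\<omega>. (g \<omega>)\<^sup>2)"
proof -
  have i: "integrable M (\<lambda>\<omega>. (f \<omega>)\<^sup>2)" "integrable M (\<lambda>\<omega>. (g \<omega>)\<^sup>2)" "integrable M (\<lambda>\<omega>. f \<omega> * g \<omega>)"
    unfolding power2_eq_square using assms by (auto intro!: integrable_bdd_mult)
  have "expectation (\<lambda>\<omega>. (f \<omega> + g \<omega>)\<^sup>2)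
      = expectation (\<lambda>\<omega>. (f \<omega>)\<^sup>2 + (g \<omega>)\<^sup>2 + 2 * (f \<omega> * g \<omega>))"
    by (rule Bochner_Integration.integral_cong) (auto simp: power2_sum)
  also have "\<dots> = expectation (\<lambda>\<omega>. (f \<omega>)\<^sup>2) + expectation (\<lambda>\<omega>. (g \<omega>)\<^sup>2)"
    using i assms(5) by (simp del: mult.assoc)
  finally show ?thesis .
qed

definition cont_adapted :: "(real \<Rightarrow> 'a \<Rightarrow> real) \<Rightarrow> bool" where
  "cont_adapted Y \<longleftrightarrow> (\<forall>t. Y t \<in> borel_measurable (G t)) \<and>
     (\<forall>\<omega>\<in>space M. continuous_on UNIV (\<lambda>t. Y t \<omega>))"

text \<open>The martingale property is expressed by testing increments against bounded
  \<open>G s\<close>-measurable variables instead of through conditional expectations. This is the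
  form in which earlier weights and earlier increments are inserted.\<close>

definition bdd_mart :: "(real \<Rightarrow> 'a \<Rightarrow> real) \<Rightarrow> bool" where
  "bdd_mart Y \<longleftrightarrow> cont_adapted Y \<and> (\<exists>C. \<forall>t. \<forall>\<omega>\<in>space M. \<bar>Y t \<omega>\<bar> \<le> C) \<and>
     (\<forall>s t Z C. s \<le> t \<longrightarrow> Z \<in> borel_measurable (G s) \<longrightarrow> (\<forall>\<omega>\<in>space M. \<bar>Z \<omega>\<bar> \<le> C) \<longrightarrow>
        expectation (\<lambda>\<omega>. Z \<omega> * (Y t \<omega> - Y s \<omega>)) = 0)"

text \<open>In terms of brackets this would follow from
  \<open>d[Y] \<le> \<delta>\<^sup>2 d[L]\<close>. Comparing second moments over deterministic
  intervals suffices for the maximal and Chebyshev bounds and survives concatenation in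
  time.\<close>

definition dominated :: "real \<Rightarrow> (real \<Rightarrow> 'a \<Rightarrow> real) \<Rightarrow> (real \<Rightarrow> 'a \<Rightarrow> real) \<Rightarrow> bool" where
  "dominated \<delta> L Y \<longleftrightarrow> bdd_mart Y \<and> (\<forall>s t. s \<le> t \<longrightarrow>
     expectation (\<lambda>\<omega>. (Y t \<omega> - Y s \<omega>)\<^sup>2) \<le> \<delta>\<^sup>2 * expectation (\<lambda>\<omega>. (L t \<omega> - L s \<omega>)\<^sup>2))"

lemma cont_adapted_meas: "cont_adapted Y \<Longrightarrow> Y t \<in> borel_measurable (G t)"
  by (simp add: cont_adapted_def)

lemma cont_adapted_cont: "cont_adapted Y \<Longrightarrow> \<omega> \<in> space M \<Longrightarrow> continuous_on A (\<lambda>t. Y t \<omega>)"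
  unfolding cont_adapted_def by (meson continuous_on_subset top_greatest)

lemma bdd_mart_cproc: "bdd_mart Y \<Longrightarrow> cont_adapted Y" by (simp add: bdd_mart_def)

lemma bdd_mart_meas: "bdd_mart Y \<Longrightarrow> Y t \<in> borel_measurable (G t)"
  by (simp add: bdd_mart_def cont_adapted_def)

lemma bdd_mart_meas_M [measurable_dest]: "bdd_mart Y \<Longrightarrow> Y t \<in> borel_measurable M"
  using bdd_mart_meas meas_G_M by blast

lemma bdd_mart_bdd: "bdd_mart Y \<Longrightarrow> \<exists>C\<ge>0. \<forall>t. \<forall>\<omega>\<in>space M. \<bar>Y t \<omega>\<bar> \<le> C"
  unfolding bdd_mart_def by (meson abs_ge_zero order_trans linear)

lemma bdd_mart_orth:
  assumes "bdd_mart Y" "Z \<in> borel_measurable (G r)" "\<And>\<omega>. \<omega> \<in> space M \<Longrightarrow> \<bar>Z \<omega>\<bar> \<le> C" "r \<le> s" "s \<le> t"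
  shows "expectation (\<lambda>\<omega>. Z \<omega> * (Y t \<omega> - Y s \<omega>)) = 0"
  using assms meas_G_mono[OF assms(2,4)] unfolding bdd_mart_def by blast

lemma bdd_mart_incr_bdd:
  assumes "bdd_mart Y"
  shows "\<exists>C\<ge>0. \<forall>s t. \<forall>\<omega>\<in>space M. \<bar>Y t \<omega> - Y s \<omega>\<bar> \<le> C"
proof -
  obtain C where C: "C \<ge> 0" "\<forall>t. \<forall>\<omega>\<in>space M. \<bar>Y t \<omega>\<bar> \<le> C" using bdd_mart_bdd[OF assms] by auto
  have "\<bar>Y t \<omega> - Y s \<omega>\<bar> \<le> 2 * C" if "\<omega> \<in> space M" for s t \<omega>
    using C(2)[rule_format, of \<omega> t] C(2)[rule_format, of \<omega> s] that by linarith
  then show ?thesis using C(1) by (intro exI[of _ "2*C"]) auto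
qed

lemma bdd_mart_incr_square:
  assumes L: "bdd_mart L" and C: "\<And>\<omega>. \<omega> \<in> space M \<Longrightarrow> \<bar>L t \<omega> - L s \<omega>\<bar> \<le> C"
  shows "integrable M (\<lambda>\<omega>. (L t \<omega> - L s \<omega>)\<^sup>2)" "expectation (\<lambda>\<omega>. (L t \<omega> - L s \<omega>)\<^sup>2) \<le> C\<^sup>2"
proof -
  note [measurable] = bdd_mart_meas_M[OF L]
  show i: "integrable M (\<lambda>\<omega>. (L t \<omega> - L s \<omega>)\<^sup>2)"
    unfolding power2_eq_square by (rule integrable_bdd_mult[of _ C _ C]) (use C in auto)
  have "expectation (\<lambda>\<omega>. (L t \<omega> - L s \<omega>)\<^sup>2) \<le> expectation (\<lambda>\<omega>. C\<^sup>2)"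
  proof (rule integral_mono[OF i])
    show "(L t \<omega> - L s \<omega>)\<^sup>2 \<le> C\<^sup>2" if "\<omega> \<in> space M" for \<omega>
      using C[OF that] by (metis abs_ge_zero power2_abs power_mono)
  qed simp
  then show "expectation (\<lambda>\<omega>. (L t \<omega> - L s \<omega>)\<^sup>2) \<le> C\<^sup>2" by (simp add: prob_space)
qed

text \<open>The part of the increment before \<open>b\<close> is known at \<open>b\<close>, hence
  orthogonal to the part after \<open>b\<close>. The clamps let \<open>b\<close> lie anywhere: when
  it misses the interval, one of the two parts is zero.\<close>

lemma bdd_mart_split_at:
  assumes "bdd_mart L"
  shows "expectation (\<lambda>\<omega>. (L t \<omega> - L s \<omega>)\<^sup>2) =
     expectation (\<lambda>\<omega>. (L (min t b) \<omega> - L (min s b) \<omega>)\<^sup>2) +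
     expectation (\<lambda>\<omega>. (L (max t b) \<omega> - L (max s b) \<omega>)\<^sup>2)"
proof -
  obtain C where C: "\<forall>s t. \<forall>\<omega>\<in>space M. \<bar>L t \<omega> - L s \<omega>\<bar> \<le> C" using bdd_mart_incr_bdd[OF assms] by auto
  note [measurable] = bdd_mart_meas_M[OF assms]
  have Zm: "(\<lambda>\<omega>. L (min t b) \<omega> - L (min s b) \<omega>) \<in> borel_measurable (G b)"
    by (intro borel_measurable_diff meas_G_mono[OF bdd_mart_meas[OF assms]]) auto
  have "expectation (\<lambda>\<omega>. (L (min t b) \<omega> - L (min s b) \<omega>) * (L (max t b) \<omega> - L (max s b) \<omega>)) = 0"
  proof (cases "s \<le> t")
    case True
    show ?thesis by (rule bdd_mart_orth[OF assms Zm, of C]) (use C True in auto)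
  next
    case False
    have "expectation (\<lambda>\<omega>. (L (min t b) \<omega> - L (min s b) \<omega>) * (L (max s b) \<omega> - L (max t b) \<omega>)) = 0"
      by (rule bdd_mart_orth[OF assms Zm, of C]) (use C False in auto)
    then have "- expectation (\<lambda>\<omega>. (L (min t b) \<omega> - L (min s b) \<omega>) * (L (max s b) \<omega> - L (max t b) \<omega>)) = 0"
      by simp
    then show ?thesis unfolding Bochner_Integration.integral_minus[symmetric]
      by (simp add: algebra_simps)
  qed
  then have "expectation (\<lambda>\<omega>. ((L (min t b) \<omega> - L (min s b) \<omega>) + (L (max t b) \<omega> - L (max s b) \<omega>))\<^sup>2) =
     expectation (\<lambda>\<omega>. (L (min t b) \<omega> - L (min s b) \<omega>)\<^sup>2) +
     expectation (\<lambda>\<omega>. (L (max t b) \<omega> - L (max s b) \<omega>)\<^sup>2)"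
    by (intro expectation_square_add[of _ C _ C]) (use C in auto)
  moreover have "(L (min t b) \<omega> - L (min s b) \<omega>) + (L (max t b) \<omega> - L (max s b) \<omega>) = L t \<omega> - L s \<omega>" for \<omega>
    by (auto simp: min_def max_def)
  ultimately show ?thesis by simp
qed

lemma dominated_zero: "bdd_mart L \<Longrightarrow> dominated \<delta> L (\<lambda>t \<omega>. 0)"
  unfolding dominated_def bdd_mart_def cont_adapted_def by auto

text \<open>\<open>Y1\<close> moves only up to \<open>b\<close> and \<open>Y2\<close> only from
  \<open>b\<close> on, so an increment of the sum is an increment of \<open>Y1\<close> known at
  \<open>b\<close> plus one of \<open>Y2\<close> after \<open>b\<close>. Their product has mean
  zero, and the two bounds add up by \<open>bdd_mart_split_at\<close>.\<close>

lemma dominated_concat: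
  assumes L: "bdd_mart L" and 1: "dominated \<delta> L Y1" and 2: "dominated \<delta> L Y2"
    and c1: "\<And>t \<omega>. \<omega> \<in> space M \<Longrightarrow> b \<le> t \<Longrightarrow> Y1 t \<omega> = Y1 b \<omega>"
    and c2: "\<And>t \<omega>. \<omega> \<in> space M \<Longrightarrow> t \<le> b \<Longrightarrow> Y2 t \<omega> = 0"
  shows "dominated \<delta> L (\<lambda>t \<omega>. Y1 t \<omega> + Y2 t \<omega>)"
proof -
  have b1: "bdd_mart Y1" and b2: "bdd_mart Y2" using 1 2 by (auto simp: dominated_def)
  note [measurable] = bdd_mart_meas_M[OF b1] bdd_mart_meas_M[OF b2]
  obtain C where C: "\<forall>t. \<forall>\<omega>\<in>space M. \<bar>Y1 t \<omega>\<bar> \<le> C" using bdd_mart_bdd[OF b1] by auto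
  obtain D where D: "\<forall>t. \<forall>\<omega>\<in>space M. \<bar>Y2 t \<omega>\<bar> \<le> D" using bdd_mart_bdd[OF b2] by auto
  obtain C' where C': "\<forall>s t. \<forall>\<omega>\<in>space M. \<bar>Y1 t \<omega> - Y1 s \<omega>\<bar> \<le> C'" using bdd_mart_incr_bdd[OF b1] by auto
  obtain D' where D': "\<forall>s t. \<forall>\<omega>\<in>space M. \<bar>Y2 t \<omega> - Y2 s \<omega>\<bar> \<le> D'" using bdd_mart_incr_bdd[OF b2] by auto
  have bm: "bdd_mart (\<lambda>t \<omega>. Y1 t \<omega> + Y2 t \<omega>)"
    unfolding bdd_mart_def
  proof (intro conjI allI impI)
    show "cont_adapted (\<lambda>t \<omega>. Y1 t \<omega> + Y2 t \<omega>)"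
      unfolding cont_adapted_def
      using bdd_mart_meas[OF b1] bdd_mart_meas[OF b2] cont_adapted_cont[OF bdd_mart_cproc[OF b1]] cont_adapted_cont[OF bdd_mart_cproc[OF b2]]
      by (auto intro!: continuous_on_add)
    show "\<exists>C. \<forall>t. \<forall>\<omega>\<in>space M. \<bar>Y1 t \<omega> + Y2 t \<omega>\<bar> \<le> C"
      using C D by (intro exI[of _ "C+D"]) (meson abs_triangle_ineq add_mono order_trans)
    fix s t :: real and Z :: "'a \<Rightarrow> real" and E assume st: "s \<le> t" and Z: "Z \<in> borel_measurable (G s)"
      and E: "\<forall>\<omega>\<in>space M. \<bar>Z \<omega>\<bar> \<le> E"
    note [measurable] = meas_G_M[OF Z]
    have i: "integrable M (\<lambda>\<omega>. Z \<omega> * (Y1 t \<omega> - Y1 s \<omega>))" "integrable M (\<lambda>\<omega>. Z \<omega> * (Y2 t \<omega> - Y2 s \<omega>))"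
      by (rule integrable_bdd_mult[of _ E _ C'], use E C' in auto)
        (rule integrable_bdd_mult[of _ E _ D'], use E D' in auto)
    have "expectation (\<lambda>\<omega>. Z \<omega> * (Y1 t \<omega> + Y2 t \<omega> - (Y1 s \<omega> + Y2 s \<omega>)))
       = expectation (\<lambda>\<omega>. Z \<omega> * (Y1 t \<omega> - Y1 s \<omega>) + Z \<omega> * (Y2 t \<omega> - Y2 s \<omega>))"
      by (simp add: algebra_simps)
    also have "\<dots> = 0"
      using i bdd_mart_orth[OF b1 Z, of E s t] bdd_mart_orth[OF b2 Z, of E s t] E st by simp
    finally show "expectation (\<lambda>\<omega>. Z \<omega> * (Y1 t \<omega> + Y2 t \<omega> - (Y1 s \<omega> + Y2 s \<omega>))) = 0" .
  qed
  have "expectation (\<lambda>\<omega>. (Y1 t \<omega> + Y2 t \<omega> - (Y1 s \<omega> + Y2 s \<omega>))\<^sup>2) \<le> \<delta>\<^sup>2 * expectation (\<lambda>\<omega>. (L t \<omega> - L s \<omega>)\<^sup>2)"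
    if st: "s \<le> t" for s t
  proof -
    have Zm: "(\<lambda>\<omega>. Y1 (min t b) \<omega> - Y1 (min s b) \<omega>) \<in> borel_measurable (G b)"
      by (intro borel_measurable_diff meas_G_mono[OF bdd_mart_meas[OF b1]]) auto
    have z: "expectation (\<lambda>\<omega>. (Y1 (min t b) \<omega> - Y1 (min s b) \<omega>) * (Y2 (max t b) \<omega> - Y2 (max s b) \<omega>)) = 0"
      by (rule bdd_mart_orth[OF b2 Zm, of C']) (use C' st in auto)
    have "expectation (\<lambda>\<omega>. (Y1 t \<omega> + Y2 t \<omega> - (Y1 s \<omega> + Y2 s \<omega>))\<^sup>2) =
        expectation (\<lambda>\<omega>. ((Y1 (min t b) \<omega> - Y1 (min s b) \<omega>) + (Y2 (max t b) \<omega> - Y2 (max s b) \<omega>))\<^sup>2)"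
    proof (rule Bochner_Integration.integral_cong)
      fix \<omega> assume w: "\<omega> \<in> space M"
      have "Y1 (min t b) \<omega> = Y1 t \<omega>" "Y1 (min s b) \<omega> = Y1 s \<omega>" "Y2 (max t b) \<omega> = Y2 t \<omega>" "Y2 (max s b) \<omega> = Y2 s \<omega>"
        using c1[OF w, of t] c1[OF w, of s] c2[OF w, of t] c2[OF w, of s] c2[OF w, of b] by (auto simp: min_def max_def)
      then show "(Y1 t \<omega> + Y2 t \<omega> - (Y1 s \<omega> + Y2 s \<omega>))\<^sup>2 =
         ((Y1 (min t b) \<omega> - Y1 (min s b) \<omega>) + (Y2 (max t b) \<omega> - Y2 (max s b) \<omega>))\<^sup>2"
        by (simp add: algebra_simps)
    qed simp
    also have "\<dots> = expectation (\<lambda>\<omega>. (Y1 (min t b) \<omega> - Y1 (min s b) \<omega>)\<^sup>2) +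
        expectation (\<lambda>\<omega>. (Y2 (max t b) \<omega> - Y2 (max s b) \<omega>)\<^sup>2)"
      by (rule expectation_square_add[of _ C' _ D']) (use C' D' z in auto)
    also have "\<dots> \<le> \<delta>\<^sup>2 * expectation (\<lambda>\<omega>. (L (min t b) \<omega> - L (min s b) \<omega>)\<^sup>2) +
        \<delta>\<^sup>2 * expectation (\<lambda>\<omega>. (L (max t b) \<omega> - L (max s b) \<omega>)\<^sup>2)"
      using 1 2 st unfolding dominated_def by (intro add_mono) auto
    also have "\<dots> = \<delta>\<^sup>2 * expectation (\<lambda>\<omega>. (L t \<omega> - L s \<omega>)\<^sup>2)"
      using bdd_mart_split_at[OF L, of t s b] by (simp add: algebra_simps)
    finally show ?thesis .
  qed
  with bm show ?thesis unfolding dominated_def by blast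
qed

text \<open>The summands live on consecutive cells and are concatenated one by one. Constancy after
  \<open>p k\<close> is carried through the induction because \<open>dominated_concat\<close>
  requires it of the first block in the next step.\<close>

lemma dominated_sum:
  fixes p :: "nat \<Rightarrow> real"
  assumes L: "bdd_mart L" and p: "\<And>i. i < k \<Longrightarrow> p i \<le> p (Suc i)"
    and d: "\<And>i. i < k \<Longrightarrow> dominated \<delta> L (Y i)"
    and z: "\<And>i t \<omega>. i < k \<Longrightarrow> \<omega> \<in> space M \<Longrightarrow> t \<le> p i \<Longrightarrow> Y i t \<omega> = 0"
    and c: "\<And>i t \<omega>. i < k \<Longrightarrow> \<omega> \<in> space M \<Longrightarrow> p (Suc i) \<le> t \<Longrightarrow> Y i t \<omega> = Y i (p (Suc i)) \<omega>"
  shows "dominated \<delta> L (\<lambda>t \<omega>. \<Sum>i<k. Y i t \<omega>) \<and>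
    (\<forall>\<omega>\<in>space M. \<forall>t\<ge>p k. (\<Sum>i<k. Y i t \<omega>) = (\<Sum>i<k. Y i (p k) \<omega>))"
  using p d z c
proof (induction k)
  case 0
  then show ?case using dominated_zero[OF L] by simp
next
  case (Suc k)
  have IH: "dominated \<delta> L (\<lambda>t \<omega>. \<Sum>i<k. Y i t \<omega>)"
    "\<forall>\<omega>\<in>space M. \<forall>t\<ge>p k. (\<Sum>i<k. Y i t \<omega>) = (\<Sum>i<k. Y i (p k) \<omega>)"
    using Suc.IH[OF Suc.prems(1,2,3,4)] less_SucI by blast+
  have "dominated \<delta> L (\<lambda>t \<omega>. (\<Sum>i<k. Y i t \<omega>) + Y k t \<omega>)"
  proof (rule dominated_concat[OF L IH(1)])
    show "dominated \<delta> L (Y k)" by (rule Suc.prems(2)) simp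
    show "(\<Sum>i<k. Y i t \<omega>) = (\<Sum>i<k. Y i (p k) \<omega>)" if "\<omega> \<in> space M" "p k \<le> t" for t \<omega>
      using IH(2) that by blast
    show "Y k t \<omega> = 0" if "\<omega> \<in> space M" "t \<le> p k" for t \<omega>
      using Suc.prems(3)[of k] that by blast
  qed
  then have 1: "dominated \<delta> L (\<lambda>t \<omega>. \<Sum>i<Suc k. Y i t \<omega>)" by simp
  have "(\<Sum>i<Suc k. Y i t \<omega>) = (\<Sum>i<Suc k. Y i (p (Suc k)) \<omega>)" if w: "\<omega> \<in> space M" and "p (Suc k) \<le> t" for \<omega> t
  proof -
    have "p k \<le> p (Suc k)" using Suc.prems(1) by simp
    then have "p k \<le> t" using that(2) by simp
    then have "(\<Sum>i<k. Y i t \<omega>) = (\<Sum>i<k. Y i (p (Suc k)) \<omega>)"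
      using IH(2)[rule_format, OF w, of t] IH(2)[rule_format, OF w \<open>p k \<le> p (Suc k)\<close>] by simp
    moreover have "Y k t \<omega> = Y k (p (Suc k)) \<omega>" using Suc.prems(4)[of k \<omega> t] w that by simp
    ultimately show ?thesis by simp
  qed
  with 1 show ?case by blast
qed

lemma dominated_simple:
  assumes L: "bdd_mart L" and Z: "Z \<in> borel_measurable (G u)" and Zb: "\<And>\<omega>. \<omega> \<in> space M \<Longrightarrow> \<bar>Z \<omega>\<bar> \<le> \<delta>"
    and uv: "u \<le> v"
  shows "dominated \<delta> L (\<lambda>t \<omega>. Z \<omega> * (L (min t v) \<omega> - L (min t u) \<omega>))"
proof -
  \<comment> \<open>Clamping \<open>t\<close> to \<open>[u, v]\<close> shows that the process is
    zero up to time \<open>u\<close>; hence it is adapted although \<open>Z\<close> is known only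
    from \<open>u\<close> on.\<close>
  define Y where "Y t \<omega> = Z \<omega> * (L (max u (min t v)) \<omega> - L u \<omega>)" for t \<omega>
  have eq: "(\<lambda>t \<omega>. Z \<omega> * (L (min t v) \<omega> - L (min t u) \<omega>)) = Y"
  proof (intro ext)
    fix t \<omega>
    show "Z \<omega> * (L (min t v) \<omega> - L (min t u) \<omega>) = Y t \<omega>"
      unfolding Y_def using uv by (cases "t \<le> u"; cases "t \<le> v") (simp_all add: min_def max_def)
  qed
  obtain C where C: "C \<ge> 0" "\<forall>s t. \<forall>\<omega>\<in>space M. \<bar>L t \<omega> - L s \<omega>\<bar> \<le> C" using bdd_mart_incr_bdd[OF L] by auto
  note [measurable] = bdd_mart_meas_M[OF L] meas_G_M[OF Z]
  have Ym: "Y t \<in> borel_measurable (G t)" for t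
  proof (cases "t \<le> u")
    case True
    then have "Y t = (\<lambda>\<omega>. 0)" using uv by (auto simp: Y_def max_def min_def)
    then show ?thesis by simp
  next
    case False
    then show ?thesis unfolding Y_def
      by (intro borel_measurable_times borel_measurable_diff meas_G_mono[OF Z] meas_G_mono[OF bdd_mart_meas[OF L]]) auto
  qed
  have Yb: "\<bar>Y t \<omega>\<bar> \<le> \<delta> * C" if "\<omega> \<in> space M" for t \<omega>
    using that C Zb[OF that] unfolding Y_def abs_mult by (intro mult_mono) auto
  have Yc: "continuous_on UNIV (\<lambda>t. Y t \<omega>)" if "\<omega> \<in> space M" for \<omega>
    unfolding Y_def
    by (intro continuous_intros continuous_on_compose2[OF cont_adapted_cont[OF bdd_mart_cproc[OF L] that, of UNIV]]) auto
  have "expectation (\<lambda>\<omega>. W \<omega> * (Y t \<omega> - Y s \<omega>)) = 0"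
    if st: "s \<le> t" and W: "W \<in> borel_measurable (G s)" and E: "\<forall>\<omega>\<in>space M. \<bar>W \<omega>\<bar> \<le> E" for s t W E
  proof (cases "s \<ge> v \<or> t \<le> u")
    case True
    then have "max u (min t v) = max u (min s v)" using st uv by auto
    then have "\<And>\<omega>. Y t \<omega> = Y s \<omega>" by (simp add: Y_def)
    then show ?thesis by simp
  next
    case False
    have "(\<lambda>\<omega>. W \<omega> * (Y t \<omega> - Y s \<omega>)) = (\<lambda>\<omega>. (W \<omega> * Z \<omega>) * (L (max u (min t v)) \<omega> - L (max u s) \<omega>))"
      using False by (intro ext) (auto simp: Y_def algebra_simps min_def)
    moreover have "expectation (\<lambda>\<omega>. (W \<omega> * Z \<omega>) * (L (max u (min t v)) \<omega> - L (max u s) \<omega>)) = 0"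
    proof (rule bdd_mart_orth[OF L, of _ "max u s" "E * \<delta>"])
      show "(\<lambda>\<omega>. W \<omega> * Z \<omega>) \<in> borel_measurable (G (max u s))"
        by (intro borel_measurable_times meas_G_mono[OF Z] meas_G_mono[OF W]) auto
      show "\<bar>W \<omega> * Z \<omega>\<bar> \<le> E * \<delta>" if "\<omega> \<in> space M" for \<omega>
        using E[rule_format, OF that] Zb[OF that] unfolding abs_mult by (intro mult_mono) auto
    qed (use st False in auto)
    ultimately show ?thesis by simp
  qed
  then have bm: "bdd_mart Y" unfolding bdd_mart_def cont_adapted_def using Ym Yc Yb by blast
  have "expectation (\<lambda>\<omega>. (Y t \<omega> - Y s \<omega>)\<^sup>2) \<le> \<delta>\<^sup>2 * expectation (\<lambda>\<omega>. (L t \<omega> - L s \<omega>)\<^sup>2)" if st: "s \<le> t" for s t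
  proof -
    define a b where "a = max u (min s v)" and "b = max u (min t v)"
    have int: "integrable M (\<lambda>\<omega>. (L x \<omega> - L y \<omega>)\<^sup>2)" for x y
      unfolding power2_eq_square by (rule integrable_bdd_mult[of _ C _ C]) (use C in auto)
    have "expectation (\<lambda>\<omega>. (Y t \<omega> - Y s \<omega>)\<^sup>2) \<le> expectation (\<lambda>\<omega>. \<delta>\<^sup>2 * (L b \<omega> - L a \<omega>)\<^sup>2)"
    proof (rule integral_mono)
      obtain D where D: "\<forall>s t. \<forall>\<omega>\<in>space M. \<bar>Y t \<omega> - Y s \<omega>\<bar> \<le> D" using bdd_mart_incr_bdd[OF bm] by auto
      note [measurable] = bdd_mart_meas_M[OF bm]
      show "integrable M (\<lambda>\<omega>. (Y t \<omega> - Y s \<omega>)\<^sup>2)" unfolding power2_eq_square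
        by (rule integrable_bdd_mult[of _ D _ D]) (use D in auto)
      show "integrable M (\<lambda>\<omega>. \<delta>\<^sup>2 * (L b \<omega> - L a \<omega>)\<^sup>2)" using int by auto
      fix \<omega> assume w: "\<omega> \<in> space M"
      have "(Y t \<omega> - Y s \<omega>)\<^sup>2 = (Z \<omega>)\<^sup>2 * (L b \<omega> - L a \<omega>)\<^sup>2"
        unfolding Y_def a_def b_def by (simp add: power2_eq_square algebra_simps)
      also have "(Z \<omega>)\<^sup>2 \<le> \<delta>\<^sup>2" using Zb[OF w] by (metis abs_ge_zero power2_abs power_mono)
      finally show "(Y t \<omega> - Y s \<omega>)\<^sup>2 \<le> \<delta>\<^sup>2 * (L b \<omega> - L a \<omega>)\<^sup>2" by (simp add: mult_right_mono)
    qed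
    also have "\<dots> = \<delta>\<^sup>2 * expectation (\<lambda>\<omega>. (L b \<omega> - L a \<omega>)\<^sup>2)" by simp
    \<comment> \<open>\<open>a\<close> and \<open>b\<close> are \<open>s\<close> and
      \<open>t\<close> clamped to \<open>[u, v]\<close>. Splitting at \<open>v\<close> and then at
      \<open>u\<close> exhibits the left side as one of three nonnegative summands of the right
      side.\<close>
    also have "expectation (\<lambda>\<omega>. (L b \<omega> - L a \<omega>)\<^sup>2) \<le> expectation (\<lambda>\<omega>. (L t \<omega> - L s \<omega>)\<^sup>2)"
    proof -
      have pos: "expectation (\<lambda>\<omega>. (L x \<omega> - L y \<omega>)\<^sup>2) \<ge> 0" for x y by (simp add: integral_nonneg_AE)
      show ?thesis
        unfolding a_def b_def
        using bdd_mart_split_at[OF L, of t s v] bdd_mart_split_at[OF L, of "min t v" "min s v" u]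
          pos[of "max t v" "max s v"] pos[of "min (min t v) u" "min (min s v) u"]
        unfolding max.commute[of u] by linarith
    qed
    finally show ?thesis by (simp add: mult_left_mono)
  qed
  with bm show ?thesis unfolding eq dominated_def by blast
qed

text \<open>The i-th term of a martingale transform moves only on \<open>[r i, r (Suc i)]\<close>
  and its weight is known at the left end, so the one-step bounds concatenate.\<close>

lemma dominated_elementary:
  fixes r :: "nat \<Rightarrow> real"
  assumes L: "bdd_mart L" and r: "\<And>i. i < n \<Longrightarrow> r i \<le> r (Suc i)"
    and Z: "\<And>i. i < n \<Longrightarrow> Z i \<in> borel_measurable (G (r i))"
    and Zb: "\<And>i \<omega>. i < n \<Longrightarrow> \<omega> \<in> space M \<Longrightarrow> \<bar>Z i \<omega>\<bar> \<le> \<delta>"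
  shows "dominated \<delta> L (\<lambda>t \<omega>. \<Sum>i<n. Z i \<omega> * (L (min t (r (Suc i))) \<omega> - L (min t (r i)) \<omega>))"
proof -
  have "dominated \<delta> L (\<lambda>t \<omega>. Z i \<omega> * (L (min t (r (Suc i))) \<omega> - L (min t (r i)) \<omega>))" if "i < n" for i
    by (rule dominated_simple[OF L Z[OF that] Zb[OF that] r[OF that]])
  moreover have "min t (r (Suc i)) = t" "min t (r i) = t" if "i < n" "t \<le> r i" for i t
    using r[OF that(1)] that by auto
  moreover have "min t (r i) = r i" "min (r (Suc i)) (r i) = r i" "min t (r (Suc i)) = r (Suc i)"
    if "i < n" "r (Suc i) \<le> t" for i t
    using r[OF that(1)] that by auto
  ultimately show ?thesis
    using r by (intro conjunct1[OF dominated_sum[OF L, of n r]]) simp_all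
qed

end

section \<open>Riemann sums along two partitions\<close>

lemma sum_telescope_clamp:
  fixes p :: "nat \<Rightarrow> real" and f :: "real \<Rightarrow> real"
  assumes "\<And>i. i < k \<Longrightarrow> p i \<le> p (Suc i)"
  shows "p 0 \<le> p k \<and> (\<Sum>i<k. f (max (p i) (min x (p (Suc i)))) - f (p i)) = f (max (p 0) (min x (p k))) - f (p 0)"
  using assms
proof (induction k)
  case (Suc k)
  have IH: "p 0 \<le> p k" "(\<Sum>i<k. f (max (p i) (min x (p (Suc i)))) - f (p i)) = f (max (p 0) (min x (p k))) - f (p 0)"
    using Suc by auto
  have "p k \<le> p (Suc k)" using Suc.prems by simp
  then show ?case using IH by (auto simp: min_def max_def)
qed auto

text \<open>\<open>r i j\<close> is the point \<open>q j\<close> clamped to the cell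
  \<open>[p i, p (Suc i)]\<close>, so the double sum runs over the common refinement. Summing over
  \<open>i\<close> recovers the increments along \<open>q\<close> cut to \<open>[p 0, p k]\<close>;
  summing over \<open>j\<close> recovers those along \<open>p\<close>, completely because
  \<open>q\<close> covers the range of \<open>p\<close>.\<close>

lemma riemann_sum_refine:
  fixes p q :: "nat \<Rightarrow> real" and f h :: "real \<Rightarrow> real"
  assumes p: "\<And>i. i < k \<Longrightarrow> p i \<le> p (Suc i)" and q0: "q 0 \<le> p 0" and qm: "p k \<le> q m"
  defines "r \<equiv> \<lambda>i j. max (p i) (min (q j) (p (Suc i)))"
    and "c \<equiv> \<lambda>x. max (p 0) (min x (p k))"
  shows "(\<Sum>i<k. \<Sum>j<m. (h (q j) - h (p i)) * (f (r i (Suc j)) - f (r i j))) =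
    (\<Sum>j<m. h (q j) * (f (c (q (Suc j))) - f (c (q j)))) - (\<Sum>i<k. h (p i) * (f (p (Suc i)) - f (p i)))"
proof -
  have pm: "p 0 \<le> p i" "p i \<le> p k" if "i \<le> k" for i
    using mono_upto[of i p 0] mono_upto[of k p i] p that by auto
  have 1: "(\<Sum>i<k. f (r i (Suc j)) - f (r i j)) = f (c (q (Suc j))) - f (c (q j))" for j
  proof -
    have "(\<Sum>i<k. f (r i (Suc j)) - f (r i j)) = (\<Sum>i<k. f (r i (Suc j)) - f (p i)) - (\<Sum>i<k. f (r i j) - f (p i))"
      by (simp add: sum_subtractf)
    then show ?thesis unfolding r_def c_def
      using sum_telescope_clamp[of k p f "q (Suc j)"] sum_telescope_clamp[of k p f "q j"] p by simp
  qed
  have 2: "(\<Sum>j<m. f (r i (Suc j)) - f (r i j)) = f (p (Suc i)) - f (p i)" if i: "i < k" for i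
  proof -
    have "(\<Sum>j<m. f (r i (Suc j)) - f (r i j)) = f (r i m) - f (r i 0)"
      by (rule sum_lessThan_telescope)
    moreover have "r i m = p (Suc i)" "r i 0 = p i"
      unfolding r_def using pm[of i] pm[of "Suc i"] i q0 qm p[OF i] by auto
    ultimately show ?thesis by simp
  qed
  have "(\<Sum>i<k. \<Sum>j<m. (h (q j) - h (p i)) * (f (r i (Suc j)) - f (r i j))) =
     (\<Sum>i<k. \<Sum>j<m. h (q j) * (f (r i (Suc j)) - f (r i j))) - (\<Sum>i<k. h (p i) * (\<Sum>j<m. f (r i (Suc j)) - f (r i j)))"
    unfolding left_diff_distrib sum_subtractf sum_distrib_left[symmetric] ..
  also have "(\<Sum>i<k. \<Sum>j<m. h (q j) * (f (r i (Suc j)) - f (r i j))) = (\<Sum>j<m. h (q j) * (\<Sum>i<k. f (r i (Suc j)) - f (r i j)))"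
    by (subst sum.swap) (simp add: sum_distrib_left)
  finally show ?thesis using 1 2 by simp
qed

context filtered_space
begin

text \<open>On the common refinement the difference of two left-point sums is a transform of
  \<open>L\<close> with weights \<open>H (q j) - H (p i)\<close>. \<open>Y\<close> is the same
  transform with the weights cut at \<delta>: its L2 bound holds without exception, while its
  identity with the difference is claimed only for outcomes whose modulus at scale \<open>h\<close>
  is at most \<delta>.\<close>

lemma comparison:
  fixes p q :: "nat \<Rightarrow> real" and H :: "real \<Rightarrow> 'a \<Rightarrow> real"
  assumes L: "bdd_mart L" and H: "\<And>t. H t \<in> borel_measurable (G t)" and d: "0 \<le> \<delta>"
    and p: "\<And>i. i < k \<Longrightarrow> p i \<le> p (Suc i)" "\<And>i. i < k \<Longrightarrow> p (Suc i) - p i < h"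
    and q: "\<And>j. j < m \<Longrightarrow> q j \<le> q (Suc j)" "\<And>j. j < m \<Longrightarrow> q (Suc j) - q j < h"
    and q0: "q 0 \<le> p 0" and qm: "p k \<le> q m"
  shows "\<exists>Y. dominated \<delta> L Y \<and> (\<forall>\<omega>\<in>space M. \<forall>t\<le>p 0. Y t \<omega> = 0) \<and>
    (\<forall>\<omega>\<in>space M. (\<forall>s u. \<bar>s - u\<bar> < h \<longrightarrow> \<bar>H s \<omega> - H u \<omega>\<bar> \<le> \<delta>) \<longrightarrow> (\<forall>t. Y t \<omega> =
      (\<Sum>j<m. H (q j) \<omega> * (L (min t (max (p 0) (min (q (Suc j)) (p k)))) \<omega> - L (min t (max (p 0) (min (q j) (p k)))) \<omega>))
      - (\<Sum>i<k. H (p i) \<omega> * (L (min t (p (Suc i))) \<omega> - L (min t (p i)) \<omega>))))"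
proof -
  define r where "r i j = max (p i) (min (q j) (p (Suc i)))" for i j
  \<comment> \<open>The test \<open>q j \<le> r i j\<close> makes the weight measurable at the start
    of its cell. If it fails, \<open>q j\<close> lies beyond \<open>p (Suc i)\<close>, the cell has
    collapsed to a point and the weight multiplies zero.\<close>
  define Z where "Z i j \<omega> = (if q j \<le> r i j then max (-\<delta>) (min \<delta> (H (q j) \<omega> - H (p i) \<omega>)) else 0)" for i j \<omega>
  define Y1 where "Y1 i t \<omega> = (\<Sum>j<m. Z i j \<omega> * (L (min t (r i (Suc j))) \<omega> - L (min t (r i j)) \<omega>))" for i t \<omega>
  define Y where "Y t \<omega> = (\<Sum>i<k. Y1 i t \<omega>)" for t \<omega>
  have pm: "p 0 \<le> p i" "p i \<le> p k" if "i \<le> k" for i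
    using mono_upto[of i p 0] mono_upto[of k p i] p(1) that by auto
  have rr: "r i j \<le> r i (Suc j)" if "j < m" for i j
    using q(1)[OF that] by (auto simp: r_def max_def min_def)
  have rp: "p i \<le> r i j" "r i j \<le> p (Suc i)" if "i < k" for i j
    using p(1)[OF that] by (auto simp: r_def)
  have Zm: "Z i j \<in> borel_measurable (G (r i j))" if i: "i < k" for i j
  proof (cases "q j \<le> r i j")
    case True
    have "(\<lambda>\<omega>. max (-\<delta>) (min \<delta> (H (q j) \<omega> - H (p i) \<omega>))) \<in> borel_measurable (G (r i j))"
      by (intro borel_measurable_max borel_measurable_min borel_measurable_diff borel_measurable_const
          meas_G_mono[OF H True] meas_G_mono[OF H rp(1)[OF i]])
    then show ?thesis using True by (simp add: Z_def[abs_def])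
  qed (simp add: Z_def[abs_def])
  have Y1d: "dominated \<delta> L (Y1 i)" if i: "i < k" for i
    unfolding Y1_def
  proof (rule dominated_elementary[OF L])
    show "\<bar>Z i j \<omega>\<bar> \<le> \<delta>" for j \<omega> using d by (auto simp: Z_def)
  qed (use rr Zm i in auto)
  have Y10: "Y1 i t \<omega> = 0" if "i < k" "t \<le> p i" for i t \<omega>
  proof -
    have "min t (r i j) = t" for j using rp(1)[OF that(1), of j] that(2) by simp
    then show ?thesis by (simp add: Y1_def)
  qed
  have Y11: "Y1 i t \<omega> = Y1 i (p (Suc i)) \<omega>" if "i < k" "p (Suc i) \<le> t" for i t \<omega>
  proof -
    have "min t (r i j) = r i j" "min (p (Suc i)) (r i j) = r i j" for j
      using rp(2)[OF that(1), of j] that(2) by simp_all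
    then show ?thesis by (simp add: Y1_def)
  qed
  have Yd: "dominated \<delta> L Y"
    unfolding Y_def
  proof (rule conjunct1[OF dominated_sum[of L k p, OF L p(1) Y1d]])
    show "Y1 i t \<omega> = 0" if "i < k" "t \<le> p i" for i t \<omega> using Y10 that by blast
    show "Y1 i t \<omega> = Y1 i (p (Suc i)) \<omega>" if "i < k" "p (Suc i) \<le> t" for i t \<omega> using Y11 that by blast
  qed
  have Y0: "Y t \<omega> = 0" if "t \<le> p 0" for t \<omega>
    unfolding Y_def
  proof (rule sum.neutral, rule ballI)
    fix i assume "i \<in> {..<k}"
    then show "Y1 i t \<omega> = 0" using Y10[of i t \<omega>] pm(1)[of i] that by simp
  qed
  have "Y t \<omega> = (\<Sum>j<m. H (q j) \<omega> * (L (min t (max (p 0) (min (q (Suc j)) (p k)))) \<omega> - L (min t (max (p 0) (min (q j) (p k)))) \<omega>))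
      - (\<Sum>i<k. H (p i) \<omega> * (L (min t (p (Suc i))) \<omega> - L (min t (p i)) \<omega>))"
    if w: "\<forall>s u. \<bar>s - u\<bar> < h \<longrightarrow> \<bar>H s \<omega> - H u \<omega>\<bar> \<le> \<delta>" for t \<omega>
  proof -
    have "Z i j \<omega> * (L (min t (r i (Suc j))) \<omega> - L (min t (r i j)) \<omega>) =
        (H (q j) \<omega> - H (p i) \<omega>) * (L (min t (r i (Suc j))) \<omega> - L (min t (r i j)) \<omega>)" if ij: "i < k" "j < m" for i j
    proof (cases "r i j = r i (Suc j)")
      case False
      \<comment> \<open>A nondegenerate intersection means that the two cells overlap, so their left
        ends are closer than \<open>h\<close> and the truncation is inactive.\<close>
      then have 1: "p i < q (Suc j)" "q j < p (Suc i)"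
        using rr[OF ij(2), of i] q(1)[OF ij(2)] p(1)[OF ij(1)] by (auto simp: r_def max_def min_def split: if_splits)
      then have "\<bar>q j - p i\<bar> < h" using p(2)[OF ij(1)] q(2)[OF ij(2)] by linarith
      then have "\<bar>H (q j) \<omega> - H (p i) \<omega>\<bar> \<le> \<delta>" using w by blast
      moreover have "q j \<le> r i j" using 1 by (simp add: r_def)
      ultimately have "Z i j \<omega> = H (q j) \<omega> - H (p i) \<omega>" by (auto simp: Z_def)
      then show ?thesis by simp
    qed simp
    then have "Y t \<omega> = (\<Sum>i<k. \<Sum>j<m. (H (q j) \<omega> - H (p i) \<omega>) * (L (min t (r i (Suc j))) \<omega> - L (min t (r i j)) \<omega>))"
      unfolding Y_def Y1_def by (intro sum.cong refl) auto
    then show ?thesis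
      using riemann_sum_refine[of k p q m "\<lambda>x. H x \<omega>" "\<lambda>x. L (min t x) \<omega>"] p(1) q0 qm
      unfolding r_def by simp
  qed
  then show ?thesis using Yd Y0 by blast
qed

end

section \<open>Hitting times and oscillation events\<close>

text \<open>The strict inequality makes the exceedance set relatively open in \<open>S\<close>, so
  by continuity an exceedance anywhere forces one on a countable dense subset.\<close>

lemma sets_exists_gt:
  fixes S :: "'b::euclidean_space set" and Y :: "'b \<Rightarrow> 'a \<Rightarrow> real"
  assumes m: "\<And>b. b \<in> S \<Longrightarrow> Y b \<in> borel_measurable N"
    and c: "\<And>\<omega>. \<omega> \<in> space N \<Longrightarrow> continuous_on S (\<lambda>b. Y b \<omega>)"
  shows "{\<omega>\<in>space N. \<exists>b\<in>S. \<delta> < Y b \<omega>} \<in> sets N"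
proof -
  obtain D where D: "countable D" "D \<subseteq> S" "S \<subseteq> closure D" using separable[of S] by blast
  have "(\<exists>b\<in>S. \<delta> < Y b \<omega>) \<longleftrightarrow> (\<exists>b\<in>D. \<delta> < Y b \<omega>)" if w: "\<omega> \<in> space N" for \<omega>
  proof
    assume "\<exists>b\<in>S. \<delta> < Y b \<omega>"
    then obtain b where b: "b \<in> S" "\<delta> < Y b \<omega>" by auto
    have "open {\<delta><..}" by simp
    then obtain A where A: "open A" "A \<inter> S = (\<lambda>b. Y b \<omega>) -` {\<delta><..} \<inter> S"
      using c[OF w] by (metis continuous_on_open_invariant)
    have "b \<in> A" using A(2) b by auto
    moreover have "b \<in> closure D" using b D by auto
    ultimately obtain x where "x \<in> D" "x \<in> A" using A(1)
      by (metis closure_iff_nhds_not_empty disjoint_iff subset_refl)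
    then show "\<exists>b\<in>D. \<delta> < Y b \<omega>" using A(2) D(2) by auto
  qed (use D in auto)
  then have "{\<omega>\<in>space N. \<exists>b\<in>S. \<delta> < Y b \<omega>} = (\<Union>b\<in>D. {\<omega>\<in>space N. \<delta> < Y b \<omega>})" by auto
  also have "\<dots> \<in> sets N"
    using D m by (intro sets.countable_UN'') auto
  finally show ?thesis .
qed

lemma (in finite_measure) measure_vanish_seq:
  assumes [measurable]: "\<And>n. E n \<in> sets M" and v: "AE \<omega> in M. \<forall>\<^sub>F n in sequentially. \<omega> \<notin> E n"
  shows "(\<lambda>n. measure M (E n)) \<longlonglongrightarrow> 0"
proof -
  have "(\<lambda>n. integral\<^sup>L M (indicat_real (E n))) \<longlonglongrightarrow> integral\<^sup>L M (\<lambda>_. 0)"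
  proof (rule integral_dominated_convergence[where w = "\<lambda>_. 1"])
    show "AE x in M. (\<lambda>n. indicat_real (E n) x) \<longlonglongrightarrow> 0"
      using v
    proof eventually_elim
      case (elim x)
      then have "\<forall>\<^sub>F n in sequentially. indicat_real (E n) x = 0" by (rule eventually_mono) simp
      then show ?case by (rule tendsto_eventually)
    qed
  qed (auto simp: indicator_def)
  then show ?thesis by simp
qed

text \<open>Dominated convergence is sequential, so the limit at 0 is tested along sequences;
  keeping them below \<open>b\<close> secures the measurability of every set that occurs.\<close>

lemma (in finite_measure) measure_vanish_at_right:
  fixes E :: "real \<Rightarrow> 'a set"
  assumes m: "\<forall>\<^sub>F e in at_right 0. E e \<in> sets M"
    and v: "AE \<omega> in M. \<forall>\<^sub>F e in at_right 0. \<omega> \<notin> E e"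
  shows "((\<lambda>e. measure M (E e)) \<longlongrightarrow> 0) (at_right 0)"
proof -
  obtain b where b: "b > 0" "\<And>e. 0 < e \<Longrightarrow> e < b \<Longrightarrow> E e \<in> sets M"
    using m unfolding eventually_at_right_field by auto
  show ?thesis
  proof (rule tendsto_at_right_sequentially[OF b(1)])
    fix S :: "nat \<Rightarrow> real" assume S: "\<And>n. 0 < S n" "\<And>n. S n < b" "S \<longlonglongrightarrow> 0"
    have f: "filterlim S (at_right 0) sequentially"
      unfolding filterlim_at using S(3) less_imp_neq[OF S(1)] S(1) by (auto intro: always_eventually)
    show "(\<lambda>n. measure M (E (S n))) \<longlonglongrightarrow> 0"
    proof (rule measure_vanish_seq)
      show "E (S n) \<in> sets M" for n using b S by auto
      show "AE \<omega> in M. \<forall>\<^sub>F n in sequentially. \<omega> \<notin> E (S n)"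
        using v
      proof eventually_elim
        case (elim x)
        show ?case by (rule eventually_compose_filterlim[OF elim f])
      qed
    qed
  qed
qed

context filtered_space
begin

text \<open>Constancy outside [0,T] turns uniform continuity of a path on [0,T] into uniform
  continuity on the line, so that one modulus also covers increments reaching beyond
  \<open>T\<close>.\<close>

definition ext_adapted :: "(real \<Rightarrow> 'a \<Rightarrow> real) \<Rightarrow> bool" where
  "ext_adapted Y \<longleftrightarrow> cont_adapted Y \<and> (\<forall>t. \<forall>\<omega>\<in>space M. Y t \<omega> = Y (max 0 (min t T)) \<omega>)"

lemma ext_adapted_cproc: "ext_adapted Y \<Longrightarrow> cont_adapted Y" by (simp add: ext_adapted_def)

lemma ext_adapted_clip: "ext_adapted Y \<Longrightarrow> \<omega> \<in> space M \<Longrightarrow> Y t \<omega> = Y (max 0 (min t T)) \<omega>"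
  unfolding ext_adapted_def by blast

lemma cont_adapted_meas_M: "cont_adapted Y \<Longrightarrow> Y t \<in> borel_measurable M"
  using cont_adapted_meas meas_G_M by blast

lemma ext_adapted_ext:
  assumes "cont_proc M T Y" "adapted T Fi Y"
  shows "ext_adapted (ext_proc T Y)"
proof -
  have "continuous_on UNIV (\<lambda>t. ext_proc T Y t \<omega>)" if "\<omega> \<in> space M" for \<omega>
    unfolding ext_proc_def
    by (rule continuous_on_compose2[of "{0..T}" "\<lambda>t. Y t \<omega>"])
      (use assms(1) that T_pos in \<open>auto simp: cont_proc_def intro!: continuous_intros\<close>)
  moreover have "ext_proc T Y t \<in> borel_measurable (G t)" for t
    using assms(2) T_pos unfolding adapted_def ext_proc_def G_def by auto
  ultimately show ?thesis by (auto simp: ext_adapted_def cont_adapted_def ext_proc_def min_def max_def)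
qed

lemma ext_adapted_uniform:
  assumes Y: "ext_adapted Y" and w: "\<omega> \<in> space M" and d: "\<delta> > 0"
  shows "\<exists>h>0. \<forall>s u. \<bar>s - u\<bar> < h \<longrightarrow> \<bar>Y s \<omega> - Y u \<omega>\<bar> < \<delta>"
proof -
  have "uniformly_continuous_on {0..T} (\<lambda>t. Y t \<omega>)"
    by (rule compact_uniformly_continuous[OF cont_adapted_cont[OF ext_adapted_cproc[OF Y] w]]) simp
  then obtain h where h: "h > 0" "\<And>s u. s \<in> {0..T} \<Longrightarrow> u \<in> {0..T} \<Longrightarrow> dist s u < h \<Longrightarrow> dist (Y s \<omega>) (Y u \<omega>) < \<delta>"
    unfolding uniformly_continuous_on_def using d by metis
  have "\<bar>Y s \<omega> - Y u \<omega>\<bar> < \<delta>" if "\<bar>s - u\<bar> < h" for s u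
  proof -
    have "dist (max 0 (min s T)) (max 0 (min u T)) < h"
      using that by (auto simp: dist_real_def max_def min_def)
    then have "dist (Y (max 0 (min s T)) \<omega>) (Y (max 0 (min u T)) \<omega>) < \<delta>"
      using T_pos by (intro h) auto
    then show ?thesis using ext_adapted_clip[OF Y w, of s] ext_adapted_clip[OF Y w, of u] by (simp add: dist_real_def)
  qed
  then show ?thesis using h by blast
qed

text \<open>The failure of a deterministic modulus of continuity. Off this event the random modulus
  is replaced by the constants \<open>h\<close> and \<delta>; for fixed \<delta> its probability
  tends to 0 with \<open>h\<close>.\<close>

definition osc_event :: "(real \<Rightarrow> 'a \<Rightarrow> real) \<Rightarrow> real \<Rightarrow> real \<Rightarrow> 'a set" where
  "osc_event H h \<delta> = {\<omega>\<in>space M. \<exists>x\<in>{(s, u). \<bar>s - u\<bar> < h}. \<delta> < \<bar>H (fst x) \<omega> - H (snd x) \<omega>\<bar>}"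

lemma osc_event_sets:
  assumes "cont_adapted H"
  shows "osc_event H h \<delta> \<in> sets M"
  unfolding osc_event_def
proof (rule sets_exists_gt)
  fix b :: "real \<times> real"
  show "(\<lambda>\<omega>. \<bar>H (fst b) \<omega> - H (snd b) \<omega>\<bar>) \<in> borel_measurable M"
    using cont_adapted_meas_M[OF assms] by (intro borel_measurable_abs borel_measurable_diff)
next
  fix \<omega> assume w: "\<omega> \<in> space M"
  show "continuous_on {(s, u). \<bar>s - u\<bar> < h} (\<lambda>b. \<bar>H (fst b) \<omega> - H (snd b) \<omega>\<bar>)"
    by (intro continuous_intros continuous_on_compose2[OF cont_adapted_cont[OF assms w, of UNIV]]) auto
qed

lemma not_osc_event: "\<omega> \<in> space M - osc_event H h \<delta> \<Longrightarrow> \<bar>s - u\<bar> < h \<Longrightarrow> \<bar>H s \<omega> - H u \<omega>\<bar> \<le> \<delta>"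
  unfolding osc_event_def by force

lemma osc_event_vanish:
  assumes "ext_adapted H" "\<delta> > 0"
  shows "((\<lambda>h. prob (osc_event H h \<delta>)) \<longlongrightarrow> 0) (at_right 0)"
proof (rule measure_vanish_at_right)
  show "\<forall>\<^sub>F h in at_right 0. osc_event H h \<delta> \<in> events"
    using osc_event_sets[OF ext_adapted_cproc[OF assms(1)]] by simp
  have "\<forall>\<^sub>F h in at_right 0. \<omega> \<notin> osc_event H h \<delta>" if w: "\<omega> \<in> space M" for \<omega>
  proof -
    obtain h where "h > 0" and h: "\<forall>s u. \<bar>s - u\<bar> < h \<longrightarrow> \<bar>H s \<omega> - H u \<omega>\<bar> < \<delta>"
      using ext_adapted_uniform[OF assms(1) w assms(2)] by auto
    have "\<omega> \<notin> osc_event H e \<delta>" if e: "0 < e" "e < h" for e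
    proof
      assume "\<omega> \<in> osc_event H e \<delta>"
      then obtain s u where "\<bar>s - u\<bar> < e" "\<delta> < \<bar>H s \<omega> - H u \<omega>\<bar>" unfolding osc_event_def by auto
      then show False using h[rule_format, of s u] e by linarith
    qed
    then show ?thesis unfolding eventually_at_right_field using \<open>h > 0\<close> by blast
  qed
  then show "AE \<omega> in M. \<forall>\<^sub>F e in at_right 0. \<omega> \<notin> osc_event H e \<delta>" by simp
qed

lemma osc_event_small:
  assumes "ext_adapted H" "\<delta> > 0" "\<gamma> > 0"
  shows "\<exists>h>0. prob (osc_event H h \<delta>) \<le> \<gamma>"
proof -
  have "\<forall>\<^sub>F h in at_right 0. prob (osc_event H h \<delta>) < \<gamma>"
    using order_tendstoD(2)[OF osc_event_vanish[OF assms(1,2)] assms(3)] .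
  then obtain b where "b > 0" "\<forall>h>0. h < b \<longrightarrow> prob (osc_event H h \<delta>) < \<gamma>"
    unfolding eventually_at_right_field by auto
  then have "0 < b/2" "prob (osc_event H (b/2) \<delta>) < \<gamma>" by simp_all
  then have "0 < b/2" "prob (osc_event H (b/2) \<delta>) \<le> \<gamma>" by simp_all
  then show ?thesis by blast
qed

section \<open>Stopping times, stopped processes and hitting times\<close>

lemma stop_sets:
  assumes "stopping_time_on M T Fi \<rho>"
  shows "{\<omega>\<in>space M. \<rho> \<omega> \<le> t} \<in> sets (G t)"
proof -
  have r: "\<omega> \<in> space M \<Longrightarrow> 0 \<le> \<rho> \<omega> \<and> \<rho> \<omega> \<le> T" for \<omega>
    using assms by (auto simp: stopping_time_on_def)
  consider "t < 0" | "t > T" | "0 \<le> t" "t \<le> T" by linarith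
  then show ?thesis
  proof cases
    case 1
    then have "{\<omega>\<in>space M. \<rho> \<omega> \<le> t} = {}" using r by force
    then show ?thesis by (simp only: sets.empty_sets)
  next
    case 2
    then have "{\<omega>\<in>space M. \<rho> \<omega> \<le> t} = space (G t)" using r by force
    then show ?thesis by (simp only: sets.top)
  next
    case 3
    then show ?thesis using assms by (auto simp: stopping_time_on_def G_def)
  qed
qed

lemma stopping_time_min:
  assumes "stopping_time_on M T Fi \<rho>" "stopping_time_on M T Fi \<sigma>"
  shows "stopping_time_on M T Fi (\<lambda>\<omega>. min (\<rho> \<omega>) (\<sigma> \<omega>))"
  unfolding stopping_time_on_def
proof (intro conjI ballI)
  show "min (\<rho> \<omega>) (\<sigma> \<omega>) \<in> {0..T}" if "\<omega> \<in> space M" for \<omega>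
    using assms that by (auto simp: stopping_time_on_def)
  fix t assume "t \<in> {0..T}"
  then have "{\<omega>\<in>space M. \<rho> \<omega> \<le> t} \<in> sets (Fi t)" "{\<omega>\<in>space M. \<sigma> \<omega> \<le> t} \<in> sets (Fi t)"
    using assms by (auto simp: stopping_time_on_def)
  moreover have "{\<omega>\<in>space M. min (\<rho> \<omega>) (\<sigma> \<omega>) \<le> t} = {\<omega>\<in>space M. \<rho> \<omega> \<le> t} \<union> {\<omega>\<in>space M. \<sigma> \<omega> \<le> t}"
    by (auto simp: min_le_iff_disj)
  ultimately show "{\<omega>\<in>space M. min (\<rho> \<omega>) (\<sigma> \<omega>) \<le> t} \<in> sets (Fi t)" by simp
qed

text \<open>The time \<open>min t \<rho>\<close> is rounded down to a grid, so that only countably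
  many random variables are selected, and the grid is refined along the continuous path.\<close>

lemma stopped_cproc:
  assumes Y: "cont_adapted Y" and r: "stopping_time_on M T Fi \<rho>"
  shows "cont_adapted (\<lambda>t \<omega>. Y (min t (\<rho> \<omega>)) \<omega>)"
  unfolding cont_adapted_def
proof (intro conjI allI ballI)
  show "continuous_on UNIV (\<lambda>t. Y (min t (\<rho> \<omega>)) \<omega>)" if "\<omega> \<in> space M" for \<omega>
    by (intro continuous_intros continuous_on_compose2[OF cont_adapted_cont[OF Y that, of UNIV]]) auto
  fix t
  have rm: "(\<lambda>\<omega>. min t (\<rho> \<omega>)) \<in> borel_measurable (G t)"
    unfolding borel_measurable_iff_le
  proof
    fix a
    show "{\<omega> \<in> space (G t). min t (\<rho> \<omega>) \<le> a} \<in> sets (G t)"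
    proof (cases "t \<le> a")
      case True
      then have "{\<omega> \<in> space (G t). min t (\<rho> \<omega>) \<le> a} = space (G t)" by auto
      then show ?thesis by (simp only: sets.top)
    next
      case False
      then have "{\<omega> \<in> space (G t). min t (\<rho> \<omega>) \<le> a} = {\<omega>\<in>space M. \<rho> \<omega> \<le> a}" by auto
      then show ?thesis using stop_sets[OF r, of a] sets_G_mono[of a t] False by auto
    qed
  qed
  \<comment> \<open>The rounded value never exceeds \<open>t\<close>. The outer \<open>min t\<close>
    makes each of the countably many slices measurable at \<open>t\<close>, including slices whose
    index does not occur.\<close>
  define f where "f n \<omega> = min t (real_of_int \<lfloor>real (Suc n) * min t (\<rho> \<omega>)\<rfloor> / real (Suc n))" for n \<omega>
  show "(\<lambda>\<omega>. Y (min t (\<rho> \<omega>)) \<omega>) \<in> borel_measurable (G t)"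
  proof (rule borel_measurable_LIMSEQ_real)
    fix n
    show "(\<lambda>\<omega>. Y (f n \<omega>) \<omega>) \<in> borel_measurable (G t)"
      unfolding f_def
    proof (rule measurable_compose_countable[where g = "\<lambda>\<omega>. \<lfloor>real (Suc n) * min t (\<rho> \<omega>)\<rfloor>"
        and f = "\<lambda>i \<omega>. Y (min t (real_of_int i / real (Suc n))) \<omega>"])
      show "(\<lambda>\<omega>. Y (min t (real_of_int i / real (Suc n))) \<omega>) \<in> borel_measurable (G t)" for i
        by (rule meas_G_mono[OF cont_adapted_meas[OF Y]]) simp
      show "(\<lambda>\<omega>. \<lfloor>real (Suc n) * min t (\<rho> \<omega>)\<rfloor>) \<in> G t \<rightarrow>\<^sub>M count_space UNIV"
        using rm by measurable
    qed
  next
    fix \<omega> assume "\<omega> \<in> space (G t)"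
    then have w: "\<omega> \<in> space M" by simp
    define x where "x = min t (\<rho> \<omega>)"
    have "(\<lambda>n. real_of_int \<lfloor>real (Suc n) * x\<rfloor> / real (Suc n)) \<longlonglongrightarrow> x"
      by (rule floor_approx)
    then have "(\<lambda>n. f n \<omega>) \<longlonglongrightarrow> min t x"
      unfolding f_def x_def[symmetric] by (intro tendsto_min tendsto_const)
    moreover have "min t x = x" by (simp add: x_def)
    ultimately have "(\<lambda>n. f n \<omega>) \<longlonglongrightarrow> x" by simp
    moreover have "isCont (\<lambda>t. Y t \<omega>) x"
      using cont_adapted_cont[OF Y w, of UNIV] by (simp add: continuous_on_eq_continuous_at)
    ultimately have "(\<lambda>n. Y (f n \<omega>) \<omega>) \<longlonglongrightarrow> Y x \<omega>"
      by (rule isCont_tendsto_compose[rotated])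
    then show "(\<lambda>n. Y (f n \<omega>) \<omega>) \<longlonglongrightarrow> Y (min t (\<rho> \<omega>)) \<omega>" by (simp add: x_def)
  qed
qed

text \<open>Inserting \<open>T\<close> keeps the set nonempty and gives the value \<open>T\<close>
  when the level is not reached.\<close>

definition hitting :: "(real \<Rightarrow> 'a \<Rightarrow> real) \<Rightarrow> real \<Rightarrow> 'a \<Rightarrow> real" where
  "hitting Y k \<omega> = Inf (insert T {t\<in>{0..T}. k \<le> Y t \<omega>})"

lemma hitting_range: "hitting Y k \<omega> \<in> {0..T}"
proof -
  have "0 \<le> hitting Y k \<omega>" unfolding hitting_def using T_pos by (intro cInf_greatest) auto
  moreover have "hitting Y k \<omega> \<le> T" unfolding hitting_def using T_pos by (intro cInf_lower bdd_belowI[of _ 0]) auto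
  ultimately show ?thesis by simp
qed

lemma hitting_lower: "0 \<le> t \<Longrightarrow> t < hitting Y k \<omega> \<Longrightarrow> Y t \<omega> < k"
proof (rule ccontr)
  assume t: "0 \<le> t" "t < hitting Y k \<omega>" "\<not> Y t \<omega> < k"
  have "t \<le> T" using t hitting_range[of Y k \<omega>] by simp
  then have "hitting Y k \<omega> \<le> t" unfolding hitting_def using t T_pos by (intro cInf_lower bdd_belowI[of _ 0]) auto
  then show False using t by simp
qed

text \<open>Strictly before the hitting time the path is below \<open>k\<close>, and left continuity
  carries the weak inequality to the hitting time itself. Time 0 is excluded because the path may
  start above \<open>k\<close>.\<close>

lemma hitting_bound:
  assumes Y: "cont_adapted Y" and w: "\<omega> \<in> space M" and u: "0 < u" "u \<le> hitting Y k \<omega>"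
  shows "Y u \<omega> \<le> k"
proof (rule ccontr)
  assume "\<not> Y u \<omega> \<le> k"
  then have k: "k < Y u \<omega>" by simp
  have "isCont (\<lambda>t. Y t \<omega>) u"
    using cont_adapted_cont[OF Y w, of UNIV] by (simp add: continuous_on_eq_continuous_at)
  then have "\<forall>\<^sub>F t in at u. k < Y t \<omega>"
    using order_tendstoD(1)[OF _ k] by (simp add: isCont_def)
  then have "\<forall>\<^sub>F t in at_left u. k < Y t \<omega>" by (simp add: eventually_at_split)
  moreover have "\<forall>\<^sub>F t in at_left u. 0 < t" "\<forall>\<^sub>F t in at_left u. t < u"
    using u(1) by (auto simp: eventually_at_left_field intro: exI[of _ 0])
  ultimately have "\<forall>\<^sub>F t in at_left u. False"
  proof eventually_elim
    case (elim t)
    then show False using hitting_lower[of t Y k \<omega>] u by simp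
  qed
  then show False by simp
qed

lemma hitting_stopping:
  assumes Y: "cont_adapted Y"
  shows "stopping_time_on M T Fi (hitting Y k)"
  unfolding stopping_time_on_def
proof (intro conjI ballI)
  show "hitting Y k \<omega> \<in> {0..T}" for \<omega> by (rule hitting_range)
  fix t assume t: "t \<in> {0..T}"
  have "{\<omega>\<in>space M. hitting Y k \<omega> \<le> t} \<in> sets (G t)"
  proof (cases "t = T")
    case True
    then have "{\<omega>\<in>space M. hitting Y k \<omega> \<le> t} = space (G t)" using hitting_range by auto
    then show ?thesis by (simp only: sets.top)
  next
    case False
    then have tT: "0 \<le> t" "t < T" using t by auto
    \<comment> \<open>For \<open>t < T\<close>, hitting by time \<open>t\<close> means that the
      maximum over \<open>[0, t]\<close> is at least \<open>k\<close>. Countably many strict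
      exceedances of \<open>k - 1/(n+1)\<close> express this measurably; as the maximum is attained,
      nothing is lost in the limit.\<close>
    have "hitting Y k \<omega> \<le> t \<longleftrightarrow> (\<forall>n. \<exists>s\<in>{0..t}. k - 1 / real (Suc n) < Y s \<omega>)" if w: "\<omega> \<in> space M" for \<omega>
    proof
      assume h: "hitting Y k \<omega> \<le> t"
      show "\<forall>n. \<exists>s\<in>{0..t}. k - 1 / real (Suc n) < Y s \<omega>"
      proof (rule ccontr)
        assume "\<not> (\<forall>n. \<exists>s\<in>{0..t}. k - 1 / real (Suc n) < Y s \<omega>)"
        then obtain n where n: "\<And>s. s \<in> {0..t} \<Longrightarrow> Y s \<omega> \<le> k - 1 / real (Suc n)"
          by (meson not_le_imp_less)
        have pos: "0 < 1 / real (Suc n)" by simp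
        have lt: "Y t \<omega> < k" using n[of t] tT pos by (meson atLeastAtMost_iff diff_less_eq less_add_same_cancel1 order_le_less_trans order_refl)
        have "isCont (\<lambda>t. Y t \<omega>) t"
          using cont_adapted_cont[OF Y w, of UNIV] by (simp add: continuous_on_eq_continuous_at)
        then have "\<forall>\<^sub>F s in at t. Y s \<omega> < k"
          using order_tendstoD(2)[OF _ lt] by (simp add: isCont_def)
        then have "\<forall>\<^sub>F s in at_right t. Y s \<omega> < k" by (simp add: eventually_at_split)
        then obtain b where b: "b > t" "\<And>s. t < s \<Longrightarrow> s < b \<Longrightarrow> Y s \<omega> < k"
          unfolding eventually_at_right_field by auto
        have "min b T \<le> hitting Y k \<omega>"
          unfolding hitting_def
        proof (rule cInf_greatest)
          fix s assume s: "s \<in> insert T {t \<in> {0..T}. k \<le> Y t \<omega>}"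
          show "min b T \<le> s"
          proof (rule ccontr)
            assume "\<not> min b T \<le> s"
            then have s': "s < b" "s < T" by auto
            then have s2: "0 \<le> s" "k \<le> Y s \<omega>" using s by auto
            have "\<not> s \<le> t"
            proof
              assume "s \<le> t"
              then show False using n[of s] s2 pos by (simp del: of_nat_Suc)
            qed
            then show False using b(2)[of s] s' s2 by simp
          qed
        qed auto
        then show False using b tT h by simp
      qed
    next
      assume a: "\<forall>n. \<exists>s\<in>{0..t}. k - 1 / real (Suc n) < Y s \<omega>"
      obtain x where x: "x \<in> {0..t}" "\<And>s. s \<in> {0..t} \<Longrightarrow> Y s \<omega> \<le> Y x \<omega>"
        using continuous_attains_sup[of "{0..t}" "\<lambda>t. Y t \<omega>"] cont_adapted_cont[OF Y w] tT by auto
      have kn: "k - 1 / real (Suc n) \<le> Y x \<omega>" for n using a x by (meson less_eq_real_def order_trans)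
      have "k \<le> Y x \<omega>"
      proof (rule field_le_epsilon)
        fix e :: real assume "0 < e"
        then obtain n where "1 / real (Suc n) < e" using nat_approx_posE by blast
        then show "k \<le> Y x \<omega> + e" using kn[of n] by linarith
      qed
      then have "hitting Y k \<omega> \<le> x" unfolding hitting_def using x tT by (intro cInf_lower bdd_belowI[of _ 0]) auto
      then show "hitting Y k \<omega> \<le> t" using x by simp
    qed
    then have "{\<omega>\<in>space M. hitting Y k \<omega> \<le> t} = {\<omega>\<in>space (G t). \<forall>n. \<omega> \<in> {\<omega>\<in>space (G t). \<exists>s\<in>{0..t}. k - 1 / real (Suc n) < Y s \<omega>}}"
      by auto
    also have "\<dots> \<in> sets (G t)"
    proof (rule sets.sets_Collect_countable_All)
      fix n :: nat
      have "{\<omega>\<in>space (G t). \<exists>s\<in>{0..t}. k - 1 / real (Suc n) < Y s \<omega>} \<in> sets (G t)"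
        by (rule sets_exists_gt) (use meas_G_mono[OF cont_adapted_meas[OF Y]] cont_adapted_cont[OF Y] in auto)
      then show "{\<omega>\<in>space (G t). \<omega> \<in> {\<omega>\<in>space (G t). \<exists>s\<in>{0..t}. k - 1 / real (Suc n) < Y s \<omega>}} \<in> sets (G t)"
        by simp
    qed
    finally show ?thesis .
  qed
  then show "{\<omega>\<in>space M. hitting Y k \<omega> \<le> t} \<in> sets (Fi t)" using t by (simp add: G_def)
qed

lemma hitting_mono: "k \<le> l \<Longrightarrow> hitting Y k \<omega> \<le> hitting Y l \<omega>"
  unfolding hitting_def using T_pos by (intro cInf_superset_mono bdd_belowI[of _ 0]) auto

lemma hitting_eventually_T:
  assumes Y: "cont_adapted Y" and w: "\<omega> \<in> space M"
  shows "\<exists>K. \<forall>k\<ge>K. hitting Y k \<omega> = T"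
proof -
  have "\<exists>x\<in>{0..T}. \<forall>s\<in>{0..T}. Y s \<omega> \<le> Y x \<omega>"
    by (rule continuous_attains_sup) (use cont_adapted_cont[OF Y w] T_pos in auto)
  then obtain x where x: "\<And>s. s \<in> {0..T} \<Longrightarrow> Y s \<omega> \<le> Y x \<omega>" by blast
  have "hitting Y k \<omega> = T" if "k \<ge> Y x \<omega> + 1" for k
  proof -
    have "{t\<in>{0..T}. k \<le> Y t \<omega>} = {}" using x that by force
    then show ?thesis unfolding hitting_def by (simp only: cInf_singleton)
  qed
  then show ?thesis by blast
qed

end

section \<open>Optional stopping and localisation\<close>

context filtered_space
begin

text \<open>The defining property of conditional expectation, brought into the tested form of
  \<open>bdd_mart\<close>. The martingale is merely integrable, so the products are controlled by
  the bound on \<open>W\<close>.\<close>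

lemma martingale_test:
  assumes L: "martingale_on M T Fi L" and st: "s \<le> t"
    and W: "W \<in> borel_measurable (G s)" and Wb: "\<And>\<omega>. \<omega> \<in> space M \<Longrightarrow> \<bar>W \<omega>\<bar> \<le> C"
  shows "integrable M (\<lambda>\<omega>. W \<omega> * ext_proc T L t \<omega>)"
    "expectation (\<lambda>\<omega>. W \<omega> * (ext_proc T L t \<omega> - ext_proc T L s \<omega>)) = 0"
proof -
  interpret sub: finite_measure_subalgebra M "G s"
    by (unfold_locales) (rule subalg_G)
  have int: "integrable M (ext_proc T L u)" for u
    using L T_pos by (auto simp: martingale_on_def ext_proc_def)
  have Wm: "W \<in> borel_measurable M" using meas_G_M[OF W] .
  have intW: "integrable M (\<lambda>\<omega>. W \<omega> * ext_proc T L u \<omega>)" for u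
  proof (rule Bochner_Integration.integrable_bound[of _ "\<lambda>\<omega>. C * ext_proc T L u \<omega>"])
    show "integrable M (\<lambda>\<omega>. C * ext_proc T L u \<omega>)" using int by simp
    show "(\<lambda>\<omega>. W \<omega> * ext_proc T L u \<omega>) \<in> borel_measurable M" using Wm int[of u] by simp
    show "AE \<omega> in M. norm (W \<omega> * ext_proc T L u \<omega>) \<le> norm (C * ext_proc T L u \<omega>)"
    proof (rule AE_I2)
      fix \<omega> assume "\<omega> \<in> space M"
      then have "\<bar>W \<omega>\<bar> \<le> \<bar>C\<bar>" using Wb by (meson abs_ge_self order_trans)
      then show "norm (W \<omega> * ext_proc T L u \<omega>) \<le> norm (C * ext_proc T L u \<omega>)"
        by (simp add: abs_mult mult_right_mono)
    qed
  qed
  show "integrable M (\<lambda>\<omega>. W \<omega> * ext_proc T L t \<omega>)" by (rule intW)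
  have m: "AE \<omega> in M. real_cond_exp M (G s) (ext_proc T L t) \<omega> = ext_proc T L s \<omega>"
    using L st T_pos unfolding martingale_on_def ext_proc_def G_def by auto
  have "expectation (\<lambda>\<omega>. W \<omega> * ext_proc T L t \<omega>) = expectation (\<lambda>\<omega>. W \<omega> * real_cond_exp M (G s) (ext_proc T L t) \<omega>)"
    by (rule sub.real_cond_exp_intg(2)[symmetric, OF intW W]) (use int in auto)
  also have "\<dots> = expectation (\<lambda>\<omega>. W \<omega> * ext_proc T L s \<omega>)"
  proof (rule integral_cong_AE)
    show "(\<lambda>\<omega>. W \<omega> * real_cond_exp M (G s) (ext_proc T L t) \<omega>) \<in> borel_measurable M"
      using Wm by simp
    show "(\<lambda>\<omega>. W \<omega> * ext_proc T L s \<omega>) \<in> borel_measurable M" using Wm int[of s] by simp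
    show "AE \<omega> in M. W \<omega> * real_cond_exp M (G s) (ext_proc T L t) \<omega> = W \<omega> * ext_proc T L s \<omega>"
      using m by eventually_elim simp
  qed
  finally have "expectation (\<lambda>\<omega>. W \<omega> * ext_proc T L t \<omega>) = expectation (\<lambda>\<omega>. W \<omega> * ext_proc T L s \<omega>)" .
  then show "expectation (\<lambda>\<omega>. W \<omega> * (ext_proc T L t \<omega> - ext_proc T L s \<omega>)) = 0"
    using intW by (simp add: right_diff_distrib)
qed

text \<open>Discretising \<open>\<rho>\<close> from above, the test function \<open>Z 1{|L| \<le> K + 1}\<close> evaluated at the discretised
  time replaces uniform integrability.\<close>
lemma optional_stopping_test:
  assumes L: "martingale_on M T Fi L" and Lc: "cont_proc M T L" and r: "stopping_time_on M T Fi \<rho>"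
    and K: "\<And>t \<omega>. \<omega> \<in> space M \<Longrightarrow> \<bar>ext_proc T L (min t (\<rho> \<omega>)) \<omega>\<bar> \<le> K"
    and st: "s < t" and Z: "Z \<in> borel_measurable (G s)" and Zb: "\<And>\<omega>. \<omega> \<in> space M \<Longrightarrow> \<bar>Z \<omega>\<bar> \<le> C"
  shows "expectation (\<lambda>\<omega>. if s < \<rho> \<omega> \<and> \<rho> \<omega> \<le> t then Z \<omega> * (ext_proc T L t \<omega> - ext_proc T L (\<rho> \<omega>) \<omega>) else 0) = 0"
    (is "expectation ?A = 0")
proof -
  define E where "E = ext_proc T L"
  have e: "ext_adapted E" unfolding E_def
    by (rule ext_adapted_ext[OF Lc]) (use L in \<open>auto simp: martingale_on_def\<close>)
  have Ec: "cont_adapted E" using e by (rule ext_adapted_cproc)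
  note Em = cont_adapted_meas[OF Ec]
  have [measurable]: "E u \<in> borel_measurable M" for u using cont_adapted_meas_M[OF Ec] .
  have int: "integrable M (E u)" for u
    using L T_pos by (auto simp: E_def martingale_on_def ext_proc_def)
  have Zm [measurable]: "Z \<in> borel_measurable M" using meas_G_M[OF Z] .
  define g where "g n i = s + (t - s) * real i / real (Suc n)" for n i
  define B where "B n i = {\<omega>\<in>space M. g n i < \<rho> \<omega> \<and> \<rho> \<omega> \<le> g n (Suc i)}" for n i
  define W where "W n i \<omega> = (if \<omega> \<in> B n i \<and> \<bar>E (g n (Suc i)) \<omega>\<bar> \<le> K + 1 then Z \<omega> else 0)" for n i \<omega>
  define A where "A n \<omega> = (\<Sum>i\<in>{..n}. W n i \<omega> * (E t \<omega> - E (g n (Suc i)) \<omega>))" for n \<omega>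
  have g_le: "s \<le> g n i" "i \<le> Suc n \<Longrightarrow> g n i \<le> t" for n i
  proof -
    show "s \<le> g n i" using st by (simp add: g_def)
    assume "i \<le> Suc n"
    then have "real i / real (Suc n) \<le> 1" by simp
    then have "(t - s) * (real i / real (Suc n)) \<le> (t - s) * 1" using st by (intro mult_left_mono) auto
    then show "g n i \<le> t" by (simp add: g_def)
  qed
  have g_mono: "g n i \<le> g n (Suc i)" for n i
    unfolding g_def using st by (intro add_left_mono divide_right_mono mult_left_mono) auto
  have Bm: "B n i \<in> sets (G (g n (Suc i)))" for n i
  proof -
    have "B n i = {\<omega>\<in>space M. \<rho> \<omega> \<le> g n (Suc i)} - {\<omega>\<in>space M. \<rho> \<omega> \<le> g n i}" by (auto simp: B_def)
    then show ?thesis using stop_sets[OF r, of "g n (Suc i)"] stop_sets[OF r, of "g n i"] sets_G_mono[OF g_mono[of n i]] by auto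
  qed
  have Wm: "W n i \<in> borel_measurable (G (g n (Suc i)))" for n i
  proof -
    note [measurable] = Bm[of n i] Em[of "g n (Suc i)"] meas_G_mono[OF Z g_le(1)[of n "Suc i"]]
    show ?thesis unfolding W_def[abs_def] by measurable
  qed
  have C0: "0 \<le> C" using Zb not_empty by (meson abs_ge_zero all_not_in_conv order_trans)
  have Wb: "\<bar>W n i \<omega>\<bar> \<le> C" if "\<omega> \<in> space M" for n i \<omega>
    using Zb[OF that] C0 by (simp add: W_def)
  have A0: "expectation (A n) = 0" for n
  proof -
    have "expectation (A n) = (\<Sum>i\<in>{..n}. expectation (\<lambda>\<omega>. W n i \<omega> * (E t \<omega> - E (g n (Suc i)) \<omega>)))"
      unfolding A_def
    proof (rule Bochner_Integration.integral_sum)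
      fix i assume "i \<in> {..n}"
      have "integrable M (\<lambda>\<omega>. W n i \<omega> * E t \<omega> - W n i \<omega> * E (g n (Suc i)) \<omega>)"
      proof (rule Bochner_Integration.integrable_diff)
        show "integrable M (\<lambda>\<omega>. W n i \<omega> * E t \<omega>)" unfolding E_def
          by (rule martingale_test(1)[OF L _ Wm Wb]) (use g_le \<open>i \<in> {..n}\<close> in auto)
        show "integrable M (\<lambda>\<omega>. W n i \<omega> * E (g n (Suc i)) \<omega>)" unfolding E_def
          by (rule martingale_test(1)[OF L _ Wm Wb]) auto
      qed
      then show "integrable M (\<lambda>\<omega>. W n i \<omega> * (E t \<omega> - E (g n (Suc i)) \<omega>))" by (simp add: right_diff_distrib)
    qed
    also have "\<dots> = 0"
    proof (rule sum.neutral, rule ballI)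
      fix i assume "i \<in> {..n}"
      then show "expectation (\<lambda>\<omega>. W n i \<omega> * (E t \<omega> - E (g n (Suc i)) \<omega>)) = 0"
        unfolding E_def by (intro martingale_test(2)[OF L _ Wm Wb]) (use g_le in auto)
    qed
    finally show ?thesis .
  qed
  \<comment> \<open>The number of the first grid point at or after \<open>\<rho> \<omega>\<close>.
    Thus \<open>B n i\<close> is the event that it equals \<open>Suc i\<close>, and for
    \<open>s < \<rho> \<omega> \<le> t\<close> it lies between 1 and \<open>Suc n\<close>.\<close>
  define k where "k n \<omega> = nat \<lceil>(\<rho> \<omega> - s) * real (Suc n) / (t - s)\<rceil>" for n \<omega>
  have kB: "\<omega> \<in> B n i \<longleftrightarrow> k n \<omega> = Suc i" if w: "\<omega> \<in> space M" for n i \<omega>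
  proof -
    have "k n \<omega> = Suc i \<longleftrightarrow> \<lceil>(\<rho> \<omega> - s) * real (Suc n) / (t - s)\<rceil> = int (Suc i)"
      unfolding k_def by linarith
    also have "\<dots> \<longleftrightarrow> real i < (\<rho> \<omega> - s) * real (Suc n) / (t - s) \<and> (\<rho> \<omega> - s) * real (Suc n) / (t - s) \<le> real (Suc i)"
      unfolding ceiling_eq_iff by simp
    also have "\<dots> \<longleftrightarrow> (t - s) * real i / real (Suc n) < \<rho> \<omega> - s \<and> \<rho> \<omega> - s \<le> (t - s) * real (Suc i) / real (Suc n)"
      using st by (simp add: pos_less_divide_eq pos_divide_less_eq pos_le_divide_eq pos_divide_le_eq mult.commute del: of_nat_Suc)
    also have "\<dots> \<longleftrightarrow> \<omega> \<in> B n i" using w unfolding B_def g_def by auto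
    finally show ?thesis by simp
  qed
  have k_le: "k n \<omega> \<le> Suc n" "0 < k n \<omega>" if "s < \<rho> \<omega>" "\<rho> \<omega> \<le> t" for n \<omega>
  proof -
    have "(\<rho> \<omega> - s) * real (Suc n) \<le> real (Suc n) * (t - s)" 
      using that by (subst mult.commute) (intro mult_left_mono, auto)
    then have "(\<rho> \<omega> - s) * real (Suc n) / (t - s) \<le> real (Suc n)" using st by (simp add: pos_divide_le_eq)
    then show "k n \<omega> \<le> Suc n" unfolding k_def by (simp add: ceiling_le_iff nat_le_iff)
    show "0 < k n \<omega>" unfolding k_def using that st by simp
  qed
  have A_eq: "A n \<omega> = (if s < \<rho> \<omega> \<and> \<rho> \<omega> \<le> t \<and> \<bar>E (g n (k n \<omega>)) \<omega>\<bar> \<le> K + 1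
      then Z \<omega> * (E t \<omega> - E (g n (k n \<omega>)) \<omega>) else 0)" if w: "\<omega> \<in> space M" for n \<omega>
  proof (cases "s < \<rho> \<omega> \<and> \<rho> \<omega> \<le> t")
    case True
    obtain j where j: "k n \<omega> = Suc j" "j \<le> n" using k_le[of \<omega> n] True by (metis Suc_le_mono gr0_implies_Suc)
    have "A n \<omega> = (\<Sum>i\<in>{..n}. if i = j then W n j \<omega> * (E t \<omega> - E (g n (Suc j)) \<omega>) else 0)"
      unfolding A_def by (rule sum.cong) (use kB[OF w] j in \<open>auto simp: W_def\<close>)
    also have "\<dots> = W n j \<omega> * (E t \<omega> - E (g n (Suc j)) \<omega>)" using j by simp
    finally show ?thesis using True kB[OF w, of n j] j by (simp add: W_def)
  next
    case False
    have "W n i \<omega> = 0" if "i \<in> {..n}" for i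
      using False g_le(1)[of n i] g_le(2)[of "Suc i" n] that by (auto simp: W_def B_def)
    then have "A n \<omega> = 0" unfolding A_def by (intro sum.neutral) auto
    then show ?thesis using False by (metis (no_types, lifting))
  qed
  have lim: "(\<lambda>n. A n \<omega>) \<longlonglongrightarrow> ?A \<omega>" if w: "\<omega> \<in> space M" for \<omega>
  proof (cases "s < \<rho> \<omega> \<and> \<rho> \<omega> \<le> t")
    case True
    have "(\<lambda>n. g n (k n \<omega>)) \<longlonglongrightarrow> \<rho> \<omega>"
    proof (rule real_tendsto_sandwich)
      show "\<forall>\<^sub>F n in sequentially. \<rho> \<omega> \<le> g n (k n \<omega>)" "\<forall>\<^sub>F n in sequentially. g n (k n \<omega>) \<le> \<rho> \<omega> + (t - s) / real (Suc n)"
      proof -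
        have "\<rho> \<omega> \<le> g n (k n \<omega>) \<and> g n (k n \<omega>) \<le> \<rho> \<omega> + (t - s) / real (Suc n)" for n
        proof -
          obtain j where j: "k n \<omega> = Suc j" using k_le[of \<omega> n] True by (metis gr0_implies_Suc)
          then have "g n j < \<rho> \<omega>" "\<rho> \<omega> \<le> g n (Suc j)" using kB[OF w, of n j] by (auto simp: B_def)
          moreover have "g n (Suc j) = g n j + (t - s) / real (Suc n)"
            by (simp add: g_def add_divide_distrib distrib_left del: of_nat_Suc) (simp add: distrib_left add_divide_distrib)
          ultimately show ?thesis using j by simp
        qed
        then show "\<forall>\<^sub>F n in sequentially. \<rho> \<omega> \<le> g n (k n \<omega>)" "\<forall>\<^sub>F n in sequentially. g n (k n \<omega>) \<le> \<rho> \<omega> + (t - s) / real (Suc n)"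
          by auto
      qed
      show "(\<lambda>n. \<rho> \<omega> + (t - s) / real (Suc n)) \<longlonglongrightarrow> \<rho> \<omega>"
        using tendsto_add[OF tendsto_const tendsto_mult_right[OF LIMSEQ_inverse_real_of_nat], of "\<rho> \<omega>" "t - s"]
        by (simp add: divide_inverse mult.commute)
    qed simp
    moreover have "isCont (\<lambda>u. E u \<omega>) (\<rho> \<omega>)"
      using cont_adapted_cont[OF Ec w, of UNIV] by (simp add: continuous_on_eq_continuous_at)
    ultimately have l: "(\<lambda>n. E (g n (k n \<omega>)) \<omega>) \<longlonglongrightarrow> E (\<rho> \<omega>) \<omega>"
      by (rule isCont_tendsto_compose[rotated])
    then have l': "(\<lambda>n. Z \<omega> * (E t \<omega> - E (g n (k n \<omega>)) \<omega>)) \<longlonglongrightarrow> Z \<omega> * (E t \<omega> - E (\<rho> \<omega>) \<omega>)"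
      by (intro tendsto_intros)
    \<comment> \<open>The stopped value is at most \<open>K\<close>, so the cut-off at
      \<open>K + 1\<close> is met strictly in the limit and becomes inactive for large
      \<open>n\<close>; a cut-off at \<open>K\<close> might stay active.\<close>
    have "\<bar>E (\<rho> \<omega>) \<omega>\<bar> < K + 1" using K[OF w, of "\<rho> \<omega>"] by (simp add: E_def)
    then have "\<forall>\<^sub>F n in sequentially. \<bar>E (g n (k n \<omega>)) \<omega>\<bar> < K + 1"
      using order_tendstoD(2)[OF tendsto_rabs[OF l]] by simp
    then have "\<forall>\<^sub>F n in sequentially. Z \<omega> * (E t \<omega> - E (g n (k n \<omega>)) \<omega>) = A n \<omega>"
      by (rule eventually_mono) (use A_eq[OF w] True in auto)
    then have "(\<lambda>n. A n \<omega>) \<longlonglongrightarrow> Z \<omega> * (E t \<omega> - E (\<rho> \<omega>) \<omega>)"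
      using l' by (rule Lim_transform_eventually[rotated])
    then show ?thesis using True by (simp add: E_def)
  next
    case False
    then have "A n \<omega> = 0" for n using A_eq[OF w, of n] by (metis (no_types, lifting))
    then show ?thesis using False by auto
  qed
  have Am: "A n \<in> borel_measurable M" for n
    unfolding A_def using meas_G_M[OF Wm] by (intro borel_measurable_sum borel_measurable_times borel_measurable_diff) auto
  have "(\<lambda>n. expectation (A n)) \<longlonglongrightarrow> expectation ?A"
  \<comment> \<open>The cut-off bounds the value at the discretised time, which leaves
    \<open>E t\<close>, at a fixed time, as the only unbounded part of the dominating
    function.\<close>
  proof (rule integral_dominated_convergence[where w = "\<lambda>\<omega>. C * (\<bar>E t \<omega>\<bar> + \<bar>K + 1\<bar>)"])
    show "?A \<in> borel_measurable M" by (rule borel_measurable_LIMSEQ_real[OF lim Am])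
    show "integrable M (\<lambda>\<omega>. C * (\<bar>E t \<omega>\<bar> + \<bar>K + 1\<bar>))" using int by simp
    show "AE x in M. norm (A n x) \<le> C * (\<bar>E t x\<bar> + \<bar>K + 1\<bar>)" for n
    proof (rule AE_I2)
      fix x assume x: "x \<in> space M"
      show "norm (A n x) \<le> C * (\<bar>E t x\<bar> + \<bar>K + 1\<bar>)"
      proof (cases "s < \<rho> x \<and> \<rho> x \<le> t \<and> \<bar>E (g n (k n x)) x\<bar> \<le> K + 1")
        case True
        then have "A n x = Z x * (E t x - E (g n (k n x)) x)" using A_eq[OF x, of n] by simp
        moreover have "\<bar>E t x - E (g n (k n x)) x\<bar> \<le> \<bar>E t x\<bar> + \<bar>K + 1\<bar>" using True by linarith
        ultimately show ?thesis using Zb[OF x] C0 by (simp add: abs_mult mult_mono)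
      next
        case False
        then have "A n x = 0" using A_eq[OF x, of n] by auto
        then show ?thesis using C0 by simp
      qed
    qed
  qed (use Am lim in auto)
  moreover have "(\<lambda>n. expectation (A n)) \<longlonglongrightarrow> 0" using A0 by simp
  ultimately show ?thesis by (rule LIMSEQ_unique)
qed

text \<open>On \<open>s < \<rho>\<close> the stopped increment is the full increment
  \<open>E t - E s\<close> minus, when \<open>\<rho> \<le> t\<close>, the overshoot
  \<open>E t - E \<rho>\<close>; elsewhere it is zero. The full increment is centred by the
  martingale property with \<open>Z\<close> restricted to \<open>s < \<rho>\<close>, the overshoot
  by \<open>optional_stopping_test\<close>.\<close>

lemma stopped_bmart:
  assumes L: "martingale_on M T Fi L" and Lc: "cont_proc M T L" and r: "stopping_time_on M T Fi \<rho>"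
    and K: "\<And>t \<omega>. \<omega> \<in> space M \<Longrightarrow> \<bar>ext_proc T L (min t (\<rho> \<omega>)) \<omega>\<bar> \<le> K"
  shows "bdd_mart (\<lambda>t \<omega>. ext_proc T L (min t (\<rho> \<omega>)) \<omega>)"
proof -
  define E where "E = ext_proc T L"
  have e: "ext_adapted E" unfolding E_def
    by (rule ext_adapted_ext[OF Lc]) (use L in \<open>auto simp: martingale_on_def\<close>)
  have Ec: "cont_adapted E" using e by (rule ext_adapted_cproc)
  have cs: "cont_adapted (\<lambda>t \<omega>. E (min t (\<rho> \<omega>)) \<omega>)" by (rule stopped_cproc[OF Ec r])
  have [measurable]: "E u \<in> borel_measurable M" for u using cont_adapted_meas_M[OF Ec] .
  have "expectation (\<lambda>\<omega>. Z \<omega> * (E (min t (\<rho> \<omega>)) \<omega> - E (min s (\<rho> \<omega>)) \<omega>)) = 0"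
    if st: "s \<le> t" and Z: "Z \<in> borel_measurable (G s)" and Zb: "\<forall>\<omega>\<in>space M. \<bar>Z \<omega>\<bar> \<le> C" for s t Z C
  proof (cases "s = t")
    case False
    then have st: "s < t" using st by simp
    note [measurable] = meas_G_M[OF Z]
    define W where "W \<omega> = (if s < \<rho> \<omega> then Z \<omega> else 0)" for \<omega>
    have Wm: "W \<in> borel_measurable (G s)"
    proof -
      have 1: "{\<omega>\<in>space (G s). s < \<rho> \<omega>} = space (G s) - {\<omega>\<in>space M. \<rho> \<omega> \<le> s}" by auto
      have "{\<omega>\<in>space (G s). s < \<rho> \<omega>} \<in> sets (G s)" unfolding 1 using stop_sets[OF r, of s] by blast
      then show ?thesis unfolding W_def[abs_def] using Z by (intro measurable_If) (auto simp: pred_def)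
    qed
    note [measurable] = meas_G_M[OF Wm]
    have C0: "0 \<le> C" using Zb not_empty by (meson abs_ge_zero all_not_in_conv order_trans)
    have Wb: "\<And>\<omega>. \<omega> \<in> space M \<Longrightarrow> \<bar>W \<omega>\<bar> \<le> C" using Zb C0 by (simp add: W_def)
    let ?A = "\<lambda>\<omega>. if s < \<rho> \<omega> \<and> \<rho> \<omega> \<le> t then Z \<omega> * (E t \<omega> - E (\<rho> \<omega>) \<omega>) else 0"
    have eq: "Z \<omega> * (E (min t (\<rho> \<omega>)) \<omega> - E (min s (\<rho> \<omega>)) \<omega>) = W \<omega> * (E t \<omega> - E s \<omega>) - ?A \<omega>" if "\<omega> \<in> space M" for \<omega>
      using st by (auto simp: W_def min_def algebra_simps)
    have a: "expectation ?A = 0"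
      using optional_stopping_test[OF L Lc r K st Z] Zb unfolding E_def by blast
    have i1: "integrable M (\<lambda>\<omega>. W \<omega> * (E t \<omega> - E s \<omega>))"
      using Bochner_Integration.integrable_diff[OF martingale_test(1)[OF L order.strict_implies_order[OF st] Wm Wb] martingale_test(1)[OF L order_refl Wm Wb]]
      by (simp add: E_def right_diff_distrib)
    have i2: "integrable M (\<lambda>\<omega>. Z \<omega> * (E (min t (\<rho> \<omega>)) \<omega> - E (min s (\<rho> \<omega>)) \<omega>))"
    proof (rule integrable_bdd_mult[of _ C _ "K + K"])
      show "(\<lambda>\<omega>. E (min t (\<rho> \<omega>)) \<omega> - E (min s (\<rho> \<omega>)) \<omega>) \<in> borel_measurable M"
        using cont_adapted_meas_M[OF cs] by (intro borel_measurable_diff)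
      show "\<bar>E (min t (\<rho> \<omega>)) \<omega> - E (min s (\<rho> \<omega>)) \<omega>\<bar> \<le> K + K" if "\<omega> \<in> space M" for \<omega>
        using K[OF that, of t] K[OF that, of s] unfolding E_def by linarith
    qed (use Zb in auto)
    \<comment> \<open>Integrability of the overshoot is read off the identity \<open>eq\<close>, as
      the difference of two integrable terms.\<close>
    have i3: "integrable M ?A"
    proof -
      have "integrable M (\<lambda>\<omega>. W \<omega> * (E t \<omega> - E s \<omega>) - Z \<omega> * (E (min t (\<rho> \<omega>)) \<omega> - E (min s (\<rho> \<omega>)) \<omega>))"
        using i1 i2 by simp
      also have "?this \<longleftrightarrow> integrable M ?A"
        by (rule Bochner_Integration.integrable_cong) (use eq in auto)
      finally show ?thesis .
    qed
    have "expectation (\<lambda>\<omega>. Z \<omega> * (E (min t (\<rho> \<omega>)) \<omega> - E (min s (\<rho> \<omega>)) \<omega>)) =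
        expectation (\<lambda>\<omega>. W \<omega> * (E t \<omega> - E s \<omega>) - ?A \<omega>)"
      by (rule Bochner_Integration.integral_cong) (use eq in auto)
    also have "\<dots> = expectation (\<lambda>\<omega>. W \<omega> * (E t \<omega> - E s \<omega>)) - expectation ?A"
      by (rule Bochner_Integration.integral_diff[OF i1 i3])
    also have "\<dots> = 0" using a martingale_test(2)[OF L order.strict_implies_order[OF st] Wm Wb] by (simp add: E_def)
    finally show ?thesis .
  qed simp
  then show ?thesis unfolding bdd_mart_def E_def[symmetric] using cs K unfolding E_def[symmetric] by blast
qed

text \<open>The given localising times are lowered to the hitting time of |N - N 0| + |H|, which
  bounds the stopped martingale and, before the stopping time, the integrand. \<open>N 0\<close> is
  subtracted because it may be unbounded; the bound on \<open>H\<close> holds strictly before the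
  stopping time because \<open>H\<close> may already start above the level.\<close>

lemma localization:
  assumes N: "cont_local_martingale M T Fi N" and H: "cont_adapted H"
  obtains \<rho> :: "nat \<Rightarrow> 'a \<Rightarrow> real"
  where "\<And>k. stopping_time_on M T Fi (\<rho> k)"
    "\<And>\<omega>. \<omega> \<in> space M \<Longrightarrow> mono (\<lambda>k. \<rho> k \<omega>)"
    "AE \<omega> in M. \<exists>k. \<rho> k \<omega> = T"
    "\<And>k. bdd_mart (\<lambda>t \<omega>. ext_proc T N (min t (\<rho> k \<omega>)) \<omega> - N 0 \<omega>)"
    "\<And>k t \<omega>. \<omega> \<in> space M \<Longrightarrow> 0 \<le> t \<Longrightarrow> t < \<rho> k \<omega> \<Longrightarrow> \<bar>H t \<omega>\<bar> \<le> real k"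
proof -
  have Nc: "cont_proc M T N" and Na: "adapted T Fi N"
    using N by (auto simp: cont_local_martingale_def local_martingale_on_def)
  define E where "E = ext_proc T N"
  have e: "ext_adapted E" unfolding E_def by (rule ext_adapted_ext[OF Nc Na])
  have Ec: "cont_adapted E" using e by (rule ext_adapted_cproc)
  obtain \<sigma> :: "nat \<Rightarrow> 'a \<Rightarrow> real" where s: "\<And>n. stopping_time_on M T Fi (\<sigma> n)" "\<And>\<omega>. \<omega> \<in> space M \<Longrightarrow> mono (\<lambda>n. \<sigma> n \<omega>)"
    "AE \<omega> in M. \<exists>n. \<sigma> n \<omega> = T"
    "\<And>n. martingale_on M T Fi (\<lambda>t \<omega>. N (min t (\<sigma> n \<omega>)) \<omega> - N 0 \<omega>)"
    using N unfolding cont_local_martingale_def local_martingale_on_def by blast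
  have sr: "0 \<le> \<sigma> n \<omega>" "\<sigma> n \<omega> \<le> T" if "\<omega> \<in> space M" for n \<omega>
    using s(1)[of n] that by (auto simp: stopping_time_on_def)
  \<comment> \<open>\<open>E (min t 0)\<close> is \<open>N 0\<close>, written so as to be measurable
    at every real time \<open>t\<close>.\<close>
  define Y where "Y t \<omega> = \<bar>E t \<omega> - E (min t 0) \<omega>\<bar> + \<bar>H t \<omega>\<bar>" for t \<omega>
  have Yc: "cont_adapted Y"
    unfolding cont_adapted_def Y_def
  proof (intro conjI allI ballI)
    show "(\<lambda>\<omega>. \<bar>E t \<omega> - E (min t 0) \<omega>\<bar> + \<bar>H t \<omega>\<bar>) \<in> borel_measurable (G t)" for t
      using cont_adapted_meas[OF Ec, of t] cont_adapted_meas[OF H, of t] meas_G_mono[OF cont_adapted_meas[OF Ec, of "min t 0"], of t] by measurable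
    show "continuous_on UNIV (\<lambda>t. \<bar>E t \<omega> - E (min t 0) \<omega>\<bar> + \<bar>H t \<omega>\<bar>)" if "\<omega> \<in> space M" for \<omega>
      by (intro continuous_intros continuous_on_compose2[OF cont_adapted_cont[OF Ec that, of UNIV]]
          continuous_on_compose2[OF cont_adapted_cont[OF H that, of UNIV]]) auto
  qed
  have E0: "E u \<omega> = N 0 \<omega>" if "u \<le> 0" for u \<omega> using that T_pos by (simp add: E_def ext_proc_def)
  define \<rho> where "\<rho> k \<omega> = min (\<sigma> k \<omega>) (hitting Y (real k) \<omega>)" for k \<omega>
  have r: "stopping_time_on M T Fi (\<rho> k)" for k
    unfolding \<rho>_def[abs_def] by (rule stopping_time_min[OF s(1) hitting_stopping[OF Yc]])
  have mono: "mono (\<lambda>k. \<rho> k \<omega>)" if "\<omega> \<in> space M" for \<omega>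
  proof (rule monoI)
    fix k l :: nat assume "k \<le> l"
    then show "\<rho> k \<omega> \<le> \<rho> l \<omega>" unfolding \<rho>_def
      using monoD[OF s(2)[OF that] \<open>k \<le> l\<close>] hitting_mono[of "real k" "real l" Y \<omega>] by (auto intro!: min.mono)
  qed
  have ae: "AE \<omega> in M. \<exists>k. \<rho> k \<omega> = T"
    using s(3)
  proof (rule AE_mp, intro AE_I2 impI)
    fix \<omega> assume w: "\<omega> \<in> space M" and "\<exists>n. \<sigma> n \<omega> = T"
    then obtain n where n: "\<sigma> n \<omega> = T" by auto
    obtain K where K: "\<And>k. k \<ge> K \<Longrightarrow> hitting Y k \<omega> = T" using hitting_eventually_T[OF Yc w] by auto
    define k where "k = max n (nat \<lceil>K\<rceil>)"
    have "K \<le> real k" unfolding k_def by linarith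
    moreover have "T \<le> \<sigma> k \<omega>" using monoD[OF s(2)[OF w], of n k] n by (simp add: k_def)
    then have "\<sigma> k \<omega> = T" using sr(2)[OF w, of k] by simp
    ultimately have "\<rho> k \<omega> = T" using K by (simp add: \<rho>_def)
    then show "\<exists>k. \<rho> k \<omega> = T" by blast
  qed
  have bm: "bdd_mart (\<lambda>t \<omega>. ext_proc T N (min t (\<rho> k \<omega>)) \<omega> - N 0 \<omega>)" for k
  proof -
    \<comment> \<open>\<open>N - N 0\<close> stopped at \<open>\<sigma> k\<close>. Since
      \<open>\<rho> k \<le> \<sigma> k\<close>, stopping it once more at \<open>\<rho> k\<close>
      gives the claimed process.\<close>
    define L where "L t \<omega> = N (min t (\<sigma> k \<omega>)) \<omega> - N 0 \<omega>" for t \<omega>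
    have Lm: "martingale_on M T Fi L" using s(4)[of k] by (simp add: L_def[abs_def])
    have Lc: "cont_proc M T L"
      unfolding cont_proc_def L_def
    proof (intro ballI)
      fix \<omega> assume w: "\<omega> \<in> space M"
      have "continuous_on {0..T} (\<lambda>t. N t \<omega>)" using Nc w by (simp add: cont_proc_def)
      then have "continuous_on {0..T} (\<lambda>t. N (min t (\<sigma> k \<omega>)) \<omega>)"
        by (rule continuous_on_compose2[where g = "\<lambda>t. N t \<omega>"])
          (use sr[OF w, of k] in \<open>auto intro!: continuous_on_min continuous_on_id continuous_on_const\<close>)
      then show "continuous_on {0..T} (\<lambda>t. N (min t (\<sigma> k \<omega>)) \<omega> - N 0 \<omega>)"
        by (intro continuous_on_diff continuous_on_const)
    qed
    have eq: "ext_proc T L (min t (\<rho> k \<omega>)) \<omega> = ext_proc T N (min t (\<rho> k \<omega>)) \<omega> - N 0 \<omega>" if w: "\<omega> \<in> space M" for t \<omega>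
    proof -
      have "\<rho> k \<omega> \<le> \<sigma> k \<omega>" "0 \<le> \<rho> k \<omega>" using sr[OF w, of k] hitting_range[of Y "real k" \<omega>] by (auto simp: \<rho>_def)
      then have "min (max 0 (min (min t (\<rho> k \<omega>)) T)) (\<sigma> k \<omega>) = max 0 (min (min t (\<rho> k \<omega>)) T)" using sr[OF w, of k] by auto
      then show ?thesis by (simp add: ext_proc_def L_def)
    qed
    have "\<bar>ext_proc T L (min t (\<rho> k \<omega>)) \<omega>\<bar> \<le> real k" if w: "\<omega> \<in> space M" for t \<omega>
    proof (cases "min t (\<rho> k \<omega>) \<le> 0")
      case True
      then show ?thesis unfolding eq[OF w] using E0[OF True, of \<omega>] by (simp add: E_def)
    next
      case False
      define u where "u = min t (\<rho> k \<omega>)"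
      have "Y u \<omega> \<le> real k"
        by (rule hitting_bound[OF Yc w]) (use False in \<open>auto simp: u_def \<rho>_def\<close>)
      moreover have "ext_proc T L u \<omega> = E u \<omega> - N 0 \<omega>" using eq[OF w, of t] by (simp add: u_def E_def)
      moreover have "E (min u 0) \<omega> = N 0 \<omega>" by (rule E0) simp
      ultimately have "\<bar>ext_proc T L u \<omega>\<bar> \<le> real k" by (simp add: Y_def)
      then show ?thesis by (simp add: u_def)
    qed
    from stopped_bmart[OF Lm Lc r this]
    have b: "bdd_mart (\<lambda>t \<omega>. ext_proc T L (min t (\<rho> k \<omega>)) \<omega>)" by simp
    have mm: "(\<lambda>\<omega>. ext_proc T N (min t (\<rho> k \<omega>)) \<omega> - N 0 \<omega>) \<in> borel_measurable (G t) \<longleftrightarrow> (\<lambda>\<omega>. ext_proc T L (min t (\<rho> k \<omega>)) \<omega>) \<in> borel_measurable (G t)" for t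
      by (rule measurable_cong) (simp add: eq)
    have ii: "expectation (\<lambda>\<omega>. Z \<omega> * (ext_proc T N (min t (\<rho> k \<omega>)) \<omega> - N 0 \<omega> - (ext_proc T N (min s (\<rho> k \<omega>)) \<omega> - N 0 \<omega>)))
       = expectation (\<lambda>\<omega>. Z \<omega> * (ext_proc T L (min t (\<rho> k \<omega>)) \<omega> - ext_proc T L (min s (\<rho> k \<omega>)) \<omega>))" for Z s t
      by (rule Bochner_Integration.integral_cong) (simp_all add: eq)
    show ?thesis using b unfolding bdd_mart_def cont_adapted_def mm ii by (simp add: eq cong: ball_cong)
  qed
  have hb: "\<bar>H t \<omega>\<bar> \<le> real k" if "\<omega> \<in> space M" "0 \<le> t" "t < \<rho> k \<omega>" for k t \<omega>
    using hitting_lower[of t Y "real k" \<omega>] that by (auto simp: \<rho>_def Y_def)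
  show ?thesis using that[OF r mono ae bm hb] by blast
qed

lemma localized_small:
  assumes "\<And>k. stopping_time_on M T Fi (\<rho> k)" "\<And>\<omega>. \<omega> \<in> space M \<Longrightarrow> mono (\<lambda>k. \<rho> k \<omega>)"
    "AE \<omega> in M. \<exists>k. \<rho> k \<omega> = T" "\<gamma> > 0"
  shows "\<exists>k::nat. {\<omega>\<in>space M. \<rho> k \<omega> < T} \<in> sets M \<and> prob {\<omega>\<in>space M. \<rho> k \<omega> < T} \<le> \<gamma>"
proof -
  have m: "{\<omega>\<in>space M. \<rho> k \<omega> < T} \<in> sets M" for k
  proof -
    have "{\<omega>\<in>space M. \<rho> k \<omega> < T} = (\<Union>n. {\<omega>\<in>space M. \<rho> k \<omega> \<le> T - 1 / real (Suc n)})"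
    proof safe
      fix \<omega> assume "\<rho> k \<omega> < T" and w: "\<omega> \<in> space M"
      then obtain n where "1 / real (Suc n) < T - \<rho> k \<omega>" using nat_approx_posE[of "T - \<rho> k \<omega>"] by auto
      then show "\<omega> \<in> (\<Union>n. {\<omega>\<in>space M. \<rho> k \<omega> \<le> T - 1 / real (Suc n)})" using w by (auto intro!: exI[of _ n])
    next
      fix \<omega> n assume "\<rho> k \<omega> \<le> T - 1 / real (Suc n)"
      moreover have "0 < 1 / real (Suc n)" by simp
      ultimately show "\<rho> k \<omega> < T" by linarith
    qed
    also have "\<dots> \<in> sets M" using sets_G_M[OF stop_sets[OF assms(1)]] by (intro sets.countable_UN) auto
    finally show ?thesis .
  qed
  have "(\<lambda>k. prob {\<omega>\<in>space M. \<rho> k \<omega> < T}) \<longlonglongrightarrow> 0"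
  proof (rule measure_vanish_seq[OF m])
    show "AE \<omega> in M. \<forall>\<^sub>F n in sequentially. \<omega> \<notin> {\<omega> \<in> space M. \<rho> n \<omega> < T}"
      using assms(3)
    proof (rule AE_mp, intro AE_I2 impI)
      fix \<omega> assume w: "\<omega> \<in> space M" and "\<exists>k. \<rho> k \<omega> = T"
      then obtain k where "\<rho> k \<omega> = T" by auto
      then have "\<rho> l \<omega> \<ge> T" if "l \<ge> k" for l using monoD[OF assms(2)[OF w] that] by simp
      then show "\<forall>\<^sub>F n in sequentially. \<omega> \<notin> {\<omega> \<in> space M. \<rho> n \<omega> < T}"
        unfolding eventually_sequentially by (force intro: exI[of _ k])
    qed
  qed
  then have "\<forall>\<^sub>F k in sequentially. prob {\<omega>\<in>space M. \<rho> k \<omega> < T} < \<gamma>"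
    using assms(4) by (rule order_tendstoD)
  then obtain k where "prob {\<omega>\<in>space M. \<rho> k \<omega> < T} < \<gamma>" unfolding eventually_sequentially by auto
  then show ?thesis using m[of k] by (intro exI[of _ k]) auto
qed

section \<open>The weak maximal inequality\<close>

lemma doob_weak_finite:
  assumes Y: "bdd_mart Y" and D: "finite D" "\<And>d. d \<in> D \<Longrightarrow> d \<le> b" and l: "c > 0"
  shows "prob {\<omega>\<in>space M. \<exists>d\<in>D. c < \<bar>Y d \<omega>\<bar>} \<le> expectation (\<lambda>\<omega>. \<bar>Y b \<omega>\<bar>) / c"
proof -
  note [measurable] = bdd_mart_meas_M[OF Y]
  obtain C where C: "\<forall>t. \<forall>\<omega>\<in>space M. \<bar>Y t \<omega>\<bar> \<le> C" using bdd_mart_bdd[OF Y] by auto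
  \<comment> \<open>\<open>d\<close> is the first time in \<open>D\<close> with an exceedance. These
    events are disjoint, and each is known at its own time.\<close>
  define A where "A d = {\<omega>\<in>space M. c < \<bar>Y d \<omega>\<bar> \<and> (\<forall>d'\<in>D. d' < d \<longrightarrow> \<bar>Y d' \<omega>\<bar> \<le> c)}" for d
  have AG: "A d \<in> sets (G d)" for d
  proof -
    have "{\<omega>\<in>space (G d). c < \<bar>Y d \<omega>\<bar>} \<in> sets (G d)" using bdd_mart_meas[OF Y, of d] by measurable
    moreover have "{\<omega>\<in>space (G d). \<forall>d'\<in>{d'\<in>D. d' < d}. \<bar>Y d' \<omega>\<bar> \<le> c} \<in> sets (G d)"
    proof (rule sets.sets_Collect_finite_All)
      show "finite {d' \<in> D. d' < d}" using D by simp
      fix d' assume "d' \<in> {d'\<in>D. d' < d}"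
      then have "Y d' \<in> borel_measurable (G d)" using meas_G_mono[OF bdd_mart_meas[OF Y, of d'], of d] by simp
      then show "{\<omega>\<in>space (G d). \<bar>Y d' \<omega>\<bar> \<le> c} \<in> sets (G d)" by measurable
    qed
    moreover have "A d = {\<omega>\<in>space (G d). c < \<bar>Y d \<omega>\<bar>} \<inter> {\<omega>\<in>space (G d). \<forall>d'\<in>{d'\<in>D. d' < d}. \<bar>Y d' \<omega>\<bar> \<le> c}"
      by (auto simp: A_def)
    ultimately show ?thesis by auto
  qed
  have AM [measurable]: "A d \<in> sets M" for d using sets_G_M[OF AG] .
  have dis: "disjoint_family_on A D"
    unfolding disjoint_family_on_def
  proof (intro ballI impI)
    fix d d' assume "d \<in> D" "d' \<in> D" "d \<noteq> d'"
    then show "A d \<inter> A d' = {}" unfolding A_def by (cases "d < d'") (force simp: not_less)+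
  qed
  have un: "{\<omega>\<in>space M. \<exists>d\<in>D. c < \<bar>Y d \<omega>\<bar>} = (\<Union>d\<in>D. A d)"
  proof safe
    fix \<omega> d assume w: "\<omega> \<in> space M" and d: "d \<in> D" "c < \<bar>Y d \<omega>\<bar>"
    define B where "B = {d\<in>D. c < \<bar>Y d \<omega>\<bar>}"
    have B: "finite B" "B \<noteq> {}" using d D by (auto simp: B_def)
    have "Min B \<in> B" using B by (rule Min_in)
    moreover have "\<bar>Y d' \<omega>\<bar> \<le> c" if "d' \<in> D" "d' < Min B" for d'
      using that Min_le[OF B(1), of d'] by (fastforce simp: B_def)
    ultimately have "\<omega> \<in> A (Min B)" "Min B \<in> D" using w by (auto simp: A_def B_def)
    then show "\<omega> \<in> (\<Union>d\<in>D. A d)" by blast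
  qed (auto simp: A_def)
  have step: "c * prob (A d) \<le> expectation (\<lambda>\<omega>. indicator (A d) \<omega> * \<bar>Y b \<omega>\<bar>)" if d: "d \<in> D" for d
  proof -
    \<comment> \<open>Testing with the sign of \<open>Y d\<close> turns the martingale property into
      the submartingale inequality for the absolute value on \<open>A d\<close>.\<close>
    define S where "S \<omega> = indicator (A d) \<omega> * sgn (Y d \<omega>)" for \<omega>
    have Sm: "S \<in> borel_measurable (G d)" unfolding S_def[abs_def]
      using AG[of d] bdd_mart_meas[OF Y, of d] by measurable
    have Sb: "\<bar>S \<omega>\<bar> \<le> 1" for \<omega> by (auto simp: S_def indicator_def sgn_real_def)
    note [measurable] = meas_G_M[OF Sm]
    have iS: "integrable M (\<lambda>\<omega>. S \<omega> * Y u \<omega>)" for u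
      by (rule integrable_bdd_mult[of _ 1 _ C]) (use Sb C in auto)
    have iA: "integrable M (\<lambda>\<omega>. indicator (A d) \<omega> * \<bar>Y u \<omega>\<bar>)" for u
      by (rule integrable_bdd_mult[of _ 1 _ C]) (use C in \<open>auto simp: indicator_def\<close>)
    have "c * prob (A d) = expectation (\<lambda>\<omega>. c * indicator (A d) \<omega>)" by simp
    also have "\<dots> \<le> expectation (\<lambda>\<omega>. S \<omega> * Y d \<omega>)"
    proof (rule integral_mono)
      show "integrable M (\<lambda>\<omega>. c * indicat_real (A d) \<omega>)" by (simp add: emeasure_eq_measure)
      show "c * indicat_real (A d) \<omega> \<le> S \<omega> * Y d \<omega>" for \<omega>
        by (auto simp: S_def indicator_def A_def sgn_real_def)
    qed (rule iS)
    also have "\<dots> = expectation (\<lambda>\<omega>. S \<omega> * Y b \<omega>)"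
    proof -
      have "expectation (\<lambda>\<omega>. S \<omega> * (Y b \<omega> - Y d \<omega>)) = 0"
        by (rule bdd_mart_orth[OF Y Sm Sb order_refl D(2)[OF d]])
      then show ?thesis using iS by (simp add: right_diff_distrib)
    qed
    also have "\<dots> \<le> expectation (\<lambda>\<omega>. indicator (A d) \<omega> * \<bar>Y b \<omega>\<bar>)"
      by (rule integral_mono[OF iS iA]) (auto simp: S_def indicator_def sgn_real_def)
    finally show ?thesis .
  qed
  have "c * prob (\<Union>d\<in>D. A d) = (\<Sum>d\<in>D. c * prob (A d))"
    using finite_measure_finite_Union[OF D(1) _ dis] AM by (simp add: image_subset_iff sum_distrib_left)
  also have "\<dots> \<le> (\<Sum>d\<in>D. expectation (\<lambda>\<omega>. indicator (A d) \<omega> * \<bar>Y b \<omega>\<bar>))"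
    by (rule sum_mono) (rule step)
  also have "\<dots> = expectation (\<lambda>\<omega>. \<Sum>d\<in>D. indicator (A d) \<omega> * \<bar>Y b \<omega>\<bar>)"
    by (rule Bochner_Integration.integral_sum[symmetric])
      (rule integrable_bdd_mult[of _ 1 _ C], use C in \<open>auto simp: indicator_def\<close>)
  also have "\<dots> \<le> expectation (\<lambda>\<omega>. \<bar>Y b \<omega>\<bar>)"
  proof (rule integral_mono)
    show "integrable M (\<lambda>\<omega>. \<Sum>d\<in>D. indicat_real (A d) \<omega> * \<bar>Y b \<omega>\<bar>)"
      by (rule Bochner_Integration.integrable_sum)
        (rule integrable_bdd_mult[of _ 1 _ C], use C in \<open>auto simp: indicator_def\<close>)
    show "integrable M (\<lambda>\<omega>. \<bar>Y b \<omega>\<bar>)" by (rule integrable_bdd[of _ C]) (use C in auto)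
    fix \<omega>
    have "(\<Sum>d\<in>D. indicat_real (A d) \<omega>) = indicat_real (\<Union>d\<in>D. A d) \<omega>"
      by (rule indicator_UN_disjoint[OF D(1) dis, symmetric])
    then show "(\<Sum>d\<in>D. indicat_real (A d) \<omega> * \<bar>Y b \<omega>\<bar>) \<le> \<bar>Y b \<omega>\<bar>"
      by (simp add: sum_distrib_right[symmetric] indicator_def del: UN_iff)
  qed
  finally show ?thesis unfolding un using l by (simp add: pos_le_divide_eq mult.commute)
qed

text \<open>Exceedance is an open condition, so by continuity the interval reduces to a countable
  dense set. Finite sets exhaust it, and their bound does not depend on their size.\<close>

lemma doob_weak:
  assumes Y: "bdd_mart Y" and l: "c > 0"
  shows "{\<omega>\<in>space M. \<exists>t\<in>{a..b}. c < \<bar>Y t \<omega>\<bar>} \<in> sets M"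
    "prob {\<omega>\<in>space M. \<exists>t\<in>{a..b}. c < \<bar>Y t \<omega>\<bar>} \<le> expectation (\<lambda>\<omega>. \<bar>Y b \<omega>\<bar>) / c"
proof -
  note [measurable] = bdd_mart_meas_M[OF Y]
  show sets: "{\<omega>\<in>space M. \<exists>t\<in>{a..b}. c < \<bar>Y t \<omega>\<bar>} \<in> sets M"
    by (rule sets_exists_gt) (use cont_adapted_cont[OF bdd_mart_cproc[OF Y]] in \<open>auto intro!: continuous_on_rabs\<close>)
  obtain D where D: "countable D" "D \<subseteq> {a..b}" "{a..b} \<subseteq> closure D" using separable[of "{a..b}"] by blast
  show "prob {\<omega>\<in>space M. \<exists>t\<in>{a..b}. c < \<bar>Y t \<omega>\<bar>} \<le> expectation (\<lambda>\<omega>. \<bar>Y b \<omega>\<bar>) / c"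
  proof (cases "D = {}")
    case True
    then have "{a..b} = {}" using D by simp
    then have "{\<omega>\<in>space M. \<exists>t\<in>{a..b}. c < \<bar>Y t \<omega>\<bar>} = {}" by blast
    then show ?thesis using l by (simp only: measure_empty) simp
  next
    case False
    define F where "F n = from_nat_into D ` {..n}" for n :: nat
    have Fs: "finite (F n)" "F n \<subseteq> D" for n using from_nat_into[OF False] by (auto simp: F_def)
    have Fu: "(\<Union>n. F n) = D"
      using range_from_nat_into[OF False D(1)] unfolding F_def by (auto simp: image_iff) blast
    define A where "A n = {\<omega>\<in>space M. \<exists>d\<in>F n. c < \<bar>Y d \<omega>\<bar>}" for n
    have Am: "A n \<in> sets M" for n
    proof -
      have "A n = (\<Union>d\<in>F n. {\<omega>\<in>space M. c < \<bar>Y d \<omega>\<bar>})" by (auto simp: A_def)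
      also have "\<dots> \<in> sets M" using Fs by (intro sets.finite_UN) auto
      finally show ?thesis .
    qed
    have "incseq A" unfolding incseq_def A_def F_def by fastforce
    then have lim: "(\<lambda>n. prob (A n)) \<longlonglongrightarrow> prob (\<Union>n. A n)"
      using Am by (intro finite_Lim_measure_incseq) auto
    have "(\<exists>t\<in>{a..b}. c < \<bar>Y t \<omega>\<bar>) \<longrightarrow> (\<exists>d\<in>D. c < \<bar>Y d \<omega>\<bar>)" if w: "\<omega> \<in> space M" for \<omega>
    proof
      assume "\<exists>t\<in>{a..b}. c < \<bar>Y t \<omega>\<bar>"
      then obtain t where t: "t \<in> {a..b}" "c < \<bar>Y t \<omega>\<bar>" by auto
      have "open ((\<lambda>t. \<bar>Y t \<omega>\<bar>) -` {c<..})"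
        by (rule open_vimage) (use cont_adapted_cont[OF bdd_mart_cproc[OF Y] w] in \<open>auto intro!: continuous_on_rabs\<close>)
      moreover have "t \<in> closure D" using t D by auto
      ultimately obtain x where "x \<in> D" "x \<in> (\<lambda>t. \<bar>Y t \<omega>\<bar>) -` {c<..}" using t
        by (metis closure_iff_nhds_not_empty disjoint_iff subset_refl vimageI greaterThan_iff)
      then show "\<exists>d\<in>D. c < \<bar>Y d \<omega>\<bar>" by auto
    qed
    then have sub: "{\<omega>\<in>space M. \<exists>t\<in>{a..b}. c < \<bar>Y t \<omega>\<bar>} \<subseteq> (\<Union>n. A n)"
      unfolding A_def Fu[symmetric] by blast
    have "prob {\<omega>\<in>space M. \<exists>t\<in>{a..b}. c < \<bar>Y t \<omega>\<bar>} \<le> prob (\<Union>n. A n)"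
      by (rule finite_measure_mono[OF sub]) (use Am in auto)
    also have "\<dots> \<le> expectation (\<lambda>\<omega>. \<bar>Y b \<omega>\<bar>) / c"
    proof (rule LIMSEQ_le_const2[OF lim], intro exI[of _ 0] allI impI)
      fix n show "prob (A n) \<le> expectation (\<lambda>\<omega>. \<bar>Y b \<omega>\<bar>) / c"
        unfolding A_def by (rule doob_weak_finite[OF Y Fs(1) _ l]) (use Fs(2) D(2) in force)
    qed
    finally show ?thesis .
  qed
qed

end

section \<open>The stochastic integral\<close>

text \<open>Fatou's lemma: an L2 bound survives almost sure limits. Estimates proved for Riemann
  sums thereby pass to the integral.\<close>

lemma fatou_square:
  fixes V :: "'a \<Rightarrow> real"
  assumes i: "\<And>n. integrable M (\<lambda>\<omega>. (Vn n \<omega>)\<^sup>2)" and c: "\<forall>\<^sub>F n in sequentially. (\<integral>\<omega>. (Vn n \<omega>)\<^sup>2 \<partial>M) \<le> c"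
    and l: "AE \<omega> in M. (\<lambda>n. Vn n \<omega>) \<longlonglongrightarrow> V \<omega>" and m: "V \<in> borel_measurable M"
  shows "integrable M (\<lambda>\<omega>. (V \<omega>)\<^sup>2)" "(\<integral>\<omega>. (V \<omega>)\<^sup>2 \<partial>M) \<le> c"
proof -
  have [measurable]: "(\<lambda>\<omega>. (Vn n \<omega>)\<^sup>2) \<in> borel_measurable M" for n using i by auto
  have "(\<integral>\<^sup>+\<omega>. ennreal ((V \<omega>)\<^sup>2) \<partial>M) = (\<integral>\<^sup>+\<omega>. liminf (\<lambda>n. ennreal ((Vn n \<omega>)\<^sup>2)) \<partial>M)"
  proof (rule nn_integral_cong_AE)
    show "AE \<omega> in M. ennreal ((V \<omega>)\<^sup>2) = liminf (\<lambda>n. ennreal ((Vn n \<omega>)\<^sup>2))"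
      using l
    proof eventually_elim
      case (elim \<omega>)
      have "(\<lambda>n. ennreal ((Vn n \<omega>)\<^sup>2)) \<longlonglongrightarrow> ennreal ((V \<omega>)\<^sup>2)"
        by (intro tendsto_ennrealI tendsto_power elim)
      then show ?case using lim_imp_Liminf[OF sequentially_bot] by metis
    qed
  qed
  also have "\<dots> \<le> liminf (\<lambda>n. \<integral>\<^sup>+\<omega>. ennreal ((Vn n \<omega>)\<^sup>2) \<partial>M)"
    by (rule nn_integral_liminf) measurable
  also have "\<dots> \<le> ennreal c"
  proof (rule Liminf_le[OF sequentially_bot], rule eventually_mono[OF c])
    fix n assume "(\<integral>\<omega>. (Vn n \<omega>)\<^sup>2 \<partial>M) \<le> c"
    then show "(\<integral>\<^sup>+\<omega>. ennreal ((Vn n \<omega>)\<^sup>2) \<partial>M) \<le> ennreal c"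
      by (subst nn_integral_eq_integral[OF i]) (auto intro: ennreal_leI)
  qed
  finally have b: "(\<integral>\<^sup>+\<omega>. ennreal ((V \<omega>)\<^sup>2) \<partial>M) \<le> ennreal c" .
  show iV: "integrable M (\<lambda>\<omega>. (V \<omega>)\<^sup>2)"
    by (rule integrableI_nonneg) (use m b in \<open>auto intro: le_less_trans\<close>)
  obtain n where "(\<integral>\<omega>. (Vn n \<omega>)\<^sup>2 \<partial>M) \<le> c" using c unfolding eventually_sequentially by auto
  moreover have "0 \<le> (\<integral>\<omega>. (Vn n \<omega>)\<^sup>2 \<partial>M)" by simp
  ultimately have "0 \<le> c" by linarith
  then show "(\<integral>\<omega>. (V \<omega>)\<^sup>2 \<partial>M) \<le> c"
    using b by (subst (asm) nn_integral_eq_integral[OF iV]) auto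
qed

context filtered_space
begin

text \<open>The L2 bound gives uniform integrability. Cutting at level \<open>K\<close> costs at
  most \<open>c / K\<close> in L1, along the sequence as in the limit, and dominated convergence
  handles the cut variables; then \<open>K\<close> is arbitrary.\<close>

lemma test_zero_limit:
  fixes V :: "'a \<Rightarrow> real"
  assumes i: "\<And>n. integrable M (\<lambda>\<omega>. (Vn n \<omega>)\<^sup>2)" and c: "\<And>n. expectation (\<lambda>\<omega>. (Vn n \<omega>)\<^sup>2) \<le> c"
    and Vn [measurable]: "\<And>n. Vn n \<in> borel_measurable M"
    and l: "AE \<omega> in M. (\<lambda>n. Vn n \<omega>) \<longlonglongrightarrow> V \<omega>" and m [measurable]: "V \<in> borel_measurable M"
    and W [measurable]: "W \<in> borel_measurable M" and Wb: "\<And>\<omega>. \<omega> \<in> space M \<Longrightarrow> \<bar>W \<omega>\<bar> \<le> 1"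
    and z: "\<And>n. expectation (\<lambda>\<omega>. W \<omega> * Vn n \<omega>) = 0"
  shows "integrable M V" "expectation (\<lambda>\<omega>. W \<omega> * V \<omega>) = 0"
proof -
  have iV: "integrable M (\<lambda>\<omega>. (V \<omega>)\<^sup>2)" "expectation (\<lambda>\<omega>. (V \<omega>)\<^sup>2) \<le> c"
    using fatou_square[OF i _ l m, of c] c by auto
  have sq: "integrable M f" if "integrable M (\<lambda>\<omega>. (f \<omega>)\<^sup>2)" "f \<in> borel_measurable M" for f :: "'a \<Rightarrow> real"
  proof (rule Bochner_Integration.integrable_bound[of _ "\<lambda>\<omega>. 1 + (f \<omega>)\<^sup>2"])
    show "AE x in M. norm (f x) \<le> norm (1 + (f x)\<^sup>2)"
    proof (rule AE_I2)
      fix x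
      have "0 \<le> (\<bar>f x\<bar> - 1)\<^sup>2" by simp
      then have "2 * \<bar>f x\<bar> \<le> 1 + (f x)\<^sup>2" by (simp add: power2_diff)
      then show "norm (f x) \<le> norm (1 + (f x)\<^sup>2)" by simp
    qed
  qed (use that in auto)
  show int: "integrable M V" by (rule sq[OF iV(1) m])
  have intn: "integrable M (Vn n)" for n by (rule sq[OF i Vn])
  have iW: "integrable M (\<lambda>\<omega>. W \<omega> * f \<omega>)" if "integrable M f" for f :: "'a \<Rightarrow> real"
  proof (rule Bochner_Integration.integrable_bound[OF that])
    show "AE x in M. norm (W x * f x) \<le> norm (f x)"
      using Wb by (intro AE_I2) (simp add: abs_mult mult_left_le_one_le)
  qed (use that in auto)
  have "\<bar>expectation (\<lambda>\<omega>. W \<omega> * V \<omega>)\<bar> \<le> 2 * c / K" if K: "K > 0" for K :: real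
  proof -
    define \<phi> where "\<phi> x = max (-K) (min x K)" for x :: real
    have [measurable]: "\<phi> \<in> borel_measurable borel" unfolding \<phi>_def[abs_def] by measurable
    have ph: "\<bar>x - \<phi> x\<bar> \<le> x\<^sup>2 / K" for x
    proof (cases "\<bar>x\<bar> \<le> K")
      case True
      then have "\<phi> x = x" by (auto simp: \<phi>_def)
      then show ?thesis using K by simp
    next
      case False
      have "\<bar>x - \<phi> x\<bar> \<le> \<bar>x\<bar>" using K by (auto simp: \<phi>_def)
      also have "\<dots> \<le> \<bar>x\<bar> * \<bar>x\<bar> / K"
        using K False mult_left_mono[of K "\<bar>x\<bar>" "\<bar>x\<bar>"] by (simp only: pos_le_divide_eq)
      finally show ?thesis by (simp add: power2_eq_square)
    qed
    have pb: "\<bar>\<phi> x\<bar> \<le> K" for x using K by (auto simp: \<phi>_def)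
    have pc: "isCont \<phi> x" for x unfolding \<phi>_def[abs_def] by (intro continuous_intros)
    have tail: "\<bar>expectation (\<lambda>\<omega>. W \<omega> * (f \<omega> - \<phi> (f \<omega>)))\<bar> \<le> expectation (\<lambda>\<omega>. (f \<omega>)\<^sup>2) / K"
      if f: "integrable M (\<lambda>\<omega>. (f \<omega>)\<^sup>2)" "f \<in> borel_measurable M" for f
    proof -
      have [measurable]: "f \<in> borel_measurable M" by fact
      have "norm (expectation (\<lambda>\<omega>. W \<omega> * (f \<omega> - \<phi> (f \<omega>)))) \<le> expectation (\<lambda>\<omega>. norm (W \<omega> * (f \<omega> - \<phi> (f \<omega>))))"
        by (rule integral_norm_bound)
      also have "\<dots> \<le> expectation (\<lambda>\<omega>. (f \<omega>)\<^sup>2 / K)"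
      proof (rule integral_mono)
        show "integrable M (\<lambda>\<omega>. norm (W \<omega> * (f \<omega> - \<phi> (f \<omega>))))"
          by (intro Bochner_Integration.integrable_norm iW Bochner_Integration.integrable_diff sq[OF f] integrable_bdd[of _ K]) (use pb in auto)
        show "norm (W x * (f x - \<phi> (f x))) \<le> (f x)\<^sup>2 / K" if "x \<in> space M" for x
          using mult_mono[OF Wb[OF that] ph[of "f x"]] by (simp add: abs_mult)
      qed (use f in auto)
      finally show ?thesis by simp
    qed
    have split: "expectation (\<lambda>\<omega>. W \<omega> * f \<omega>) = expectation (\<lambda>\<omega>. W \<omega> * (f \<omega> - \<phi> (f \<omega>))) + expectation (\<lambda>\<omega>. W \<omega> * \<phi> (f \<omega>))"
      if f: "integrable M f" for f
    proof -
      have [measurable]: "f \<in> borel_measurable M" using f by auto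
      have "integrable M (\<lambda>\<omega>. \<phi> (f \<omega>))" by (rule integrable_bdd[of _ K]) (use pb in auto)
      then show ?thesis using iW[OF f] iW[of "\<lambda>\<omega>. \<phi> (f \<omega>)"] by (simp add: right_diff_distrib)
    qed
    have "(\<lambda>n. expectation (\<lambda>\<omega>. W \<omega> * \<phi> (Vn n \<omega>))) \<longlonglongrightarrow> expectation (\<lambda>\<omega>. W \<omega> * \<phi> (V \<omega>))"
    proof (rule integral_dominated_convergence[where w = "\<lambda>_. K"])
      show "AE x in M. (\<lambda>n. W x * \<phi> (Vn n x)) \<longlonglongrightarrow> W x * \<phi> (V x)"
        using l by eventually_elim (intro tendsto_intros isCont_tendsto_compose[OF pc])
      show "AE x in M. norm (W x * \<phi> (Vn n x)) \<le> K" for n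
        using mult_mono[OF Wb pb] K by (intro AE_I2) (force simp: abs_mult)
    qed auto
    moreover have "\<bar>expectation (\<lambda>\<omega>. W \<omega> * \<phi> (Vn n \<omega>))\<bar> \<le> c / K" for n
    proof -
      have "\<bar>expectation (\<lambda>\<omega>. W \<omega> * \<phi> (Vn n \<omega>))\<bar> \<le> expectation (\<lambda>\<omega>. (Vn n \<omega>)\<^sup>2) / K"
        using tail[OF i Vn, of n] split[OF intn, of n] z[of n] by simp
      also have "\<dots> \<le> c / K" using c[of n] K by (simp add: divide_right_mono)
      finally show ?thesis .
    qed
    ultimately have "\<bar>expectation (\<lambda>\<omega>. W \<omega> * \<phi> (V \<omega>))\<bar> \<le> c / K"
      by (intro LIMSEQ_le_const2[OF tendsto_rabs]) auto
    moreover have "\<bar>expectation (\<lambda>\<omega>. W \<omega> * (V \<omega> - \<phi> (V \<omega>)))\<bar> \<le> c / K"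
      using tail[OF iV(1) m] iV(2) K by (meson divide_right_mono less_imp_le order_trans)
    ultimately show ?thesis using split[OF int] by linarith
  qed
  note bnd = this
  show "expectation (\<lambda>\<omega>. W \<omega> * V \<omega>) = 0"
  proof (rule ccontr)
    assume n: "expectation (\<lambda>\<omega>. W \<omega> * V \<omega>) \<noteq> 0"
    have "0 \<le> expectation (\<lambda>\<omega>. (V \<omega>)\<^sup>2)" by simp
    then have c0: "0 \<le> c" using iV(2) by linarith
    \<comment> \<open>At this level the bound \<open>2 * c / K\<close> falls below the value that is
      assumed to be nonzero.\<close>
    define K where "K = (2 * c + 1) / \<bar>expectation (\<lambda>\<omega>. W \<omega> * V \<omega>)\<bar>"
    have K: "K > 0" using n c0 by (simp add: K_def)
    from bnd[OF K] have "\<bar>expectation (\<lambda>\<omega>. W \<omega> * V \<omega>)\<bar> * K \<le> 2 * c" using K by (simp add: pos_le_divide_eq)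
    moreover have "\<bar>expectation (\<lambda>\<omega>. W \<omega> * V \<omega>)\<bar> * K = 2 * c + 1" using n by (simp add: K_def)
    ultimately show False by simp
  qed
qed

text \<open>The first moment comes from \<open>|y| \<le> y\<^sup>2 / \<delta> + \<delta>\<close>.
  With \<delta> as the weight both terms are of order \<delta>, so the L1 bound is linear in
  \<delta>.\<close>

lemma dominated_L1:
  assumes d: "dominated \<delta> L Y" "\<delta> > 0" and st: "s \<le> t" and z: "\<And>\<omega>. \<omega> \<in> space M \<Longrightarrow> Y s \<omega> = 0"
    and L: "bdd_mart L" and C: "\<And>\<omega>. \<omega> \<in> space M \<Longrightarrow> \<bar>L t \<omega> - L s \<omega>\<bar> \<le> C"
  shows "expectation (\<lambda>\<omega>. (Y t \<omega>)\<^sup>2) \<le> \<delta>\<^sup>2 * C\<^sup>2" "expectation (\<lambda>\<omega>. \<bar>Y t \<omega>\<bar>) \<le> \<delta> * (C\<^sup>2 + 1)"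
proof -
  have bY: "bdd_mart Y" using d by (simp add: dominated_def)
  note [measurable] = bdd_mart_meas_M[OF bY] bdd_mart_meas_M[OF L]
  obtain D where D: "\<forall>t. \<forall>\<omega>\<in>space M. \<bar>Y t \<omega>\<bar> \<le> D" using bdd_mart_bdd[OF bY] by auto
  have "expectation (\<lambda>\<omega>. (Y t \<omega>)\<^sup>2) = expectation (\<lambda>\<omega>. (Y t \<omega> - Y s \<omega>)\<^sup>2)"
    by (rule Bochner_Integration.integral_cong) (auto simp: z)
  also have "\<dots> \<le> \<delta>\<^sup>2 * expectation (\<lambda>\<omega>. (L t \<omega> - L s \<omega>)\<^sup>2)" using d st by (auto simp: dominated_def)
  also have "expectation (\<lambda>\<omega>. (L t \<omega> - L s \<omega>)\<^sup>2) \<le> C\<^sup>2" by (rule bdd_mart_incr_square(2)[OF L C])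
  finally show sq: "expectation (\<lambda>\<omega>. (Y t \<omega>)\<^sup>2) \<le> \<delta>\<^sup>2 * C\<^sup>2" by (simp add: mult_left_mono)
  have i2: "integrable M (\<lambda>\<omega>. (Y t \<omega>)\<^sup>2)" unfolding power2_eq_square
    by (rule integrable_bdd_mult[of _ D _ D]) (use D in auto)
  have i1: "integrable M (\<lambda>\<omega>. \<bar>Y t \<omega>\<bar>)" by (rule integrable_bdd[of _ D]) (use D in auto)
  have "expectation (\<lambda>\<omega>. \<bar>Y t \<omega>\<bar>) \<le> expectation (\<lambda>\<omega>. (Y t \<omega>)\<^sup>2 / \<delta> + \<delta>)"
  proof (rule integral_mono[OF i1])
    show "integrable M (\<lambda>\<omega>. (Y t \<omega>)\<^sup>2 / \<delta> + \<delta>)" using i2 by auto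
    fix \<omega>
    have "0 \<le> (\<bar>Y t \<omega>\<bar> - \<delta>)\<^sup>2" by simp
    then have "2 * (\<bar>Y t \<omega>\<bar> * \<delta>) \<le> (Y t \<omega>)\<^sup>2 + \<delta> * \<delta>" by (simp add: power2_diff power2_eq_square algebra_simps)
    moreover have "0 \<le> \<bar>Y t \<omega>\<bar> * \<delta>" using d(2) by simp
    ultimately have "\<bar>Y t \<omega>\<bar> * \<delta> \<le> (Y t \<omega>)\<^sup>2 + \<delta> * \<delta>" by linarith
    then show "\<bar>Y t \<omega>\<bar> \<le> (Y t \<omega>)\<^sup>2 / \<delta> + \<delta>" using d(2) by (simp add: pos_le_divide_eq field_simps)
  qed
  also have "\<dots> = expectation (\<lambda>\<omega>. (Y t \<omega>)\<^sup>2) / \<delta> + \<delta>" using i2 by (simp add: prob_space)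
  also have "\<dots> \<le> \<delta>\<^sup>2 * C\<^sup>2 / \<delta> + \<delta>" using sq d(2) by (simp add: divide_right_mono)
  also have "\<dots> = \<delta> * (C\<^sup>2 + 1)" using d(2) by (simp add: power2_eq_square algebra_simps)
  finally show "expectation (\<lambda>\<omega>. \<bar>Y t \<omega>\<bar>) \<le> \<delta> * (C\<^sup>2 + 1)" .
qed

section \<open>Left-point sums along uniform grids and their limit\<close>

definition grid :: "nat \<Rightarrow> nat \<Rightarrow> real" where
  "grid n j = T * real j / real (Suc n)"

text \<open>The integrator is stopped at \<open>t\<close>, which makes the sum a continuous adapted
  process in \<open>t\<close>: cells that start after \<open>t\<close> contribute nothing.\<close>

definition grid_sum :: "(real \<Rightarrow> 'a \<Rightarrow> real) \<Rightarrow> (real \<Rightarrow> 'a \<Rightarrow> real) \<Rightarrow> nat \<Rightarrow> real \<Rightarrow> 'a \<Rightarrow> real" where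
  "grid_sum H E n t \<omega> = (\<Sum>j<Suc n. H (grid n j) \<omega> * (E (min t (grid n (Suc j))) \<omega> - E (min t (grid n j)) \<omega>))"

lemma grid_simps: "grid n 0 = 0" "grid n (Suc n) = T"
  by (simp_all add: grid_def del: of_nat_Suc)

lemma grid_step: "grid n (Suc j) - grid n j = T / real (Suc n)"
  by (simp add: grid_def diff_divide_distrib[symmetric] right_diff_distrib[symmetric])

lemma grid_mono: "grid n j \<le> grid n (Suc j)"
  using grid_step[of n j] T_pos by (smt (verit) divide_nonneg_nonneg of_nat_0_le_iff)

lemma grid_nonneg: "0 \<le> grid n j"
  using T_pos by (simp add: grid_def)

lemma grid_le_T: "j \<le> Suc n \<Longrightarrow> grid n j \<le> T"
proof -
  assume "j \<le> Suc n"
  then have "real j / real (Suc n) \<le> 1" by simp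
  then have "T * (real j / real (Suc n)) \<le> T * 1" using T_pos by (intro mult_left_mono) auto
  then show ?thesis by (simp add: grid_def)
qed

lemma grid_mesh_small: "h > 0 \<Longrightarrow> \<exists>n0. \<forall>n\<ge>n0. T / real (Suc n) < h"
proof -
  assume h: "h > 0"
  obtain n0 where n0: "1 / real (Suc n0) < h / T" using nat_approx_posE[of "h / T"] h T_pos by auto
  have "T / real (Suc n) < h" if "n \<ge> n0" for n
  proof -
    have "1 / real (Suc n) \<le> 1 / real (Suc n0)" using that by (simp add: frac_le)
    then have "1 / real (Suc n) < h / T" using n0 by simp
    then show ?thesis using T_pos by (simp add: field_simps)
  qed
  then show ?thesis by blast
qed

lemma grid_sum_eproc:
  assumes H: "cont_adapted H" and E: "ext_adapted E"
  shows "ext_adapted (grid_sum H E n)"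
proof -
  note Ec = ext_adapted_cproc[OF E]
  have m: "grid_sum H E n t \<in> borel_measurable (G t)" for t
    unfolding grid_sum_def
  proof (rule borel_measurable_sum)
    fix j
    show "(\<lambda>\<omega>. H (grid n j) \<omega> * (E (min t (grid n (Suc j))) \<omega> - E (min t (grid n j)) \<omega>)) \<in> borel_measurable (G t)"
    proof (cases "t \<le> grid n j")
      case True
      then have "min t (grid n (Suc j)) = t" "min t (grid n j) = t" using grid_mono[of n j] by auto
      then show ?thesis by simp
    next
      case False
      then show ?thesis
        by (intro borel_measurable_times borel_measurable_diff meas_G_mono[OF cont_adapted_meas[OF H]] meas_G_mono[OF cont_adapted_meas[OF Ec]]) auto
    qed
  qed
  have c: "continuous_on UNIV (\<lambda>t. grid_sum H E n t \<omega>)" if w: "\<omega> \<in> space M" for \<omega>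
  proof -
    have "continuous_on UNIV (\<lambda>t. E (min t b) \<omega>)" for b
      by (rule continuous_on_compose2[OF cont_adapted_cont[OF Ec w, of UNIV]]) (auto intro!: continuous_on_min continuous_on_id continuous_on_const)
    then show ?thesis unfolding grid_sum_def by (intro continuous_on_sum continuous_on_mult continuous_on_const continuous_on_diff)
  qed
  have e: "grid_sum H E n t \<omega> = grid_sum H E n (max 0 (min t T)) \<omega>" if w: "\<omega> \<in> space M" for t \<omega>
    unfolding grid_sum_def
  proof (rule sum.cong[OF refl])
    fix j assume "j \<in> {..<Suc n}"
    then have 1: "0 \<le> grid n j" "grid n j \<le> T" "0 \<le> grid n (Suc j)" "grid n (Suc j) \<le> T"
      using grid_nonneg grid_le_T by auto
    have e: "E (min t b) \<omega> = E (min (max 0 (min t T)) b) \<omega>" if "0 \<le> b" "b \<le> T" for b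
    proof -
      have "max 0 (min (min t b) T) = max 0 (min (min (max 0 (min t T)) b) T)" using that by auto
      from arg_cong[OF this, of "\<lambda>v. E v \<omega>"] show ?thesis
        by (rule ext_adapted_clip[OF E w, of "min t b", THEN trans, OF trans, OF _ ext_adapted_clip[OF E w, of "min (max 0 (min t T)) b", symmetric]])
    qed
    show "H (grid n j) \<omega> * (E (min t (grid n (Suc j))) \<omega> - E (min t (grid n j)) \<omega>) =
      H (grid n j) \<omega> * (E (min (max 0 (min t T)) (grid n (Suc j))) \<omega> - E (min (max 0 (min t T)) (grid n j)) \<omega>)"
      using e[OF 1(1,2)] e[OF 1(3,4)] by simp
  qed
  show ?thesis unfolding ext_adapted_def cont_adapted_def using m c e by blast
qed

lemma grid_sum_zero: "grid_sum H E n 0 \<omega> = 0"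
  unfolding grid_sum_def using grid_nonneg by (simp add: min_absorb1)

text \<open>Here \<open>E\<close> is the unlocalised integrator, which differs from \<open>L\<close> by a constant off a small event.\<close>
lemma grid_sum_compare:
  assumes L: "bdd_mart L" and H: "cont_adapted H" and d: "0 \<le> \<delta>"
    and p: "\<And>i. i < k \<Longrightarrow> p i \<le> p (Suc i)" "\<And>i. i < k \<Longrightarrow> p (Suc i) - p i < h"
    and n: "T / real (Suc n) < h" and p0: "0 \<le> p 0" "p k \<le> T"
  shows "\<exists>Y. dominated \<delta> L Y \<and> (\<forall>\<omega>\<in>space M. \<forall>t\<le>p 0. Y t \<omega> = 0) \<and>
    (\<forall>E c. \<forall>\<omega>\<in>space M - osc_event H h \<delta>. (\<forall>t. L t \<omega> = E t \<omega> - c) \<longrightarrow>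
       (\<forall>t\<ge>p 0. t \<le> p k \<longrightarrow> Y t \<omega> = grid_sum H E n t \<omega> - grid_sum H E n (p 0) \<omega>
         - (\<Sum>i<k. H (p i) \<omega> * (E (min t (p (Suc i))) \<omega> - E (min t (p i)) \<omega>))))"
proof -
  obtain Y where Y: "dominated \<delta> L Y" "\<forall>\<omega>\<in>space M. \<forall>t\<le>p 0. Y t \<omega> = 0"
    "\<forall>\<omega>\<in>space M. (\<forall>s u. \<bar>s - u\<bar> < h \<longrightarrow> \<bar>H s \<omega> - H u \<omega>\<bar> \<le> \<delta>) \<longrightarrow> (\<forall>t. Y t \<omega> =
      (\<Sum>j<Suc n. H (grid n j) \<omega> * (L (min t (max (p 0) (min (grid n (Suc j)) (p k)))) \<omega> - L (min t (max (p 0) (min (grid n j) (p k)))) \<omega>))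
      - (\<Sum>i<k. H (p i) \<omega> * (L (min t (p (Suc i))) \<omega> - L (min t (p i)) \<omega>)))"
  proof -
    have "\<exists>Y. dominated \<delta> L Y \<and> (\<forall>\<omega>\<in>space M. \<forall>t\<le>p 0. Y t \<omega> = 0) \<and>
      (\<forall>\<omega>\<in>space M. (\<forall>s u. \<bar>s - u\<bar> < h \<longrightarrow> \<bar>H s \<omega> - H u \<omega>\<bar> \<le> \<delta>) \<longrightarrow> (\<forall>t. Y t \<omega> =
      (\<Sum>j<Suc n. H (grid n j) \<omega> * (L (min t (max (p 0) (min (grid n (Suc j)) (p k)))) \<omega> - L (min t (max (p 0) (min (grid n j) (p k)))) \<omega>))
      - (\<Sum>i<k. H (p i) \<omega> * (L (min t (p (Suc i))) \<omega> - L (min t (p i)) \<omega>))))"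
      by (rule comparison[where k = k and p = p and q = "grid n" and m = "Suc n" and h = h, OF L cont_adapted_meas[OF H] d p grid_mono])
        (simp_all only: grid_step n grid_simps p0)
    then show ?thesis using that by blast
  qed
  have pk: "p 0 \<le> p k" using sum_telescope_clamp[of k p] p(1) by blast
  have "Y t \<omega> = grid_sum H E n t \<omega> - grid_sum H E n (p 0) \<omega>
         - (\<Sum>i<k. H (p i) \<omega> * (E (min t (p (Suc i))) \<omega> - E (min t (p i)) \<omega>))"
    if w: "\<omega> \<in> space M - osc_event H h \<delta>" and LE: "\<forall>t. L t \<omega> = E t \<omega> - c" and t: "p 0 \<le> t" "t \<le> p k" for E c \<omega> t
  proof -
    \<comment> \<open>After clamping to \<open>[p 0, p k]\<close> and stopping at \<open>t\<close>,
      what is left of an increment is its part up to \<open>t\<close> minus its part up to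
      \<open>p 0\<close>; the fine sum thus becomes a difference of two grid sums.\<close>
    have e: "E (min t (max (p 0) (min x (p k)))) \<omega> = E (min t x) \<omega> - E (min (p 0) x) \<omega> + E (p 0) \<omega>" for x
    proof (cases "x \<le> p 0")
      case True
      then show ?thesis using t pk by (simp add: min_def max_def)
    next
      case False
      then have "min t (max (p 0) (min x (p k))) = min t x" "min (p 0) x = p 0" using t by auto
      then show ?thesis by simp
    qed
    have "\<forall>s u. \<bar>s - u\<bar> < h \<longrightarrow> \<bar>H s \<omega> - H u \<omega>\<bar> \<le> \<delta>" using not_osc_event[OF w] by blast
    then have "Y t \<omega> =
      (\<Sum>j<Suc n. H (grid n j) \<omega> * (L (min t (max (p 0) (min (grid n (Suc j)) (p k)))) \<omega> - L (min t (max (p 0) (min (grid n j) (p k)))) \<omega>))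
      - (\<Sum>i<k. H (p i) \<omega> * (L (min t (p (Suc i))) \<omega> - L (min t (p i)) \<omega>))"
      using Y(3) w by blast
    also have "\<dots> = (\<Sum>j<Suc n. H (grid n j) \<omega> * (E (min t (grid n (Suc j))) \<omega> - E (min t (grid n j)) \<omega>)
       - H (grid n j) \<omega> * (E (min (p 0) (grid n (Suc j))) \<omega> - E (min (p 0) (grid n j)) \<omega>))
      - (\<Sum>i<k. H (p i) \<omega> * (E (min t (p (Suc i))) \<omega> - E (min t (p i)) \<omega>))"
      unfolding LE[rule_format] e by (intro arg_cong2[where f = "(-)"] sum.cong refl) (simp_all add: algebra_simps)
    also have "\<dots> = grid_sum H E n t \<omega> - grid_sum H E n (p 0) \<omega>
         - (\<Sum>i<k. H (p i) \<omega> * (E (min t (p (Suc i))) \<omega> - E (min t (p i)) \<omega>))"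
      unfolding grid_sum_def by (simp only: sum_subtractf)
    finally show ?thesis .
  qed
  then show ?thesis using Y(1,2) by blast
qed

text \<open>Off an event of probability at most \<gamma> a continuous local martingale is a bounded
  martingale up to its initial value. The bound \<open>C\<close> depends on \<gamma>, so later
  constants are chosen in the order \<open>C\<close>, \<delta>, \<open>h\<close>.\<close>

lemma localize_small:
  assumes N: "cont_local_martingale M T Fi N" and g: "\<gamma> > 0"
  obtains L B C where "bdd_mart L" "B \<in> sets M" "prob B \<le> \<gamma>" "C \<ge> 0"
    "\<And>s t \<omega>. \<omega> \<in> space M \<Longrightarrow> \<bar>L t \<omega> - L s \<omega>\<bar> \<le> C"
    "\<And>t \<omega>. \<omega> \<in> space M - B \<Longrightarrow> L t \<omega> = ext_proc T N t \<omega> - N 0 \<omega>"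
proof -
  have "cont_adapted (\<lambda>t \<omega>. 0)" by (simp add: cont_adapted_def)
  then obtain \<rho> :: "nat \<Rightarrow> 'a \<Rightarrow> real" where r: "\<And>k. stopping_time_on M T Fi (\<rho> k)"
    "\<And>\<omega>. \<omega> \<in> space M \<Longrightarrow> mono (\<lambda>k. \<rho> k \<omega>)" "AE \<omega> in M. \<exists>k. \<rho> k \<omega> = T"
    "\<And>k. bdd_mart (\<lambda>t \<omega>. ext_proc T N (min t (\<rho> k \<omega>)) \<omega> - N 0 \<omega>)"
    by (rule localization[OF N]) (rule that, assumption+)
  obtain k where k: "{\<omega>\<in>space M. \<rho> k \<omega> < T} \<in> sets M" "prob {\<omega>\<in>space M. \<rho> k \<omega> < T} \<le> \<gamma>"
    using localized_small[OF r(1,2,3) g] by auto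
  obtain C where C: "C \<ge> 0" "\<forall>s t. \<forall>\<omega>\<in>space M. \<bar>(ext_proc T N (min t (\<rho> k \<omega>)) \<omega> - N 0 \<omega>) - (ext_proc T N (min s (\<rho> k \<omega>)) \<omega> - N 0 \<omega>)\<bar> \<le> C"
    using bdd_mart_incr_bdd[OF r(4)[of k]] by blast
  have eq: "ext_proc T N (min t (\<rho> k \<omega>)) \<omega> - N 0 \<omega> = ext_proc T N t \<omega> - N 0 \<omega>" if "\<omega> \<in> space M - {\<omega>\<in>space M. \<rho> k \<omega> < T}" for t \<omega>
  proof -
    have "\<rho> k \<omega> = T" using that r(1)[of k] by (force simp: stopping_time_on_def)
    then show ?thesis by (simp add: ext_proc_def min_def)
  qed
  show ?thesis by (rule that[OF r(4)[of k] k C(1)]) (use C(2) eq in auto)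
qed

text \<open>Each of three exceptional events costs \<open>\<gamma> / 3\<close>: failure of the
  localisation, oscillation of the integrand, and an exceedance by the dominated difference process.
  The last is controlled by the maximal inequality, which makes the estimate uniform in
  time.\<close>

lemma grid_sum_cauchy:
  assumes N: "cont_local_martingale M T Fi N" and H: "ext_adapted H" and l: "\<eta> > 0" and g: "\<gamma> > 0"
  shows "\<exists>n0. \<forall>n\<ge>n0. \<forall>m\<ge>n0.
    prob {\<omega>\<in>space M. \<exists>t\<in>{0..T}. \<eta> < \<bar>grid_sum H (ext_proc T N) n t \<omega> - grid_sum H (ext_proc T N) m t \<omega>\<bar>} \<le> \<gamma>"
proof -
  have Hc: "cont_adapted H" by (rule ext_adapted_cproc[OF H])
  have "\<gamma> / 3 > 0" using g by simp
  from localize_small[OF N this] obtain L B C where L: "bdd_mart L" and B: "B \<in> sets M" "prob B \<le> \<gamma> / 3" and C: "C \<ge> 0"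
    "\<And>s t \<omega>. \<omega> \<in> space M \<Longrightarrow> \<bar>L t \<omega> - L s \<omega>\<bar> \<le> C"
    and LE: "\<And>t \<omega>. \<omega> \<in> space M - B \<Longrightarrow> L t \<omega> = ext_proc T N t \<omega> - N 0 \<omega>" by blast
  \<comment> \<open>Chosen so that the L1 bound \<open>\<delta> * (C\<^sup>2 + 1)\<close>, divided
    by the level \<eta>, equals \<open>\<gamma> / 3\<close>.\<close>
  define \<delta> where "\<delta> = \<eta> * \<gamma> / (3 * (C\<^sup>2 + 1))"
  have C1: "C\<^sup>2 + 1 > 0" by (smt (verit) zero_le_power2)
  have d: "\<delta> > 0" using l g C1 by (simp add: \<delta>_def)
  obtain h where h: "h > 0" "prob (osc_event H h \<delta>) \<le> \<gamma> / 3" using osc_event_small[OF H d, of "\<gamma> / 3"] g by auto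
  obtain n0 where n0: "\<forall>n\<ge>n0. T / real (Suc n) < h" using grid_mesh_small[OF h(1)] by blast
  have "prob {\<omega>\<in>space M. \<exists>t\<in>{0..T}. \<eta> < \<bar>grid_sum H (ext_proc T N) n t \<omega> - grid_sum H (ext_proc T N) m t \<omega>\<bar>} \<le> \<gamma>"
    if nm: "n \<ge> n0" "m \<ge> n0" for n m
  proof -
    obtain Y where Y: "dominated \<delta> L Y" "\<forall>\<omega>\<in>space M. \<forall>t\<le>0. Y t \<omega> = 0"
      "\<And>E c \<omega>. \<omega> \<in> space M - osc_event H h \<delta> \<Longrightarrow> (\<forall>t. L t \<omega> = E t \<omega> - c) \<Longrightarrow>
       (\<forall>t\<ge>0. t \<le> T \<longrightarrow> Y t \<omega> = grid_sum H E n t \<omega> - grid_sum H E n 0 \<omega>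
         - (\<Sum>i<Suc m. H (grid m i) \<omega> * (E (min t (grid m (Suc i))) \<omega> - E (min t (grid m i)) \<omega>)))"
      using grid_sum_compare[where k = "Suc m" and p = "grid m" and n = n and h = h, OF L Hc less_imp_le[OF d] grid_mono]
      using n0 nm grid_step[of m] grid_simps[of m] by force
    have bY: "bdd_mart Y" using Y(1) by (simp add: dominated_def)
    define A where "A = {\<omega>\<in>space M. \<exists>t\<in>{0..T}. \<eta> < \<bar>Y t \<omega>\<bar>}"
    have A: "A \<in> sets M" "prob A \<le> expectation (\<lambda>\<omega>. \<bar>Y T \<omega>\<bar>) / \<eta>"
      unfolding A_def by (rule doob_weak[OF bY l])+
    have "expectation (\<lambda>\<omega>. \<bar>Y T \<omega>\<bar>) \<le> \<delta> * (C\<^sup>2 + 1)"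
      by (rule dominated_L1(2)[OF Y(1) d, of 0]) (use T_pos Y(2) L C in auto)
    also have "\<dots> = \<eta> * \<gamma> / 3" unfolding \<delta>_def using C1 by (simp add: field_simps)
    finally have "prob A \<le> \<gamma> / 3" using A(2) l
      by (smt (verit) divide_right_mono nonzero_mult_div_cancel_left times_divide_eq_right)
    have "{\<omega>\<in>space M. \<exists>t\<in>{0..T}. \<eta> < \<bar>grid_sum H (ext_proc T N) n t \<omega> - grid_sum H (ext_proc T N) m t \<omega>\<bar>} \<subseteq> B \<union> osc_event H h \<delta> \<union> A"
    proof (rule subsetI, rule ccontr)
      fix \<omega> assume a: "\<omega> \<in> {\<omega>\<in>space M. \<exists>t\<in>{0..T}. \<eta> < \<bar>grid_sum H (ext_proc T N) n t \<omega> - grid_sum H (ext_proc T N) m t \<omega>\<bar>}"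
        and n: "\<omega> \<notin> B \<union> osc_event H h \<delta> \<union> A"
      then obtain t where t: "t \<in> {0..T}" "\<eta> < \<bar>grid_sum H (ext_proc T N) n t \<omega> - grid_sum H (ext_proc T N) m t \<omega>\<bar>" and w: "\<omega> \<in> space M" by auto
      have "Y t \<omega> = grid_sum H (ext_proc T N) n t \<omega> - grid_sum H (ext_proc T N) n 0 \<omega> - grid_sum H (ext_proc T N) m t \<omega>"
        unfolding grid_sum_def[of _ _ m] using Y(3)[of \<omega> "ext_proc T N" "N 0 \<omega>"] LE[of \<omega>] n w t by auto
      then have "\<eta> < \<bar>Y t \<omega>\<bar>" using t by (simp add: grid_sum_zero)
      then have "\<omega> \<in> A" using t w by (auto simp: A_def)
      then show False using n by simp
    qed
    then have "prob {\<omega>\<in>space M. \<exists>t\<in>{0..T}. \<eta> < \<bar>grid_sum H (ext_proc T N) n t \<omega> - grid_sum H (ext_proc T N) m t \<omega>\<bar>}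
       \<le> prob (B \<union> osc_event H h \<delta> \<union> A)"
      using B A osc_event_sets[OF Hc] by (intro finite_measure_mono) auto
    also have "\<dots> \<le> prob B + prob (osc_event H h \<delta>) + prob A"
      using measure_Un_le[of "B \<union> osc_event H h \<delta>" M A] measure_Un_le[of B M "osc_event H h \<delta>"] B A osc_event_sets[OF Hc, of h \<delta>] by auto
    also have "\<dots> \<le> \<gamma>" using B(2) h(2) \<open>prob A \<le> \<gamma> / 3\<close> by simp
    finally show ?thesis .
  qed
  then show ?thesis by blast
qed

lemma prob_Un3_le:
  assumes "A \<in> sets M" "B \<in> sets M" "C \<in> sets M"
  shows "prob (A \<union> B \<union> C) \<le> prob A + prob B + prob C"
  using measure_Un_le[of "A \<union> B" M C] measure_Un_le[of A M B] assms by auto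

text \<open>Along a rapid subsequence the deviations exceed \<open>(1/2)^k\<close> with summable
  probability, so Borel-Cantelli gives uniform convergence in time almost surely. The subsequence
  \<open>r\<close> is part of the result, since the properties of \<open>I\<close> are derived by
  passing to the limit along it.\<close>

lemma grid_sum_limit:
  assumes N: "cont_local_martingale M T Fi N" and H: "ext_adapted H"
  obtains I r where "ext_adapted I" "\<And>\<omega>. I 0 \<omega> = 0" "filterlim r sequentially sequentially"
    "AE \<omega> in M. \<forall>t. (\<lambda>k. grid_sum H (ext_proc T N) (r k) t \<omega>) \<longlonglongrightarrow> I t \<omega>"
proof -
  let ?E = "ext_proc T N"
  have E: "ext_adapted ?E" using N by (intro ext_adapted_ext) (auto simp: cont_local_martingale_def local_martingale_on_def)
  define J where "J n = grid_sum H ?E n" for n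
  have Je: "ext_adapted (J n)" for n unfolding J_def by (rule grid_sum_eproc[OF ext_adapted_cproc[OF H] E])
  note Jc = ext_adapted_cproc[OF Je]
  have "\<forall>k. \<exists>n0. \<forall>n\<ge>n0. \<forall>m\<ge>n0. prob {\<omega>\<in>space M. \<exists>t\<in>{0..T}. (1/2)^k < \<bar>J n t \<omega> - J m t \<omega>\<bar>} \<le> (1/2)^k"
    unfolding J_def by (rule allI, rule grid_sum_cauchy[OF N H]) simp_all
  from choice[OF this] obtain f where f: "\<And>k n m. n \<ge> f k \<Longrightarrow> m \<ge> f k \<Longrightarrow>
      prob {\<omega>\<in>space M. \<exists>t\<in>{0..T}. (1/2)^k < \<bar>J n t \<omega> - J m t \<omega>\<bar>} \<le> (1/2)^k"
    by blast
  \<comment> \<open>Adding all thresholds up to \<open>k\<close> makes \<open>r\<close> strictly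
    increasing and at least \<open>f k\<close> at both \<open>k\<close> and \<open>Suc k\<close>, so
    consecutive differences obey the k-th bound.\<close>
  define r where "r k = k + (\<Sum>i\<le>k. f i)" for k
  have rf: "r k \<ge> f k" "r (Suc k) \<ge> f k" for k
  proof -
    have "f k \<le> (\<Sum>i\<le>k. f i)" by (rule member_le_sum) auto
    then show "r k \<ge> f k" "r (Suc k) \<ge> f k" by (auto simp: r_def)
  qed
  have rl: "filterlim r sequentially sequentially"
    by (rule filterlim_subseq) (auto simp: strict_mono_Suc_iff r_def)
  define A where "A k = {\<omega>\<in>space M. \<exists>t\<in>{0..T}. (1/2)^k < \<bar>J (r (Suc k)) t \<omega> - J (r k) t \<omega>\<bar>}" for k
  have Am: "A k \<in> sets M" for k
    unfolding A_def
    by (rule sets_exists_gt) (use cont_adapted_meas_M[OF Jc] cont_adapted_cont[OF Jc] in \<open>auto intro!: borel_measurable_abs borel_measurable_diff continuous_on_rabs continuous_on_diff\<close>)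
  have Ap: "prob (A k) \<le> (1/2)^k" for k
    unfolding A_def by (rule f) (use rf in auto)
  have ae: "AE x in M. \<forall>\<^sub>F k in sequentially. x \<in> space M - A k"
  proof (rule borel_cantelli_AE1[OF Am])
    show "summable (\<lambda>k. prob (A k))"
      by (rule summable_comparison_test[where g = "\<lambda>k. (1/2)^k"]) (use Ap in \<open>auto intro!: summable_geometric\<close>)
  qed (simp add: emeasure_eq_measure)
  define Gd where "Gd = {\<omega>\<in>space M. \<forall>\<^sub>F k in sequentially. \<omega> \<notin> A k}"
  obtain N0 where N0: "N0 \<in> null_sets M" "space M - Gd \<subseteq> N0"
  proof -
    from ae obtain N0 where "{x\<in>space M. \<not> (\<forall>\<^sub>F k in sequentially. x \<in> space M - A k)} \<subseteq> N0" "emeasure M N0 = 0" "N0 \<in> sets M"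
      by (rule AE_E)
    then show ?thesis by (intro that[of N0]) (auto simp: Gd_def)
  qed
  have GdG: "Gd \<in> sets (G t)" for t
  proof -
    have "space M - Gd \<in> sets (G t)" by (rule null_G[OF _ N0]) auto
    then have "space (G t) - (space M - Gd) \<in> sets (G t)" by blast
    moreover have "space (G t) - (space M - Gd) = Gd" by (auto simp: Gd_def)
    ultimately show ?thesis by simp
  qed
  \<comment> \<open>The default 0 off \<open>Gd\<close> keeps every path continuous; adaptedness is
    kept because \<open>Gd\<close> belongs to every \<open>G t\<close>.\<close>
  define I where "I t \<omega> = (if \<omega> \<in> Gd then J (r 0) t \<omega> + (\<Sum>k. J (r (Suc k)) t \<omega> - J (r k) t \<omega>) else 0)" for t \<omega>
  have unif: "uniform_limit UNIV (\<lambda>n t. J (r n) t \<omega>) (\<lambda>t. I t \<omega>) sequentially" if w: "\<omega> \<in> Gd" for \<omega>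
  proof -
    have ws: "\<omega> \<in> space M" using w by (simp add: Gd_def)
    have "uniform_limit UNIV (\<lambda>n t. \<Sum>k<n. J (r (Suc k)) t \<omega> - J (r k) t \<omega>) (\<lambda>t. \<Sum>k. J (r (Suc k)) t \<omega> - J (r k) t \<omega>) sequentially"
    proof (rule Weierstrass_m_test_ev[where M = "\<lambda>k. (1/2)^k"])
      have "\<forall>\<^sub>F k in sequentially. \<omega> \<notin> A k" using w by (simp add: Gd_def)
      then show "\<forall>\<^sub>F k in sequentially. \<forall>t\<in>UNIV. norm (J (r (Suc k)) t \<omega> - J (r k) t \<omega>) \<le> (1/2)^k"
      proof (rule eventually_mono, intro ballI)
        fix k t assume "\<omega> \<notin> A k"
        then have "\<forall>t\<in>{0..T}. \<bar>J (r (Suc k)) t \<omega> - J (r k) t \<omega>\<bar> \<le> (1/2)^k"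
          using ws unfolding A_def by (simp add: not_less del: power_divide)
        then have "\<bar>J (r (Suc k)) (max 0 (min t T)) \<omega> - J (r k) (max 0 (min t T)) \<omega>\<bar> \<le> (1/2)^k"
          using T_pos by (elim ballE) auto
        then show "norm (J (r (Suc k)) t \<omega> - J (r k) t \<omega>) \<le> (1/2)^k"
          using ext_adapted_clip[OF Je ws, of "r (Suc k)" t] ext_adapted_clip[OF Je ws, of "r k" t] by (metis real_norm_def)
      qed
    qed (simp add: summable_geometric)
    then have "uniform_limit UNIV (\<lambda>n t. J (r 0) t \<omega> + (\<Sum>k<n. J (r (Suc k)) t \<omega> - J (r k) t \<omega>))
        (\<lambda>t. J (r 0) t \<omega> + (\<Sum>k. J (r (Suc k)) t \<omega> - J (r k) t \<omega>)) sequentially"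
      by (intro uniform_limit_add uniform_limit_const)
    moreover have "J (r 0) t \<omega> + (\<Sum>k<n. J (r (Suc k)) t \<omega> - J (r k) t \<omega>) = J (r n) t \<omega>" for n t
      by (subst sum_lessThan_telescope) simp
    ultimately show ?thesis using w unfolding I_def by simp
  qed
  have lim: "(\<lambda>n. J (r n) t \<omega>) \<longlonglongrightarrow> I t \<omega>" if "\<omega> \<in> Gd" for \<omega> t
    using tendsto_uniform_limitI[OF unif[OF that], of t] by simp
  have Ic: "continuous_on UNIV (\<lambda>t. I t \<omega>)" if ws: "\<omega> \<in> space M" for \<omega>
  proof (cases "\<omega> \<in> Gd")
    case True
    show ?thesis
      by (rule uniform_limit_theorem[OF _ unif[OF True]]) (use cont_adapted_cont[OF Jc ws] in auto)
  next
    case False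
    then show ?thesis by (simp add: I_def)
  qed
  have Im: "I t \<in> borel_measurable (G t)" for t
  proof (rule borel_measurable_LIMSEQ_real)
    show "(\<lambda>\<omega>. if \<omega> \<in> Gd then J (r n) t \<omega> else 0) \<in> borel_measurable (G t)" for n
      using cont_adapted_meas[OF Jc, of "r n" t] GdG[of t] by measurable
    show "(\<lambda>n. if \<omega> \<in> Gd then J (r n) t \<omega> else 0) \<longlonglongrightarrow> I t \<omega>" for \<omega>
      using lim[of \<omega> t] by (cases "\<omega> \<in> Gd") (simp_all add: I_def)
  qed
  have Icl: "I t \<omega> = I (max 0 (min t T)) \<omega>" if ws: "\<omega> \<in> space M" for t \<omega>
  proof -
    have "J n t \<omega> = J n (max 0 (min t T)) \<omega>" for n by (rule ext_adapted_clip[OF Je ws])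
    then have "(\<lambda>n. J n t \<omega>) = (\<lambda>n. J n (max 0 (min t T)) \<omega>)" by (rule ext)
    then have "(\<lambda>n. J (r n) t \<omega>) = (\<lambda>n. J (r n) (max 0 (min t T)) \<omega>)" by meson
    then have e: "(\<lambda>n. J (r n) t \<omega>) = (\<lambda>n. J (r n) u \<omega>)" if "u = max 0 (min t T)" for u using that by simp
    define u where "u = max 0 (min t T)"
    show ?thesis
    proof (cases "\<omega> \<in> Gd")
      case True
      have "(\<lambda>n. J (r n) u \<omega>) \<longlonglongrightarrow> I t \<omega>" using lim[OF True, of t] unfolding e[OF u_def] .
      then show ?thesis unfolding u_def[symmetric] using lim[OF True, of u] by (rule LIMSEQ_unique)
    next
      case False
      then show ?thesis by (simp add: I_def)
    qed
  qed
  have 1: "ext_adapted I" unfolding ext_adapted_def cont_adapted_def using Im Ic Icl by blast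
  have 2: "I 0 \<omega> = 0" for \<omega>
    unfolding I_def J_def grid_sum_zero by simp
  have 3: "AE \<omega> in M. \<forall>t. (\<lambda>k. grid_sum H ?E (r k) t \<omega>) \<longlonglongrightarrow> I t \<omega>"
    using ae
  proof (rule AE_mp, intro AE_I2 impI allI)
    fix \<omega> t assume "\<omega> \<in> space M" "\<forall>\<^sub>F k in sequentially. \<omega> \<in> space M - A k"
    then have "\<omega> \<in> Gd" by (auto simp: Gd_def elim: eventually_mono)
    then show "(\<lambda>k. grid_sum H ?E (r k) t \<omega>) \<longlonglongrightarrow> I t \<omega>" using lim by (simp add: J_def)
  qed
  show ?thesis by (rule that[OF 1 2 rl 3])
qed

text \<open>The L2 bound for differences of sums passes to \<open>I\<close> by Fatou. The right side
  involves only the second moment of \<open>L\<close> over \<open>[p 0, p k]\<close>, so the bound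
  serves for a partition of a whole interval as well as for single short steps that are integrated
  over time later. The indicator of \<open>S\<close> removes the outcomes where localisation or
  modulus fails.\<close>

lemma integral_increment_estimate:
  fixes p :: "nat \<Rightarrow> real"
  assumes H: "ext_adapted H" and E: "ext_adapted E" and I: "ext_adapted I" and r: "filterlim r sequentially sequentially"
    and lim: "AE \<omega> in M. \<forall>t. (\<lambda>k. grid_sum H E (r k) t \<omega>) \<longlonglongrightarrow> I t \<omega>"
    and L: "bdd_mart L" and B: "B \<in> sets M" and LE: "\<And>t \<omega>. \<omega> \<in> space M - B \<Longrightarrow> L t \<omega> = E t \<omega> - c \<omega>"
    and d: "0 \<le> \<delta>" and h: "h > 0"
    and p: "\<And>i. i < k \<Longrightarrow> p i \<le> p (Suc i)" "\<And>i. i < k \<Longrightarrow> p (Suc i) - p i < h"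
    and p0: "0 \<le> p 0" "p k \<le> T"
  defines "D \<equiv> \<lambda>\<omega>. I (p k) \<omega> - I (p 0) \<omega> - (\<Sum>i<k. H (p i) \<omega> * (E (p (Suc i)) \<omega> - E (p i) \<omega>))"
  defines "S \<equiv> space M - (B \<union> osc_event H h \<delta>)"
  shows "D \<in> borel_measurable M" "integrable M (\<lambda>\<omega>. (indicator S \<omega> * D \<omega>)\<^sup>2)"
    "expectation (\<lambda>\<omega>. (indicator S \<omega> * D \<omega>)\<^sup>2) \<le> \<delta>\<^sup>2 * expectation (\<lambda>\<omega>. (L (p k) \<omega> - L (p 0) \<omega>)\<^sup>2)"
proof -
  note Hc = ext_adapted_cproc[OF H] and Ec = ext_adapted_cproc[OF E] and Ic = ext_adapted_cproc[OF I]
  note [measurable] = cont_adapted_meas_M[OF Hc] cont_adapted_meas_M[OF Ec] cont_adapted_meas_M[OF Ic] B osc_event_sets[OF Hc, of h \<delta>]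
  show Dm [measurable]: "D \<in> borel_measurable M" unfolding D_def by measurable
  have pk: "p i \<le> p k" if "i \<le> k" for i
    using mono_upto[of k p i] p(1) that by blast
  have p0k: "p 0 \<le> p k" using pk[of 0] by simp
  obtain n0 where n0: "\<forall>n\<ge>n0. T / real (Suc n) < h" using grid_mesh_small[OF h] by blast
  obtain k0 where k0: "\<And>j. j \<ge> k0 \<Longrightarrow> r j \<ge> n0"
    using r unfolding filterlim_at_top eventually_sequentially by blast
  \<comment> \<open>The shift makes every grid of the subsequence finer than
    \<open>h\<close>.\<close>
  define R where "R j = r (j + k0)" for j
  have Rn: "T / real (Suc (R j)) < h" for j using n0 k0[of "j + k0"] by (simp add: R_def)
  have "\<forall>j. \<exists>Y. dominated \<delta> L Y \<and> (\<forall>\<omega>\<in>space M. \<forall>t\<le>p 0. Y t \<omega> = 0) \<and>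
    (\<forall>E c. \<forall>\<omega>\<in>space M - osc_event H h \<delta>. (\<forall>t. L t \<omega> = E t \<omega> - c) \<longrightarrow>
       (\<forall>t\<ge>p 0. t \<le> p k \<longrightarrow> Y t \<omega> = grid_sum H E (R j) t \<omega> - grid_sum H E (R j) (p 0) \<omega>
         - (\<Sum>i<k. H (p i) \<omega> * (E (min t (p (Suc i))) \<omega> - E (min t (p i)) \<omega>))))"
    by (rule allI, rule grid_sum_compare[OF L Hc d p Rn p0])
  from choice[OF this] obtain Y where Y: "\<And>j. dominated \<delta> L (Y j)" "\<And>j t \<omega>. \<omega> \<in> space M \<Longrightarrow> t \<le> p 0 \<Longrightarrow> Y j t \<omega> = 0"
    "\<And>j E c \<omega> t. \<omega> \<in> space M - osc_event H h \<delta> \<Longrightarrow> (\<And>t. L t \<omega> = E t \<omega> - c) \<Longrightarrow> p 0 \<le> t \<Longrightarrow> t \<le> p k \<Longrightarrow>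
       Y j t \<omega> = grid_sum H E (R j) t \<omega> - grid_sum H E (R j) (p 0) \<omega>
         - (\<Sum>i<k. H (p i) \<omega> * (E (min t (p (Suc i))) \<omega> - E (min t (p i)) \<omega>))"
    by blast
  define V where "V j \<omega> = indicator S \<omega> * Y j (p k) \<omega>" for j \<omega>
  have bY: "bdd_mart (Y j)" for j using Y(1) by (simp add: dominated_def)
  note [measurable] = bdd_mart_meas_M[OF bY] bdd_mart_meas_M[OF L]
  have [measurable]: "S \<in> sets M" unfolding S_def by measurable
  have iY: "integrable M (\<lambda>\<omega>. (Y j (p k) \<omega>)\<^sup>2)" for j
  proof -
    obtain C where "\<forall>t. \<forall>\<omega>\<in>space M. \<bar>Y j t \<omega>\<bar> \<le> C" using bdd_mart_bdd[OF bY] by blast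
    then show ?thesis unfolding power2_eq_square by (intro integrable_bdd_mult[of _ C _ C]) auto
  qed
  have Vb: "(V j \<omega>)\<^sup>2 \<le> (Y j (p k) \<omega>)\<^sup>2" for j \<omega> by (simp add: V_def indicator_def)
  have iV: "integrable M (\<lambda>\<omega>. (V j \<omega>)\<^sup>2)" for j
    by (rule Bochner_Integration.integrable_bound[OF iY[of j]]) (use Vb in \<open>auto simp: V_def\<close>)
  have cV: "expectation (\<lambda>\<omega>. (V j \<omega>)\<^sup>2) \<le> \<delta>\<^sup>2 * expectation (\<lambda>\<omega>. (L (p k) \<omega> - L (p 0) \<omega>)\<^sup>2)" for j
  proof -
    have "expectation (\<lambda>\<omega>. (V j \<omega>)\<^sup>2) \<le> expectation (\<lambda>\<omega>. (Y j (p k) \<omega>)\<^sup>2)"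
      by (rule integral_mono[OF iV iY Vb])
    also have "\<dots> = expectation (\<lambda>\<omega>. (Y j (p k) \<omega> - Y j (p 0) \<omega>)\<^sup>2)"
      by (rule Bochner_Integration.integral_cong) (auto simp: Y(2))
    also have "\<dots> \<le> \<delta>\<^sup>2 * expectation (\<lambda>\<omega>. (L (p k) \<omega> - L (p 0) \<omega>)\<^sup>2)"
      using Y(1)[of j] p0k unfolding dominated_def by blast
    finally show ?thesis .
  qed
  have Rl: "filterlim (\<lambda>j. j + k0) sequentially sequentially" by (rule filterlim_add_const_nat_at_top)
  have l: "AE \<omega> in M. (\<lambda>j. V j \<omega>) \<longlonglongrightarrow> indicator S \<omega> * D \<omega>"
    using lim
  proof (rule AE_mp, intro AE_I2 impI)
    fix \<omega> assume w: "\<omega> \<in> space M" and lim: "\<forall>t. (\<lambda>k. grid_sum H E (r k) t \<omega>) \<longlonglongrightarrow> I t \<omega>"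
    show "(\<lambda>j. V j \<omega>) \<longlonglongrightarrow> indicator S \<omega> * D \<omega>"
    proof (cases "\<omega> \<in> S")
      case True
      then have 1: "\<omega> \<in> space M - osc_event H h \<delta>" "\<omega> \<in> space M - B" by (auto simp: S_def)
      have m: "min (p k) (p i) = p i" if "i \<le> k" for i using pk[OF that] by simp
      have "Y j (p k) \<omega> = grid_sum H E (R j) (p k) \<omega> - grid_sum H E (R j) (p 0) \<omega>
         - (\<Sum>i<k. H (p i) \<omega> * (E (min (p k) (p (Suc i))) \<omega> - E (min (p k) (p i)) \<omega>))" for j
        by (rule Y(3)[of \<omega> E "c \<omega>" "p k" j, OF 1(1) LE[OF 1(2)] p0k order_refl])
      also have "(\<Sum>i<k. H (p i) \<omega> * (E (min (p k) (p (Suc i))) \<omega> - E (min (p k) (p i)) \<omega>)) =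
          (\<Sum>i<k. H (p i) \<omega> * (E (p (Suc i)) \<omega> - E (p i) \<omega>))"
        by (rule sum.cong) (simp_all add: m)
      finally have e: "Y j (p k) \<omega> = grid_sum H E (R j) (p k) \<omega> - grid_sum H E (R j) (p 0) \<omega>
         - (\<Sum>i<k. H (p i) \<omega> * (E (p (Suc i)) \<omega> - E (p i) \<omega>))" for j .
      have "(\<lambda>j. grid_sum H E (R j) t \<omega>) \<longlonglongrightarrow> I t \<omega>" for t
        unfolding R_def using filterlim_compose[OF lim[rule_format, of t] Rl] by simp
      then have "(\<lambda>j. Y j (p k) \<omega>) \<longlonglongrightarrow> D \<omega>" unfolding e D_def by (intro tendsto_intros)
      then show ?thesis using True by (simp add: V_def)
    qed (simp add: V_def)
  qed
  have sD: "(\<lambda>\<omega>. indicator S \<omega> * D \<omega>) \<in> borel_measurable M" by measurable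
  show "integrable M (\<lambda>\<omega>. (indicator S \<omega> * D \<omega>)\<^sup>2)"
    "expectation (\<lambda>\<omega>. (indicator S \<omega> * D \<omega>)\<^sup>2) \<le> \<delta>\<^sup>2 * expectation (\<lambda>\<omega>. (L (p k) \<omega> - L (p 0) \<omega>)\<^sup>2)"
    using fatou_square[OF iV always_eventually[OF allI[OF cV]] l sD] by auto
qed

lemma chebyshev:
  assumes "integrable M (\<lambda>\<omega>. (f \<omega>)\<^sup>2)" "f \<in> borel_measurable M" "\<eta> > 0"
  shows "prob {\<omega>\<in>space M. \<eta> < \<bar>f \<omega>\<bar>} \<le> expectation (\<lambda>\<omega>. (f \<omega>)\<^sup>2) / \<eta>\<^sup>2"
proof -
  note [measurable] = assms(2)
  have "prob {\<omega>\<in>space M. \<eta> < \<bar>f \<omega>\<bar>} \<le> prob {\<omega>\<in>space M. \<eta>\<^sup>2 \<le> (f \<omega>)\<^sup>2}"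
  proof (rule finite_measure_mono)
    have "\<eta>\<^sup>2 \<le> (f \<omega>)\<^sup>2" if "\<eta> < \<bar>f \<omega>\<bar>" for \<omega>
      using assms(3) that by (metis less_imp_le power2_abs power_mono)
    then show "{\<omega>\<in>space M. \<eta> < \<bar>f \<omega>\<bar>} \<subseteq> {\<omega>\<in>space M. \<eta>\<^sup>2 \<le> (f \<omega>)\<^sup>2}" by auto
  qed measurable
  also have "\<dots> \<le> expectation (\<lambda>\<omega>. (f \<omega>)\<^sup>2) / \<eta>\<^sup>2"
    by (rule integral_Markov_inequality_measure[where A = "space M"]) (use assms in auto)
  finally show ?thesis .
qed

text \<open>One application of \<open>integral_increment_estimate\<close> to the whole partition of
  \<open>[0, t]\<close>, followed by Chebyshev: an arbitrary partition of small mesh is compared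
  with the grid-based limit itself.\<close>

lemma is_stoch_integral_limit:
  assumes N: "cont_local_martingale M T Fi N" and H: "ext_adapted H" and I: "ext_adapted I" and I0: "\<And>\<omega>. I 0 \<omega> = 0"
    and r: "filterlim r sequentially sequentially"
    and lim: "AE \<omega> in M. \<forall>t. (\<lambda>k. grid_sum H (ext_proc T N) (r k) t \<omega>) \<longlonglongrightarrow> I t \<omega>"
  shows "is_stoch_integral M T H N I"
  unfolding is_stoch_integral_def
proof (intro conjI ballI allI impI)
  note Hc = ext_adapted_cproc[OF H] and Ic = ext_adapted_cproc[OF I]
  show "cont_proc M T I" unfolding cont_proc_def using cont_adapted_cont[OF Ic] by blast
  let ?E = "ext_proc T N"
  have E: "ext_adapted ?E" using N by (intro ext_adapted_ext) (auto simp: cont_local_martingale_def local_martingale_on_def)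
  have NE: "N t \<omega> = ?E t \<omega>" if "0 \<le> t" "t \<le> T" for t \<omega> using that by (simp add: ext_proc_def)
  fix t and k :: "nat \<Rightarrow> nat" and p :: "nat \<Rightarrow> nat \<Rightarrow> real"
  assume t: "t \<in> {0..T}" and a: "(\<forall>n. is_partition t (k n) (p n)) \<and>
     (\<forall>e>0. \<forall>\<^sub>F n in sequentially. \<forall>i<k n. p n (Suc i) - p n i < e)"
  have p: "p n 0 = 0" "p n (k n) = t" "\<And>i. i < k n \<Longrightarrow> p n i \<le> p n (Suc i)" for n
    using a unfolding is_partition_def by (auto intro: less_imp_le)
  have pr: "0 \<le> p n i" "p n i \<le> T" if "i \<le> k n" for n i
  proof -
    have "p n 0 \<le> p n i" using sum_telescope_clamp[of i "p n"] p(3) that by auto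
    moreover have "p n i \<le> p n (k n)" using that
      using mono_upto[of "k n" "p n" i] p(3) by blast
    ultimately show "0 \<le> p n i" "p n i \<le> T" using p(1,2) t by auto
  qed
  define R where "R n \<omega> = (\<Sum>i<k n. H (p n i) \<omega> * (?E (p n (Suc i)) \<omega> - ?E (p n i) \<omega>))" for n \<omega>
  have Req: "(\<Sum>i<k n. H (p n i) \<omega> * (N (p n (Suc i)) \<omega> - N (p n i) \<omega>)) = R n \<omega>" for n \<omega>
    unfolding R_def by (rule sum.cong) (use NE pr in auto)
  note [measurable] = cont_adapted_meas_M[OF Hc] cont_adapted_meas_M[OF ext_adapted_cproc[OF E]] cont_adapted_meas_M[OF Ic]
  have Rm [measurable]: "R n \<in> borel_measurable M" for n unfolding R_def by measurable
  show "tendsto_in_prob_seq M (\<lambda>n \<omega>. \<Sum>i<k n. H (p n i) \<omega> * (N (p n (Suc i)) \<omega> - N (p n i) \<omega>)) (I t)"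
    unfolding tendsto_in_prob_seq_def Req
  proof (intro conjI allI impI)
    show "I t \<in> borel_measurable M" by simp
    show "\<forall>\<^sub>F n in sequentially. (\<lambda>\<omega>. R n \<omega>) \<in> borel_measurable M" using Rm by simp
    fix \<eta> :: real assume l: "\<eta> > 0"
    show "(\<lambda>n. prob {\<omega>\<in>space M. \<eta> < \<bar>R n \<omega> - I t \<omega>\<bar>}) \<longlonglongrightarrow> 0"
    proof (rule LIMSEQ_I)
      fix \<gamma>' :: real assume g': "\<gamma>' > 0"
      define \<gamma> where "\<gamma> = \<gamma>' / 2"
      have g: "\<gamma> > 0" using g' by (simp add: \<gamma>_def)
      then have "\<gamma> / 3 > 0" by simp
      from localize_small[OF N this] obtain L B C where L: "bdd_mart L" and B: "B \<in> sets M" "prob B \<le> \<gamma> / 3" and C: "C \<ge> 0"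
        "\<And>s t \<omega>. \<omega> \<in> space M \<Longrightarrow> \<bar>L t \<omega> - L s \<omega>\<bar> \<le> C"
        and LE: "\<And>t \<omega>. \<omega> \<in> space M - B \<Longrightarrow> L t \<omega> = ?E t \<omega> - N 0 \<omega>" by blast
      note [measurable] = bdd_mart_meas_M[OF L]
      \<comment> \<open>Solves \<open>\<delta>\<^sup>2 * (C\<^sup>2 + 1) / \<eta>\<^sup>2 = \<gamma>
        / 3\<close>, the share of the Chebyshev bound.\<close>
      define \<delta> where "\<delta> = sqrt (\<eta>\<^sup>2 * \<gamma> / (3 * (C\<^sup>2 + 1)))"
      have C1: "C\<^sup>2 + 1 > 0" by (smt (verit) zero_le_power2)
      have d: "\<delta> > 0" using l g C1 by (simp add: \<delta>_def)
      have d2: "\<delta>\<^sup>2 = \<eta>\<^sup>2 * \<gamma> / (3 * (C\<^sup>2 + 1))" using l g C1 by (simp add: \<delta>_def)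
      obtain h where h: "h > 0" "prob (osc_event H h \<delta>) \<le> \<gamma> / 3" using osc_event_small[OF H d, of "\<gamma> / 3"] g by auto
      obtain n0 where n0: "\<And>n i. n \<ge> n0 \<Longrightarrow> i < k n \<Longrightarrow> p n (Suc i) - p n i < h"
        using a h(1) unfolding eventually_sequentially by blast
      have "prob {\<omega>\<in>space M. \<eta> < \<bar>R n \<omega> - I t \<omega>\<bar>} \<le> \<gamma>" if n: "n \<ge> n0" for n
      proof -
        define S where "S = space M - (B \<union> osc_event H h \<delta>)"
        define D where "D \<omega> = I (p n (k n)) \<omega> - I (p n 0) \<omega> - (\<Sum>i<k n. H (p n i) \<omega> * (?E (p n (Suc i)) \<omega> - ?E (p n i) \<omega>))" for \<omega>
        have De: "D \<omega> = I t \<omega> - R n \<omega>" for \<omega>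
          unfolding D_def R_def p(1,2) I0 by simp
        note est = integral_increment_estimate[where k = "k n" and p = "p n", OF H E I r lim L B(1) LE less_imp_le[OF d] h(1)
            p(3) n0[OF n] pr(1)[OF le0] pr(2)[OF order_refl], folded D_def S_def]
        have Sm [measurable]: "S \<in> sets M" unfolding S_def using B(1) osc_event_sets[OF Hc] by auto
        have "expectation (\<lambda>\<omega>. (L (p n (k n)) \<omega> - L (p n 0) \<omega>)\<^sup>2) \<le> C\<^sup>2"
          by (rule bdd_mart_incr_square(2)[OF L C(2)])
        then have "expectation (\<lambda>\<omega>. (indicator S \<omega> * D \<omega>)\<^sup>2) \<le> \<delta>\<^sup>2 * C\<^sup>2"
          using order_trans[OF est(3) mult_left_mono] by simp
        also have "\<dots> \<le> \<delta>\<^sup>2 * (C\<^sup>2 + 1)" by (simp add: mult_left_mono)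
        also have "\<dots> = \<eta>\<^sup>2 * \<gamma> / 3" unfolding d2 using C1 by (simp add: field_simps)
        finally have e3: "expectation (\<lambda>\<omega>. (indicator S \<omega> * D \<omega>)\<^sup>2) \<le> \<eta>\<^sup>2 * \<gamma> / 3" .
        define A where "A = {\<omega>\<in>space M. \<eta> < \<bar>indicator S \<omega> * D \<omega>\<bar>}"
        have Dm [measurable]: "D \<in> borel_measurable M" using est(1) by (simp add: D_def[abs_def])
        have Am [measurable]: "A \<in> sets M" unfolding A_def by measurable
        have "prob A \<le> expectation (\<lambda>\<omega>. (indicator S \<omega> * D \<omega>)\<^sup>2) / \<eta>\<^sup>2"
          unfolding A_def by (rule chebyshev[OF est(2) _ l]) measurable
        also have "\<dots> \<le> (\<eta>\<^sup>2 * \<gamma> / 3) / \<eta>\<^sup>2" using e3 by (rule divide_right_mono) simp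
        also have "\<dots> = \<gamma> / 3" using l by simp
        finally have pA: "prob A \<le> \<gamma> / 3" .
        have "{\<omega>\<in>space M. \<eta> < \<bar>R n \<omega> - I t \<omega>\<bar>} \<subseteq> B \<union> osc_event H h \<delta> \<union> A"
          by (auto simp: A_def S_def De abs_minus_commute)
        then have "prob {\<omega>\<in>space M. \<eta> < \<bar>R n \<omega> - I t \<omega>\<bar>} \<le> prob (B \<union> osc_event H h \<delta> \<union> A)"
          using B(1) osc_event_sets[OF Hc] Am by (intro finite_measure_mono) auto
        also have "\<dots> \<le> prob B + prob (osc_event H h \<delta>) + prob A" by (rule prob_Un3_le[OF B(1) osc_event_sets[OF Hc] Am])
        also have "\<dots> \<le> \<gamma>" using B(2) h(2) pA by simp
        finally show ?thesis .
      qed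
      then show "\<exists>n0. \<forall>n\<ge>n0. norm (prob {\<omega>\<in>space M. \<eta> < \<bar>R n \<omega> - I t \<omega>\<bar>} - 0) < \<gamma>'"
        using g' by (intro exI[of _ n0]) (force simp: \<gamma>_def)
    qed
  qed
qed

text \<open>Stopped at \<open>\<rho> k\<close>, the grid sums are transforms of a bounded martingale
  with weights bounded by \<open>k\<close>. Their increments are bounded in L2, so
  \<open>test_zero_limit\<close> transfers the martingale property to the limit. The initial value
  \<open>Z\<close> cancels in the increments from time 0.\<close>

lemma integral_local_martingale:
  assumes N: "cont_local_martingale M T Fi N" and H: "ext_adapted H" and I: "ext_adapted I" and I0: "\<And>\<omega>. I 0 \<omega> = 0"
    and r: "filterlim r sequentially sequentially"
    and lim: "AE \<omega> in M. \<forall>t. (\<lambda>k. grid_sum H (ext_proc T N) (r k) t \<omega>) \<longlonglongrightarrow> I t \<omega>"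
    and Zm: "Z \<in> borel_measurable (Fi 0)"
  shows "cont_local_martingale M T Fi (\<lambda>t \<omega>. Z \<omega> + I t \<omega>)"
proof -
  let ?E = "ext_proc T N"
  note Hc = ext_adapted_cproc[OF H] and Ic = ext_adapted_cproc[OF I]
  have E: "ext_adapted ?E" using N by (intro ext_adapted_ext) (auto simp: cont_local_martingale_def local_martingale_on_def)
  have G0: "G 0 = Fi 0" using T_pos by (simp add: G_def)
  have Gt: "G t = Fi t" if "t \<in> {0..T}" for t using that by (simp add: G_def)
  have It: "I t \<in> borel_measurable (Fi t)" if "t \<in> {0..T}" for t using cont_adapted_meas[OF Ic, of t] Gt[OF that] by simp
  have Zt: "Z \<in> borel_measurable (Fi t)" if "t \<in> {0..T}" for t
    using meas_G_mono[of Z 0 t] Zm G0 Gt[OF that] that by simp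
  have ad: "adapted T Fi (\<lambda>t \<omega>. Z \<omega> + I t \<omega>)"
    unfolding adapted_def using It Zt by (auto intro!: borel_measurable_add)
  have cp: "cont_proc M T (\<lambda>t \<omega>. Z \<omega> + I t \<omega>)"
    unfolding cont_proc_def using cont_adapted_cont[OF Ic] by (auto intro!: continuous_on_add continuous_on_const)
  obtain \<rho> :: "nat \<Rightarrow> 'a \<Rightarrow> real" where s: "\<And>k. stopping_time_on M T Fi (\<rho> k)"
    "\<And>\<omega>. \<omega> \<in> space M \<Longrightarrow> mono (\<lambda>k. \<rho> k \<omega>)"
    "AE \<omega> in M. \<exists>k. \<rho> k \<omega> = T"
    "\<And>k. bdd_mart (\<lambda>t \<omega>. ext_proc T N (min t (\<rho> k \<omega>)) \<omega> - N 0 \<omega>)"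
    "\<And>k t \<omega>. \<omega> \<in> space M \<Longrightarrow> 0 \<le> t \<Longrightarrow> t < \<rho> k \<omega> \<Longrightarrow> \<bar>H t \<omega>\<bar> \<le> real k"
    using localization[OF N Hc] by blast
  have mart: "martingale_on M T Fi (\<lambda>t \<omega>. (Z \<omega> + I (min t (\<rho> k \<omega>)) \<omega>) - (Z \<omega> + I 0 \<omega>))" for k
  proof -
    define L where "L t \<omega> = ext_proc T N (min t (\<rho> k \<omega>)) \<omega> - N 0 \<omega>" for t \<omega>
    have L: "bdd_mart L" using s(4)[of k] by (simp add: L_def[abs_def])
    obtain C where C: "C \<ge> 0" "\<And>s t \<omega>. \<omega> \<in> space M \<Longrightarrow> \<bar>L t \<omega> - L s \<omega>\<bar> \<le> C"
      using bdd_mart_incr_bdd[OF L] by blast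
    \<comment> \<open>A weight is dropped when stopping has occurred by the start of its cell, an
      event known at that time. Otherwise the cell starts strictly before \<open>\<rho> k\<close>,
      where \<open>H\<close> is bounded by \<open>k\<close>.\<close>
    define W where "W n j \<omega> = (if \<rho> k \<omega> \<le> grid n j then 0 else H (grid n j) \<omega>)" for n j \<omega>
    define Y where "Y n t \<omega> = (\<Sum>j<Suc n. W n j \<omega> * (L (min t (grid n (Suc j))) \<omega> - L (min t (grid n j)) \<omega>))" for n t \<omega>
    have Wm: "W n j \<in> borel_measurable (G (grid n j))" for n j
    proof -
      have "{\<omega>\<in>space (G (grid n j)). \<rho> k \<omega> \<le> grid n j} \<in> sets (G (grid n j))" using stop_sets[OF s(1), of k "grid n j"] by simp
      then show ?thesis unfolding W_def[abs_def] using cont_adapted_meas[OF Hc, of "grid n j"]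
        by (intro measurable_If) (auto simp: pred_def)
    qed
    have Wb: "\<bar>W n j \<omega>\<bar> \<le> real k" if "\<omega> \<in> space M" for n j \<omega>
      using s(5)[OF that grid_nonneg[of n j], of k] by (auto simp: W_def)
    have Yd: "dominated (real k) L (Y n)" for n
      unfolding Y_def[abs_def] by (rule dominated_elementary[where r = "grid n" and n = "Suc n" and Z = "W n", OF L grid_mono Wm Wb])
    have Y0: "Y n t \<omega> = 0" if "t \<le> 0" for n t \<omega>
    proof -
      have "min t (grid n j) = t" for j using grid_nonneg[of n j] that by simp
      then show ?thesis by (simp add: Y_def)
    qed
    have bY: "bdd_mart (Y n)" for n using Yd by (simp add: dominated_def)
    \<comment> \<open>The stopped integrator has no increment on cells that start after
      \<open>\<rho> k\<close>, so dropping their weights changes nothing and the transform is the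
      stopped grid sum.\<close>
    have Yeq: "Y n t \<omega> = grid_sum H ?E n (min t (\<rho> k \<omega>)) \<omega>" if w: "\<omega> \<in> space M" for n t \<omega>
      unfolding Y_def grid_sum_def
    proof (rule sum.cong[OF refl])
      fix j assume "j \<in> {..<Suc n}"
      show "W n j \<omega> * (L (min t (grid n (Suc j))) \<omega> - L (min t (grid n j)) \<omega>) =
         H (grid n j) \<omega> * (?E (min (min t (\<rho> k \<omega>)) (grid n (Suc j))) \<omega> - ?E (min (min t (\<rho> k \<omega>)) (grid n j)) \<omega>)"
      proof (cases "\<rho> k \<omega> \<le> grid n j")
        case True
        then have "min (min t (\<rho> k \<omega>)) (grid n (Suc j)) = min (min t (\<rho> k \<omega>)) (grid n j)"
          using grid_mono[of n j] by auto
        then show ?thesis using True by (simp add: W_def)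
      next
        case False
        have "min (min t b) (\<rho> k \<omega>) = min (min t (\<rho> k \<omega>)) b" for b by auto
        then show ?thesis using False by (simp add: W_def L_def)
      qed
    qed
    have sc: "cont_adapted (\<lambda>t \<omega>. I (min t (\<rho> k \<omega>)) \<omega>)" by (rule stopped_cproc[OF Ic s(1)])
    note [measurable] = cont_adapted_meas_M[OF sc] bdd_mart_meas_M[OF bY]
    have Ylim: "AE \<omega> in M. (\<lambda>n. Y (r n) t \<omega>) \<longlonglongrightarrow> I (min t (\<rho> k \<omega>)) \<omega>" for t
      using lim
    proof (rule AE_mp, intro AE_I2 impI)
      fix \<omega> assume w: "\<omega> \<in> space M" and l: "\<forall>t. (\<lambda>k. grid_sum H ?E (r k) t \<omega>) \<longlonglongrightarrow> I t \<omega>"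
      show "(\<lambda>n. Y (r n) t \<omega>) \<longlonglongrightarrow> I (min t (\<rho> k \<omega>)) \<omega>"
        unfolding Yeq[OF w] using l by blast
    qed
    have bnd: "integrable M (\<lambda>\<omega>. (Y n t \<omega> - Y n s \<omega>)\<^sup>2)"
      "expectation (\<lambda>\<omega>. (Y n t \<omega> - Y n s \<omega>)\<^sup>2) \<le> (real k)\<^sup>2 * C\<^sup>2" if "s \<le> t" for n s t
    proof -
      obtain D where "\<forall>s t. \<forall>\<omega>\<in>space M. \<bar>Y n t \<omega> - Y n s \<omega>\<bar> \<le> D" using bdd_mart_incr_bdd[OF bY] by blast
      then show "integrable M (\<lambda>\<omega>. (Y n t \<omega> - Y n s \<omega>)\<^sup>2)"
        unfolding power2_eq_square by (intro integrable_bdd_mult[of _ D _ D]) auto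
      note [measurable] = bdd_mart_meas_M[OF L]
      have "expectation (\<lambda>\<omega>. (Y n t \<omega> - Y n s \<omega>)\<^sup>2) \<le> (real k)\<^sup>2 * expectation (\<lambda>\<omega>. (L t \<omega> - L s \<omega>)\<^sup>2)"
        using Yd that unfolding dominated_def by blast
      also have "expectation (\<lambda>\<omega>. (L t \<omega> - L s \<omega>)\<^sup>2) \<le> C\<^sup>2" by (rule bdd_mart_incr_square(2)[OF L C(2)])
      finally show "expectation (\<lambda>\<omega>. (Y n t \<omega> - Y n s \<omega>)\<^sup>2) \<le> (real k)\<^sup>2 * C\<^sup>2"
        by (simp add: mult_left_mono)
    qed
    have main: "integrable M (\<lambda>\<omega>. I (min t (\<rho> k \<omega>)) \<omega> - I (min s (\<rho> k \<omega>)) \<omega>)"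
      "expectation (\<lambda>\<omega>. indicator A \<omega> * (I (min t (\<rho> k \<omega>)) \<omega> - I (min s (\<rho> k \<omega>)) \<omega>)) = 0"
      if st: "s \<le> t" and A: "A \<in> sets (G s)" for s t A
    proof -
      have am: "AE \<omega> in M. (\<lambda>n. Y (r n) t \<omega> - Y (r n) s \<omega>) \<longlonglongrightarrow> I (min t (\<rho> k \<omega>)) \<omega> - I (min s (\<rho> k \<omega>)) \<omega>"
        using Ylim[of t] Ylim[of s] by eventually_elim (rule tendsto_diff)
      have z: "expectation (\<lambda>\<omega>. indicator A \<omega> * (Y (r n) t \<omega> - Y (r n) s \<omega>)) = 0" for n
        by (rule bdd_mart_orth[OF bY _ _ order_refl st, of _ 1]) (use A in \<open>auto simp: indicator_def\<close>)
      have Am: "A \<in> sets M" using sets_G_M[OF A] .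
      show "integrable M (\<lambda>\<omega>. I (min t (\<rho> k \<omega>)) \<omega> - I (min s (\<rho> k \<omega>)) \<omega>)"
        "expectation (\<lambda>\<omega>. indicator A \<omega> * (I (min t (\<rho> k \<omega>)) \<omega> - I (min s (\<rho> k \<omega>)) \<omega>)) = 0"
        using test_zero_limit[where Vn = "\<lambda>n \<omega>. Y (r n) t \<omega> - Y (r n) s \<omega>" and W = "indicator A",
            OF bnd(1)[OF st] bnd(2)[OF st] _ am _ _ _ z] Am by (auto simp: indicator_def)
    qed
    have r0: "0 \<le> \<rho> k \<omega>" if "\<omega> \<in> space M" for \<omega> using s(1)[of k] that by (auto simp: stopping_time_on_def)
    have int: "integrable M (\<lambda>\<omega>. I (min t (\<rho> k \<omega>)) \<omega>)" if "0 \<le> t" for t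
    proof -
      have "integrable M (\<lambda>\<omega>. I (min t (\<rho> k \<omega>)) \<omega> - I (min 0 (\<rho> k \<omega>)) \<omega>)"
        using main(1)[OF that sets.empty_sets] .
      also have "?this \<longleftrightarrow> integrable M (\<lambda>\<omega>. I (min t (\<rho> k \<omega>)) \<omega>)"
        by (rule Bochner_Integration.integrable_cong) (use r0 I0 in \<open>auto simp: min_absorb1\<close>)
      finally show ?thesis .
    qed
    show ?thesis
      unfolding martingale_on_def I0
    proof (intro conjI ballI allI impI)
      show "adapted T Fi (\<lambda>t \<omega>. Z \<omega> + I (min t (\<rho> k \<omega>)) \<omega> - (Z \<omega> + 0))"
        unfolding adapted_def using cont_adapted_meas[OF sc] Gt by (metis (no_types, lifting) add.right_neutral add_diff_cancel_left' measurable_cong)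
      show "integrable M (\<lambda>\<omega>. Z \<omega> + I (min t (\<rho> k \<omega>)) \<omega> - (Z \<omega> + 0))" if "t \<in> {0..T}" for t
        using int[of t] that by simp
      fix s t assume st: "0 \<le> s" "s \<le> t" "t \<le> T"
      have Gs: "G s = Fi s" using Gt st by simp
      interpret sub: finite_measure_subalgebra M "Fi s"
        unfolding Gs[symmetric] by unfold_locales (rule subalg_G)
      have "AE \<omega> in M. real_cond_exp M (Fi s) (\<lambda>\<omega>. I (min t (\<rho> k \<omega>)) \<omega>) \<omega> = I (min s (\<rho> k \<omega>)) \<omega>"
      proof (rule sub.real_cond_exp_charact)
        show "integrable M (\<lambda>\<omega>. I (min t (\<rho> k \<omega>)) \<omega>)" "integrable M (\<lambda>\<omega>. I (min s (\<rho> k \<omega>)) \<omega>)"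
          using int st by auto
        show "(\<lambda>\<omega>. I (min s (\<rho> k \<omega>)) \<omega>) \<in> borel_measurable (Fi s)" using cont_adapted_meas[OF sc, of s] Gs by simp
        fix A assume "A \<in> sets (Fi s)"
        then have A: "A \<in> sets (G s)" using Gs by simp
        have Am: "A \<in> sets M" using sets_G_M[OF A] .
        have i: "integrable M (\<lambda>\<omega>. indicator A \<omega> * I (min u (\<rho> k \<omega>)) \<omega>)" if "0 \<le> u" for u
          using integrable_mult_indicator[OF Am int[OF that]] by simp
        have "expectation (\<lambda>\<omega>. indicator A \<omega> * I (min t (\<rho> k \<omega>)) \<omega>) - expectation (\<lambda>\<omega>. indicator A \<omega> * I (min s (\<rho> k \<omega>)) \<omega>) = 0"
          using main(2)[OF st(2) A] i[of t] i[of s] st by (simp add: right_diff_distrib)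
        then show "(\<integral>\<omega>\<in>A. I (min t (\<rho> k \<omega>)) \<omega> \<partial>M) = (\<integral>\<omega>\<in>A. I (min s (\<rho> k \<omega>)) \<omega> \<partial>M)"
          by (simp add: set_lebesgue_integral_def)
      qed
      then show "AE \<omega> in M. real_cond_exp M (Fi s) (\<lambda>\<omega>. Z \<omega> + I (min t (\<rho> k \<omega>)) \<omega> - (Z \<omega> + 0)) \<omega>
           = Z \<omega> + I (min s (\<rho> k \<omega>)) \<omega> - (Z \<omega> + 0)"
        by simp
    qed
  qed
  show ?thesis
    unfolding cont_local_martingale_def local_martingale_on_def
    using cp ad s(1,2,3) mart by blast
qed

end

section \<open>Covariation estimates\<close>

lemma lebesgue_Icc:
  fixes f :: "real \<Rightarrow> real"
  assumes "continuous_on {0..t} f"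
  shows "integrable lborel (\<lambda>s. indicator {0..t} s * f s)"
    "integral {0..t} f = (\<integral>s. indicator {0..t} s * f s \<partial>lborel)"
  using borel_integrable_atLeastAtMost'[OF assms] set_borel_integral_eq_integral(2)[OF borel_integrable_atLeastAtMost'[OF assms]]
  by (simp_all add: set_integrable_def set_lebesgue_integral_def)

context filtered_space
begin

section \<open>Joint measurability and averages over shifted meshes\<close>

definition jointly_meas :: "(real \<Rightarrow> 'a \<Rightarrow> real) \<Rightarrow> bool" where
  "jointly_meas Y \<longleftrightarrow> (\<lambda>(\<omega>, s). Y s \<omega>) \<in> borel_measurable (M \<Otimes>\<^sub>M lborel)"

lemma jointly_meas_diff: "jointly_meas X \<Longrightarrow> jointly_meas Y \<Longrightarrow> jointly_meas (\<lambda>s \<omega>. X s \<omega> - Y s \<omega>)"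
  unfolding jointly_meas_def split_beta' by (rule borel_measurable_diff)

lemma jointly_meas_mult: "jointly_meas X \<Longrightarrow> jointly_meas Y \<Longrightarrow> jointly_meas (\<lambda>s \<omega>. X s \<omega> * Y s \<omega>)"
  unfolding jointly_meas_def split_beta' by (rule borel_measurable_times)

lemma jointly_meas_power: "jointly_meas X \<Longrightarrow> jointly_meas (\<lambda>s \<omega>. (X s \<omega>) ^ n)"
  unfolding jointly_meas_def split_beta' by (rule borel_measurable_power)

lemma jointly_meas_abs: "jointly_meas X \<Longrightarrow> jointly_meas (\<lambda>s \<omega>. \<bar>X s \<omega>\<bar>)"
  unfolding jointly_meas_def split_beta' by (rule borel_measurable_abs)

lemma jointly_meas_max: "jointly_meas X \<Longrightarrow> jointly_meas (\<lambda>s \<omega>. max c (X s \<omega>))"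
  unfolding jointly_meas_def split_beta' by (intro borel_measurable_max borel_measurable_const)

lemma jointly_meas_min: "jointly_meas X \<Longrightarrow> jointly_meas (\<lambda>s \<omega>. min c (X s \<omega>))"
  unfolding jointly_meas_def split_beta' by (intro borel_measurable_min borel_measurable_const)

lemma jointly_meas_rv: "f \<in> borel_measurable M \<Longrightarrow> jointly_meas (\<lambda>s \<omega>. f \<omega>)"
  unfolding jointly_meas_def split_beta' by (rule measurable_compose[OF measurable_fst])

lemma jointly_meas_time: "g \<in> borel_measurable lborel \<Longrightarrow> jointly_meas (\<lambda>s \<omega>. g s)"
  unfolding jointly_meas_def split_beta' by (rule measurable_compose[OF measurable_snd])

lemma jointly_meas_shift: "jointly_meas X \<Longrightarrow> jointly_meas (\<lambda>s. X (s + c))"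
proof -
  assume "jointly_meas X"
  then have X: "(\<lambda>(\<omega>, s). X s \<omega>) \<in> borel_measurable (M \<Otimes>\<^sub>M lborel)" by (simp add: jointly_meas_def)
  have "(\<lambda>x. (fst x, snd x + c)) \<in> M \<Otimes>\<^sub>M lborel \<rightarrow>\<^sub>M M \<Otimes>\<^sub>M lborel" by measurable
  from measurable_compose[OF this X] show ?thesis unfolding jointly_meas_def by (simp add: split_beta')
qed

lemma jointly_meas_sum: "(\<And>i. i \<in> A \<Longrightarrow> jointly_meas (X i)) \<Longrightarrow> jointly_meas (\<lambda>s \<omega>. \<Sum>i\<in>A. X i s \<omega>)"
  unfolding jointly_meas_def split_beta' by (rule borel_measurable_sum)

text \<open>Rounding the time down to a grid gives functions assembled from countably many time
  slices, and these converge along each continuous path.\<close>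

lemma jointly_meas_cont:
  assumes m: "\<And>s. Y s \<in> borel_measurable M" and c: "\<And>\<omega>. \<omega> \<in> space M \<Longrightarrow> continuous_on UNIV (\<lambda>s. Y s \<omega>)"
  shows "jointly_meas Y"
  unfolding jointly_meas_def split_beta'
proof (rule borel_measurable_LIMSEQ_real)
  let ?f = "\<lambda>n (x :: 'a \<times> real). real_of_int \<lfloor>real (Suc n) * snd x\<rfloor> / real (Suc n)"
  show "(\<lambda>x. Y (?f n x) (fst x)) \<in> borel_measurable (M \<Otimes>\<^sub>M lborel)" for n
  proof (rule measurable_compose_countable[where g = "\<lambda>x. \<lfloor>real (Suc n) * snd x\<rfloor>"
        and f = "\<lambda>i x. Y (real_of_int i / real (Suc n)) (fst x)"])
    show "(\<lambda>x. Y (real_of_int i / real (Suc n)) (fst x)) \<in> borel_measurable (M \<Otimes>\<^sub>M lborel)" for i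
      by (rule measurable_compose[OF measurable_fst m])
    show "(\<lambda>x. \<lfloor>real (Suc n) * snd x\<rfloor>) \<in> M \<Otimes>\<^sub>M lborel \<rightarrow>\<^sub>M count_space UNIV" by measurable
  qed
  fix x :: "'a \<times> real" assume x: "x \<in> space (M \<Otimes>\<^sub>M lborel)"
  then have w: "fst x \<in> space M" by (auto simp: space_pair_measure)
  have "(\<lambda>n. ?f n x) \<longlonglongrightarrow> snd x" by (rule floor_approx)
  moreover have "isCont (\<lambda>s. Y s (fst x)) (snd x)"
    using c[OF w] by (simp add: continuous_on_eq_continuous_at)
  ultimately show "(\<lambda>n. Y (?f n x) (fst x)) \<longlonglongrightarrow> Y (snd x) (fst x)"
    by (rule isCont_tendsto_compose[rotated])
qed

lemma jointly_meas_cproc: "cont_adapted Y \<Longrightarrow> jointly_meas Y"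
  by (rule jointly_meas_cont[OF cont_adapted_meas_M cont_adapted_cont])

lemma jointly_meas_section: "jointly_meas Y \<Longrightarrow> \<omega> \<in> space M \<Longrightarrow> (\<lambda>s. Y s \<omega>) \<in> borel_measurable lborel"
  unfolding jointly_meas_def using measurable_compose[OF measurable_Pair1'[of \<omega> M lborel]] by fastforce

lemma jointly_meas_time_section: "jointly_meas Y \<Longrightarrow> Y s \<in> borel_measurable M"
proof -
  assume "jointly_meas Y"
  then have "(\<lambda>(\<omega>, s). Y s \<omega>) \<in> borel_measurable (M \<Otimes>\<^sub>M lborel)" by (simp add: jointly_meas_def)
  from measurable_compose[OF measurable_Pair2'[of s lborel M] this] show ?thesis by simp
qed

lemma jointly_meas_integral: "jointly_meas Y \<Longrightarrow> (\<lambda>\<omega>. \<integral>s. Y s \<omega> \<partial>lborel) \<in> borel_measurable M"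
  unfolding jointly_meas_def by (rule lborel.borel_measurable_lebesgue_integral)

lemma jointly_meas_Fubini:
  assumes "jointly_meas Y"
  shows "(\<integral>\<^sup>+\<omega>. \<integral>\<^sup>+s. ennreal (Y s \<omega>) \<partial>lborel \<partial>M) = (\<integral>\<^sup>+s. \<integral>\<^sup>+\<omega>. ennreal (Y s \<omega>) \<partial>M \<partial>lborel)"
proof -
  interpret P: pair_sigma_finite M lborel by unfold_locales
  have "(\<lambda>(\<omega>, s). ennreal (Y s \<omega>)) \<in> borel_measurable (M \<Otimes>\<^sub>M lborel)"
    using assms unfolding jointly_meas_def split_beta' by measurable
  from P.Fubini'[OF this] show ?thesis by simp
qed

lemma markov_abs:
  assumes "integrable M f" "expectation (\<lambda>\<omega>. \<bar>f \<omega>\<bar>) \<le> c" "a > (0::real)"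
  shows "prob {\<omega>\<in>space M. a < \<bar>f \<omega>\<bar>} \<le> c / a"
proof -
  have [measurable]: "f \<in> borel_measurable M" using assms by auto
  have "prob {\<omega>\<in>space M. a < \<bar>f \<omega>\<bar>} \<le> prob {\<omega>\<in>space M. a \<le> \<bar>f \<omega>\<bar>}"
    by (rule finite_measure_mono) auto
  also have "\<dots> \<le> expectation (\<lambda>\<omega>. \<bar>f \<omega>\<bar>) / a"
    by (rule integral_Markov_inequality_measure[where A = "space M"]) (use assms in auto)
  also have "\<dots> \<le> c / a" using assms by (simp add: divide_right_mono)
  finally show ?thesis .
qed

text \<open>Splitting \<open>[0, n\<epsilon>)\<close> into blocks of length \<open>\<epsilon>\<close> and exchanging sum and integral turns a time
  integral of \<open>\<epsilon>\<close>-increments into an average of sums over non-overlapping increments.\<close>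
lemma block_bound:
  assumes jointly_meas: "jointly_meas \<phi>" and B: "\<And>s \<omega>. \<omega> \<in> space M \<Longrightarrow> \<bar>\<phi> s \<omega>\<bar> \<le> B"
    and supp: "\<And>s \<omega>. s \<notin> {0..b} \<Longrightarrow> \<phi> s \<omega> = 0" and e: "\<epsilon> > 0"
    and C: "\<And>n u. expectation (\<lambda>\<omega>. \<bar>\<Sum>k<n. \<phi> (u + real k * \<epsilon>) \<omega>\<bar>) \<le> C"
  shows "integrable M (\<lambda>\<omega>. \<integral>s. \<phi> s \<omega> \<partial>lborel)" "expectation (\<lambda>\<omega>. \<bar>\<integral>s. \<phi> s \<omega> \<partial>lborel\<bar>) \<le> C * \<epsilon>"
proof -
  have int: "integrable lborel (\<lambda>s. \<phi> s \<omega>)" if w: "\<omega> \<in> space M" for \<omega>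
  proof -
    have "integrable lborel (\<lambda>s. indicator {0..b} s *\<^sub>R \<phi> s \<omega>)"
      by (rule integrableI_bounded_set_indicator[where B = B]) (use jointly_meas_section[OF jointly_meas w] B[OF w] in \<open>auto simp: emeasure_lborel_Icc_eq\<close>)
    moreover have "(\<lambda>s. indicator {0..b} s *\<^sub>R \<phi> s \<omega>) = (\<lambda>s. \<phi> s \<omega>)"
    proof (rule ext)
      show "indicator {0..b} s *\<^sub>R \<phi> s \<omega> = \<phi> s \<omega>" for s
        using supp[of s \<omega>] by (cases "s \<in> {0..b}") auto
    qed
    ultimately show ?thesis by simp
  qed
  \<comment> \<open>These \<open>n\<close> blocks reach strictly beyond \<open>b\<close>, so the
    half-open blocks cover the closed support.\<close>
  define n where "n = Suc (nat \<lceil>b / \<epsilon>\<rceil>)"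
  have nb: "b < real n * \<epsilon>"
  proof -
    have "b / \<epsilon> < real n" unfolding n_def by linarith
    then show ?thesis using e by (simp add: pos_divide_less_eq)
  qed
  \<comment> \<open>\<open>u\<close> is the offset of the mesh. The bound \<open>C\<close> holds for
    every offset, and the offsets fill an interval of length \<epsilon>.\<close>
  define \<psi> where "\<psi> u \<omega> = indicator {0..<\<epsilon>} u * (\<Sum>k<n. \<phi> (u + real k * \<epsilon>) \<omega>)" for u \<omega>
  have jmp: "jointly_meas \<psi>" unfolding \<psi>_def by (intro jointly_meas_mult jointly_meas_time jointly_meas_sum jointly_meas_shift jointly_meas) measurable
  have split: "integrable lborel (\<lambda>u. \<psi> u \<omega>) \<and> (\<integral>s. \<phi> s \<omega> \<partial>lborel) = (\<integral>u. \<psi> u \<omega> \<partial>lborel)" if w: "\<omega> \<in> space M" for \<omega>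
  proof -
    have i1: "integrable lborel (\<lambda>s. indicator {a..<c} s * \<phi> s \<omega>)" for a c
      using integrable_mult_indicator[OF _ int[OF w], of "{a..<c}"] by simp
    have sh: "integrable lborel (\<lambda>u. indicator {0..<\<epsilon>} u * \<phi> (u + real k * \<epsilon>) \<omega>) \<and>
       (\<integral>s. indicator {real k * \<epsilon>..<real (Suc k) * \<epsilon>} s * \<phi> s \<omega> \<partial>lborel) = (\<integral>u. indicator {0..<\<epsilon>} u * \<phi> (u + real k * \<epsilon>) \<omega> \<partial>lborel)" for k
    proof -
      let ?g = "\<lambda>s. indicator {real k * \<epsilon>..<real (Suc k) * \<epsilon>} s * \<phi> s \<omega>"
      have eq: "?g (real k * \<epsilon> + 1 * u) = indicator {0..<\<epsilon>} u * \<phi> (u + real k * \<epsilon>) \<omega>" for u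
        by (auto simp: indicator_def algebra_simps)
      have "integrable lborel (\<lambda>u. ?g (real k * \<epsilon> + 1 * u))"
        by (rule lborel_integrable_real_affine[OF i1]) simp
      moreover have "(\<integral>s. ?g s \<partial>lborel) = \<bar>1\<bar> *\<^sub>R (\<integral>u. ?g (real k * \<epsilon> + 1 * u) \<partial>lborel)"
        by (rule lborel_integral_real_affine) simp
      ultimately show ?thesis unfolding eq by simp
    qed
    have "(\<integral>s. indicator {0..<real m * \<epsilon>} s * \<phi> s \<omega> \<partial>lborel) =
       (\<Sum>k<m. \<integral>u. indicator {0..<\<epsilon>} u * \<phi> (u + real k * \<epsilon>) \<omega> \<partial>lborel)" for m
    proof (induction m)
      case (Suc m)
      have "indicator {0..<real (Suc m) * \<epsilon>} s * \<phi> s \<omega> =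
         indicator {0..<real m * \<epsilon>} s * \<phi> s \<omega> + indicator {real m * \<epsilon>..<real (Suc m) * \<epsilon>} s * \<phi> s \<omega>" for s
      proof -
        have "0 \<le> real m * \<epsilon>" "real m * \<epsilon> \<le> real (Suc m) * \<epsilon>" using e by (auto simp: algebra_simps)
        then show ?thesis by (auto simp: indicator_def)
      qed
      then have "(\<integral>s. indicator {0..<real (Suc m) * \<epsilon>} s * \<phi> s \<omega> \<partial>lborel) =
         (\<integral>s. indicator {0..<real m * \<epsilon>} s * \<phi> s \<omega> \<partial>lborel) + (\<integral>s. indicator {real m * \<epsilon>..<real (Suc m) * \<epsilon>} s * \<phi> s \<omega> \<partial>lborel)"
        using i1 by (simp del: of_nat_Suc)
      then show ?case using Suc sh[of m] by (simp del: of_nat_Suc)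
    qed simp
    from this[of n] have "(\<integral>s. indicator {0..<real n * \<epsilon>} s * \<phi> s \<omega> \<partial>lborel) = (\<Sum>k<n. \<integral>u. indicator {0..<\<epsilon>} u * \<phi> (u + real k * \<epsilon>) \<omega> \<partial>lborel)" .
    also have "\<dots> = (\<integral>u. \<psi> u \<omega> \<partial>lborel)"
      unfolding \<psi>_def sum_distrib_left using sh by (intro Bochner_Integration.integral_sum[symmetric]) auto
    finally have "(\<integral>s. indicator {0..<real n * \<epsilon>} s * \<phi> s \<omega> \<partial>lborel) = (\<integral>u. \<psi> u \<omega> \<partial>lborel)" .
    moreover have "(\<lambda>s. indicator {0..<real n * \<epsilon>} s * \<phi> s \<omega>) = (\<lambda>s. \<phi> s \<omega>)"
    proof (rule ext)
      fix s
      show "indicator {0..<real n * \<epsilon>} s * \<phi> s \<omega> = \<phi> s \<omega>"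
        using supp[of s \<omega>] nb by (cases "s \<in> {0..b}") (auto simp: indicator_def)
    qed
    moreover have "integrable lborel (\<lambda>u. \<psi> u \<omega>)"
      unfolding \<psi>_def sum_distrib_left using sh by (intro Bochner_Integration.integrable_sum) auto
    ultimately show ?thesis by simp
  qed
  have "(\<integral>\<^sup>+\<omega>. ennreal \<bar>\<integral>s. \<phi> s \<omega> \<partial>lborel\<bar> \<partial>M) \<le> (\<integral>\<^sup>+\<omega>. \<integral>\<^sup>+u. ennreal \<bar>\<psi> u \<omega>\<bar> \<partial>lborel \<partial>M)"
  proof (rule nn_integral_mono)
    fix \<omega> assume w: "\<omega> \<in> space M"
    show "ennreal \<bar>\<integral>s. \<phi> s \<omega> \<partial>lborel\<bar> \<le> (\<integral>\<^sup>+u. ennreal \<bar>\<psi> u \<omega>\<bar> \<partial>lborel)"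
      using integral_norm_bound_ennreal[OF conjunct1[OF split[OF w]]] split[OF w] by simp
  qed
  also have "\<dots> = (\<integral>\<^sup>+u. \<integral>\<^sup>+\<omega>. ennreal \<bar>\<psi> u \<omega>\<bar> \<partial>M \<partial>lborel)" by (rule jointly_meas_Fubini[OF jointly_meas_abs[OF jmp]])
  also have "\<dots> \<le> (\<integral>\<^sup>+u. ennreal C * indicator {0..<\<epsilon>} u \<partial>lborel)"
  proof (rule nn_integral_mono)
    fix u :: real
    show "(\<integral>\<^sup>+\<omega>. ennreal \<bar>\<psi> u \<omega>\<bar> \<partial>M) \<le> ennreal C * indicator {0..<\<epsilon>} u"
    proof (cases "u \<in> {0..<\<epsilon>}")
      case True
      have i: "integrable M (\<lambda>\<omega>. \<bar>\<Sum>k<n. \<phi> (u + real k * \<epsilon>) \<omega>\<bar>)"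
        by (intro integrable_abs Bochner_Integration.integrable_sum integrable_bdd[OF jointly_meas_time_section[OF jointly_meas] B])
      have "(\<integral>\<^sup>+\<omega>. ennreal \<bar>\<psi> u \<omega>\<bar> \<partial>M) = (\<integral>\<^sup>+\<omega>. ennreal \<bar>\<Sum>k<n. \<phi> (u + real k * \<epsilon>) \<omega>\<bar> \<partial>M)"
        using True by (simp add: \<psi>_def)
      also have "\<dots> = ennreal (expectation (\<lambda>\<omega>. \<bar>\<Sum>k<n. \<phi> (u + real k * \<epsilon>) \<omega>\<bar>))"
        by (rule nn_integral_eq_integral[OF i]) simp
      also have "\<dots> \<le> ennreal C" by (rule ennreal_leI[OF C])
      finally show ?thesis using True by simp
    qed (simp add: \<psi>_def)
  qed
  also have "\<dots> = ennreal C * ennreal \<epsilon>" using e by (simp add: nn_integral_cmult_indicator)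
  also have "\<dots> = ennreal (C * \<epsilon>)" using e by (simp add: ennreal_mult'')
  finally have nn: "(\<integral>\<^sup>+\<omega>. ennreal \<bar>\<integral>s. \<phi> s \<omega> \<partial>lborel\<bar> \<partial>M) \<le> ennreal (C * \<epsilon>)" .
  have m: "(\<lambda>\<omega>. \<integral>s. \<phi> s \<omega> \<partial>lborel) \<in> borel_measurable M" by (rule jointly_meas_integral[OF jointly_meas])
  show i: "integrable M (\<lambda>\<omega>. \<integral>s. \<phi> s \<omega> \<partial>lborel)"
    by (rule integrableI_bounded[OF m]) (use nn in \<open>auto intro: le_less_trans\<close>)
  have "ennreal (expectation (\<lambda>\<omega>. \<bar>\<integral>s. \<phi> s \<omega> \<partial>lborel\<bar>)) \<le> ennreal (C * \<epsilon>)"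
    using nn by (subst (asm) nn_integral_eq_integral) (use i in auto)
  moreover have "0 \<le> C" using C[of 0 0] by simp
  ultimately show "expectation (\<lambda>\<omega>. \<bar>\<integral>s. \<phi> s \<omega> \<partial>lborel\<bar>) \<le> C * \<epsilon>"
    using e by (subst (asm) ennreal_le_iff) auto
qed

text \<open>Increments over successive cells are orthogonal, so their second moments add up to that
  of the total increment, whatever the number of cells.\<close>

lemma bdd_mart_sum_squares:
  fixes r :: "nat \<Rightarrow> real"
  assumes L: "bdd_mart L" and C: "\<And>s t \<omega>. \<omega> \<in> space M \<Longrightarrow> \<bar>L t \<omega> - L s \<omega>\<bar> \<le> C"
    and r: "\<And>i. r i \<le> r (Suc i)"
  shows "expectation (\<lambda>\<omega>. \<Sum>i<n. (L (r (Suc i)) \<omega> - L (r i) \<omega>)\<^sup>2) \<le> C\<^sup>2"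
proof -
  note [measurable] = bdd_mart_meas_M[OF L]
  have int: "integrable M (\<lambda>\<omega>. (L x \<omega> - L y \<omega>)\<^sup>2)" for x y
    by (rule bdd_mart_incr_square(1)[OF L C])
  have "(\<Sum>i<n. expectation (\<lambda>\<omega>. (L (r (Suc i)) \<omega> - L (r i) \<omega>)\<^sup>2)) = expectation (\<lambda>\<omega>. (L (r n) \<omega> - L (r 0) \<omega>)\<^sup>2)"
  proof (induction n)
    case (Suc n)
    have "r 0 \<le> r n" using mono_upto[of n r 0] r by auto
    then have "expectation (\<lambda>\<omega>. (L (r (Suc n)) \<omega> - L (r 0) \<omega>)\<^sup>2) =
       expectation (\<lambda>\<omega>. (L (r n) \<omega> - L (r 0) \<omega>)\<^sup>2) + expectation (\<lambda>\<omega>. (L (r (Suc n)) \<omega> - L (r n) \<omega>)\<^sup>2)"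
      using bdd_mart_split_at[OF L, of "r (Suc n)" "r 0" "r n"] r[of n] by (simp add: min_absorb1 max_absorb1 min_absorb2 max_absorb2)
    then show ?case using Suc by simp
  qed simp
  also have "\<dots> \<le> C\<^sup>2" by (rule bdd_mart_incr_square(2)[OF L C])
  finally show ?thesis using int by simp
qed

text \<open>The energy of the \<epsilon>-increments is of order \<epsilon>, the role usually played
  by the expected bracket. The third form has the expectation inside the time integral, ready to be
  combined with estimates at each fixed time.\<close>

lemma bdd_mart_energy:
  assumes L: "bdd_mart L" and C: "\<And>s t \<omega>. \<omega> \<in> space M \<Longrightarrow> \<bar>L t \<omega> - L s \<omega>\<bar> \<le> C" and e: "\<epsilon> > 0"
  shows "integrable M (\<lambda>\<omega>. integral {0..T} (\<lambda>s. (L (s + \<epsilon>) \<omega> - L s \<omega>)\<^sup>2))"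
    "expectation (\<lambda>\<omega>. \<bar>integral {0..T} (\<lambda>s. (L (s + \<epsilon>) \<omega> - L s \<omega>)\<^sup>2)\<bar>) \<le> C\<^sup>2 * \<epsilon>"
    "(\<integral>\<^sup>+s. ennreal (indicator {0..T} s * expectation (\<lambda>\<omega>. (L (s + \<epsilon>) \<omega> - L s \<omega>)\<^sup>2)) \<partial>lborel) \<le> ennreal (C\<^sup>2 * \<epsilon>)"
proof -
  note [measurable] = bdd_mart_meas_M[OF L]
  note Lc = bdd_mart_cproc[OF L]
  have cont: "continuous_on A (\<lambda>s. (L (s + \<epsilon>) \<omega> - L s \<omega>)\<^sup>2)" if "\<omega> \<in> space M" for A \<omega>
    by (intro continuous_on_power continuous_on_diff cont_adapted_cont[OF Lc that]
        continuous_on_compose2[OF cont_adapted_cont[OF Lc that, of UNIV], of A "\<lambda>s. s + \<epsilon>"] continuous_on_add continuous_on_id continuous_on_const) auto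
  define \<phi> where "\<phi> s \<omega> = indicator {0..T} s * (L (s + \<epsilon>) \<omega> - L s \<omega>)\<^sup>2" for s \<omega>
  have jointly_meas: "jointly_meas \<phi>" unfolding \<phi>_def
    by (intro jointly_meas_mult jointly_meas_time jointly_meas_power jointly_meas_diff jointly_meas_shift jointly_meas_cproc[OF Lc]) measurable
  have eq: "integral {0..T} (\<lambda>s. (L (s + \<epsilon>) \<omega> - L s \<omega>)\<^sup>2) = (\<integral>s. \<phi> s \<omega> \<partial>lborel)" if "\<omega> \<in> space M" for \<omega>
    unfolding \<phi>_def by (rule lebesgue_Icc(2)[OF cont[OF that]])
  have sqb: "(L t \<omega> - L s \<omega>)\<^sup>2 \<le> C\<^sup>2" if "\<omega> \<in> space M" for s t \<omega>
    using C[OF that] by (metis abs_ge_zero power2_abs power_mono)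
  have B: "\<bar>\<phi> s \<omega>\<bar> \<le> C\<^sup>2" if "\<omega> \<in> space M" for s \<omega>
    using sqb[OF that, of "s + \<epsilon>" s] by (simp add: \<phi>_def indicator_def)
  have "expectation (\<lambda>\<omega>. \<bar>\<Sum>k<n. \<phi> (u + real k * \<epsilon>) \<omega>\<bar>) \<le> C\<^sup>2" for n u
  proof -
    define r where "r k = u + real k * \<epsilon>" for k
    have rS: "r (Suc k) = r k + \<epsilon>" for k by (simp add: r_def algebra_simps)
    have "expectation (\<lambda>\<omega>. \<bar>\<Sum>k<n. \<phi> (r k) \<omega>\<bar>) \<le> expectation (\<lambda>\<omega>. \<Sum>i<n. (L (r (Suc i)) \<omega> - L (r i) \<omega>)\<^sup>2)"
    proof (rule integral_mono)
      show "integrable M (\<lambda>\<omega>. \<bar>\<Sum>k<n. \<phi> (r k) \<omega>\<bar>)"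
        by (intro integrable_abs Bochner_Integration.integrable_sum integrable_bdd[OF jointly_meas_time_section[OF jointly_meas] B])
      show "integrable M (\<lambda>\<omega>. \<Sum>i<n. (L (r (Suc i)) \<omega> - L (r i) \<omega>)\<^sup>2)"
        unfolding power2_eq_square
        by (intro Bochner_Integration.integrable_sum integrable_bdd_mult[of _ C _ C]) (use C in auto)
      fix \<omega>
      have "\<bar>\<Sum>k<n. \<phi> (r k) \<omega>\<bar> \<le> (\<Sum>k<n. \<bar>\<phi> (r k) \<omega>\<bar>)" by (rule sum_abs)
      also have "\<dots> \<le> (\<Sum>i<n. (L (r (Suc i)) \<omega> - L (r i) \<omega>)\<^sup>2)"
        by (rule sum_mono) (simp add: \<phi>_def indicator_def rS)
      finally show "\<bar>\<Sum>k<n. \<phi> (r k) \<omega>\<bar> \<le> (\<Sum>i<n. (L (r (Suc i)) \<omega> - L (r i) \<omega>)\<^sup>2)" .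
    qed
    also have "\<dots> \<le> C\<^sup>2" by (rule bdd_mart_sum_squares[OF L C]) (use e in \<open>auto simp: rS\<close>)
    finally show ?thesis by (simp add: r_def)
  qed
  note bb = block_bound[OF jointly_meas B _ e this, of T]
  have i: "integrable M (\<lambda>\<omega>. \<integral>s. \<phi> s \<omega> \<partial>lborel)" and b: "expectation (\<lambda>\<omega>. \<bar>\<integral>s. \<phi> s \<omega> \<partial>lborel\<bar>) \<le> C\<^sup>2 * \<epsilon>"
    using bb by (auto simp: \<phi>_def)
  have "integrable M (\<lambda>\<omega>. integral {0..T} (\<lambda>s. (L (s + \<epsilon>) \<omega> - L s \<omega>)\<^sup>2)) \<longleftrightarrow> integrable M (\<lambda>\<omega>. \<integral>s. \<phi> s \<omega> \<partial>lborel)"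
    by (rule Bochner_Integration.integrable_cong) (simp_all add: eq)
  then show "integrable M (\<lambda>\<omega>. integral {0..T} (\<lambda>s. (L (s + \<epsilon>) \<omega> - L s \<omega>)\<^sup>2))" using i by simp
  have "expectation (\<lambda>\<omega>. \<bar>integral {0..T} (\<lambda>s. (L (s + \<epsilon>) \<omega> - L s \<omega>)\<^sup>2)\<bar>) = expectation (\<lambda>\<omega>. \<bar>\<integral>s. \<phi> s \<omega> \<partial>lborel\<bar>)"
    by (rule Bochner_Integration.integral_cong) (simp_all add: eq)
  then show "expectation (\<lambda>\<omega>. \<bar>integral {0..T} (\<lambda>s. (L (s + \<epsilon>) \<omega> - L s \<omega>)\<^sup>2)\<bar>) \<le> C\<^sup>2 * \<epsilon>" using b by simp
  have pos: "0 \<le> \<phi> s \<omega>" for s \<omega> by (simp add: \<phi>_def)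
  have intp: "integrable lborel (\<lambda>s. \<phi> s \<omega>)" if "\<omega> \<in> space M" for \<omega>
    unfolding \<phi>_def by (rule lebesgue_Icc(1)[OF cont[OF that]])
  have "(\<integral>\<^sup>+s. ennreal (indicator {0..T} s * expectation (\<lambda>\<omega>. (L (s + \<epsilon>) \<omega> - L s \<omega>)\<^sup>2)) \<partial>lborel) = (\<integral>\<^sup>+s. \<integral>\<^sup>+\<omega>. ennreal (\<phi> s \<omega>) \<partial>M \<partial>lborel)"
  proof (rule nn_integral_cong)
    fix s
    have "(\<integral>\<^sup>+\<omega>. ennreal (\<phi> s \<omega>) \<partial>M) = ennreal (expectation (\<phi> s))"
      by (rule nn_integral_eq_integral[OF integrable_bdd[OF jointly_meas_time_section[OF jointly_meas] B]]) (use pos in auto)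
    also have "expectation (\<phi> s) = indicator {0..T} s * expectation (\<lambda>\<omega>. (L (s + \<epsilon>) \<omega> - L s \<omega>)\<^sup>2)"
      unfolding \<phi>_def[abs_def] by (rule integral_mult_right_zero)
    finally show "ennreal (indicator {0..T} s * expectation (\<lambda>\<omega>. (L (s + \<epsilon>) \<omega> - L s \<omega>)\<^sup>2)) = (\<integral>\<^sup>+\<omega>. ennreal (\<phi> s \<omega>) \<partial>M)"
      by simp
  qed
  also have "\<dots> = (\<integral>\<^sup>+\<omega>. \<integral>\<^sup>+s. ennreal (\<phi> s \<omega>) \<partial>lborel \<partial>M)" by (rule jointly_meas_Fubini[OF jointly_meas, symmetric])
  also have "\<dots> = (\<integral>\<^sup>+\<omega>. ennreal \<bar>\<integral>s. \<phi> s \<omega> \<partial>lborel\<bar> \<partial>M)"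
  proof (rule nn_integral_cong)
    fix \<omega> assume w: "\<omega> \<in> space M"
    have "0 \<le> (\<integral>s. \<phi> s \<omega> \<partial>lborel)" using pos by simp
    then show "(\<integral>\<^sup>+s. ennreal (\<phi> s \<omega>) \<partial>lborel) = ennreal \<bar>\<integral>s. \<phi> s \<omega> \<partial>lborel\<bar>"
      using nn_integral_eq_integral[OF intp[OF w]] pos by simp
  qed
  also have "\<dots> = ennreal (expectation (\<lambda>\<omega>. \<bar>\<integral>s. \<phi> s \<omega> \<partial>lborel\<bar>))"
    by (rule nn_integral_eq_integral) (use i in auto)
  also have "\<dots> \<le> ennreal (C\<^sup>2 * \<epsilon>)" by (rule ennreal_leI[OF b])
  finally show "(\<integral>\<^sup>+s. ennreal (indicator {0..T} s * expectation (\<lambda>\<omega>. (L (s + \<epsilon>) \<omega> - L s \<omega>)\<^sup>2)) \<partial>lborel) \<le> ennreal (C\<^sup>2 * \<epsilon>)" .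
qed

section \<open>Smallness and tightness in probability\<close>

definition smallP :: "(real \<Rightarrow> 'a \<Rightarrow> real) \<Rightarrow> bool" where
  "smallP f \<longleftrightarrow> (\<forall>\<delta>>0. \<forall>\<gamma>>0. \<forall>\<^sub>F e in at_right 0. \<exists>B\<in>sets M. prob B \<le> \<gamma> \<and> (\<forall>\<omega>\<in>space M - B. \<bar>f e \<omega>\<bar> \<le> \<delta>))"

text \<open>\<open>smallP\<close> is o_P(1) and \<open>tightP\<close> is O_P(1) as \<open>e\<close>
  decreases to 0. Both name an exceptional event instead of measuring a deviation set, so estimates
  are made pathwise off \<open>B\<close> without asking whether \<open>f e\<close> is
  measurable.\<close>

definition tightP :: "(real \<Rightarrow> 'a \<Rightarrow> real) \<Rightarrow> bool" where
  "tightP f \<longleftrightarrow> (\<forall>\<gamma>>0. \<exists>K>0. \<forall>\<^sub>F e in at_right 0. \<exists>B\<in>sets M. prob B \<le> \<gamma> \<and> (\<forall>\<omega>\<in>space M - B. \<bar>f e \<omega>\<bar> \<le> K))"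

definition unif_smallP :: "'b set \<Rightarrow> (real \<Rightarrow> 'b \<Rightarrow> 'a \<Rightarrow> real) \<Rightarrow> bool" where
  "unif_smallP S Y \<longleftrightarrow> (\<forall>\<delta>>0. \<forall>\<gamma>>0. \<forall>\<^sub>F e in at_right 0. \<exists>B\<in>sets M. prob B \<le> \<gamma> \<and>
     (\<forall>\<omega>\<in>space M - B. \<forall>b\<in>S. \<bar>Y e b \<omega>\<bar> \<le> \<delta>))"

lemma oPD: "smallP f \<Longrightarrow> \<delta> > 0 \<Longrightarrow> \<gamma> > 0 \<Longrightarrow>
    \<forall>\<^sub>F e in at_right 0. \<exists>B\<in>sets M. prob B \<le> \<gamma> \<and> (\<forall>\<omega>\<in>space M - B. \<bar>f e \<omega>\<bar> \<le> \<delta>)"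
  by (simp add: smallP_def)

lemma prob_Un2_half:
  assumes "A \<in> sets M" "B \<in> sets M" "prob A \<le> \<gamma> / 2" "prob B \<le> \<gamma> / 2"
  shows "A \<union> B \<in> sets M" "prob (A \<union> B) \<le> \<gamma>"
  using measure_Un_le[of A M B] assms by auto

lemma smallP_add:
  assumes "smallP f" "smallP g"
  shows "smallP (\<lambda>e \<omega>. f e \<omega> + g e \<omega>)"
  unfolding smallP_def
proof (intro allI impI)
  fix \<delta> \<gamma> :: real assume "\<delta> > 0" "\<gamma> > 0"
  then have h: "\<delta> / 2 > 0" "\<gamma> / 2 > 0" by auto
  show "\<forall>\<^sub>F e in at_right 0. \<exists>B\<in>sets M. prob B \<le> \<gamma> \<and> (\<forall>\<omega>\<in>space M - B. \<bar>f e \<omega> + g e \<omega>\<bar> \<le> \<delta>)"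
    using oPD[OF assms(1) h] oPD[OF assms(2) h]
  proof eventually_elim
    case (elim e)
    then obtain A B where A: "A \<in> sets M" "prob A \<le> \<gamma> / 2" "\<forall>\<omega>\<in>space M - A. \<bar>f e \<omega>\<bar> \<le> \<delta> / 2"
      and B: "B \<in> sets M" "prob B \<le> \<gamma> / 2" "\<forall>\<omega>\<in>space M - B. \<bar>g e \<omega>\<bar> \<le> \<delta> / 2" by blast
    have "\<bar>f e \<omega> + g e \<omega>\<bar> \<le> \<delta>" if "\<omega> \<in> space M - (A \<union> B)" for \<omega>
      using A(3)[rule_format, of \<omega>] B(3)[rule_format, of \<omega>] that by auto
    then show ?case using prob_Un2_half[OF A(1) B(1) A(2) B(2)] by blast
  qed
qed

lemma smallP_mono:
  assumes "smallP g" "\<forall>\<^sub>F e in at_right 0. \<forall>\<omega>\<in>space M. \<bar>f e \<omega>\<bar> \<le> \<bar>g e \<omega>\<bar>"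
  shows "smallP f"
  unfolding smallP_def
proof (intro allI impI)
  fix \<delta> \<gamma> :: real assume h: "\<delta> > 0" "\<gamma> > 0"
  show "\<forall>\<^sub>F e in at_right 0. \<exists>B\<in>sets M. prob B \<le> \<gamma> \<and> (\<forall>\<omega>\<in>space M - B. \<bar>f e \<omega>\<bar> \<le> \<delta>)"
    using oPD[OF assms(1) h] assms(2)
  proof eventually_elim
    case (elim e)
    then show ?case by (meson DiffD1 order_trans)
  qed
qed

lemma smallP_sum: "finite A \<Longrightarrow> (\<And>i. i \<in> A \<Longrightarrow> smallP (f i)) \<Longrightarrow> smallP (\<lambda>e \<omega>. \<Sum>i\<in>A. f i e \<omega>)"
proof (induction A rule: finite_induct)
  case empty
  have "smallP (\<lambda>e \<omega>. 0)" unfolding smallP_def by (auto intro!: always_eventually bexI[of _ "{}"])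
  then show ?case by simp
next
  case (insert x F)
  then show ?case using smallP_add[of "f x" "\<lambda>e \<omega>. \<Sum>i\<in>F. f i e \<omega>"] by simp
qed

lemma smallP_mult_tight:
  assumes "smallP f" "tightP g"
  shows "smallP (\<lambda>e \<omega>. f e \<omega> * g e \<omega>)"
  unfolding smallP_def
proof (intro allI impI)
  fix \<delta> \<gamma> :: real assume h: "\<delta> > 0" "\<gamma> > 0"
  then have g2: "\<gamma> / 2 > 0" by simp
  obtain K where K: "K > 0" "\<forall>\<^sub>F e in at_right 0. \<exists>B\<in>sets M. prob B \<le> \<gamma> / 2 \<and> (\<forall>\<omega>\<in>space M - B. \<bar>g e \<omega>\<bar> \<le> K)"
    using assms(2) g2 unfolding tightP_def by blast
  have "\<delta> / K > 0" using h K by simp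
  show "\<forall>\<^sub>F e in at_right 0. \<exists>B\<in>sets M. prob B \<le> \<gamma> \<and> (\<forall>\<omega>\<in>space M - B. \<bar>f e \<omega> * g e \<omega>\<bar> \<le> \<delta>)"
    using oPD[OF assms(1) \<open>\<delta> / K > 0\<close> g2] K(2)
  proof eventually_elim
    case (elim e)
    then obtain A B where A: "A \<in> sets M" "prob A \<le> \<gamma> / 2" "\<forall>\<omega>\<in>space M - A. \<bar>f e \<omega>\<bar> \<le> \<delta> / K"
      and B: "B \<in> sets M" "prob B \<le> \<gamma> / 2" "\<forall>\<omega>\<in>space M - B. \<bar>g e \<omega>\<bar> \<le> K" by blast
    have "\<bar>f e \<omega> * g e \<omega>\<bar> \<le> \<delta>" if "\<omega> \<in> space M - (A \<union> B)" for \<omega>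
    proof -
      have "\<bar>f e \<omega>\<bar> * \<bar>g e \<omega>\<bar> \<le> (\<delta> / K) * K"
        using A(3) B(3) that h K by (intro mult_mono) auto
      then show ?thesis using K by (simp add: abs_mult)
    qed
    then show ?case using prob_Un2_half[OF A(1) B(1) A(2) B(2)] by blast
  qed
qed

lemma tightP_add:
  assumes "tightP f" "tightP g"
  shows "tightP (\<lambda>e \<omega>. f e \<omega> + g e \<omega>)"
  unfolding tightP_def
proof (intro allI impI)
  fix \<gamma> :: real assume h: "\<gamma> > 0"
  then have g2: "\<gamma> / 2 > 0" by simp
  obtain K where K: "K > 0" "\<forall>\<^sub>F e in at_right 0. \<exists>B\<in>sets M. prob B \<le> \<gamma> / 2 \<and> (\<forall>\<omega>\<in>space M - B. \<bar>f e \<omega>\<bar> \<le> K)"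
    using assms(1) g2 unfolding tightP_def by blast
  obtain K' where K': "K' > 0" "\<forall>\<^sub>F e in at_right 0. \<exists>B\<in>sets M. prob B \<le> \<gamma> / 2 \<and> (\<forall>\<omega>\<in>space M - B. \<bar>g e \<omega>\<bar> \<le> K')"
    using assms(2) g2 unfolding tightP_def by blast
  have "\<forall>\<^sub>F e in at_right 0. \<exists>B\<in>sets M. prob B \<le> \<gamma> \<and> (\<forall>\<omega>\<in>space M - B. \<bar>f e \<omega> + g e \<omega>\<bar> \<le> K + K')"
    using K(2) K'(2)
  proof eventually_elim
    case (elim e)
    then obtain A B where A: "A \<in> sets M" "prob A \<le> \<gamma> / 2" "\<forall>\<omega>\<in>space M - A. \<bar>f e \<omega>\<bar> \<le> K"
      and B: "B \<in> sets M" "prob B \<le> \<gamma> / 2" "\<forall>\<omega>\<in>space M - B. \<bar>g e \<omega>\<bar> \<le> K'" by blast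
    have "\<bar>f e \<omega> + g e \<omega>\<bar> \<le> K + K'" if "\<omega> \<in> space M - (A \<union> B)" for \<omega>
      using A(3)[rule_format, of \<omega>] B(3)[rule_format, of \<omega>] that by auto
    then show ?case using prob_Un2_half[OF A(1) B(1) A(2) B(2)] by blast
  qed
  then show "\<exists>K>0. \<forall>\<^sub>F e in at_right 0. \<exists>B\<in>sets M. prob B \<le> \<gamma> \<and> (\<forall>\<omega>\<in>space M - B. \<bar>f e \<omega> + g e \<omega>\<bar> \<le> K)"
    using K(1) K'(1) by (intro exI[of _ "K + K'"]) auto
qed

lemma tightP_mono:
  assumes "tightP g" "\<forall>\<^sub>F e in at_right 0. \<forall>\<omega>\<in>space M. \<bar>f e \<omega>\<bar> \<le> c * \<bar>g e \<omega>\<bar>" "c > 0"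
  shows "tightP f"
  unfolding tightP_def
proof (intro allI impI)
  fix \<gamma> :: real assume h: "\<gamma> > 0"
  obtain K where K: "K > 0" "\<forall>\<^sub>F e in at_right 0. \<exists>B\<in>sets M. prob B \<le> \<gamma> \<and> (\<forall>\<omega>\<in>space M - B. \<bar>g e \<omega>\<bar> \<le> K)"
    using assms(1) h unfolding tightP_def by blast
  have "\<forall>\<^sub>F e in at_right 0. \<exists>B\<in>sets M. prob B \<le> \<gamma> \<and> (\<forall>\<omega>\<in>space M - B. \<bar>f e \<omega>\<bar> \<le> c * K)"
    using K(2) assms(2)
  proof eventually_elim
    case (elim e)
    then obtain B where B: "B \<in> sets M" "prob B \<le> \<gamma>" "\<forall>\<omega>\<in>space M - B. \<bar>g e \<omega>\<bar> \<le> K" by blast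
    have "\<bar>f e \<omega>\<bar> \<le> c * K" if "\<omega> \<in> space M - B" for \<omega>
    proof -
      have "\<bar>f e \<omega>\<bar> \<le> c * \<bar>g e \<omega>\<bar>" using elim(2) that by auto
      also have "\<dots> \<le> c * K" using B(3) that assms(3) by (intro mult_left_mono) auto
      finally show ?thesis .
    qed
    then show ?case using B by blast
  qed
  then show "\<exists>K>0. \<forall>\<^sub>F e in at_right 0. \<exists>B\<in>sets M. prob B \<le> \<gamma> \<and> (\<forall>\<omega>\<in>space M - B. \<bar>f e \<omega>\<bar> \<le> K)"
    using K(1) assms(3) by (intro exI[of _ "c * K"]) auto
qed

lemma tightP_rv:
  assumes [measurable]: "f \<in> borel_measurable M"
  shows "tightP (\<lambda>e. f)"
  unfolding tightP_def
proof (intro allI impI)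
  fix \<gamma> :: real assume h: "\<gamma> > 0"
  define A where "A n = {\<omega>\<in>space M. real n < \<bar>f \<omega>\<bar>}" for n :: nat
  have Am: "A n \<in> sets M" for n unfolding A_def by measurable
  have "(\<lambda>n. prob (A n)) \<longlonglongrightarrow> 0"
  proof (rule measure_vanish_seq[OF Am])
    show "AE \<omega> in M. \<forall>\<^sub>F n in sequentially. \<omega> \<notin> A n"
    proof (rule AE_I2)
      fix \<omega>
      obtain n0 :: nat where n0: "\<bar>f \<omega>\<bar> \<le> real n0" using real_arch_simple by blast
      then have "\<omega> \<notin> A n" if "n \<ge> n0" for n using that by (auto simp: A_def)
      then show "\<forall>\<^sub>F n in sequentially. \<omega> \<notin> A n" unfolding eventually_sequentially by blast
    qed
  qed
  then have "\<forall>\<^sub>F n in sequentially. prob (A n) < \<gamma>" using h by (rule order_tendstoD)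
  then obtain n0 where n0: "\<forall>n\<ge>n0. prob (A n) < \<gamma>" unfolding eventually_sequentially by blast
  have "\<exists>B\<in>sets M. prob B \<le> \<gamma> \<and> (\<forall>\<omega>\<in>space M - B. \<bar>f \<omega>\<bar> \<le> real (Suc n0))"
    using Am[of "Suc n0"] n0 by (intro bexI[of _ "A (Suc n0)"]) (auto simp: A_def intro: less_imp_le)
  then show "\<exists>K>0. \<forall>\<^sub>F e in at_right 0. \<exists>B\<in>sets M. prob B \<le> \<gamma> \<and> (\<forall>\<omega>\<in>space M - B. \<bar>f \<omega>\<bar> \<le> K)"
    by (intro exI[of _ "real (Suc n0)"]) auto
qed

lemma smallP_tight: "smallP f \<Longrightarrow> tightP f"
  unfolding tightP_def
proof (intro allI impI)
  fix \<gamma> :: real assume "smallP f" "\<gamma> > 0"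
  then show "\<exists>K>0. \<forall>\<^sub>F e in at_right 0. \<exists>B\<in>sets M. prob B \<le> \<gamma> \<and> (\<forall>\<omega>\<in>space M - B. \<bar>f e \<omega>\<bar> \<le> K)"
    using oPD[of f 1 \<gamma>] by (intro exI[of _ 1]) auto
qed

lemma tendsto_oP:
  assumes "tendsto_in_prob M f g"
  shows "smallP (\<lambda>e \<omega>. f e \<omega> - g \<omega>)"
  unfolding smallP_def
proof (intro allI impI)
  fix \<delta> \<gamma> :: real assume h: "\<delta> > 0" "\<gamma> > 0"
  have g [measurable]: "g \<in> borel_measurable M" and f: "\<forall>\<^sub>F e in at_right 0. f e \<in> borel_measurable M"
    and l: "((\<lambda>e. prob {\<omega>\<in>space M. \<delta> < \<bar>f e \<omega> - g \<omega>\<bar>}) \<longlongrightarrow> 0) (at_right 0)"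
    using assms h by (auto simp: tendsto_in_prob_def)
  show "\<forall>\<^sub>F e in at_right 0. \<exists>B\<in>sets M. prob B \<le> \<gamma> \<and> (\<forall>\<omega>\<in>space M - B. \<bar>f e \<omega> - g \<omega>\<bar> \<le> \<delta>)"
    using f order_tendstoD(2)[OF l h(2)]
  proof eventually_elim
    case (elim e)
    note [measurable] = elim(1)
    show ?case
      by (rule bexI[of _ "{\<omega>\<in>space M. \<delta> < \<bar>f e \<omega> - g \<omega>\<bar>}"]) (use elim in auto)
  qed
qed

lemma smallP_tendsto:
  assumes "smallP f" "\<forall>\<^sub>F e in at_right 0. f e \<in> borel_measurable M"
  shows "tendsto_in_prob M f (\<lambda>\<omega>. 0)"
  unfolding tendsto_in_prob_def
proof (intro conjI allI impI)
  fix \<delta> :: real assume d: "\<delta> > 0"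
  show "((\<lambda>e. prob {\<omega>\<in>space M. \<delta> < \<bar>f e \<omega> - 0\<bar>}) \<longlongrightarrow> 0) (at_right 0)"
  proof (rule tendstoI)
    fix \<gamma> :: real assume g: "\<gamma> > 0"
    then have "\<gamma> / 2 > 0" by simp
    from oPD[OF assms(1) d this] show "\<forall>\<^sub>F e in at_right 0. dist (prob {\<omega>\<in>space M. \<delta> < \<bar>f e \<omega> - 0\<bar>}) 0 < \<gamma>"
    proof eventually_elim
      case (elim e)
      then obtain B where B: "B \<in> sets M" "prob B \<le> \<gamma> / 2" "\<forall>\<omega>\<in>space M - B. \<bar>f e \<omega>\<bar> \<le> \<delta>" by blast
      have "{\<omega>\<in>space M. \<delta> < \<bar>f e \<omega> - 0\<bar>} \<subseteq> B" using B(3) by force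
      then have "prob {\<omega>\<in>space M. \<delta> < \<bar>f e \<omega> - 0\<bar>} \<le> prob B" by (rule finite_measure_mono[OF _ B(1)])
      then show ?case using B(2) g by (simp add: dist_real_def)
    qed
  qed
qed (use assms(2) in auto)

text \<open>Convergence along every path implies convergence in probability. Continuity in the
  parameter makes the events of a large supremum measurable.\<close>

lemma unif_smallP_pathwise:
  fixes S :: "'b::euclidean_space set"
  assumes m: "\<forall>\<^sub>F e in at_right 0. (\<forall>b\<in>S. Y e b \<in> borel_measurable M) \<and> (\<forall>\<omega>\<in>space M. continuous_on S (\<lambda>b. Y e b \<omega>))"
    and l: "\<And>\<omega> \<delta>. \<omega> \<in> space M \<Longrightarrow> \<delta> > 0 \<Longrightarrow> \<forall>\<^sub>F e in at_right 0. \<forall>b\<in>S. \<bar>Y e b \<omega>\<bar> \<le> \<delta>"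
  shows "unif_smallP S Y"
  unfolding unif_smallP_def
proof (intro allI impI)
  fix \<delta> \<gamma> :: real assume h: "\<delta> > 0" "\<gamma> > 0"
  define E where "E e = {\<omega>\<in>space M. \<exists>b\<in>S. \<delta> < \<bar>Y e b \<omega>\<bar>}" for e
  have Em: "\<forall>\<^sub>F e in at_right 0. E e \<in> sets M"
    using m
  proof eventually_elim
    case (elim e)
    then show ?case unfolding E_def
      by (intro sets_exists_gt) (auto intro!: continuous_on_rabs borel_measurable_abs)
  qed
  have "((\<lambda>e. prob (E e)) \<longlongrightarrow> 0) (at_right 0)"
  proof (rule measure_vanish_at_right[OF Em], rule AE_I2)
    fix \<omega> assume w: "\<omega> \<in> space M"
    from l[OF w h(1)] show "\<forall>\<^sub>F e in at_right 0. \<omega> \<notin> E e"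
      by eventually_elim (force simp: E_def)
  qed
  from order_tendstoD(2)[OF this h(2)] Em
  show "\<forall>\<^sub>F e in at_right 0. \<exists>B\<in>sets M. prob B \<le> \<gamma> \<and> (\<forall>\<omega>\<in>space M - B. \<forall>b\<in>S. \<bar>Y e b \<omega>\<bar> \<le> \<delta>)"
  proof eventually_elim
    case (elim e)
    then show ?case by (intro bexI[of _ "E e"]) (auto simp: E_def simp flip: not_less)
  qed
qed

section \<open>Regularised increments and approximate quadratic variation\<close>

definition incr :: "real \<Rightarrow> (real \<Rightarrow> 'a \<Rightarrow> real) \<Rightarrow> real \<Rightarrow> 'a \<Rightarrow> real" where
  "incr e Y s \<omega> = Y (s + e) \<omega> - Y s \<omega>"

lemma incr_cont: "cont_adapted Y \<Longrightarrow> \<omega> \<in> space M \<Longrightarrow> continuous_on A (\<lambda>s. incr e Y s \<omega>)"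
  unfolding incr_def
  by (intro continuous_on_diff cont_adapted_cont continuous_on_compose2[OF cont_adapted_cont[of Y \<omega> UNIV], of A "\<lambda>s. s + e"]
      continuous_on_add continuous_on_id continuous_on_const) auto

lemma incr_jm: "cont_adapted Y \<Longrightarrow> jointly_meas (incr e Y)"
  unfolding incr_def[abs_def] by (intro jointly_meas_diff jointly_meas_shift jointly_meas_cproc)

lemma cov_eps_integral:
  assumes "ext_adapted (ext_proc T X)" "ext_adapted (ext_proc T Y)" "\<omega> \<in> space M" "0 \<le> t"
  shows "cov_eps T X Y e t \<omega> = integral {0..t} (\<lambda>s. incr e (ext_proc T X) s \<omega> * incr e (ext_proc T Y) s \<omega> / e)"
proof -
  have c: "continuous_on {0..t} (\<lambda>s. incr e (ext_proc T X) s \<omega> * incr e (ext_proc T Y) s \<omega> / e)"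
    unfolding divide_inverse
    by (intro continuous_on_mult incr_cont ext_adapted_cproc assms continuous_on_const)
  have "cov_eps T X Y e t \<omega> = (LBINT s=ereal 0..ereal t. incr e (ext_proc T X) s \<omega> * incr e (ext_proc T Y) s \<omega> / e)"
    unfolding cov_eps_def incr_def zero_ereal_def ..
  also have "\<dots> = (LBINT s:{0..t}. incr e (ext_proc T X) s \<omega> * incr e (ext_proc T Y) s \<omega> / e)"
    by (rule interval_integral_Icc[OF assms(4)])
  also have "\<dots> = integral {0..t} (\<lambda>s. incr e (ext_proc T X) s \<omega> * incr e (ext_proc T Y) s \<omega> / e)"
    by (rule set_borel_integral_eq_integral(2)[OF borel_integrable_atLeastAtMost'[OF c]])
  finally show ?thesis .
qed

lemma time_integral_meas:
  assumes "jointly_meas f" "\<And>\<omega>. \<omega> \<in> space M \<Longrightarrow> continuous_on {0..t} (\<lambda>s. f s \<omega>)"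
  shows "(\<lambda>\<omega>. integral {0..t} (\<lambda>s. f s \<omega>)) \<in> borel_measurable M"
proof -
  have "jointly_meas (\<lambda>s \<omega>. indicator {0..t} s * f s \<omega>)" by (intro jointly_meas_mult jointly_meas_time assms) measurable
  from jointly_meas_integral[OF this] show ?thesis
    by (subst measurable_cong[OF lebesgue_Icc(2)[OF assms(2)]])
qed

lemma cov_eps_meas:
  assumes "ext_adapted (ext_proc T X)" "ext_adapted (ext_proc T Y)" "0 \<le> t"
  shows "cov_eps T X Y e t \<in> borel_measurable M"
proof -
  have "(\<lambda>\<omega>. integral {0..t} (\<lambda>s. incr e (ext_proc T X) s \<omega> * incr e (ext_proc T Y) s \<omega> * inverse e)) \<in> borel_measurable M"
    by (intro time_integral_meas jointly_meas_mult incr_jm ext_adapted_cproc assms jointly_meas_rv continuous_on_mult incr_cont continuous_on_const borel_measurable_const)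
  then show ?thesis
    by (subst measurable_cong[OF cov_eps_integral[OF assms(1,2) _ assms(3)]]) (simp_all add: divide_inverse)
qed

lemma Icc_integrable: "continuous_on {0..t} f \<Longrightarrow> f integrable_on {0..t::real}" for f :: "real \<Rightarrow> real"
  by (rule integrable_continuous_interval)

lemma integral_mono_upper:
  fixes f :: "real \<Rightarrow> real"
  assumes "continuous_on {0..T} f" "\<And>s. s \<in> {0..T} \<Longrightarrow> 0 \<le> f s" "t \<in> {0..T}"
  shows "0 \<le> integral {0..t} f" "integral {0..t} f \<le> integral {0..T} f"
proof -
  have i: "f integrable_on {0..t}" "f integrable_on {0..T}"
    using assms by (auto intro!: Icc_integrable intro: continuous_on_subset)
  show "0 \<le> integral {0..t} f" by (rule integral_nonneg[OF i(1)]) (use assms in auto)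
  show "integral {0..t} f \<le> integral {0..T} f"
    by (rule integral_subset_le[OF _ i]) (use assms in auto)
qed

lemma square_inc_cont: "cont_adapted Y \<Longrightarrow> \<omega> \<in> space M \<Longrightarrow> continuous_on A (\<lambda>s. (incr e Y s \<omega>)\<^sup>2)"
  by (intro continuous_on_power incr_cont)

text \<open>Taken over the whole of [0,T], it also bounds the integral over any shorter interval
  from 0. It is used through its tightness, which both finite quadratic variation and the local
  martingale property provide.\<close>

definition approx_qv :: "real \<Rightarrow> (real \<Rightarrow> 'a \<Rightarrow> real) \<Rightarrow> 'a \<Rightarrow> real" where
  "approx_qv e Y \<omega> = integral {0..T} (\<lambda>s. (incr e Y s \<omega>)\<^sup>2) / e"

text \<open>Markov's inequality for the energy of the localised martingale; the factor
  \<open>e\<close> of the energy cancels the division by \<open>e\<close>. The value of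
  \<open>K\<close> makes the cost at most \<open>\<gamma> / 2\<close>.\<close>

lemma tight_qv_martingale:
  assumes N: "cont_local_martingale M T Fi N"
  shows "tightP (\<lambda>e. approx_qv e (ext_proc T N))"
  unfolding tightP_def
proof (intro allI impI)
  fix \<gamma> :: real assume g: "\<gamma> > 0"
  then have "\<gamma> / 2 > 0" by simp
  from localize_small[OF N this] obtain L B C where L: "bdd_mart L" and B: "B \<in> sets M" "prob B \<le> \<gamma> / 2" and C: "C \<ge> 0"
    "\<And>s t \<omega>. \<omega> \<in> space M \<Longrightarrow> \<bar>L t \<omega> - L s \<omega>\<bar> \<le> C"
    and LE: "\<And>t \<omega>. \<omega> \<in> space M - B \<Longrightarrow> L t \<omega> = ext_proc T N t \<omega> - N 0 \<omega>" by blast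
  define K where "K = 2 * (C\<^sup>2 + 1) / \<gamma>"
  have C1: "C\<^sup>2 + 1 > 0" by (smt (verit) zero_le_power2)
  have K: "K > 0" using g C1 by (simp add: K_def)
  have "\<forall>\<^sub>F e in at_right 0. \<exists>B\<in>sets M. prob B \<le> \<gamma> \<and> (\<forall>\<omega>\<in>space M - B. \<bar>approx_qv e (ext_proc T N) \<omega>\<bar> \<le> K)"
    using eventually_at_right_less[of 0]
  proof eventually_elim
    case (elim e)
    note en = bdd_mart_energy[OF L C(2) elim, folded incr_def]
    define A where "A = {\<omega>\<in>space M. K * e < \<bar>integral {0..T} (\<lambda>s. (incr e L s \<omega>)\<^sup>2)\<bar>}"
    have [measurable]: "(\<lambda>\<omega>. integral {0..T} (\<lambda>s. (incr e L s \<omega>)\<^sup>2)) \<in> borel_measurable M" using en(1) by auto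
    have A: "A \<in> sets M" unfolding A_def by measurable
    have "prob A \<le> C\<^sup>2 * e / (K * e)"
      unfolding A_def by (rule markov_abs[OF en(1,2) mult_pos_pos[OF K elim]])
    also have "\<dots> = C\<^sup>2 / K" using elim by simp
    also have "\<dots> \<le> (C\<^sup>2 + 1) / K" using K by (simp add: divide_right_mono)
    also have "\<dots> = \<gamma> / 2"
    proof -
      have "x / (2 * x / \<gamma>) = \<gamma> / 2" if "x > 0" for x using that g by simp
      from this[OF C1] show ?thesis by (simp only: K_def)
    qed
    finally have pA: "prob A \<le> \<gamma> / 2" .
    have "\<bar>approx_qv e (ext_proc T N) \<omega>\<bar> \<le> K" if w: "\<omega> \<in> space M - (B \<union> A)" for \<omega>
    proof -
      have "incr e (ext_proc T N) s \<omega> = incr e L s \<omega>" for s using LE[of \<omega>] w by (simp add: incr_def)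
      then have "approx_qv e (ext_proc T N) \<omega> = integral {0..T} (\<lambda>s. (incr e L s \<omega>)\<^sup>2) / e" by (simp add: approx_qv_def)
      moreover have "\<bar>integral {0..T} (\<lambda>s. (incr e L s \<omega>)\<^sup>2)\<bar> \<le> K * e" using w by (auto simp: A_def)
      ultimately show ?thesis using elim by (simp add: pos_divide_le_eq)
    qed
    then show ?case using prob_Un2_half[OF B(1) A B(2) pA] by blast
  qed
  then show "\<exists>K>0. \<forall>\<^sub>F e in at_right 0. \<exists>B\<in>sets M. prob B \<le> \<gamma> \<and> (\<forall>\<omega>\<in>space M - B. \<bar>approx_qv e (ext_proc T N) \<omega>\<bar> \<le> K)"
    using K by blast
qed

lemma tight_qv_finite:
  assumes "finite_quadratic_variation M T X" and X: "ext_adapted (ext_proc T X)"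
  shows "tightP (\<lambda>e. approx_qv e (ext_proc T X))"
proof -
  obtain Cv where "is_covariation M T X X Cv" using assms(1) by (auto simp: finite_quadratic_variation_def)
  then have t: "tendsto_in_prob M (\<lambda>e. cov_eps T X X e T) (Cv T)"
    using T_pos by (auto simp: is_covariation_def)
  then have "Cv T \<in> borel_measurable M" by (simp add: tendsto_in_prob_def)
  then have "tightP (\<lambda>e \<omega>. (cov_eps T X X e T \<omega> - Cv T \<omega>) + Cv T \<omega>)"
    by (intro tightP_add smallP_tight tendsto_oP t tightP_rv)
  then show ?thesis
  proof (rule tightP_mono[where c = 1])
    have "approx_qv e (ext_proc T X) \<omega> = cov_eps T X X e T \<omega>" if "\<omega> \<in> space M" for e \<omega>
      using cov_eps_integral[OF X X that, of T e] T_pos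
      by (simp add: approx_qv_def power2_eq_square)
    then show "\<forall>\<^sub>F e in at_right 0. \<forall>\<omega>\<in>space M. \<bar>approx_qv e (ext_proc T X) \<omega>\<bar> \<le> 1 * \<bar>cov_eps T X X e T \<omega> - Cv T \<omega> + Cv T \<omega>\<bar>"
      by simp
  qed simp
qed

lemma tight_qv_diff:
  assumes X: "cont_adapted X" "tightP (\<lambda>e. approx_qv e X)" and Y: "cont_adapted Y" "tightP (\<lambda>e. approx_qv e Y)"
    and A: "\<And>t \<omega>. \<omega> \<in> space M \<Longrightarrow> A t \<omega> = X t \<omega> - Y t \<omega>"
  shows "tightP (\<lambda>e. approx_qv e A)"
proof (rule tightP_mono[OF tightP_add[OF X(2) Y(2)], where c = 2])
  show "\<forall>\<^sub>F e in at_right 0. \<forall>\<omega>\<in>space M. \<bar>approx_qv e A \<omega>\<bar> \<le> 2 * \<bar>approx_qv e X \<omega> + approx_qv e Y \<omega>\<bar>"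
    using eventually_at_right_less[of 0]
  proof (eventually_elim, intro ballI)
    fix e :: real and \<omega> assume e: "0 < e" and w: "\<omega> \<in> space M"
    have eq: "incr e A s \<omega> = incr e X s \<omega> - incr e Y s \<omega>" for s using A[OF w] by (simp add: incr_def)
    note ix = Icc_integrable[OF square_inc_cont[OF X(1) w, of "{0..T}" e]] and iy = Icc_integrable[OF square_inc_cont[OF Y(1) w, of "{0..T}" e]]
    have ca: "continuous_on {0..T} (\<lambda>s. (incr e A s \<omega>)\<^sup>2)"
      unfolding eq by (intro continuous_on_power continuous_on_diff incr_cont X Y w)
    have "integral {0..T} (\<lambda>s. (incr e A s \<omega>)\<^sup>2) \<le> integral {0..T} (\<lambda>s. 2 * ((incr e X s \<omega>)\<^sup>2 + (incr e Y s \<omega>)\<^sup>2))"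
    proof (rule integral_le[OF Icc_integrable[OF ca]])
      show "(\<lambda>s. 2 * ((incr e X s \<omega>)\<^sup>2 + (incr e Y s \<omega>)\<^sup>2)) integrable_on {0..T}"
        by (intro Icc_integrable continuous_on_mult continuous_on_const continuous_on_add square_inc_cont X Y w)
      fix s
      have "0 \<le> (incr e X s \<omega> + incr e Y s \<omega>)\<^sup>2" by simp
      then show "(incr e A s \<omega>)\<^sup>2 \<le> 2 * ((incr e X s \<omega>)\<^sup>2 + (incr e Y s \<omega>)\<^sup>2)"
        unfolding eq by (simp add: power2_sum power2_diff)
    qed
    also have "\<dots> = 2 * (integral {0..T} (\<lambda>s. (incr e X s \<omega>)\<^sup>2) + integral {0..T} (\<lambda>s. (incr e Y s \<omega>)\<^sup>2))"
      using ix iy by (simp add: integral_add)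
    finally have "approx_qv e A \<omega> \<le> 2 * (approx_qv e X \<omega> + approx_qv e Y \<omega>)"
      using e unfolding approx_qv_def by (simp add: pos_divide_le_eq algebra_simps)
    moreover have "0 \<le> approx_qv e A \<omega>" unfolding approx_qv_def using integral_mono_upper(1)[OF ca, of T] T_pos e by simp
    ultimately show "\<bar>approx_qv e A \<omega>\<bar> \<le> 2 * \<bar>approx_qv e X \<omega> + approx_qv e Y \<omega>\<bar>" by (simp only: abs_of_nonneg) (rule order_trans[OF _ mult_left_mono[OF abs_ge_self]], simp_all)
  qed
qed simp

text \<open>Cut at \<delta>, the weight is adapted and bounded, so along a mesh of step
  \<open>e\<close> its products with the increments of \<open>L\<close> form a martingale transform
  of L1 size of order \<delta>, whatever the number of terms. Averaging over offsets gives order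
  \<open>\<delta> * e\<close>, which absorbs the division by \<open>e\<close>.\<close>

lemma adapted_weight_negligible:
  assumes N: "cont_local_martingale M T Fi N" and t: "t \<in> {0..T}"
    and Zm: "\<forall>\<^sub>F e in at_right 0. (\<forall>s\<in>{0..T}. Z e s \<in> borel_measurable (G s)) \<and>
       (\<forall>\<omega>\<in>space M. continuous_on {0..T} (\<lambda>s. Z e s \<omega>))"
    and Zs: "unif_smallP {0..T} Z"
  shows "smallP (\<lambda>e \<omega>. integral {0..t} (\<lambda>s. Z e s \<omega> * incr e (ext_proc T N) s \<omega> / e))"
  unfolding smallP_def
proof (intro allI impI)
  fix \<delta>0 \<gamma> :: real assume h: "\<delta>0 > 0" "\<gamma> > 0"
  let ?E = "ext_proc T N"
  have E: "ext_adapted ?E" using N by (intro ext_adapted_ext) (auto simp: cont_local_martingale_def local_martingale_on_def)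
  note Ec = ext_adapted_cproc[OF E]
  have g3: "\<gamma> / 3 > 0" using h by simp
  from localize_small[OF N this] obtain L B C where L: "bdd_mart L" and B: "B \<in> sets M" "prob B \<le> \<gamma> / 3" and C: "C \<ge> 0"
    "\<And>s t \<omega>. \<omega> \<in> space M \<Longrightarrow> \<bar>L t \<omega> - L s \<omega>\<bar> \<le> C"
    and LE: "\<And>t \<omega>. \<omega> \<in> space M - B \<Longrightarrow> L t \<omega> = ?E t \<omega> - N 0 \<omega>" by blast
  note Lc = bdd_mart_cproc[OF L]
  define \<delta> where "\<delta> = \<delta>0 * \<gamma> / (3 * (C\<^sup>2 + 1))"
  have C1: "C\<^sup>2 + 1 > 0" by (smt (verit) zero_le_power2)
  have d: "\<delta> > 0" using h C1 by (simp add: \<delta>_def)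
  have "\<forall>\<^sub>F e in at_right 0. \<exists>B\<in>sets M. prob B \<le> \<gamma> / 3 \<and> (\<forall>\<omega>\<in>space M - B. \<forall>s\<in>{0..T}. \<bar>Z e s \<omega>\<bar> \<le> \<delta>)"
    using Zs d g3 unfolding unif_smallP_def by blast
  with Zm eventually_at_right_less[of 0]
  show "\<forall>\<^sub>F e in at_right 0. \<exists>B\<in>sets M. prob B \<le> \<gamma> \<and>
     (\<forall>\<omega>\<in>space M - B. \<bar>integral {0..t} (\<lambda>s. Z e s \<omega> * incr e ?E s \<omega> / e)\<bar> \<le> \<delta>0)"
  proof eventually_elim
    case (elim e)
    then obtain Be where Be: "Be \<in> sets M" "prob Be \<le> \<gamma> / 3" "\<And>\<omega> s. \<omega> \<in> space M - Be \<Longrightarrow> s \<in> {0..T} \<Longrightarrow> \<bar>Z e s \<omega>\<bar> \<le> \<delta>"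
      by blast
    have Zm: "\<And>s. s \<in> {0..T} \<Longrightarrow> Z e s \<in> borel_measurable (G s)" and
      Zc: "\<And>\<omega>. \<omega> \<in> space M \<Longrightarrow> continuous_on {0..T} (\<lambda>s. Z e s \<omega>)" and e: "e > 0" using elim by auto
    define c where "c s = max 0 (min s T)" for s
    have cr: "c s \<in> {0..T}" for s using T_pos by (auto simp: c_def)
    \<comment> \<open>Clamping the time extends the weight from [0,T] to the line for the sake of
      joint measurability; the indicator restricts it to \<open>[0, t]\<close>, where the clamp is
      the identity.\<close>
    define Z' where "Z' s \<omega> = indicator {0..t} s * max (-\<delta>) (min \<delta> (Z e (c s) \<omega>))" for s \<omega>
    define \<phi> where "\<phi> s \<omega> = Z' s \<omega> * incr e L s \<omega>" for s \<omega>
    have Z'b: "\<bar>Z' s \<omega>\<bar> \<le> \<delta>" for s \<omega> using d by (auto simp: Z'_def indicator_def)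
    have jmZ: "jointly_meas (\<lambda>s. Z e (c s))"
    proof (rule jointly_meas_cont)
      show "Z e (c s) \<in> borel_measurable M" for s using meas_G_M[OF Zm[OF cr]] .
      show "continuous_on UNIV (\<lambda>s. Z e (c s) \<omega>)" if "\<omega> \<in> space M" for \<omega>
        by (rule continuous_on_compose2[OF Zc[OF that]])
          (use cr in \<open>auto simp: c_def intro!: continuous_on_max continuous_on_min continuous_on_id continuous_on_const\<close>)
    qed
    have jointly_meas: "jointly_meas \<phi>" unfolding \<phi>_def[abs_def] Z'_def
      by (intro jointly_meas_mult jointly_meas_time jointly_meas_max jointly_meas_min jmZ incr_jm Lc) measurable
    have \<phi>b: "\<bar>\<phi> s \<omega>\<bar> \<le> \<delta> * C" if "\<omega> \<in> space M" for s \<omega>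
      using mult_mono[OF Z'b C(2)[OF that, of "s + e" s]] d by (simp add: \<phi>_def incr_def abs_mult)
    have supp: "\<phi> s \<omega> = 0" if "s \<notin> {0..t}" for s \<omega> using that by (auto simp: \<phi>_def Z'_def)
    have sumb: "expectation (\<lambda>\<omega>. \<bar>\<Sum>k<n. \<phi> (u + real k * e) \<omega>\<bar>) \<le> \<delta> * (C\<^sup>2 + 1)" for n u
    proof -
      define r where "r k = u + real k * e" for k
      have rS: "r (Suc k) = r k + e" for k by (simp add: r_def algebra_simps)
      have rmono: "r k \<le> r (Suc k)" for k using e by (simp add: rS)
      have r_le: "r k \<le> r n" if "k \<le> n" for k n using mono_upto[of n r k] rmono that by blast
      \<comment> \<open>At the last mesh point this transform equals the block sum of \<phi>, and at
        the first it vanishes.\<close>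
      define Y where "Y \<tau> \<omega> = (\<Sum>k<n. Z' (r k) \<omega> * (L (min \<tau> (r (Suc k))) \<omega> - L (min \<tau> (r k)) \<omega>))" for \<tau> \<omega>
      have Z'm: "Z' s \<in> borel_measurable (G s)" for s
      proof (cases "s \<in> {0..t}")
        case True
        then have "c s = s" "s \<in> {0..T}" using t by (auto simp: c_def)
        then show ?thesis using Zm[of s] True unfolding Z'_def[abs_def] by simp
      qed (simp add: Z'_def[abs_def])
      have Yd: "dominated \<delta> L Y"
        unfolding Y_def[abs_def]
        by (rule dominated_elementary[where r = r and n = n and Z = "\<lambda>k. Z' (r k)", OF L rmono Z'm Z'b])
      have "Y (r 0) \<omega> = 0" for \<omega>
      proof -
        have "min (r 0) (r k) = r 0" for k using r_le[of 0 k] by simp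
        then show ?thesis by (simp add: Y_def)
      qed
      then have "expectation (\<lambda>\<omega>. \<bar>Y (r n) \<omega>\<bar>) \<le> \<delta> * (C\<^sup>2 + 1)"
        by (intro dominated_L1(2)[OF Yd d r_le[of 0 n] _ L C(2)]) auto
      moreover have "Y (r n) \<omega> = (\<Sum>k<n. \<phi> (r k) \<omega>)" for \<omega>
      proof -
        have m: "min (r n) (r k) = r k" if "k \<le> n" for k using r_le[OF that] by simp
        show ?thesis unfolding Y_def \<phi>_def incr_def by (rule sum.cong) (auto simp: m rS[symmetric])
      qed
      ultimately show ?thesis by (simp add: r_def)
    qed
    note bb = block_bound[OF jointly_meas \<phi>b supp e sumb]
    have i: "integrable M (\<lambda>\<omega>. \<integral>s. \<phi> s \<omega> \<partial>lborel)" and b: "expectation (\<lambda>\<omega>. \<bar>\<integral>s. \<phi> s \<omega> \<partial>lborel\<bar>) \<le> \<delta> * (C\<^sup>2 + 1) * e"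
      using bb by auto
    define A where "A = {\<omega>\<in>space M. \<delta>0 * e < \<bar>\<integral>s. \<phi> s \<omega> \<partial>lborel\<bar>}"
    have [measurable]: "(\<lambda>\<omega>. \<integral>s. \<phi> s \<omega> \<partial>lborel) \<in> borel_measurable M" using i by auto
    have A: "A \<in> sets M" unfolding A_def by measurable
    have "prob A \<le> \<delta> * (C\<^sup>2 + 1) * e / (\<delta>0 * e)"
      unfolding A_def by (rule markov_abs[OF i b]) (use h e in simp)
    also have "\<delta> * (C\<^sup>2 + 1) = \<delta>0 * \<gamma> / 3"
    proof -
      have "\<delta>0 * \<gamma> / (3 * x) * x = \<delta>0 * \<gamma> / 3" if "x > 0" for x using that by simp
      from this[OF C1] show ?thesis by (simp only: \<delta>_def)
    qed
    also have "\<delta>0 * \<gamma> / 3 * e / (\<delta>0 * e) = \<gamma> / 3" using h e by simp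
    finally have pA: "prob A \<le> \<gamma> / 3" .
    have "\<bar>integral {0..t} (\<lambda>s. Z e s \<omega> * incr e ?E s \<omega> / e)\<bar> \<le> \<delta>0" if w: "\<omega> \<in> space M - (B \<union> Be \<union> A)" for \<omega>
    proof -
      have ws: "\<omega> \<in> space M" using w by simp
      have cc: "continuous_on {0..t} (\<lambda>s. Z e s \<omega> * incr e ?E s \<omega> / e)"
        unfolding divide_inverse using t
        by (intro continuous_on_mult incr_cont Ec ws continuous_on_const continuous_on_subset[OF Zc[OF ws]]) auto
      have "indicator {0..t} s * (Z e s \<omega> * incr e ?E s \<omega> / e) = \<phi> s \<omega> / e" for s
      proof (cases "s \<in> {0..t}")
        case True
        then have s: "s \<in> {0..T}" "c s = s" using t by (auto simp: c_def)
        have "\<bar>Z e s \<omega>\<bar> \<le> \<delta>" using Be(3)[of \<omega> s] w s by auto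
        moreover have "incr e ?E s \<omega> = incr e L s \<omega>" using LE[of \<omega>] w by (simp add: incr_def)
        ultimately show ?thesis using True s by (simp add: \<phi>_def Z'_def abs_le_iff)
      qed (simp add: supp)
      then have "integral {0..t} (\<lambda>s. Z e s \<omega> * incr e ?E s \<omega> / e) = (\<integral>s. \<phi> s \<omega> / e \<partial>lborel)"
        by (simp only: lebesgue_Icc(2)[OF cc])
      also have "\<dots> = (\<integral>s. \<phi> s \<omega> \<partial>lborel) / e" by simp
      finally have "\<bar>integral {0..t} (\<lambda>s. Z e s \<omega> * incr e ?E s \<omega> / e)\<bar> = \<bar>\<integral>s. \<phi> s \<omega> \<partial>lborel\<bar> / e"
        using e by simp
      also have "\<dots> \<le> \<delta>0" using w e by (auto simp: A_def pos_divide_le_eq not_less)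
      finally show ?thesis .
    qed
    moreover have "B \<union> Be \<union> A \<in> sets M" "prob (B \<union> Be \<union> A) \<le> \<gamma>"
      using prob_Un3_le[OF B(1) Be(1) A] B Be A pA by auto
    ultimately show ?case by blast
  qed
qed

lemma amgm_bound: "\<delta> > 0 \<Longrightarrow> \<bar>x * y\<bar> \<le> x\<^sup>2 / (2 * \<delta>) + \<delta> * y\<^sup>2 / (2::real)"
proof -
  assume d: "\<delta> > 0"
  have "0 \<le> (\<bar>x\<bar> - \<delta> * \<bar>y\<bar>)\<^sup>2" by simp
  then have "2 * \<delta> * (\<bar>x\<bar> * \<bar>y\<bar>) \<le> x\<^sup>2 + \<delta>\<^sup>2 * y\<^sup>2" by (simp add: power2_diff power_mult_distrib algebra_simps)
  then have "\<bar>x\<bar> * \<bar>y\<bar> \<le> (x\<^sup>2 + \<delta>\<^sup>2 * y\<^sup>2) / (2 * \<delta>)" using d by (simp add: pos_le_divide_eq mult.commute)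
  also have "\<dots> = x\<^sup>2 / (2 * \<delta>) + \<delta> * y\<^sup>2 / 2" using d by (simp add: add_divide_distrib power2_eq_square)
  finally show ?thesis by (simp add: abs_mult)
qed

lemma product_integral_bound:
  assumes X: "\<omega> \<in> space M" "cont_adapted X" and Y: "cont_adapted Y" and e: "e > 0"
  shows "integral {0..T} (\<lambda>s. \<bar>incr e X s \<omega> * incr e Y s \<omega>\<bar> / e) \<le> (approx_qv e X \<omega> + approx_qv e Y \<omega>) / 2"
proof -
  have "integral {0..T} (\<lambda>s. \<bar>incr e X s \<omega> * incr e Y s \<omega>\<bar> / e) \<le>
      integral {0..T} (\<lambda>s. ((incr e X s \<omega>)\<^sup>2 + (incr e Y s \<omega>)\<^sup>2) * inverse (2 * e))"
  proof (rule integral_le)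
    show "(\<lambda>s. \<bar>incr e X s \<omega> * incr e Y s \<omega>\<bar> / e) integrable_on {0..T}"
      unfolding divide_inverse
      by (intro Icc_integrable continuous_on_mult continuous_on_rabs incr_cont X Y continuous_on_const)
    show "(\<lambda>s. ((incr e X s \<omega>)\<^sup>2 + (incr e Y s \<omega>)\<^sup>2) * inverse (2 * e)) integrable_on {0..T}"
      by (intro Icc_integrable continuous_on_mult continuous_on_add square_inc_cont X Y continuous_on_const)
    fix s
    have "\<bar>incr e X s \<omega> * incr e Y s \<omega>\<bar> \<le> ((incr e X s \<omega>)\<^sup>2 + (incr e Y s \<omega>)\<^sup>2) / 2"
      using amgm_bound[of 1 "incr e X s \<omega>" "incr e Y s \<omega>"] by simp
    then have "\<bar>incr e X s \<omega> * incr e Y s \<omega>\<bar> / e \<le> ((incr e X s \<omega>)\<^sup>2 + (incr e Y s \<omega>)\<^sup>2) / 2 / e"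
      using e by (intro divide_right_mono) auto
    then show "\<bar>incr e X s \<omega> * incr e Y s \<omega>\<bar> / e \<le> ((incr e X s \<omega>)\<^sup>2 + (incr e Y s \<omega>)\<^sup>2) * inverse (2 * e)"
      by (simp add: field_simps)
  qed
  also have "\<dots> = (integral {0..T} (\<lambda>s. (incr e X s \<omega>)\<^sup>2) + integral {0..T} (\<lambda>s. (incr e Y s \<omega>)\<^sup>2)) * inverse (2 * e)"
    using Icc_integrable[OF square_inc_cont[OF X(2,1), of "{0..T}" e]] Icc_integrable[OF square_inc_cont[OF Y X(1), of "{0..T}" e]]
    by (simp add: integral_add)
  also have "\<dots> = (approx_qv e X \<omega> + approx_qv e Y \<omega>) / 2" using e by (simp add: approx_qv_def field_simps)
  finally show ?thesis .
qed

text \<open>Holding the integrand at its value at \<open>s\<close> over one step leaves a remainder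
  \<open>D s\<close> whose second moment is at most \<open>\<delta>\<^sup>2\<close> times that of
  the increment of the localised \<open>Mp\<close>, once \<open>e\<close> is below the oscillation
  scale. Splitting the product as \<open>D\<^sup>2 / (2 * \<delta>)\<close> plus \<delta>/2 times
  the squared increment of \<open>N\<close> gives two terms of order \<open>\<delta> * e\<close> in
  expectation, by the energy bounds.\<close>

lemma integral_remainder_negligible:
  assumes N: "cont_local_martingale M T Fi N" and Mp: "cont_local_martingale M T Fi Mp" and t: "t \<in> {0..T}"
    and H: "ext_adapted H" and I: "ext_adapted I" and r: "filterlim r sequentially sequentially"
    and lim: "AE \<omega> in M. \<forall>t. (\<lambda>k. grid_sum H (ext_proc T Mp) (r k) t \<omega>) \<longlonglongrightarrow> I t \<omega>"
  shows "smallP (\<lambda>e \<omega>. integral {0..t} (\<lambda>s. (incr e I s \<omega> - H s \<omega> * incr e (ext_proc T Mp) s \<omega>) * incr e (ext_proc T N) s \<omega> / e))"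
  unfolding smallP_def
proof (intro allI impI)
  fix \<delta>0 \<gamma> :: real assume h: "\<delta>0 > 0" "\<gamma> > 0"
  let ?E = "ext_proc T N" and ?E' = "ext_proc T Mp"
  have E: "ext_adapted ?E" using N by (intro ext_adapted_ext) (auto simp: cont_local_martingale_def local_martingale_on_def)
  have E': "ext_adapted ?E'" using Mp by (intro ext_adapted_ext) (auto simp: cont_local_martingale_def local_martingale_on_def)
  note Ec = ext_adapted_cproc[OF E] and E'c = ext_adapted_cproc[OF E'] and Hc = ext_adapted_cproc[OF H] and Ic = ext_adapted_cproc[OF I]
  have g4: "\<gamma> / 4 > 0" using h by simp
  from localize_small[OF N g4] obtain L B C where L: "bdd_mart L" and B: "B \<in> sets M" "prob B \<le> \<gamma> / 4" and C: "C \<ge> 0"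
    "\<And>s t \<omega>. \<omega> \<in> space M \<Longrightarrow> \<bar>L t \<omega> - L s \<omega>\<bar> \<le> C"
    and LE: "\<And>t \<omega>. \<omega> \<in> space M - B \<Longrightarrow> L t \<omega> = ?E t \<omega> - N 0 \<omega>" by blast
  from localize_small[OF Mp g4] obtain L' B' C' where L': "bdd_mart L'" and B': "B' \<in> sets M" "prob B' \<le> \<gamma> / 4" and C': "C' \<ge> 0"
    "\<And>s t \<omega>. \<omega> \<in> space M \<Longrightarrow> \<bar>L' t \<omega> - L' s \<omega>\<bar> \<le> C'"
    and LE': "\<And>t \<omega>. \<omega> \<in> space M - B' \<Longrightarrow> L' t \<omega> = ?E' t \<omega> - Mp 0 \<omega>" by blast
  note Lc = bdd_mart_cproc[OF L] and L'c = bdd_mart_cproc[OF L']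
  define K where "K = C\<^sup>2 + C'\<^sup>2 + 1"
  have K: "K > 0" unfolding K_def by (smt (verit) zero_le_power2)
  \<comment> \<open>\<open>K\<close> collects both energy constants; this \<delta> gives
    \<open>\<gamma> / 4\<close> in Markov's inequality for \<open>U\<close>, the share of one of
    four exceptional events.\<close>
  define \<delta> where "\<delta> = \<delta>0 * \<gamma> / (2 * K)"
  have d: "\<delta> > 0" using h K by (simp add: \<delta>_def)
  obtain hh where hh: "hh > 0" "prob (osc_event H hh \<delta>) \<le> \<gamma> / 4" using osc_event_small[OF H d g4] by auto
  define S where "S = space M - (B' \<union> osc_event H hh \<delta>)"
  have modm: "osc_event H hh \<delta> \<in> sets M" by (rule osc_event_sets[OF Hc])
  have Sm [measurable]: "S \<in> sets M" unfolding S_def using B'(1) modm by auto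
  have "\<forall>\<^sub>F e in at_right 0. (0::real) < e \<and> e < hh"
    using hh(1) by (auto simp: eventually_at_right_field)
  then show "\<forall>\<^sub>F e in at_right 0. \<exists>B\<in>sets M. prob B \<le> \<gamma> \<and>
     (\<forall>\<omega>\<in>space M - B. \<bar>integral {0..t} (\<lambda>s. (incr e I s \<omega> - H s \<omega> * incr e ?E' s \<omega>) * incr e ?E s \<omega> / e)\<bar> \<le> \<delta>0)"
  proof eventually_elim
    case (elim e)
    then have e: "e > 0" "e < hh" by auto
    define D where "D s \<omega> = incr e I s \<omega> - H s \<omega> * incr e ?E' s \<omega>" for s \<omega>
    have Dcont: "continuous_on A (\<lambda>s. D s \<omega>)" if "\<omega> \<in> space M" for A \<omega>
      unfolding D_def by (intro continuous_on_diff continuous_on_mult incr_cont Ic E'c cont_adapted_cont[OF Hc] that)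
    have Djm: "jointly_meas D" unfolding D_def by (intro jointly_meas_diff jointly_meas_mult incr_jm Ic E'c jointly_meas_cproc Hc)
    have Dest: "integrable M (\<lambda>\<omega>. (indicator S \<omega> * D s \<omega>)\<^sup>2)"
      "expectation (\<lambda>\<omega>. (indicator S \<omega> * D s \<omega>)\<^sup>2) \<le> \<delta>\<^sup>2 * expectation (\<lambda>\<omega>. (incr e L' s \<omega>)\<^sup>2)" if s: "s \<in> {0..T}" for s
    proof -
      \<comment> \<open>A partition with one cell. Its end is cut at \<open>T\<close>, as the
        estimate requires; beyond \<open>T\<close> the processes are constant, so \<open>D s\<close>
        is unchanged.\<close>
      define p where "p i = (if i = 0 then s else min (s + e) T)" for i :: nat
      have p: "p i \<le> p (Suc i)" "p (Suc i) - p i < hh" if "i < 1" for i using that s e by (auto simp: p_def)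
      have p0: "0 \<le> p 0" "p 1 \<le> T" using s by (auto simp: p_def)
      have cl: "Y (min (s + e) T) \<omega> = Y (s + e) \<omega>" if "ext_adapted Y" "\<omega> \<in> space M" for Y \<omega>
      proof -
        have "max 0 (min (s + e) T) = min (s + e) T" using s e T_pos by auto
        then show ?thesis using ext_adapted_clip[OF that, of "s + e"] by simp
      qed
      have Deq: "indicator S \<omega> * D s \<omega> = indicator S \<omega> * (I (p 1) \<omega> - I (p 0) \<omega> - (\<Sum>i<1. H (p i) \<omega> * (?E' (p (Suc i)) \<omega> - ?E' (p i) \<omega>)))"
        if "\<omega> \<in> space M" for \<omega>
        using cl[OF I that] cl[OF E' that] by (simp add: D_def incr_def p_def)
      note est = integral_increment_estimate[where k = 1 and p = p, OF H E' I r lim L' B'(1) LE' less_imp_le[OF d] hh(1) p p0, folded S_def]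
      have "integrable M (\<lambda>\<omega>. (indicator S \<omega> * D s \<omega>)\<^sup>2) \<longleftrightarrow> integrable M (\<lambda>\<omega>. (indicator S \<omega> * (I (p 1) \<omega> - I (p 0) \<omega> - (\<Sum>i<1. H (p i) \<omega> * (?E' (p (Suc i)) \<omega> - ?E' (p i) \<omega>))))\<^sup>2)"
        by (rule Bochner_Integration.integrable_cong[OF refl]) (simp only: Deq)
      then show "integrable M (\<lambda>\<omega>. (indicator S \<omega> * D s \<omega>)\<^sup>2)" using est(2) by blast
      have "expectation (\<lambda>\<omega>. (indicator S \<omega> * D s \<omega>)\<^sup>2) = expectation (\<lambda>\<omega>. (indicator S \<omega> * (I (p 1) \<omega> - I (p 0) \<omega> - (\<Sum>i<1. H (p i) \<omega> * (?E' (p (Suc i)) \<omega> - ?E' (p i) \<omega>))))\<^sup>2)"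
        by (rule Bochner_Integration.integral_cong[OF refl]) (simp only: Deq)
      also have "\<dots> \<le> \<delta>\<^sup>2 * expectation (\<lambda>\<omega>. (L' (p 1) \<omega> - L' (p 0) \<omega>)\<^sup>2)" by (rule est(3))
      \<comment> \<open>\<open>L'\<close> is known here only as a bounded martingale, so the cut
        interval is compared with the full step by splitting at the cut.\<close>
      also have "\<dots> \<le> \<delta>\<^sup>2 * expectation (\<lambda>\<omega>. (incr e L' s \<omega>)\<^sup>2)"
      proof (rule mult_left_mono)
        have "0 \<le> expectation (\<lambda>\<omega>. (L' (max (s + e) (p 1)) \<omega> - L' (max s (p 1)) \<omega>)\<^sup>2)" by simp
        moreover have "min (s + e) (p 1) = p 1" "min s (p 1) = p 0" using s e by (auto simp: p_def)
        ultimately show "expectation (\<lambda>\<omega>. (L' (p 1) \<omega> - L' (p 0) \<omega>)\<^sup>2) \<le> expectation (\<lambda>\<omega>. (incr e L' s \<omega>)\<^sup>2)"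
          using bdd_mart_split_at[OF L', of "s + e" s "p 1"] by (simp add: incr_def)
      qed simp
      finally show "expectation (\<lambda>\<omega>. (indicator S \<omega> * D s \<omega>)\<^sup>2) \<le> \<delta>\<^sup>2 * expectation (\<lambda>\<omega>. (incr e L' s \<omega>)\<^sup>2)" .
    qed
    define Q where "Q \<omega> = integral {0..T} (\<lambda>s. (indicator S \<omega> * D s \<omega>)\<^sup>2)" for \<omega>
    define P where "P \<omega> = integral {0..T} (\<lambda>s. (incr e L s \<omega>)\<^sup>2)" for \<omega>
    have SDc: "continuous_on A (\<lambda>s. (indicator S \<omega> * D s \<omega>)\<^sup>2)" if "\<omega> \<in> space M" for A \<omega>
      by (intro continuous_on_power continuous_on_mult continuous_on_const Dcont that)
    have SDjm: "jointly_meas (\<lambda>s \<omega>. (indicator S \<omega> * D s \<omega>)\<^sup>2)" by (intro jointly_meas_power jointly_meas_mult jointly_meas_rv Djm) measurable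
    have Qm [measurable]: "Q \<in> borel_measurable M" unfolding Q_def[abs_def] by (rule time_integral_meas[OF SDjm SDc])
    have Q0: "0 \<le> Q \<omega>" if "\<omega> \<in> space M" for \<omega> unfolding Q_def
      by (rule integral_mono_upper(1)[OF SDc[OF that]]) (use T_pos in auto)
    note en' = bdd_mart_energy[OF L' C'(2) e(1), folded incr_def]
    note en = bdd_mart_energy[OF L C(2) e(1), folded incr_def]
    have "(\<integral>\<^sup>+\<omega>. ennreal (Q \<omega>) \<partial>M) = (\<integral>\<^sup>+\<omega>. \<integral>\<^sup>+s. ennreal (indicator {0..T} s * (indicator S \<omega> * D s \<omega>)\<^sup>2) \<partial>lborel \<partial>M)"
    proof (rule nn_integral_cong)
      fix \<omega> assume w: "\<omega> \<in> space M"
      have "(\<integral>\<^sup>+s. ennreal (indicator {0..T} s * (indicator S \<omega> * D s \<omega>)\<^sup>2) \<partial>lborel) = ennreal (\<integral>s. indicator {0..T} s * (indicator S \<omega> * D s \<omega>)\<^sup>2 \<partial>lborel)"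
        by (rule nn_integral_eq_integral[OF lebesgue_Icc(1)[OF SDc[OF w]]]) simp
      then show "ennreal (Q \<omega>) = (\<integral>\<^sup>+s. ennreal (indicator {0..T} s * (indicator S \<omega> * D s \<omega>)\<^sup>2) \<partial>lborel)"
        unfolding Q_def using lebesgue_Icc(2)[OF SDc[OF w], of T] by simp
    qed
    also have "\<dots> = (\<integral>\<^sup>+s. \<integral>\<^sup>+\<omega>. ennreal (indicator {0..T} s * (indicator S \<omega> * D s \<omega>)\<^sup>2) \<partial>M \<partial>lborel)"
      by (rule jointly_meas_Fubini, intro jointly_meas_mult jointly_meas_time SDjm) measurable
    also have "\<dots> \<le> (\<integral>\<^sup>+s. ennreal (\<delta>\<^sup>2) * ennreal (indicator {0..T} s * expectation (\<lambda>\<omega>. (incr e L' s \<omega>)\<^sup>2)) \<partial>lborel)"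
    proof (rule nn_integral_mono)
      fix s :: real
      show "(\<integral>\<^sup>+\<omega>. ennreal (indicator {0..T} s * (indicator S \<omega> * D s \<omega>)\<^sup>2) \<partial>M)
         \<le> ennreal (\<delta>\<^sup>2) * ennreal (indicator {0..T} s * expectation (\<lambda>\<omega>. (incr e L' s \<omega>)\<^sup>2))"
      proof (cases "s \<in> {0..T}")
        case True
        have "(\<integral>\<^sup>+\<omega>. ennreal ((indicator S \<omega> * D s \<omega>)\<^sup>2) \<partial>M) = ennreal (expectation (\<lambda>\<omega>. (indicator S \<omega> * D s \<omega>)\<^sup>2))"
          by (rule nn_integral_eq_integral[OF Dest(1)[OF True]]) simp
        also have "\<dots> \<le> ennreal (\<delta>\<^sup>2 * expectation (\<lambda>\<omega>. (incr e L' s \<omega>)\<^sup>2))"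
          by (rule ennreal_leI[OF Dest(2)[OF True]])
        finally show ?thesis using True by (simp add: ennreal_mult'')
      qed simp
    qed
    also have "\<dots> = ennreal (\<delta>\<^sup>2) * (\<integral>\<^sup>+s. ennreal (indicator {0..T} s * expectation (\<lambda>\<omega>. (incr e L' s \<omega>)\<^sup>2)) \<partial>lborel)"
    proof (rule nn_integral_cmult)
      have "jointly_meas (\<lambda>s \<omega>. (incr e L' s \<omega>)\<^sup>2)" by (intro jointly_meas_power incr_jm L'c)
      then have "(\<lambda>(s, \<omega>). (incr e L' s \<omega>)\<^sup>2) \<in> borel_measurable (lborel \<Otimes>\<^sub>M M)"
        unfolding jointly_meas_def by (subst measurable_pair_swap_iff) (simp add: split_beta')
      then have "(\<lambda>s. expectation (\<lambda>\<omega>. (incr e L' s \<omega>)\<^sup>2)) \<in> borel_measurable lborel"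
        by (rule borel_measurable_lebesgue_integral)
      then show "(\<lambda>s. ennreal (indicator {0..T} s * expectation (\<lambda>\<omega>. (incr e L' s \<omega>)\<^sup>2))) \<in> borel_measurable lborel"
        by measurable
    qed
    also have "\<dots> \<le> ennreal (\<delta>\<^sup>2) * ennreal (C'\<^sup>2 * e)" by (rule mult_left_mono[OF en'(3) zero_le])
    also have "\<dots> = ennreal (\<delta>\<^sup>2 * (C'\<^sup>2 * e))" using e by (simp add: ennreal_mult)
    finally have Qnn: "(\<integral>\<^sup>+\<omega>. ennreal (Q \<omega>) \<partial>M) \<le> ennreal (\<delta>\<^sup>2 * (C'\<^sup>2 * e))" .
    have Qi: "integrable M Q"
      by (rule integrableI_nonneg) (use Qnn Q0 in \<open>auto intro: le_less_trans\<close>)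
    have QE: "expectation Q \<le> \<delta>\<^sup>2 * (C'\<^sup>2 * e)"
      using Qnn e by (subst (asm) nn_integral_eq_integral[OF Qi]) (use Q0 in auto)
    have Pi: "integrable M P" and PE: "expectation P \<le> C\<^sup>2 * e"
    proof -
      show Pi: "integrable M P" using en(1) by (simp add: P_def[abs_def])
      have "expectation P \<le> expectation (\<lambda>\<omega>. \<bar>P \<omega>\<bar>)" by (rule integral_mono) (use Pi in auto)
      then show "expectation P \<le> C\<^sup>2 * e" using en(2) by (simp add: P_def)
    qed
    \<comment> \<open>The pathwise bound for the time integral of the product, before the division
      by \<open>e\<close>.\<close>
    define U where "U \<omega> = Q \<omega> / (2 * \<delta>) + \<delta> * P \<omega> / 2" for \<omega>
    have P0: "0 \<le> P \<omega>" if "\<omega> \<in> space M" for \<omega> unfolding P_def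
      by (rule integral_mono_upper(1)[OF square_inc_cont[OF Lc that]]) (use T_pos in auto)
    have Ui: "integrable M U" unfolding U_def[abs_def] using Qi Pi by simp
    have U0: "0 \<le> U \<omega>" if "\<omega> \<in> space M" for \<omega> using Q0[OF that] P0[OF that] d by (simp add: U_def)
    have "expectation (\<lambda>\<omega>. \<bar>U \<omega>\<bar>) = expectation U"
      by (rule Bochner_Integration.integral_cong) (use U0 in auto)
    also have "\<dots> = expectation Q / (2 * \<delta>) + \<delta> * expectation P / 2" unfolding U_def[abs_def] using Qi Pi by simp
    also have "\<dots> \<le> \<delta>\<^sup>2 * (C'\<^sup>2 * e) / (2 * \<delta>) + \<delta> * (C\<^sup>2 * e) / 2"
      using QE PE d by (intro add_mono divide_right_mono mult_left_mono) auto
    also have "\<dots> = \<delta> * e * (C'\<^sup>2 + C\<^sup>2) / 2" using d by (simp add: power2_eq_square field_simps)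
    also have "\<dots> \<le> \<delta> * e * K / 2" using d e by (intro divide_right_mono mult_left_mono) (auto simp: K_def)
    finally have UE: "expectation (\<lambda>\<omega>. \<bar>U \<omega>\<bar>) \<le> \<delta> * e * K / 2" .
    define A where "A = {\<omega>\<in>space M. \<delta>0 * e < \<bar>U \<omega>\<bar>}"
    have [measurable]: "U \<in> borel_measurable M" using Ui by auto
    have A: "A \<in> sets M" unfolding A_def by measurable
    have "prob A \<le> (\<delta> * e * K / 2) / (\<delta>0 * e)"
      unfolding A_def by (rule markov_abs[OF Ui UE]) (use h e in simp)
    also have "\<dots> = \<gamma> / 4" using h e K by (simp add: \<delta>_def field_simps)
    finally have pA: "prob A \<le> \<gamma> / 4" .
    have "\<bar>integral {0..t} (\<lambda>s. (incr e I s \<omega> - H s \<omega> * incr e ?E' s \<omega>) * incr e ?E s \<omega> / e)\<bar> \<le> \<delta>0"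
      if w: "\<omega> \<in> space M - ((B \<union> B' \<union> osc_event H hh \<delta>) \<union> A)" for \<omega>
    proof -
      have ws: "\<omega> \<in> space M" "\<omega> \<in> S" using w by (auto simp: S_def)
      have incL: "incr e ?E s \<omega> = incr e L s \<omega>" for s using LE[of \<omega>] w by (simp add: incr_def)
      have c0: "continuous_on {0..x} (\<lambda>s. D s \<omega> * incr e L s \<omega> / e)" for x
        unfolding divide_inverse by (intro continuous_on_mult Dcont incr_cont Lc ws continuous_on_const)
      have c1: "continuous_on {0..x} (\<lambda>s. \<bar>D s \<omega> * incr e L s \<omega>\<bar> / e)" for x
        unfolding divide_inverse by (intro continuous_on_mult continuous_on_rabs Dcont incr_cont Lc ws continuous_on_const)
      have "\<bar>integral {0..t} (\<lambda>s. D s \<omega> * incr e L s \<omega> / e)\<bar> \<le> integral {0..t} (\<lambda>s. \<bar>D s \<omega> * incr e L s \<omega>\<bar> / e)"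
        using integral_norm_bound_integral[OF Icc_integrable[OF c0] Icc_integrable[OF c1], of t] e by (simp add: abs_mult)
      also have "\<dots> \<le> integral {0..T} (\<lambda>s. \<bar>D s \<omega> * incr e L s \<omega>\<bar> / e)"
        by (rule integral_mono_upper(2)[OF c1 _ t]) (use e in auto)
      also have "\<dots> \<le> integral {0..T} (\<lambda>s. (indicator S \<omega> * D s \<omega>)\<^sup>2 * inverse (2 * \<delta> * e) + (incr e L s \<omega>)\<^sup>2 * (\<delta> / (2 * e)))"
      proof (rule integral_le[OF Icc_integrable[OF c1]])
        show "(\<lambda>s. (indicator S \<omega> * D s \<omega>)\<^sup>2 * inverse (2 * \<delta> * e) + (incr e L s \<omega>)\<^sup>2 * (\<delta> / (2 * e))) integrable_on {0..T}"
          by (intro Icc_integrable continuous_on_add continuous_on_mult SDc square_inc_cont Lc ws continuous_on_const)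
        fix s
        have "\<bar>D s \<omega> * incr e L s \<omega>\<bar> / e \<le> ((D s \<omega>)\<^sup>2 / (2 * \<delta>) + \<delta> * (incr e L s \<omega>)\<^sup>2 / 2) / e"
          using amgm_bound[OF d] e by (intro divide_right_mono) auto
        moreover have "(a / (2 * \<delta>) + \<delta> * b / 2) / e = a * inverse (2 * \<delta> * e) + b * (\<delta> / (2 * e))" for a b
          using d e by (simp add: field_simps)
        moreover have "indicator S \<omega> * D s \<omega> = D s \<omega>" using ws by simp
        ultimately show "\<bar>D s \<omega> * incr e L s \<omega>\<bar> / e \<le> (indicator S \<omega> * D s \<omega>)\<^sup>2 * inverse (2 * \<delta> * e) + (incr e L s \<omega>)\<^sup>2 * (\<delta> / (2 * e))"
          by (simp only:)
      qed
      also have "\<dots> = Q \<omega> * inverse (2 * \<delta> * e) + P \<omega> * (\<delta> / (2 * e))"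
        unfolding Q_def P_def
          integral_add[OF integrable_on_mult_left[OF Icc_integrable[OF SDc[OF ws(1)]]] integrable_on_mult_left[OF Icc_integrable[OF square_inc_cont[OF Lc ws(1)]]]]
        by (simp only: Henstock_Kurzweil_Integration.integral_mult_left)
      also have "\<dots> = U \<omega> / e" using e d by (simp add: U_def field_simps)
      also have "\<dots> \<le> \<delta>0" using w e by (auto simp: A_def pos_divide_le_eq not_less)
      finally show ?thesis unfolding D_def incL .
    qed
    moreover have "(B \<union> B' \<union> osc_event H hh \<delta>) \<union> A \<in> sets M" using B B' modm A by auto
    moreover have "prob ((B \<union> B' \<union> osc_event H hh \<delta>) \<union> A) \<le> \<gamma>"
    proof -
      have "prob ((B \<union> B' \<union> osc_event H hh \<delta>) \<union> A) \<le> prob (B \<union> B' \<union> osc_event H hh \<delta>) + prob A"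
        using B B' modm A by (intro measure_Un_le) auto
      then show ?thesis using prob_Un3_le[OF B(1) B'(1) modm] B(2) B'(2) hh(2) pA by linarith
    qed
    ultimately show ?case by blast
  qed
qed

text \<open>Holding a weight at the left ends of the cells costs its oscillation times the total
  mass of |f|. The sum is written with integrals from 0, the form in which covariations are
  given.\<close>

lemma riemann_weight_bound:
  fixes p :: "nat \<Rightarrow> real" and f w :: "real \<Rightarrow> real"
  assumes p: "p 0 = 0" "\<And>i. i < n \<Longrightarrow> p i \<le> p (Suc i)"
    and f: "continuous_on {0..p n} f" and w: "continuous_on {0..p n} w"
    and k: "\<And>i s. i < n \<Longrightarrow> s \<in> {p i..p (Suc i)} \<Longrightarrow> \<bar>w s - w (p i)\<bar> \<le> \<kappa>"
  shows "\<bar>integral {0..p n} (\<lambda>s. w s * f s) - (\<Sum>i<n. w (p i) * (integral {0..p (Suc i)} f - integral {0..p i} f))\<bar>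
     \<le> \<kappa> * integral {0..p n} (\<lambda>s. \<bar>f s\<bar>)"
  using assms(2-)
proof (induction n)
  case 0
  then show ?case using p(1) by simp
next
  case (Suc n)
  have p0: "0 \<le> p n" using mono_upto[of n p 0] Suc.prems(1) p(1) by auto
  have pS: "p n \<le> p (Suc n)" using Suc.prems(1) by simp
  have sub: "{0..p n} \<subseteq> {0..p (Suc n)}" "{p n..p (Suc n)} \<subseteq> {0..p (Suc n)}" using p0 pS by auto
  note f = Suc.prems(2) and w = Suc.prems(3)
  have IH: "\<bar>integral {0..p n} (\<lambda>s. w s * f s) - (\<Sum>i<n. w (p i) * (integral {0..p (Suc i)} f - integral {0..p i} f))\<bar>
     \<le> \<kappa> * integral {0..p n} (\<lambda>s. \<bar>f s\<bar>)"
    by (rule Suc.IH) (use Suc.prems continuous_on_subset[OF f sub(1)] continuous_on_subset[OF w sub(1)] in auto)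
  have comb: "integral {0..p (Suc n)} g = integral {0..p n} g + integral {p n..p (Suc n)} g" if "continuous_on {0..p (Suc n)} g" for g :: "real \<Rightarrow> real"
    using Henstock_Kurzweil_Integration.integral_combine[OF p0 pS integrable_continuous_interval[OF that]] by simp
  have cf: "continuous_on {p n..p (Suc n)} f" and cw: "continuous_on {p n..p (Suc n)} w"
    using continuous_on_subset[OF f sub(2)] continuous_on_subset[OF w sub(2)] by auto
  have cwf: "continuous_on {0..p (Suc n)} (\<lambda>s. w s * f s)" by (intro continuous_on_mult f w)
  have caf: "continuous_on {0..p (Suc n)} (\<lambda>s. \<bar>f s\<bar>)" by (intro continuous_on_rabs f)
  have i1: "(\<lambda>s. (w s - w (p n)) * f s) integrable_on {p n..p (Suc n)}"
    by (intro integrable_continuous_interval continuous_on_mult continuous_on_diff continuous_on_const cf cw)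
  have i2: "(\<lambda>s. \<kappa> * \<bar>f s\<bar>) integrable_on {p n..p (Suc n)}"
    by (intro integrable_continuous_interval continuous_on_mult continuous_on_rabs continuous_on_const cf)
  have "norm (integral {p n..p (Suc n)} (\<lambda>s. (w s - w (p n)) * f s)) \<le> integral {p n..p (Suc n)} (\<lambda>s. \<kappa> * \<bar>f s\<bar>)"
  proof (rule integral_norm_bound_integral[OF i1 i2])
    fix s assume "s \<in> {p n..p (Suc n)}"
    then have "\<bar>w s - w (p n)\<bar> \<le> \<kappa>" using Suc.prems(4)[of n s] by simp
    then show "norm ((w s - w (p n)) * f s) \<le> \<kappa> * \<bar>f s\<bar>" by (simp add: abs_mult mult_right_mono)
  qed
  moreover have "integral {p n..p (Suc n)} (\<lambda>s. (w s - w (p n)) * f s) =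
      integral {p n..p (Suc n)} (\<lambda>s. w s * f s) - w (p n) * integral {p n..p (Suc n)} f"
    unfolding left_diff_distrib
    by (subst integral_diff) (auto intro!: integrable_continuous_interval continuous_on_mult continuous_on_const cf cw)
  ultimately have st: "\<bar>integral {p n..p (Suc n)} (\<lambda>s. w s * f s) - w (p n) * integral {p n..p (Suc n)} f\<bar>
      \<le> \<kappa> * integral {p n..p (Suc n)} (\<lambda>s. \<bar>f s\<bar>)"
    by simp
  have "integral {0..p (Suc n)} f - integral {0..p n} f = integral {p n..p (Suc n)} f" using comb[OF f] by simp
  then show ?case using IH st comb[OF cwf] comb[OF caf] by (simp add: distrib_left)
qed

text \<open>Weak convergence of signed measures: their distribution functions vanish in the limit
  and their total masses are tight, so the integral of a continuous weight vanishes too. The weight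
  becomes a step function on a partition that stays fixed while \<open>e\<close> tends to 0; on each
  cell a random variable multiplies a difference of two small covariations.\<close>

lemma weighted_covariation_negligible:
  assumes A: "ext_adapted A" and E: "ext_adapted E" and H: "ext_adapted H" and t: "t \<in> {0..T}"
    and tA: "tightP (\<lambda>e. approx_qv e A)" and tE: "tightP (\<lambda>e. approx_qv e E)"
    and z: "\<And>u. u \<in> {0..T} \<Longrightarrow> smallP (\<lambda>e \<omega>. integral {0..u} (\<lambda>s. incr e A s \<omega> * incr e E s \<omega> / e))"
  shows "smallP (\<lambda>e \<omega>. integral {0..t} (\<lambda>s. H s \<omega> * incr e A s \<omega> * incr e E s \<omega> / e))"
  unfolding smallP_def
proof (intro allI impI)
  fix \<delta>0 \<gamma> :: real assume h: "\<delta>0 > 0" "\<gamma> > 0"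
  note Ac = ext_adapted_cproc[OF A] and Ec = ext_adapted_cproc[OF E] and Hc = ext_adapted_cproc[OF H]
  have g3: "\<gamma> / 3 > 0" "\<delta>0 / 2 > 0" using h by auto
  obtain K where K: "K > 0" "\<forall>\<^sub>F e in at_right 0. \<exists>B\<in>sets M. prob B \<le> \<gamma> / 3 \<and> (\<forall>\<omega>\<in>space M - B. \<bar>approx_qv e A \<omega> + approx_qv e E \<omega>\<bar> \<le> K)"
    using tightP_add[OF tA tE] g3(1) unfolding tightP_def by blast
  \<comment> \<open>The total mass is at most \<open>K / 2\<close>, so the error of the step
    function is at most \<open>\<delta>0 / 2\<close>.\<close>
  define \<kappa> where "\<kappa> = \<delta>0 / K"
  have k: "\<kappa> > 0" using h K by (simp add: \<kappa>_def)
  obtain hh where hh: "hh > 0" "prob (osc_event H hh \<kappa>) \<le> \<gamma> / 3" using osc_event_small[OF H k g3(1)] by auto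
  have modm: "osc_event H hh \<kappa> \<in> sets M" by (rule osc_event_sets[OF Hc])
  obtain n where n: "T / real (Suc n) < hh" using grid_mesh_small[OF hh(1)] by blast
  define p where "p i = t * real i / real (Suc n)" for i
  have p0: "p 0 = 0" and pn: "p (Suc n) = t" by (simp_all add: p_def del: of_nat_Suc)
  have step: "p (Suc i) - p i = t / real (Suc n)" for i
    by (simp add: p_def diff_divide_distrib[symmetric] right_diff_distrib[symmetric])
  have stepb: "0 \<le> p (Suc i) - p i" "p (Suc i) - p i < hh" for i
  proof -
    show "0 \<le> p (Suc i) - p i" unfolding step using t by simp
    have "t / real (Suc n) \<le> T / real (Suc n)" using t by (intro divide_right_mono) auto
    then show "p (Suc i) - p i < hh" unfolding step using n by simp
  qed
  have pm: "p i \<le> p (Suc i)" for i using stepb(1)[of i] by simp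
  have pr: "p i \<in> {0..T}" if "i \<le> Suc n" for i
    using mono_upto[of i p 0] mono_upto[of "Suc n" p i] pm p0 pn that t by auto
  define q where "q u e \<omega> = integral {0..u} (\<lambda>s. incr e A s \<omega> * incr e E s \<omega> / e)" for u e \<omega>
  have Ro: "smallP (\<lambda>e \<omega>. \<Sum>i<Suc n. (q (p (Suc i)) e \<omega> + - q (p i) e \<omega>) * H (p i) \<omega>)"
  proof (rule smallP_sum)
    fix i assume i: "i \<in> {..<Suc n}"
    have 1: "smallP (q u)" if "u \<in> {0..T}" for u using z[OF that] by (simp add: q_def[abs_def])
    have 2: "smallP (\<lambda>e \<omega>. - q u e \<omega>)" if "u \<in> {0..T}" for u by (rule smallP_mono[OF 1[OF that]]) simp
    show "smallP (\<lambda>e \<omega>. (q (p (Suc i)) e \<omega> + - q (p i) e \<omega>) * H (p i) \<omega>)"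
      by (intro smallP_mult_tight smallP_add 1 2 pr tightP_rv cont_adapted_meas_M[OF Hc]) (use i in auto)
  qed simp
  from oPD[OF Ro g3(2,1)] K(2) eventually_at_right_less[of 0]
  show "\<forall>\<^sub>F e in at_right 0. \<exists>B\<in>sets M. prob B \<le> \<gamma> \<and>
     (\<forall>\<omega>\<in>space M - B. \<bar>integral {0..t} (\<lambda>s. H s \<omega> * incr e A s \<omega> * incr e E s \<omega> / e)\<bar> \<le> \<delta>0)"
  proof eventually_elim
    case (elim e)
    then obtain B1 B2 where B1: "B1 \<in> sets M" "prob B1 \<le> \<gamma> / 3"
       "\<And>\<omega>. \<omega> \<in> space M - B1 \<Longrightarrow> \<bar>\<Sum>i<Suc n. (q (p (Suc i)) e \<omega> + - q (p i) e \<omega>) * H (p i) \<omega>\<bar> \<le> \<delta>0 / 2"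
      and B2: "B2 \<in> sets M" "prob B2 \<le> \<gamma> / 3" "\<And>\<omega>. \<omega> \<in> space M - B2 \<Longrightarrow> \<bar>approx_qv e A \<omega> + approx_qv e E \<omega>\<bar> \<le> K"
      by blast
    have "\<bar>integral {0..t} (\<lambda>s. H s \<omega> * incr e A s \<omega> * incr e E s \<omega> / e)\<bar> \<le> \<delta>0"
      if w: "\<omega> \<in> space M - (B1 \<union> B2 \<union> osc_event H hh \<kappa>)" for \<omega>
    proof -
      have ws: "\<omega> \<in> space M" using w by simp
      let ?f = "\<lambda>s. incr e A s \<omega> * incr e E s \<omega> / e"
      have fc: "continuous_on X ?f" for X
        unfolding divide_inverse by (intro continuous_on_mult incr_cont Ac Ec ws continuous_on_const)
      have "\<bar>integral {0..p (Suc n)} (\<lambda>s. H s \<omega> * ?f s) - (\<Sum>i<Suc n. H (p i) \<omega> * (integral {0..p (Suc i)} ?f - integral {0..p i} ?f))\<bar>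
         \<le> \<kappa> * integral {0..p (Suc n)} (\<lambda>s. \<bar>?f s\<bar>)"
      proof (rule riemann_weight_bound[OF p0 pm fc cont_adapted_cont[OF Hc ws]])
        fix i s assume s: "s \<in> {p i..p (Suc i)}"
        then have "\<bar>s - p i\<bar> < hh" using stepb(2)[of i] by auto
        then show "\<bar>H s \<omega> - H (p i) \<omega>\<bar> \<le> \<kappa>" using not_osc_event[of \<omega> H hh \<kappa> s "p i"] w by auto
      qed
      moreover have "(\<Sum>i<Suc n. H (p i) \<omega> * (integral {0..p (Suc i)} ?f - integral {0..p i} ?f)) =
         (\<Sum>i<Suc n. (q (p (Suc i)) e \<omega> + - q (p i) e \<omega>) * H (p i) \<omega>)"
        by (rule sum.cong) (simp_all add: q_def)
      moreover have "\<kappa> * integral {0..t} (\<lambda>s. \<bar>?f s\<bar>) \<le> \<delta>0 / 2"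
      proof -
        have "integral {0..t} (\<lambda>s. \<bar>?f s\<bar>) \<le> integral {0..T} (\<lambda>s. \<bar>?f s\<bar>)"
          by (rule integral_mono_upper(2)[OF continuous_on_rabs[OF fc] _ t]) auto
        also have "\<dots> = integral {0..T} (\<lambda>s. \<bar>incr e A s \<omega> * incr e E s \<omega>\<bar> / e)" using elim by (simp add: abs_mult)
        also have "\<dots> \<le> (approx_qv e A \<omega> + approx_qv e E \<omega>) / 2"
          by (rule product_integral_bound[OF ws Ac Ec]) (use elim in simp)
        also have "\<dots> \<le> K / 2" using B2(3)[of \<omega>] w by auto
        finally have "\<kappa> * integral {0..t} (\<lambda>s. \<bar>?f s\<bar>) \<le> \<kappa> * (K / 2)" using k by (intro mult_left_mono) auto
        then show ?thesis using K by (simp add: \<kappa>_def)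
      qed
      moreover have "\<bar>\<Sum>i<Suc n. (q (p (Suc i)) e \<omega> + - q (p i) e \<omega>) * H (p i) \<omega>\<bar> \<le> \<delta>0 / 2"
        using B1(3)[of \<omega>] w by auto
      ultimately have "\<bar>integral {0..t} (\<lambda>s. H s \<omega> * ?f s)\<bar> \<le> \<delta>0" unfolding pn by linarith
      then show ?thesis by (simp add: mult.assoc)
    qed
    moreover have "B1 \<union> B2 \<union> osc_event H hh \<kappa> \<in> sets M" "prob (B1 \<union> B2 \<union> osc_event H hh \<kappa>) \<le> \<gamma>"
      using prob_Un3_le[OF B1(1) B2(1) modm] B1 B2 modm hh(2) by auto
    ultimately show ?case by blast
  qed
qed

end

section \<open>Functionals of the window\<close>

definition unif_cont_bdd :: "(real \<Rightarrow> real) \<Rightarrow> bool" where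
  "unif_cont_bdd x \<longleftrightarrow> (\<exists>B. \<forall>t. \<bar>x t\<bar> \<le> B) \<and> (\<forall>\<delta>>0. \<exists>h>0. \<forall>s u. \<bar>s - u\<bar> < h \<longrightarrow> \<bar>x s - x u\<bar> < \<delta>)"

text \<open>The window at time \<open>u\<close> of the path \<open>x\<close> frozen at time \<open>v\<close>.\<close>
definition frozen_window :: "real \<Rightarrow> (real \<Rightarrow> real) \<Rightarrow> real \<Rightarrow> real \<Rightarrow> (real \<Rightarrow>\<^sub>C real)" where
  "frozen_window \<tau> x u v = Bcontfun (\<lambda>y. x (min (u + clamp \<tau> y) v))"

lemma unif_cont_bdd_cont: "unif_cont_bdd x \<Longrightarrow> continuous_on A x"
  unfolding unif_cont_bdd_def continuous_on_iff dist_real_def by meson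

lemma clamp_cont: "continuous_on A (clamp \<tau>)"
  unfolding clamp_def[abs_def] by (intro continuous_on_max continuous_on_min continuous_on_const continuous_on_id)

lemma clamp_range: "\<tau> > 0 \<Longrightarrow> clamp \<tau> y \<in> {-\<tau>..0}"
  by (auto simp: clamp_def)

lemma clamp_id: "y \<in> {-\<tau>..0} \<Longrightarrow> clamp \<tau> y = y"
  by (auto simp: clamp_def)

lemma clamp_clamp: "\<tau> > 0 \<Longrightarrow> clamp \<tau> (clamp \<tau> y) = clamp \<tau> y"
  by (auto simp: clamp_def)

lemma frozen_window_apply:
  assumes "unif_cont_bdd x"
  shows "apply_bcontfun (frozen_window \<tau> x u v) y = x (min (u + clamp \<tau> y) v)"
proof -
  have "continuous_on UNIV (\<lambda>y. x (min (u + clamp \<tau> y) v))"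
    by (rule continuous_on_compose2[OF unif_cont_bdd_cont[OF assms, of UNIV]])
      (auto intro!: continuous_on_min continuous_on_add continuous_on_const clamp_cont)
  moreover obtain B where "\<forall>t. \<bar>x t\<bar> \<le> B" using assms by (auto simp: unif_cont_bdd_def)
  ultimately have "(\<lambda>y. x (min (u + clamp \<tau> y) v)) \<in> bcontfun"
    by (intro bcontfun_normI[of _ B]) auto
  then show ?thesis unfolding frozen_window_def by (simp add: Bcontfun_inverse)
qed

lemma frozen_window_Cpath: "unif_cont_bdd x \<Longrightarrow> \<tau> > 0 \<Longrightarrow> frozen_window \<tau> x u v \<in> Cpath \<tau>"
  unfolding Cpath_def by (simp add: frozen_window_apply clamp_clamp)

lemma frozen_window_dist:
  assumes x: "unif_cont_bdd x" and m: "\<forall>s u. \<bar>s - u\<bar> < h \<longrightarrow> \<bar>x s - x u\<bar> \<le> \<delta>"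
    and "\<bar>u - u'\<bar> < h" "\<bar>v - v'\<bar> < h"
  shows "dist (frozen_window \<tau> x u v) (frozen_window \<tau> x u' v') \<le> \<delta>"
proof (rule dist_bound)
  fix y
  have "\<bar>min (u + clamp \<tau> y) v - min (u' + clamp \<tau> y) v'\<bar> < h" using assms(3,4) by (auto simp: min_def)
  then show "dist (apply_bcontfun (frozen_window \<tau> x u v) y) (apply_bcontfun (frozen_window \<tau> x u' v') y) \<le> \<delta>"
    using m by (simp add: frozen_window_apply[OF x] dist_real_def)
qed

lemma frozen_window_cont:
  assumes x: "unif_cont_bdd x"
  shows "continuous_on A (\<lambda>z. frozen_window \<tau> x (fst z) (snd z))"
  unfolding continuous_on_iff
proof (intro ballI allI impI)
  fix z e assume "0 < (e::real)"
  then obtain h where h: "h > 0" "\<forall>s u. \<bar>s - u\<bar> < h \<longrightarrow> \<bar>x s - x u\<bar> < e / 2"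
    using x unfolding unif_cont_bdd_def by (meson half_gt_zero)
  have "dist (frozen_window \<tau> x (fst z') (snd z')) (frozen_window \<tau> x (fst z) (snd z)) < e" if "dist z' z < h" for z'
  proof -
    have "\<bar>fst z' - fst z\<bar> < h" "\<bar>snd z' - snd z\<bar> < h"
      using that dist_fst_le[of z' z] dist_snd_le[of z' z] by (auto simp: dist_real_def)
    then have "dist (frozen_window \<tau> x (fst z') (snd z')) (frozen_window \<tau> x (fst z) (snd z)) \<le> e / 2"
      using h(2) by (intro frozen_window_dist[OF x, of h]) (auto intro: less_imp_le)
    then show ?thesis using \<open>0 < e\<close> by simp
  qed
  then show "\<exists>d>0. \<forall>z'\<in>A. dist z' z < d \<longrightarrow> dist (frozen_window \<tau> x (fst z') (snd z')) (frozen_window \<tau> x (fst z) (snd z)) < e"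
    using h(1) by blast
qed

lemma Cpath_combine: "\<eta> \<in> Cpath \<tau> \<Longrightarrow> \<zeta> \<in> Cpath \<tau> \<Longrightarrow> \<eta> + \<rho> *\<^sub>R (\<zeta> - \<eta>) \<in> Cpath \<tau>"
  unfolding Cpath_def by simp

lemma Cpath_sum: "finite A \<Longrightarrow> (\<And>k. k \<in> A \<Longrightarrow> b k \<in> Cpath \<tau>) \<Longrightarrow> (\<Sum>k\<in>A. c k *\<^sub>R b k) \<in> Cpath \<tau>"
proof (induction A rule: finite_induct)
  case (insert k A)
  then have "b k \<in> Cpath \<tau>" "(\<Sum>k\<in>A. c k *\<^sub>R b k) \<in> Cpath \<tau>" by auto
  then have "c k *\<^sub>R b k + (\<Sum>k\<in>A. c k *\<^sub>R b k) \<in> Cpath \<tau>" unfolding Cpath_def by simp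
  then show ?case using insert by simp
qed (simp add: Cpath_def)

lemma apply_bcontfun_sum: "apply_bcontfun (\<Sum>k\<in>A. f k) y = (\<Sum>k\<in>A. apply_bcontfun (f k) y)"
  for f :: "'c \<Rightarrow> real \<Rightarrow>\<^sub>C real"
  by (induction A rule: infinite_finite_induct) auto

text \<open>Bernstein approximation makes a continuous functional of a path a limit of continuous functions of
  finitely many values of the path.\<close>
lemma Cpath_functional_measurable:
  fixes f :: "(real \<Rightarrow>\<^sub>C real) \<Rightarrow> real" and P :: "'a \<Rightarrow> (real \<Rightarrow>\<^sub>C real)"
  assumes tau: "\<tau> > 0" and f: "continuous_on (Cpath \<tau>) f"
    and P: "\<And>\<omega>. \<omega> \<in> space S \<Longrightarrow> P \<omega> \<in> Cpath \<tau>"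
    and m: "\<And>y. (\<lambda>\<omega>. apply_bcontfun (P \<omega>) y) \<in> borel_measurable S"
  shows "(\<lambda>\<omega>. f (P \<omega>)) \<in> borel_measurable S"
proof -
  \<comment> \<open>The Bernstein basis transported from [0,1] to [-\<tau>,0]; clamping places it in
    \<open>Cpath \<tau>\<close>.\<close>
  define b where "b n k = Bcontfun (\<lambda>y. Bernstein n k (1 + clamp \<tau> y / \<tau>))" for n k
  have cb: "1 + clamp \<tau> y / \<tau> \<in> {0..1}" for y
    using clamp_range[OF tau, of y] tau by (auto simp: field_simps)
  have b_apply: "apply_bcontfun (b n k) y = Bernstein n k (1 + clamp \<tau> y / \<tau>)" for n k y
  proof -
    have "continuous_on UNIV (\<lambda>y. Bernstein n k (1 + clamp \<tau> y / \<tau>))"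
      unfolding Bernstein_def divide_inverse
      by (intro continuous_on_mult continuous_on_power continuous_on_diff continuous_on_add continuous_on_const clamp_cont)
    moreover have "norm (Bernstein n k (1 + clamp \<tau> y / \<tau>)) \<le> real (n choose k)" for y
    proof -
      have "0 \<le> 1 + clamp \<tau> y / \<tau>" "1 + clamp \<tau> y / \<tau> \<le> 1" using cb[of y] by auto
      then have "\<bar>1 + clamp \<tau> y / \<tau>\<bar> ^ k \<le> 1" "\<bar>1 - (1 + clamp \<tau> y / \<tau>)\<bar> ^ (n - k) \<le> 1"
        by (intro power_le_one; simp)+
      then have "\<bar>1 + clamp \<tau> y / \<tau>\<bar> ^ k * \<bar>1 - (1 + clamp \<tau> y / \<tau>)\<bar> ^ (n - k) \<le> 1 * 1"
        by (intro mult_mono) auto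
      then have "real (n choose k) * (\<bar>1 + clamp \<tau> y / \<tau>\<bar> ^ k * \<bar>1 - (1 + clamp \<tau> y / \<tau>)\<bar> ^ (n - k)) \<le> real (n choose k) * 1"
        by (intro mult_left_mono) auto
      then show ?thesis by (simp only: Bernstein_def real_norm_def abs_mult power_abs abs_of_nat mult.assoc mult_1_right)
    qed
    ultimately have "(\<lambda>y. Bernstein n k (1 + clamp \<tau> y / \<tau>)) \<in> bcontfun" by (rule bcontfun_normI)
    then show ?thesis by (simp add: b_def Bcontfun_inverse)
  qed
  have bC: "b n k \<in> Cpath \<tau>" for n k unfolding Cpath_def by (simp add: b_apply clamp_clamp[OF tau])
  \<comment> \<open>Composed with \<open>Q n\<close>, the functional is a continuous function of the
    coefficient sequence in the product topology. The coefficients are finitely many values of the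
    path, sampled by \<open>v\<close> at equidistant points of the window.\<close>
  define Q where "Q n z = (\<Sum>k\<le>n. z k *\<^sub>R b n k)" for n and z :: "nat \<Rightarrow> real"
  define v where "v n \<omega> k = apply_bcontfun (P \<omega>) (\<tau> * (real k / real n - 1))" for n \<omega> and k :: nat
  have QC: "Q n z \<in> Cpath \<tau>" for n z unfolding Q_def by (rule Cpath_sum) (auto simp: bC)
  have Qcont: "continuous_on UNIV (Q n)" for n
    unfolding Q_def[abs_def] by (intro continuous_on_sum continuous_on_scaleR continuous_on_product_coordinates continuous_on_const)
  have "continuous_on UNIV (\<lambda>z. f (Q n z))" for n
    by (rule continuous_on_compose2[OF f Qcont]) (use QC in auto)
  then have fm: "(\<lambda>z. f (Q n z)) \<in> borel_measurable borel" for n by (rule borel_measurable_continuous_onI)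
  have vm: "v n \<in> borel_measurable S" for n
    by (rule measurable_coordinatewise_then_product) (simp add: v_def m)
  show ?thesis
  proof (rule borel_measurable_LIMSEQ_real)
    show "(\<lambda>\<omega>. f (Q n (v n \<omega>))) \<in> borel_measurable S" for n
      by (rule measurable_compose[OF vm fm])
    fix \<omega> assume w: "\<omega> \<in> space S"
    have "(\<lambda>n. Q n (v n \<omega>)) \<longlonglongrightarrow> P \<omega>"
    proof (rule metric_LIMSEQ_I)
      fix e :: real assume "0 < e"
      then have e: "e / 2 > 0" by simp
      define g where "g z = apply_bcontfun (P \<omega>) (\<tau> * (z - 1))" for z
      have "continuous_on {0..1} g" unfolding g_def
        by (rule continuous_on_compose2[OF continuous_on_apply_bcontfun[of UNIV]])
          (auto intro!: continuous_on_mult continuous_on_diff continuous_on_const continuous_on_id)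
      from Bernstein_Weierstrass[OF this e] obtain N where N: "\<And>n z. N \<le> n \<Longrightarrow> z \<in> {0..1} \<Longrightarrow>
          \<bar>g z - (\<Sum>k\<le>n. g (real k / real n) * Bernstein n k z)\<bar> < e / 2" by blast
      have "dist (Q n (v n \<omega>)) (P \<omega>) < e" if n: "n \<ge> N" for n
      proof -
        have "dist (Q n (v n \<omega>)) (P \<omega>) \<le> e / 2"
        proof (rule dist_bound)
          fix y
          have "apply_bcontfun (P \<omega>) y = apply_bcontfun (P \<omega>) (clamp \<tau> y)" using P[OF w] by (simp add: Cpath_def)
          also have "\<dots> = g (1 + clamp \<tau> y / \<tau>)" using tau by (simp add: g_def)
          finally have "apply_bcontfun (P \<omega>) y = g (1 + clamp \<tau> y / \<tau>)" .
          moreover have "apply_bcontfun (Q n (v n \<omega>)) y = (\<Sum>k\<le>n. g (real k / real n) * Bernstein n k (1 + clamp \<tau> y / \<tau>))"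
            by (simp add: Q_def apply_bcontfun_sum b_apply v_def g_def)
          ultimately show "dist (apply_bcontfun (Q n (v n \<omega>)) y) (apply_bcontfun (P \<omega>) y) \<le> e / 2"
            using N[OF n cb[of y]] by (simp add: dist_real_def abs_minus_commute)
        qed
        then show ?thesis using \<open>0 < e\<close> by simp
      qed
      then show "\<exists>N. \<forall>n\<ge>N. dist (Q n (v n \<omega>)) (P \<omega>) < e" by blast
    qed
    then show "(\<lambda>n. f (Q n (v n \<omega>))) \<longlonglongrightarrow> f (P \<omega>)"
      by (rule continuous_on_tendsto_compose[OF f _ P[OF w]]) (simp add: QC)
  qed
qed

text \<open>Points with values beyond every integer would accumulate at a point of \<open>K\<close>,
  near which \<beta> is bounded.\<close>

lemma locally_bounded_compact:
  fixes \<beta> :: "'b::metric_space \<Rightarrow> real"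
  assumes K: "compact K" and l: "\<And>x. x \<in> K \<Longrightarrow> \<exists>d>0. \<exists>B. \<forall>y\<in>K. dist y x < d \<longrightarrow> \<beta> y \<le> B"
  shows "\<exists>B. \<forall>y\<in>K. \<beta> y \<le> B"
proof (rule ccontr)
  assume "\<not> (\<exists>B. \<forall>y\<in>K. \<beta> y \<le> B)"
  then have "\<forall>n::nat. \<exists>y. y \<in> K \<and> real n < \<beta> y" by (meson not_le)
  then obtain y where y: "\<And>n. y n \<in> K" "\<And>n. real n < \<beta> (y n)" by metis
  obtain x r where x: "x \<in> K" "strict_mono r" "(y \<circ> r) \<longlonglongrightarrow> x"
    using K y(1) unfolding compact_def by blast
  obtain d B where d: "d > 0" "\<And>z. z \<in> K \<Longrightarrow> dist z x < d \<Longrightarrow> \<beta> z \<le> B" using l[OF x(1)] by blast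
  have "\<forall>\<^sub>F n in sequentially. dist ((y \<circ> r) n) x < d" using tendstoD[OF x(3) d(1)] .
  moreover obtain n0 :: nat where "B < real n0" using reals_Archimedean2 by blast
  ultimately obtain n where n: "n \<ge> n0" "dist (y (r n)) x < d"
    unfolding eventually_sequentially by (metis comp_apply max.cobounded1 max.cobounded2)
  have "real n0 \<le> real (r n)" using n(1) seq_suble[OF x(2), of n] by simp
  then have "B < \<beta> (y (r n))" using y(2)[of "r n"] \<open>B < real n0\<close> by linarith
  then show False using d(2)[OF y(1) n(2)] by simp
qed

section \<open>Estimates for the functional along a single path\<close>

locale path_functional =
  fixes T \<tau> :: real and N :: nat and a :: "nat \<Rightarrow> real"
    and F :: "real \<Rightarrow> (real \<Rightarrow>\<^sub>C real) \<Rightarrow> real"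
    and Dl :: "real \<Rightarrow> (real \<Rightarrow>\<^sub>C real) \<Rightarrow> nat \<Rightarrow> real"
    and Dg :: "real \<Rightarrow> (real \<Rightarrow>\<^sub>C real) \<Rightarrow> real \<Rightarrow> real"
  assumes T0: "T > 0" and tau: "\<tau> > 0"
    and a0: "a 0 = 0" and aN: "a N = - \<tau>" and a_dec: "\<forall>i<N. a (Suc i) < a i"
    and F_cont: "continuous_on ({0..T} \<times> Cpath \<tau>) (\<lambda>(t, \<eta>). F t \<eta>)"
    and F_deriv: "\<forall>t\<in>{0..T}. \<forall>\<eta>\<in>Cpath \<tau>. in_L2 \<tau> (Dg t \<eta>) \<and>
           (F t has_derivative Da_L2_apply \<tau> N a (Dl t \<eta>) (Dg t \<eta>)) (at \<eta> within Cpath \<tau>)"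
    and D_cont: "\<forall>t\<in>{0..T}. \<forall>\<eta>\<in>Cpath \<tau>. \<forall>e>0. \<exists>d>0. \<forall>t'\<in>{0..T}. \<forall>\<eta>'\<in>Cpath \<tau>.
           \<bar>t' - t\<bar> < d \<and> dist \<eta>' \<eta> < d \<longrightarrow>
           Da_L2_dist2 \<tau> N (Dl t' \<eta>') (Dg t' \<eta>') (Dl t \<eta>) (Dg t \<eta>) < e\<^sup>2"
begin

lemma a_bounds: "0 < N" "1 \<le> i \<Longrightarrow> i \<le> N \<Longrightarrow> a i \<le> a 1" "i \<le> N \<Longrightarrow> - \<tau> \<le> a i" "a 1 < 0"
proof -
  show N: "0 < N" using a0 aN tau by (cases N) auto
  have dec: "a j \<le> a i" if "i \<le> j" "j \<le> N" for i j
    using that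
  proof (induction j rule: dec_induct)
    case (step n)
    then have "a n \<le> a i" "a (Suc n) < a n" using a_dec by auto
    then show ?case by simp
  qed simp
  show "1 \<le> i \<Longrightarrow> i \<le> N \<Longrightarrow> a i \<le> a 1" by (rule dec)
  show "i \<le> N \<Longrightarrow> - \<tau> \<le> a i" using dec[of i N] aN by simp
  show "a 1 < 0" using a_dec N a0 by auto
qed

lemma in_L2_diff:
  assumes "in_L2 \<tau> f" "in_L2 \<tau> g"
  shows "set_integrable lborel {-\<tau>..0} (\<lambda>x. (f x - g x)\<^sup>2)"
proof -
  have m: "f \<in> borel_measurable lborel" "g \<in> borel_measurable lborel" using assms by (auto simp: in_L2_def)
  have "set_integrable lborel {-\<tau>..0} (\<lambda>x. 2 * (f x)\<^sup>2 + 2 * (g x)\<^sup>2)"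
    using assms unfolding in_L2_def by (intro set_integral_add set_integrable_mult_right) auto
  then show ?thesis
  proof (rule set_integrable_bound)
    show "set_borel_measurable lborel {-\<tau>..0} (\<lambda>x. (f x - g x)\<^sup>2)"
      unfolding set_borel_measurable_def using m by measurable
    show "AE x in lborel. x \<in> {-\<tau>..0} \<longrightarrow> norm ((f x - g x)\<^sup>2) \<le> norm (2 * (f x)\<^sup>2 + 2 * (g x)\<^sup>2)"
    proof (intro AE_I2 impI)
      fix x
      have "0 \<le> (f x + g x)\<^sup>2" by simp
      then have "(f x - g x)\<^sup>2 \<le> 2 * (f x)\<^sup>2 + 2 * (g x)\<^sup>2" by (simp add: power2_sum power2_diff)
      then show "norm ((f x - g x)\<^sup>2) \<le> norm (2 * (f x)\<^sup>2 + 2 * (g x)\<^sup>2)" by simp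
    qed
  qed
qed

text \<open>The mass at 0 is one coordinate of the Hilbert norm, so it inherits the continuity of
  the derivative.\<close>

lemma Dl_cont: "continuous_on ({0..T} \<times> Cpath \<tau>) (\<lambda>z. Dl (fst z) (snd z) 0)"
  unfolding continuous_on_iff
proof (intro ballI allI impI)
  fix z e assume z: "z \<in> {0..T} \<times> Cpath \<tau>" and e: "0 < (e::real)"
  then obtain d where d: "d > 0" "\<And>t' \<eta>'. t' \<in> {0..T} \<Longrightarrow> \<eta>' \<in> Cpath \<tau> \<Longrightarrow> \<bar>t' - fst z\<bar> < d \<Longrightarrow> dist \<eta>' (snd z) < d \<Longrightarrow>
      Da_L2_dist2 \<tau> N (Dl t' \<eta>') (Dg t' \<eta>') (Dl (fst z) (snd z)) (Dg (fst z) (snd z)) < e\<^sup>2"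
    using D_cont by (metis mem_Times_iff)
  have "dist (Dl (fst z') (snd z') 0) (Dl (fst z) (snd z) 0) < e" if z': "z' \<in> {0..T} \<times> Cpath \<tau>" "dist z' z < d" for z'
  proof -
    have "\<bar>fst z' - fst z\<bar> < d" "dist (snd z') (snd z) < d"
      using z'(2) dist_fst_le[of z' z] dist_snd_le[of z' z] by (auto simp: dist_real_def)
    then have D: "Da_L2_dist2 \<tau> N (Dl (fst z') (snd z')) (Dg (fst z') (snd z')) (Dl (fst z) (snd z)) (Dg (fst z) (snd z)) < e\<^sup>2"
      using z'(1) by (intro d) auto
    have "(Dl (fst z') (snd z') 0 - Dl (fst z) (snd z) 0)\<^sup>2 \<le> (\<Sum>i\<le>N. (Dl (fst z') (snd z') i - Dl (fst z) (snd z) i)\<^sup>2)"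
      by (rule member_le_sum[where f = "\<lambda>i. (Dl (fst z') (snd z') i - Dl (fst z) (snd z) i)\<^sup>2"]) auto
    moreover have "0 \<le> (LINT x:{-\<tau>..0}|lborel. (Dg (fst z') (snd z') x - Dg (fst z) (snd z) x)\<^sup>2)"
      unfolding set_lebesgue_integral_def by (rule integral_nonneg_AE) auto
    ultimately have "(Dl (fst z') (snd z') 0 - Dl (fst z) (snd z) 0)\<^sup>2 < e\<^sup>2"
      using D unfolding Da_L2_dist2_def by linarith
    then show ?thesis unfolding dist_real_def using e by (metis abs_le_square_iff abs_of_pos not_less)
  qed
  then show "\<exists>d>0. \<forall>z'\<in>{0..T} \<times> Cpath \<tau>. dist z' z < d \<longrightarrow> dist (Dl (fst z') (snd z') 0) (Dl (fst z) (snd z) 0) < e"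
    using d(1) by blast
qed

text \<open>Where the derivative moves by less than 1 in norm, the squared L2 norm of the density is
  at most twice its value at the centre plus 2. Compactness makes these local bounds
  uniform.\<close>

lemma Dg_bounded:
  assumes K: "compact K" "K \<subseteq> {0..T} \<times> Cpath \<tau>"
  shows "\<exists>B. \<forall>z\<in>K. (LINT x:{-\<tau>..0}|lborel. (Dg (fst z) (snd z) x)\<^sup>2) \<le> B"
proof (rule locally_bounded_compact[OF K(1)])
  fix z assume "z \<in> K"
  then have z: "z \<in> {0..T} \<times> Cpath \<tau>" using K by auto
  then obtain d where d: "d > 0" "\<And>t' \<eta>'. t' \<in> {0..T} \<Longrightarrow> \<eta>' \<in> Cpath \<tau> \<Longrightarrow> \<bar>t' - fst z\<bar> < d \<Longrightarrow> dist \<eta>' (snd z) < d \<Longrightarrow>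
      Da_L2_dist2 \<tau> N (Dl t' \<eta>') (Dg t' \<eta>') (Dl (fst z) (snd z)) (Dg (fst z) (snd z)) < 1\<^sup>2"
    using D_cont by (metis mem_Times_iff zero_less_one)
  let ?n = "\<lambda>g. (LINT x:{-\<tau>..0}|lborel. (g x)\<^sup>2)"
  have "?n (Dg (fst z') (snd z')) \<le> 2 * ?n (Dg (fst z) (snd z)) + 2" if z': "z' \<in> K" "dist z' z < d" for z'
  proof -
    let ?g' = "Dg (fst z') (snd z')" and ?g = "Dg (fst z) (snd z)"
    have z'K: "z' \<in> {0..T} \<times> Cpath \<tau>" using K z' by auto
    have L: "in_L2 \<tau> ?g'" "in_L2 \<tau> ?g" using F_deriv z z'K by auto
    have "\<bar>fst z' - fst z\<bar> < d" "dist (snd z') (snd z) < d"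
      using z'(2) dist_fst_le[of z' z] dist_snd_le[of z' z] by (auto simp: dist_real_def)
    then have D: "Da_L2_dist2 \<tau> N (Dl (fst z') (snd z')) ?g' (Dl (fst z) (snd z)) ?g < 1"
      using z'K d(2)[of "fst z'" "snd z'"] by auto
    have "0 \<le> (\<Sum>i\<le>N. (Dl (fst z') (snd z') i - Dl (fst z) (snd z) i)\<^sup>2)" by (rule sum_nonneg) simp
    then have D': "(LINT x:{-\<tau>..0}|lborel. (?g' x - ?g x)\<^sup>2) \<le> 1" using D unfolding Da_L2_dist2_def by linarith
    have i: "set_integrable lborel {-\<tau>..0} (\<lambda>x. (?g' x)\<^sup>2)" "set_integrable lborel {-\<tau>..0} (\<lambda>x. (?g x)\<^sup>2)"
      "set_integrable lborel {-\<tau>..0} (\<lambda>x. (?g' x - ?g x)\<^sup>2)"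
      using L in_L2_diff[OF L] by (auto simp: in_L2_def)
    have "?n ?g' \<le> (LINT x:{-\<tau>..0}|lborel. 2 * (?g x)\<^sup>2 + 2 * (?g' x - ?g x)\<^sup>2)"
    proof (rule set_integral_mono)
      show "set_integrable lborel {-\<tau>..0} (\<lambda>x. 2 * (?g x)\<^sup>2 + 2 * (?g' x - ?g x)\<^sup>2)"
        using i by (intro set_integral_add set_integrable_mult_right) auto
      fix x
      have "0 \<le> (?g' x - 2 * ?g x)\<^sup>2" by simp
      then show "(?g' x)\<^sup>2 \<le> 2 * (?g x)\<^sup>2 + 2 * (?g' x - ?g x)\<^sup>2"
        by (simp add: power2_diff power_mult_distrib algebra_simps)
    qed (rule i)
    also have "\<dots> = 2 * ?n ?g + 2 * (LINT x:{-\<tau>..0}|lborel. (?g' x - ?g x)\<^sup>2)"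
      using i by (subst set_integral_add) auto
    finally show ?thesis using D' by simp
  qed
  then show "\<exists>d>0. \<exists>B. \<forall>y\<in>K. dist y z < d \<longrightarrow> ?n (Dg (fst y) (snd y)) \<le> B"
    using d(1) by blast
qed

lemma F_window_cont:
  assumes x: "unif_cont_bdd x"
  shows "continuous_on ({0..T} \<times> A) (\<lambda>z. F (fst z) (frozen_window \<tau> x (fst z) (snd z)))"
proof -
  have 1: "continuous_on ({0..T} \<times> A) (\<lambda>z. (fst z, frozen_window \<tau> x (fst z) (snd z)))"
    by (intro continuous_on_Pair continuous_on_fst continuous_on_id frozen_window_cont[OF x])
  have 2: "(\<lambda>z. (fst z, frozen_window \<tau> x (fst z) (snd z))) ` ({0..T} \<times> A) \<subseteq> {0..T} \<times> Cpath \<tau>"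
    using frozen_window_Cpath[OF x tau] by auto
  from continuous_on_compose2[OF F_cont 1 2] show ?thesis by (simp add: split_beta')
qed

text \<open>The straight line from the window frozen at \<open>s\<close> to the true window at time
  \<open>u\<close>, along which the mean value theorem is applied. For \<open>s = u\<close> it
  degenerates to a point.\<close>

definition segment :: "(real \<Rightarrow> real) \<Rightarrow> real \<Rightarrow> real \<Rightarrow> real \<Rightarrow> (real \<Rightarrow>\<^sub>C real)" where
  "segment x u s \<rho> = frozen_window \<tau> x u s + \<rho> *\<^sub>R (frozen_window \<tau> x u u - frozen_window \<tau> x u s)"

lemma segment_Cpath: "unif_cont_bdd x \<Longrightarrow> segment x u s \<rho> \<in> Cpath \<tau>"
  unfolding segment_def by (intro Cpath_combine frozen_window_Cpath tau)

lemma segment_cont: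
  assumes x: "unif_cont_bdd x"
  shows "continuous_on A (\<lambda>z. (fst z, segment x (fst z) (fst (snd z)) (snd (snd z))))"
proof -
  note fc = frozen_window_cont[OF x, of UNIV \<tau>]
  have 1: "continuous_on A (\<lambda>z::real \<times> real \<times> real. frozen_window \<tau> x (fst z) (fst (snd z)))"
    using continuous_on_compose2[OF fc, of A "\<lambda>z. (fst z, fst (snd z))"]
    by (simp add: continuous_on_Pair continuous_on_fst continuous_on_snd continuous_on_id)
  have 2: "continuous_on A (\<lambda>z::real \<times> real \<times> real. frozen_window \<tau> x (fst z) (fst z))"
    using continuous_on_compose2[OF fc, of A "\<lambda>z. (fst z, fst z)"]
    by (simp add: continuous_on_Pair continuous_on_fst continuous_on_id)
  show ?thesis unfolding segment_def
    by (intro continuous_on_Pair continuous_on_add continuous_on_scaleR continuous_on_diff 1 2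
        continuous_on_fst continuous_on_snd continuous_on_id)
qed

text \<open>Freezing is jointly continuous in both times, so \<open>F u\<close> at the window frozen
  at \<open>v\<close> is uniformly continuous on the compact square of pairs
  \<open>(u, v)\<close>.\<close>

lemma frozen_increment_small:
  assumes x: "unif_cont_bdd x" and d: "\<delta> > 0"
  shows "\<exists>e0>0. \<forall>s\<in>{0..T}. \<forall>u\<in>{0..T}. \<bar>u - s\<bar> < e0 \<longrightarrow>
    \<bar>F u (frozen_window \<tau> x u s) - F s (frozen_window \<tau> x s s)\<bar> \<le> \<delta>"
proof -
  have "uniformly_continuous_on ({0..T} \<times> {0..T}) (\<lambda>z. F (fst z) (frozen_window \<tau> x (fst z) (snd z)))"
    by (rule compact_uniformly_continuous[OF F_window_cont[OF x]]) (intro compact_Times compact_Icc)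
  then obtain e0 where e0: "e0 > 0" "\<And>z z'. z \<in> {0..T} \<times> {0..T} \<Longrightarrow> z' \<in> {0..T} \<times> {0..T} \<Longrightarrow> dist z' z < e0 \<Longrightarrow>
     dist (F (fst z') (frozen_window \<tau> x (fst z') (snd z'))) (F (fst z) (frozen_window \<tau> x (fst z) (snd z))) < \<delta>"
    unfolding uniformly_continuous_on_def using d by metis
  have "\<bar>F u (frozen_window \<tau> x u s) - F s (frozen_window \<tau> x s s)\<bar> \<le> \<delta>" if "s \<in> {0..T}" "u \<in> {0..T}" "\<bar>u - s\<bar> < e0" for s u
    using e0(2)[of "(s, s)" "(u, s)"] that by (simp add: dist_Pair_Pair dist_real_def)
  then show ?thesis using e0(1) by blast
qed

text \<open>Cauchy-Schwarz on [-e,0], carried out pointwise as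
  \<open>|g| \<le> (sqrt e * g\<^sup>2 + 1 / sqrt e) / 2\<close>; both terms integrate to order sqrt
  e.\<close>

lemma L2_short_bound:
  assumes g: "in_L2 \<tau> g" and G: "(LINT x:{-\<tau>..0}|lborel. (g x)\<^sup>2) \<le> B" and e: "0 < e" "e < \<tau>"
    and w: "\<And>y. y \<in> {-\<tau>..0} \<Longrightarrow> \<bar>w y\<bar> \<le> (if - e \<le> y then \<kappa> else 0)" and k: "0 \<le> \<kappa>"
  shows "\<bar>LINT y:{-\<tau>..0}|lborel. g y * w y\<bar> \<le> \<kappa> * sqrt e * (B + 1) / 2"
proof -
  have gm: "g \<in> borel_measurable lborel" and gi: "set_integrable lborel {-\<tau>..0} (\<lambda>x. (g x)\<^sup>2)"
    using g by (auto simp: in_L2_def)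
  let ?b = "\<lambda>y. \<kappa> / 2 * (sqrt e * (g y)\<^sup>2 + indicator {-e..0} y / sqrt e)"
  have ii: "set_integrable lborel {-\<tau>..0} (\<lambda>y. indicator {-e..0} y :: real)"
  proof -
    have "set_integrable lborel {-e..0} (\<lambda>y. 1::real)" by (rule borel_integrable_atLeastAtMost') (rule continuous_on_const)
    moreover have "indicator {-e..0} y *\<^sub>R (1::real) = indicator {-\<tau>..0} y *\<^sub>R indicator {-e..0} y" for y
      using e by (cases "y \<in> {-e..0}") auto
    ultimately show ?thesis unfolding set_integrable_def by (simp only:)
  qed
  have bi: "set_integrable lborel {-\<tau>..0} ?b"
    by (intro set_integrable_mult_right set_integral_add set_integrable_divide) (use gi ii in auto)
  have pw: "\<bar>g y * w y\<bar> \<le> ?b y" if y: "y \<in> {-\<tau>..0}" for y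
  proof (cases "- e \<le> y")
    case True
    have "\<bar>g y\<bar> * 1 \<le> (sqrt e * (g y)\<^sup>2 + 1 / sqrt e) / 2"
    proof -
      define q where "q = sqrt e"
      have q: "q > 0" using e by (simp add: q_def)
      have "0 \<le> (q * \<bar>g y\<bar> - 1)\<^sup>2" by simp
      then have "2 * (q * \<bar>g y\<bar>) \<le> q\<^sup>2 * (g y)\<^sup>2 + 1" by (simp add: power2_diff power_mult_distrib)
      then have "2 * (q * \<bar>g y\<bar>) / q \<le> (q\<^sup>2 * (g y)\<^sup>2 + 1) / q" using q by (intro divide_right_mono) auto
      then have "2 * \<bar>g y\<bar> \<le> q * (g y)\<^sup>2 + 1 / q" using q by (simp add: add_divide_distrib power2_eq_square)
      then show ?thesis by (simp add: q_def)
    qed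
    moreover have "\<bar>w y\<bar> \<le> \<kappa>" using w[OF y] True by simp
    ultimately have "\<bar>g y\<bar> * \<bar>w y\<bar> \<le> (sqrt e * (g y)\<^sup>2 + 1 / sqrt e) / 2 * \<kappa>" using k by (intro mult_mono) auto
    moreover have "indicator {-e..0} y = (1::real)" using True y by simp
    ultimately show ?thesis by (simp add: abs_mult mult.commute)
  next
    case False
    then have "w y = 0" using w[OF y] by simp
    then show ?thesis using k e by (simp add: indicator_def)
  qed
  have "\<bar>LINT y:{-\<tau>..0}|lborel. g y * w y\<bar> \<le> (LINT y:{-\<tau>..0}|lborel. ?b y)"
  \<comment> \<open>A product that is not integrable has integral 0 by convention, and the bound is
    nonnegative.\<close>
  proof (cases "set_integrable lborel {-\<tau>..0} (\<lambda>y. g y * w y)")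
    case True
    have "\<bar>LINT y:{-\<tau>..0}|lborel. g y * w y\<bar> \<le> (LINT y:{-\<tau>..0}|lborel. \<bar>g y * w y\<bar>)"
      using set_integral_norm_bound[OF True] by simp
    also have "\<dots> \<le> (LINT y:{-\<tau>..0}|lborel. ?b y)"
      by (rule set_integral_mono[OF set_integrable_abs[OF True] bi]) (rule pw)
    finally show ?thesis .
  next
    case False
    then have "(LINT y:{-\<tau>..0}|lborel. g y * w y) = 0"
      unfolding set_integrable_def set_lebesgue_integral_def by (rule not_integrable_integral_eq)
    moreover have "0 \<le> (LINT y:{-\<tau>..0}|lborel. ?b y)"
      unfolding set_lebesgue_integral_def
      by (rule integral_nonneg_AE) (use k e in \<open>auto simp: indicator_def\<close>)
    ultimately show ?thesis by simp
  qed
  also have "(LINT y:{-\<tau>..0}|lborel. ?b y) = \<kappa> / 2 * (sqrt e * (LINT y:{-\<tau>..0}|lborel. (g y)\<^sup>2) + (LINT y:{-\<tau>..0}|lborel. indicator {-e..0} y) / sqrt e)"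
    using gi ii by (subst set_integral_mult_right, subst set_integral_add) auto
  also have "(LINT y:{-\<tau>..0}|lborel. indicator {-e..0} y) = e"
  proof -
    have "indicator {-\<tau>..0} y *\<^sub>R indicator {-e..0} y = (indicator {-e..0} y :: real)" for y
      using e by (cases "y \<in> {-e..0}") auto
    then have "(LINT y:{-\<tau>..0}|lborel. indicator {-e..0} y :: real) = (\<integral>y. indicator {-e..0} y \<partial>lborel)"
      unfolding set_lebesgue_integral_def by (simp only:)
    then show ?thesis using e by simp
  qed
  also have "e / sqrt e = sqrt e" using e by (simp add: real_div_sqrt)
  also have "\<kappa> / 2 * (sqrt e * (LINT y:{-\<tau>..0}|lborel. (g y)\<^sup>2) + sqrt e) \<le> \<kappa> / 2 * (sqrt e * B + sqrt e)"
    using G k e by (intro mult_left_mono add_mono) auto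
  finally show ?thesis by (simp add: algebra_simps)
qed

text \<open>The mean value theorem along the segment, which stays in \<open>Cpath\<close>, where
  \<open>F u\<close> is differentiable. The two windows differ only on [-e,0]: for
  \<open>e < - a 1\<close> the other Dirac masses do not see the difference, the density contributes
  at most \<delta> times sqrt e, and the coefficient at 0 is within \<delta> of its value at the
  starting window.\<close>

lemma remainder_small:
  assumes x: "unif_cont_bdd x" and d: "\<delta> > 0"
  shows "\<exists>e0>0. \<forall>e. 0 < e \<and> e < e0 \<longrightarrow> (\<forall>s\<in>{0..T}. \<forall>u\<in>{0..T}. s \<le> u \<and> u \<le> s + e \<longrightarrow>
    \<bar>F u (frozen_window \<tau> x u u) - F u (frozen_window \<tau> x u s) - Dl s (frozen_window \<tau> x s s) 0 * (x u - x s)\<bar>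
      \<le> \<delta> * (\<bar>x u - x s\<bar> + sqrt e))"
proof -
  let ?W = "frozen_window \<tau> x"
  \<comment> \<open>The parameters \<open>(u, s, \<rho>)\<close> of all segments. Their image is
    compact, so on it the densities are bounded and the coefficient at 0 is uniformly
    continuous.\<close>
  let ?Q = "{0..T} \<times> {0..T} \<times> {0..1::real}"
  let ?m = "\<lambda>z. (fst z, segment x (fst z) (fst (snd z)) (snd (snd z)))"
  have Qc: "compact ?Q" by (intro compact_Times compact_Icc)
  have mc: "continuous_on ?Q ?m" by (rule segment_cont[OF x])
  have mQ: "?m ` ?Q \<subseteq> {0..T} \<times> Cpath \<tau>" using segment_Cpath[OF x] by auto
  obtain B0 where B0: "\<And>z. z \<in> ?m ` ?Q \<Longrightarrow> (LINT y:{-\<tau>..0}|lborel. (Dg (fst z) (snd z) y)\<^sup>2) \<le> B0"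
    using Dg_bounded[OF compact_continuous_image[OF mc Qc] mQ] by blast
  define B where "B = max 0 B0"
  have B: "(LINT y:{-\<tau>..0}|lborel. (Dg u (segment x u s \<rho>) y)\<^sup>2) \<le> B" if "u \<in> {0..T}" "s \<in> {0..T}" "\<rho> \<in> {0..1}" for u s \<rho>
    using B0[OF imageI, of "(u, s, \<rho>)"] that by (simp add: B_def)
  have B_pos: "0 \<le> B" by (simp add: B_def)
  have "continuous_on ?Q (\<lambda>z. Dl (fst z) (segment x (fst z) (fst (snd z)) (snd (snd z))) 0)"
    using continuous_on_compose2[OF Dl_cont mc mQ] by simp
  then have "uniformly_continuous_on ?Q (\<lambda>z. Dl (fst z) (segment x (fst z) (fst (snd z)) (snd (snd z))) 0)"
    by (rule compact_uniformly_continuous[OF _ Qc])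
  then obtain e1 where e1: "e1 > 0" "\<And>z z'. z \<in> ?Q \<Longrightarrow> z' \<in> ?Q \<Longrightarrow> dist z' z < e1 \<Longrightarrow>
     dist (Dl (fst z') (segment x (fst z') (fst (snd z')) (snd (snd z'))) 0) (Dl (fst z) (segment x (fst z) (fst (snd z)) (snd (snd z))) 0) < \<delta>"
    unfolding uniformly_continuous_on_def using d by metis
  \<comment> \<open>Makes the bound \<open>\<kappa> * sqrt e * (B + 1) / 2\<close> for the density
    equal to \<open>\<delta> * sqrt e\<close>.\<close>
  define \<kappa> where "\<kappa> = 2 * \<delta> / (B + 1)"
  have k: "\<kappa> > 0" using d B_pos by (simp add: \<kappa>_def)
  obtain h where h: "h > 0" "\<And>s u. \<bar>s - u\<bar> < h \<Longrightarrow> \<bar>x s - x u\<bar> < \<kappa>" using x k unfolding unif_cont_bdd_def by meson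
  \<comment> \<open>In this order: uniform continuity of the coefficient, modulus of the path, gap
    between 0 and \<open>a 1\<close>, length of the window.\<close>
  define e0 where "e0 = min (min e1 h) (min (- a 1) \<tau>)"
  have e0: "e0 > 0" using e1 h a_bounds(4) tau by (simp add: e0_def)
  have "\<bar>F u (?W u u) - F u (?W u s) - Dl s (?W s s) 0 * (x u - x s)\<bar> \<le> \<delta> * (\<bar>x u - x s\<bar> + sqrt e)"
    if e: "0 < e" "e < e0" and s: "s \<in> {0..T}" and u: "u \<in> {0..T}" "s \<le> u" "u \<le> s + e" for e s u
  proof -
    have ee: "e < e1" "e < h" "e < - a 1" "e < \<tau>" using e by (auto simp: e0_def)
    define dw where "dw = ?W u u - ?W u s"
    have dw: "apply_bcontfun dw y = x (u + clamp \<tau> y) - x (min (u + clamp \<tau> y) s)" for y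
      using clamp_range[OF tau, of y] by (simp add: dw_def frozen_window_apply[OF x] min_absorb1)
    have dw0: "apply_bcontfun dw 0 = x u - x s" using u tau by (simp add: dw clamp_def)
    have dwz: "apply_bcontfun dw y = 0" if "y \<in> {-\<tau>..0}" "y < - e" for y
    proof -
      have "min (u + y) s = u + y" using that u by auto
      then show ?thesis by (simp add: dw clamp_id[OF that(1)])
    qed
    have dwb: "\<bar>apply_bcontfun dw y\<bar> \<le> \<kappa>" if "y \<in> {-\<tau>..0}" for y
    proof -
      have "\<bar>(u + y) - min (u + y) s\<bar> < h" using that u ee h by auto
      then show ?thesis using h(2) by (simp add: dw clamp_id[OF that] less_imp_le)
    qed
    define Hs where "Hs = Dl s (?W s s) 0"
    \<comment> \<open>With the linear term subtracted beforehand, the mean value theorem yields the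
      difference of the two coefficients at once.\<close>
    define \<phi> where "\<phi> \<rho> = F u (segment x u s \<rho>) - \<rho> * (Hs * (x u - x s))" for \<rho>
    define \<phi>' where "\<phi>' \<rho> h = Da_L2_apply \<tau> N a (Dl u (segment x u s \<rho>)) (Dg u (segment x u s \<rho>)) (h *\<^sub>R dw) - h * (Hs * (x u - x s))" for \<rho> h
    have der: "(\<phi> has_derivative \<phi>' \<rho>) (at \<rho> within {0..1})" if r: "0 \<le> \<rho>" "\<rho> \<le> 1" for \<rho>
    proof -
      have "((\<lambda>\<rho>. segment x u s \<rho>) has_derivative (\<lambda>h. h *\<^sub>R dw)) (at \<rho> within {0..1})"
        unfolding segment_def dw_def by (auto intro!: derivative_eq_intros)
      then have "((\<lambda>\<rho>. F u (segment x u s \<rho>)) has_derivative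
          (\<lambda>h. Da_L2_apply \<tau> N a (Dl u (segment x u s \<rho>)) (Dg u (segment x u s \<rho>)) (h *\<^sub>R dw))) (at \<rho> within {0..1})"
        by (rule has_derivative_in_compose)
          (rule has_derivative_subset[where s = "Cpath \<tau>"], use F_deriv u segment_Cpath[OF x] in auto)
      moreover have "((\<lambda>\<rho>. \<rho> * (Hs * (x u - x s))) has_derivative (\<lambda>h. h * (Hs * (x u - x s)))) (at \<rho> within {0..1})"
        by (rule has_derivative_mult_left[OF has_derivative_ident])
      ultimately show ?thesis unfolding \<phi>_def \<phi>'_def by (rule has_derivative_diff)
    qed
    obtain \<rho> where r: "\<rho> \<in> {0<..<1}" "\<phi> 1 - \<phi> 0 = \<phi>' \<rho> (1 - 0)"
      using mvt_simple[of 0 1 \<phi> \<phi>'] der by auto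
    let ?l = "Dl u (segment x u s \<rho>)" and ?g = "Dg u (segment x u s \<rho>)"
    have r01: "\<rho> \<in> {0..1}" using r by auto
    have sum: "(\<Sum>i\<le>N. ?l i * apply_bcontfun dw (a i)) = ?l 0 * (x u - x s)"
    proof -
      have "(\<Sum>i\<le>N. ?l i * apply_bcontfun dw (a i)) = (\<Sum>i\<in>{0}. ?l i * apply_bcontfun dw (a i))"
      proof (rule sum.mono_neutral_right)
        show "\<forall>i\<in>{..N} - {0}. ?l i * apply_bcontfun dw (a i) = 0"
        proof
          fix i assume i: "i \<in> {..N} - {0}"
          then have "a i \<le> a 1" "- \<tau> \<le> a i" using a_bounds(2,3)[of i] by auto
          then have "apply_bcontfun dw (a i) = 0" using ee a_bounds(4) by (intro dwz) auto
          then show "?l i * apply_bcontfun dw (a i) = 0" by simp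
        qed
      qed auto
      then show ?thesis by (simp add: a0 dw0)
    qed
    have "segment x u s 1 = ?W u u" "segment x u s 0 = ?W u s" by (simp_all add: segment_def)
    then have "F u (?W u u) - F u (?W u s) - Hs * (x u - x s) = \<phi> 1 - \<phi> 0" by (simp add: \<phi>_def)
    also have "\<dots> = (?l 0 - Hs) * (x u - x s) + (LINT y:{-\<tau>..0}|lborel. ?g y * apply_bcontfun dw y)"
      unfolding r(2) \<phi>'_def Da_L2_apply_def using sum by (simp add: algebra_simps)
    finally have eq: "F u (?W u u) - F u (?W u s) - Hs * (x u - x s) =
       (?l 0 - Hs) * (x u - x s) + (LINT y:{-\<tau>..0}|lborel. ?g y * apply_bcontfun dw y)" .
    have "\<bar>?l 0 - Hs\<bar> \<le> \<delta>"
    proof -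
      \<comment> \<open>The degenerate segment represents the starting window by the parameter
        \<open>(s, s, \<rho>)\<close> with the same \<rho>, so only the time \<open>u\<close> has
        moved.\<close>
      have "segment x s s \<rho> = ?W s s" by (simp add: segment_def)
      moreover have "dist (u, s, \<rho>) (s, s, \<rho>) < e1" using u ee by (simp add: dist_Pair_Pair dist_real_def)
      ultimately show ?thesis using e1(2)[of "(s, s, \<rho>)" "(u, s, \<rho>)"] s u r01 by (simp add: Hs_def dist_real_def)
    qed
    then have 1: "\<bar>(?l 0 - Hs) * (x u - x s)\<bar> \<le> \<delta> * \<bar>x u - x s\<bar>" by (simp add: abs_mult mult_right_mono)
    have "\<bar>LINT y:{-\<tau>..0}|lborel. ?g y * apply_bcontfun dw y\<bar> \<le> \<kappa> * sqrt e * (B + 1) / 2"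
    proof (rule L2_short_bound[OF _ B[OF u(1) s r01] e(1) ee(4) _ less_imp_le[OF k]])
      show "in_L2 \<tau> ?g" using F_deriv u segment_Cpath[OF x] by blast
      show "\<bar>apply_bcontfun dw y\<bar> \<le> (if - e \<le> y then \<kappa> else 0)" if "y \<in> {-\<tau>..0}" for y
        using dwz[OF that] dwb[OF that] by auto
    qed
    also have "\<dots> = \<delta> * sqrt e" using B_pos by (simp add: \<kappa>_def)
    finally have 2: "\<bar>LINT y:{-\<tau>..0}|lborel. ?g y * apply_bcontfun dw y\<bar> \<le> \<delta> * sqrt e" .
    show ?thesis using eq 1 2 unfolding Hs_def[symmetric] by (simp add: distrib_left)
  qed
  then show ?thesis using e0 by blast
qed

end

context filtered_space
begin

text \<open>Against |increment of E| / e, the part of the remainder bounded by |increment of X|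
  integrates to at most the mean of two approximate quadratic variations. The part bounded by sqrt e
  integrates to half of that of \<open>E\<close> plus \<open>T / 2\<close>, by the weighted
  inequality between means. Both are tight.\<close>

lemma remainder_negligible:
  assumes E: "cont_adapted E" and X: "cont_adapted X" and t: "t \<in> {0..T}"
    and tE: "tightP (\<lambda>e. approx_qv e E)" and tX: "tightP (\<lambda>e. approx_qv e X)"
    and rc: "\<forall>\<^sub>F e in at_right 0. \<forall>\<omega>\<in>space M. continuous_on {0..T} (\<lambda>s. r e s \<omega>)"
    and rs: "unif_smallP {0..T} (\<lambda>e s \<omega>. r e s \<omega> / (\<bar>incr e X s \<omega>\<bar> + sqrt e))"
  shows "smallP (\<lambda>e \<omega>. integral {0..t} (\<lambda>s. r e s \<omega> * incr e E s \<omega> / e))"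
  unfolding smallP_def
proof (intro allI impI)
  fix \<delta>0 \<gamma> :: real assume h: "\<delta>0 > 0" "\<gamma> > 0"
  have g2: "\<gamma> / 2 > 0" using h by simp
  \<comment> \<open>The bounded quantity is twice the bound for the time integral; \<open>T\<close>
    stems from the sqrt e part.\<close>
  have "tightP (\<lambda>e \<omega>. (approx_qv e X \<omega> + approx_qv e E \<omega>) + (approx_qv e E \<omega> + T))"
    by (intro tightP_add tX tE tightP_rv) simp
  then obtain K where K: "K > 0" "\<forall>\<^sub>F e in at_right 0. \<exists>B\<in>sets M. prob B \<le> \<gamma> / 2 \<and>
      (\<forall>\<omega>\<in>space M - B. \<bar>(approx_qv e X \<omega> + approx_qv e E \<omega>) + (approx_qv e E \<omega> + T)\<bar> \<le> K)"
    using g2 unfolding tightP_def by blast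
  define \<delta> where "\<delta> = 2 * \<delta>0 / K"
  have d: "\<delta> > 0" using h K by (simp add: \<delta>_def)
  have "\<forall>\<^sub>F e in at_right 0. \<exists>B\<in>sets M. prob B \<le> \<gamma> / 2 \<and> (\<forall>\<omega>\<in>space M - B. \<forall>s\<in>{0..T}. \<bar>r e s \<omega> / (\<bar>incr e X s \<omega>\<bar> + sqrt e)\<bar> \<le> \<delta>)"
    using rs d g2 unfolding unif_smallP_def by blast
  with K(2) rc eventually_at_right_less[of 0]
  show "\<forall>\<^sub>F e in at_right 0. \<exists>B\<in>sets M. prob B \<le> \<gamma> \<and>
     (\<forall>\<omega>\<in>space M - B. \<bar>integral {0..t} (\<lambda>s. r e s \<omega> * incr e E s \<omega> / e)\<bar> \<le> \<delta>0)"
  proof eventually_elim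
    case (elim e)
    then obtain B1 B2 where B1: "B1 \<in> sets M" "prob B1 \<le> \<gamma> / 2"
        "\<And>\<omega>. \<omega> \<in> space M - B1 \<Longrightarrow> \<bar>(approx_qv e X \<omega> + approx_qv e E \<omega>) + (approx_qv e E \<omega> + T)\<bar> \<le> K"
      and B2: "B2 \<in> sets M" "prob B2 \<le> \<gamma> / 2"
        "\<And>\<omega> s. \<omega> \<in> space M - B2 \<Longrightarrow> s \<in> {0..T} \<Longrightarrow> \<bar>r e s \<omega> / (\<bar>incr e X s \<omega>\<bar> + sqrt e)\<bar> \<le> \<delta>" by blast
    have e: "e > 0" using elim by simp
    have "\<bar>integral {0..t} (\<lambda>s. r e s \<omega> * incr e E s \<omega> / e)\<bar> \<le> \<delta>0" if w: "\<omega> \<in> space M - (B1 \<union> B2)" for \<omega>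
    proof -
      have ws: "\<omega> \<in> space M" using w by simp
      have rc: "continuous_on {0..T} (\<lambda>s. r e s \<omega>)" using elim ws by blast
      have c0: "continuous_on {0..T} (\<lambda>s. r e s \<omega> * incr e E s \<omega> / e)"
        unfolding divide_inverse by (intro continuous_on_mult rc incr_cont E ws continuous_on_const)
      have c1: "continuous_on {0..T} (\<lambda>s. \<bar>r e s \<omega> * incr e E s \<omega> / e\<bar>)" by (intro continuous_on_rabs c0)
      have sub: "{0..t} \<subseteq> {0..T}" using t by auto
      let ?a = "\<lambda>s. \<bar>incr e X s \<omega> * incr e E s \<omega>\<bar> / e" and ?b = "\<lambda>s. (incr e E s \<omega>)\<^sup>2 * inverse (2 * e) + 1 / 2"
      have ca: "continuous_on {0..T} ?a"
        unfolding divide_inverse by (intro continuous_on_mult continuous_on_rabs incr_cont X E ws continuous_on_const)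
      have cb: "continuous_on {0..T} ?b"
        by (intro continuous_on_add continuous_on_mult square_inc_cont E ws continuous_on_const)
      have "\<bar>integral {0..t} (\<lambda>s. r e s \<omega> * incr e E s \<omega> / e)\<bar> \<le> integral {0..t} (\<lambda>s. \<bar>r e s \<omega> * incr e E s \<omega> / e\<bar>)"
        using integral_norm_bound_integral[OF Icc_integrable[OF continuous_on_subset[OF c0 sub]] Icc_integrable[OF continuous_on_subset[OF c1 sub]]]
        by simp
      also have "\<dots> \<le> integral {0..T} (\<lambda>s. \<bar>r e s \<omega> * incr e E s \<omega> / e\<bar>)"
        by (rule integral_mono_upper(2)[OF c1 _ t]) simp
      also have "\<dots> \<le> integral {0..T} (\<lambda>s. \<delta> * (?a s + ?b s))"
      proof (rule integral_le[OF Icc_integrable[OF c1]])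
        show "(\<lambda>s. \<delta> * (?a s + ?b s)) integrable_on {0..T}"
          by (intro Icc_integrable continuous_on_mult continuous_on_const continuous_on_add[OF ca cb])
        fix s assume s: "s \<in> {0..T}"
        have pos: "\<bar>incr e X s \<omega>\<bar> + sqrt e > 0" using e by (simp add: add_nonneg_pos)
        have "\<bar>r e s \<omega>\<bar> / (\<bar>incr e X s \<omega>\<bar> + sqrt e) \<le> \<delta>" using B2(3)[of \<omega> s] w s pos by simp
        then have "\<bar>r e s \<omega>\<bar> \<le> \<delta> * (\<bar>incr e X s \<omega>\<bar> + sqrt e)" using pos by (simp add: pos_divide_le_eq)
        then have "\<bar>r e s \<omega>\<bar> * \<bar>incr e E s \<omega>\<bar> / e \<le> \<delta> * (\<bar>incr e X s \<omega>\<bar> + sqrt e) * \<bar>incr e E s \<omega>\<bar> / e"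
          using e by (intro divide_right_mono mult_right_mono) auto
        also have "\<dots> = \<delta> * (?a s + sqrt e * \<bar>incr e E s \<omega>\<bar> / e)"
          by (simp add: abs_mult distrib_left distrib_right add_divide_distrib)
        also have "\<dots> \<le> \<delta> * (?a s + ?b s)"
        proof (intro mult_left_mono add_left_mono)
          have "\<bar>sqrt e * incr e E s \<omega>\<bar> \<le> (sqrt e)\<^sup>2 / (2 * 1) + 1 * (incr e E s \<omega>)\<^sup>2 / 2" by (rule amgm_bound) simp
          then have "sqrt e * \<bar>incr e E s \<omega>\<bar> \<le> (e + (incr e E s \<omega>)\<^sup>2) / 2" using e by (simp add: abs_mult)
          then have "sqrt e * \<bar>incr e E s \<omega>\<bar> / e \<le> (e + (incr e E s \<omega>)\<^sup>2) / 2 / e" using e by (intro divide_right_mono) auto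
          also have "\<dots> = ?b s" using e by (simp add: field_simps)
          finally show "sqrt e * \<bar>incr e E s \<omega>\<bar> / e \<le> ?b s" .
        qed (use d in auto)
        finally show "\<bar>r e s \<omega> * incr e E s \<omega> / e\<bar> \<le> \<delta> * (?a s + ?b s)" using e by (simp add: abs_mult)
      qed
      also have "\<dots> = \<delta> * (integral {0..T} ?a + integral {0..T} ?b)"
        by (simp only: Henstock_Kurzweil_Integration.integral_mult_right integral_add[OF Icc_integrable[OF ca] Icc_integrable[OF cb]])
      also have "integral {0..T} ?b = approx_qv e E \<omega> / 2 + T / 2"
      proof -
        have "integral {0..T} ?b = integral {0..T} (\<lambda>s. (incr e E s \<omega>)\<^sup>2) * inverse (2 * e) + integral {0..T} (\<lambda>s. 1 / 2)"
          unfolding integral_add[OF integrable_on_mult_left[OF Icc_integrable[OF square_inc_cont[OF E ws]]] integrable_const_ivl]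
          by (simp only: Henstock_Kurzweil_Integration.integral_mult_left)
        then show ?thesis using T_pos e by (simp add: approx_qv_def field_simps)
      qed
      also have "\<delta> * (integral {0..T} ?a + (approx_qv e E \<omega> / 2 + T / 2)) \<le> \<delta> * (((approx_qv e X \<omega> + approx_qv e E \<omega>) + (approx_qv e E \<omega> + T)) / 2)"
        using product_integral_bound[OF ws X E e] d by (intro mult_left_mono) (auto simp: field_simps)
      also have "\<dots> \<le> \<delta> * (K / 2)" using B1(3)[of \<omega>] w d by (intro mult_left_mono) auto
      also have "\<dots> = \<delta>0" using K by (simp add: \<delta>_def)
      finally show ?thesis .
    qed
    then show ?case using prob_Un2_half[OF B1(1) B2(1) B1(2) B2(2)] by blast
  qed
qed

lemma ext_adapted_ucb:
  assumes Y: "ext_adapted Y" and w: "\<omega> \<in> space M"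
  shows "unif_cont_bdd (\<lambda>t. Y t \<omega>)"
proof -
  have "compact ((\<lambda>t. Y t \<omega>) ` {0..T})"
    by (rule compact_continuous_image[OF cont_adapted_cont[OF ext_adapted_cproc[OF Y] w]]) simp
  from compact_imp_bounded[OF this] obtain B where "\<forall>y\<in>(\<lambda>t. Y t \<omega>) ` {0..T}. norm y \<le> B"
    unfolding bounded_iff by blast
  then have B: "\<And>t. t \<in> {0..T} \<Longrightarrow> \<bar>Y t \<omega>\<bar> \<le> B" by simp
  have "\<bar>Y t \<omega>\<bar> \<le> B" for t
    using B[of "max 0 (min t T)"] T_pos unfolding ext_adapted_clip[OF Y w, of t] by auto
  then show ?thesis unfolding unif_cont_bdd_def using ext_adapted_uniform[OF Y w] by blast
qed

lemma is_stoch_integral_cong: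
  assumes I: "is_stoch_integral M T H N I" and H: "\<And>s \<omega>. s \<in> {0..T} \<Longrightarrow> H s \<omega> = H' s \<omega>"
  shows "is_stoch_integral M T H' N I"
  unfolding is_stoch_integral_def
proof (intro conjI ballI allI impI)
  show "cont_proc M T I" using I by (simp add: is_stoch_integral_def)
  fix t and k :: "nat \<Rightarrow> nat" and p :: "nat \<Rightarrow> nat \<Rightarrow> real"
  assume t: "t \<in> {0..T}" and a: "(\<forall>n. is_partition t (k n) (p n)) \<and>
     (\<forall>e>0. \<forall>\<^sub>F n in sequentially. \<forall>i<k n. p n (Suc i) - p n i < e)"
  have "p n i \<in> {0..T}" if "i < k n" for n i
  proof -
    have p: "p n 0 = 0" "p n (k n) = t" "\<And>i. i < k n \<Longrightarrow> p n i \<le> p n (Suc i)"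
      using a unfolding is_partition_def by (auto intro: less_imp_le)
    have "p n 0 \<le> p n i" using mono_upto[of i "p n" 0] p(3) that by auto
    moreover have "p n i \<le> p n (k n)" using mono_upto[of "k n" "p n" i] p(3) that by auto
    ultimately show ?thesis using p(1,2) t by auto
  qed
  then have "(\<lambda>n \<omega>. \<Sum>i<k n. H' (p n i) \<omega> * (N (p n (Suc i)) \<omega> - N (p n i) \<omega>)) =
      (\<lambda>n \<omega>. \<Sum>i<k n. H (p n i) \<omega> * (N (p n (Suc i)) \<omega> - N (p n i) \<omega>))"
    by (intro ext sum.cong refl) (simp add: H)
  moreover have "tendsto_in_prob_seq M (\<lambda>n \<omega>. \<Sum>i<k n. H (p n i) \<omega> * (N (p n (Suc i)) \<omega> - N (p n i) \<omega>)) (I t)"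
    using I t a unfolding is_stoch_integral_def by blast
  ultimately show "tendsto_in_prob_seq M (\<lambda>n \<omega>. \<Sum>i<k n. H' (p n i) \<omega> * (N (p n (Suc i)) \<omega> - N (p n i) \<omega>)) (I t)"
    by simp
qed

end

section \<open>Decomposition of the functional of a weak Dirichlet process\<close>

lemma window_eq_frozen_window: "\<tau> > 0 \<Longrightarrow> window \<tau> T X t \<omega> = frozen_window \<tau> (\<lambda>t. ext_proc T X t \<omega>) t t"
  unfolding window_def frozen_window_def using clamp_range by (intro arg_cong[where f = Bcontfun] ext) (simp add: min_absorb1)

locale window_functional = filtered_space M Fi T + path_functional T \<tau> N a F Dl Dg
  for M :: "'a measure" and Fi T \<tau> N a F Dl Dg +
  fixes X Mp :: "real \<Rightarrow> 'a \<Rightarrow> real"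
  assumes weak_dirichlet: "weak_dirichlet_mp M T Fi X Mp"
    and finite_qv: "finite_quadratic_variation M T X"
begin

abbreviation "X_ext \<equiv> ext_proc T X"
abbreviation "M_ext \<equiv> ext_proc T Mp"

definition orth_part where "orth_part t \<omega> = X t \<omega> - Mp t \<omega>"

definition stopped_window where "stopped_window u v \<omega> = frozen_window \<tau> (\<lambda>t. X_ext t \<omega>) u v"

text \<open>The integrand of the stochastic integral, with the time clamped so that it is an
  extended adapted process on the whole line.\<close>

definition dirac_coeff where "dirac_coeff s \<omega> = Dl (max 0 (min s T)) (stopped_window (max 0 (min s T)) (max 0 (min s T)) \<omega>) 0"

definition value_proc where "value_proc t \<omega> = F t (window \<tau> T X t \<omega>)"

lemma Mp: "cont_local_martingale M T Fi Mp"
  and X_cont: "cont_proc M T X"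
  and orth_part_orth: "martingale_orthogonal M T Fi orth_part"
  using weak_dirichlet by (auto simp: weak_dirichlet_mp_def orth_part_def[abs_def])

lemma M_ext: "ext_adapted M_ext"
  using Mp by (intro ext_adapted_ext) (auto simp: cont_local_martingale_def local_martingale_on_def)

lemma X_ext: "ext_adapted X_ext"
proof (rule ext_adapted_ext[OF X_cont])
  have "adapted T Fi orth_part" "adapted T Fi Mp"
    using orth_part_orth Mp by (auto simp: martingale_orthogonal_def cont_local_martingale_def local_martingale_on_def)
  then have "(\<lambda>\<omega>. orth_part t \<omega> + Mp t \<omega>) \<in> borel_measurable (Fi t)" if "t \<in> {0..T}" for t
    using that unfolding adapted_def by (intro borel_measurable_add) auto
  moreover have "(\<lambda>\<omega>. orth_part t \<omega> + Mp t \<omega>) = X t" for t by (simp add: orth_part_def)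
  ultimately show "adapted T Fi X" unfolding adapted_def by simp
qed

lemma EA: "ext_adapted (ext_proc T orth_part)"
proof (rule ext_adapted_ext)
  show "adapted T Fi orth_part" using orth_part_orth by (simp add: martingale_orthogonal_def)
  show "cont_proc M T orth_part" using X_cont Mp unfolding cont_proc_def orth_part_def cont_local_martingale_def
    by (auto intro: continuous_on_diff)
qed

lemma ext_A: "ext_proc T orth_part t \<omega> = X_ext t \<omega> - M_ext t \<omega>"
  by (simp add: ext_proc_def orth_part_def)

lemma window_W: "window \<tau> T X t \<omega> = stopped_window t t \<omega>"
  unfolding stopped_window_def by (rule window_eq_frozen_window[OF tau])

lemma path: "\<omega> \<in> space M \<Longrightarrow> unif_cont_bdd (\<lambda>t. X_ext t \<omega>)"
  by (rule ext_adapted_ucb[OF X_ext])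

lemma stopped_window_Cpath: "\<omega> \<in> space M \<Longrightarrow> stopped_window u v \<omega> \<in> Cpath \<tau>"
  unfolding stopped_window_def by (rule frozen_window_Cpath[OF path tau])

lemma stopped_window_functional_meas:
  fixes f :: "(real \<Rightarrow>\<^sub>C real) \<Rightarrow> real"
  assumes "continuous_on (Cpath \<tau>) f"
  shows "(\<lambda>\<omega>. f (stopped_window u v \<omega>)) \<in> borel_measurable (G v)"
proof (rule Cpath_functional_measurable[OF tau assms])
  show "stopped_window u v \<omega> \<in> Cpath \<tau>" if "\<omega> \<in> space (G v)" for \<omega> using stopped_window_Cpath that by simp
  fix y
  have "(\<lambda>\<omega>. apply_bcontfun (stopped_window u v \<omega>) y) \<in> borel_measurable (G v) \<longleftrightarrow> X_ext (min (u + clamp \<tau> y) v) \<in> borel_measurable (G v)"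
    by (rule measurable_cong) (simp add: stopped_window_def frozen_window_apply[OF path])
  then show "(\<lambda>\<omega>. apply_bcontfun (stopped_window u v \<omega>) y) \<in> borel_measurable (G v)"
    using meas_G_mono[OF cont_adapted_meas[OF ext_adapted_cproc[OF X_ext]], of "min (u + clamp \<tau> y) v" v] by simp
qed

lemma F_slice: "t \<in> {0..T} \<Longrightarrow> continuous_on (Cpath \<tau>) (F t)"
proof -
  assume t: "t \<in> {0..T}"
  have 1: "continuous_on (Cpath \<tau>) (\<lambda>\<eta>. (t, \<eta>))" by (intro continuous_on_Pair continuous_on_const continuous_on_id)
  have 2: "(\<lambda>\<eta>. (t, \<eta>)) ` Cpath \<tau> \<subseteq> {0..T} \<times> Cpath \<tau>" using t by auto
  from continuous_on_compose2[OF F_cont 1 2] show ?thesis by simp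
qed

lemma Dl_slice: "t \<in> {0..T} \<Longrightarrow> continuous_on (Cpath \<tau>) (\<lambda>\<eta>. Dl t \<eta> 0)"
proof -
  assume t: "t \<in> {0..T}"
  have 1: "continuous_on (Cpath \<tau>) (\<lambda>\<eta>. (t, \<eta>))" by (intro continuous_on_Pair continuous_on_const continuous_on_id)
  have 2: "(\<lambda>\<eta>. (t, \<eta>)) ` Cpath \<tau> \<subseteq> {0..T} \<times> Cpath \<tau>" using t by auto
  from continuous_on_compose2[OF Dl_cont 1 2] show ?thesis by simp
qed

lemma clip_range: "max 0 (min s T) \<in> {0..T}"
  using T_pos by auto

lemma clip_cont: "continuous_on B (\<lambda>s. max 0 (min s T))"
  by (intro continuous_on_max continuous_on_min continuous_on_const continuous_on_id)

lemma F_W_cont: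
  assumes w: "\<omega> \<in> space M" and f: "continuous_on B f" "f ` B \<subseteq> {0..T}" and g: "continuous_on B g"
  shows "continuous_on B (\<lambda>s. F (f s) (stopped_window (f s) (g s) \<omega>))"
  using continuous_on_compose2[OF F_window_cont[OF path[OF w], of UNIV] continuous_on_Pair[OF f(1) g]] f(2)
  unfolding stopped_window_def by auto

lemma dirac_coeff_eproc: "ext_adapted dirac_coeff"
  unfolding ext_adapted_def cont_adapted_def
proof (intro conjI allI ballI)
  show "dirac_coeff t \<in> borel_measurable (G t)" for t
  proof -
    have "dirac_coeff t \<in> borel_measurable (G (max 0 (min t T)))"
      unfolding dirac_coeff_def[abs_def] by (rule stopped_window_functional_meas[OF Dl_slice[OF clip_range]])
    moreover have "G (max 0 (min t T)) = G t" using T_pos by (simp add: G_def max_def min_def)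
    ultimately show ?thesis by simp
  qed
  show "continuous_on UNIV (\<lambda>t. dirac_coeff t \<omega>)" if w: "\<omega> \<in> space M" for \<omega>
  proof -
    let ?c = "\<lambda>s. max 0 (min s T)"
    have "continuous_on UNIV (\<lambda>s. stopped_window (?c s) (?c s) \<omega>)"
      unfolding stopped_window_def
      using continuous_on_compose2[OF frozen_window_cont[OF path[OF w], of UNIV] continuous_on_Pair[OF clip_cont clip_cont]] by simp
    then have 1: "continuous_on UNIV (\<lambda>s. (?c s, stopped_window (?c s) (?c s) \<omega>))" by (rule continuous_on_Pair[OF clip_cont])
    have 2: "(\<lambda>s. (?c s, stopped_window (?c s) (?c s) \<omega>)) ` UNIV \<subseteq> {0..T} \<times> Cpath \<tau>" using clip_range stopped_window_Cpath[OF w] by blast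
    from continuous_on_compose2[OF Dl_cont 1 2] show ?thesis by (simp add: dirac_coeff_def)
  qed
  show "dirac_coeff t \<omega> = dirac_coeff (max 0 (min t T)) \<omega>" for t \<omega> using T_pos by (simp add: dirac_coeff_def)
qed

lemma dirac_coeff_eq: "s \<in> {0..T} \<Longrightarrow> dirac_coeff s \<omega> = Dl s (window \<tau> T X s \<omega>) 0"
  by (simp add: dirac_coeff_def window_W)

lemma value_proc_cont: "cont_proc M T value_proc"
  unfolding cont_proc_def value_proc_def window_W
  by (auto intro!: F_W_cont continuous_on_id)

lemma value_proc_meas: "t \<in> {0..T} \<Longrightarrow> value_proc t \<in> borel_measurable (Fi t)"
  using stopped_window_functional_meas[OF F_slice, of t t t] unfolding value_proc_def[abs_def] window_W by (simp add: G_def)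

text \<open>The increment of the functional over \<open>[s, s + e]\<close> is split by freezing the path at time \<open>s\<close>.\<close>
definition frozen_incr where
  "frozen_incr e s \<omega> = F (max 0 (min (s + e) T)) (stopped_window (max 0 (min (s + e) T)) s \<omega>) - F s (stopped_window s s \<omega>)"

text \<open>The unfreezing error beyond first order. The first-order term carries the increment of
  the full process \<open>X\<close>; it is divided into orthogonal and martingale parts only in
  \<open>increment_split\<close>.\<close>

definition unfreeze_rest where
  "unfreeze_rest e s \<omega> = F (max 0 (min (s + e) T)) (stopped_window (max 0 (min (s + e) T)) (max 0 (min (s + e) T)) \<omega>)
     - F (max 0 (min (s + e) T)) (stopped_window (max 0 (min (s + e) T)) s \<omega>) - dirac_coeff s \<omega> * incr e X_ext s \<omega>"

lemma shift_cont: "continuous_on B (\<lambda>s. max 0 (min (s + e) T))"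
  by (intro continuous_on_max continuous_on_min continuous_on_const continuous_on_id continuous_on_add)

lemma frozen_incr_cont: "\<omega> \<in> space M \<Longrightarrow> continuous_on {0..T} (\<lambda>s. frozen_incr e s \<omega>)"
  unfolding frozen_incr_def by (intro continuous_on_diff F_W_cont shift_cont continuous_on_id) (use clip_range in auto)

lemma unfreeze_rest_cont: "\<omega> \<in> space M \<Longrightarrow> continuous_on {0..T} (\<lambda>s. unfreeze_rest e s \<omega>)"
  unfolding unfreeze_rest_def
  by (intro continuous_on_diff continuous_on_mult F_W_cont shift_cont continuous_on_id incr_cont
      cont_adapted_cont[OF ext_adapted_cproc[OF dirac_coeff_eproc]] ext_adapted_cproc[OF X_ext]) (use clip_range in auto)

lemma frozen_incr_meas: "s \<in> {0..T} \<Longrightarrow> frozen_incr e s \<in> borel_measurable (G s)"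
  unfolding frozen_incr_def[abs_def] by (intro borel_measurable_diff stopped_window_functional_meas F_slice clip_range)

lemma unfreeze_rest_meas: "s \<in> {0..T} \<Longrightarrow> unfreeze_rest e s \<in> borel_measurable M"
  unfolding unfreeze_rest_def[abs_def]
  by (intro borel_measurable_diff borel_measurable_times meas_G_M[OF stopped_window_functional_meas] F_slice clip_range
      cont_adapted_meas_M[OF ext_adapted_cproc[OF dirac_coeff_eproc]] jointly_meas_time_section[OF incr_jm] ext_adapted_cproc[OF X_ext])

lemma frozen_incr_uoP: "unif_smallP {0..T} frozen_incr"
proof (rule unif_smallP_pathwise)
  show "\<forall>\<^sub>F e in at_right 0. (\<forall>s\<in>{0..T}. frozen_incr e s \<in> borel_measurable M) \<and> (\<forall>\<omega>\<in>space M. continuous_on {0..T} (\<lambda>s. frozen_incr e s \<omega>))"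
    using meas_G_M[OF frozen_incr_meas] frozen_incr_cont by simp
  fix \<omega> and \<delta> :: real assume w: "\<omega> \<in> space M" and d: "\<delta> > 0"
  obtain e0 where e0: "e0 > 0" "\<And>s u. s \<in> {0..T} \<Longrightarrow> u \<in> {0..T} \<Longrightarrow> \<bar>u - s\<bar> < e0 \<Longrightarrow> \<bar>F u (stopped_window u s \<omega>) - F s (stopped_window s s \<omega>)\<bar> \<le> \<delta>"
    using frozen_increment_small[OF path[OF w] d] unfolding stopped_window_def by blast
  have "\<bar>frozen_incr e s \<omega>\<bar> \<le> \<delta>" if "0 < e" "e < e0" "s \<in> {0..T}" for e s
    unfolding frozen_incr_def by (rule e0(2)[OF that(3) clip_range]) (use that in auto)
  then show "\<forall>\<^sub>F e in at_right 0. \<forall>s\<in>{0..T}. \<bar>frozen_incr e s \<omega>\<bar> \<le> \<delta>"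
    unfolding eventually_at_right_field using e0(1) by blast
qed

lemma unfreeze_rest_uoP: "unif_smallP {0..T} (\<lambda>e s \<omega>. unfreeze_rest e s \<omega> / (\<bar>incr e X_ext s \<omega>\<bar> + sqrt e))"
proof (rule unif_smallP_pathwise)
  note ic = ext_adapted_cproc[OF X_ext]
  show "\<forall>\<^sub>F e in at_right 0. (\<forall>s\<in>{0..T}. (\<lambda>\<omega>. unfreeze_rest e s \<omega> / (\<bar>incr e X_ext s \<omega>\<bar> + sqrt e)) \<in> borel_measurable M) \<and>
     (\<forall>\<omega>\<in>space M. continuous_on {0..T} (\<lambda>s. unfreeze_rest e s \<omega> / (\<bar>incr e X_ext s \<omega>\<bar> + sqrt e)))"
    using eventually_at_right_less[of 0]
  proof (eventually_elim, intro conjI ballI)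
    fix e :: real assume e: "0 < e"
    show "(\<lambda>\<omega>. unfreeze_rest e s \<omega> / (\<bar>incr e X_ext s \<omega>\<bar> + sqrt e)) \<in> borel_measurable M" if "s \<in> {0..T}" for s
      by (intro borel_measurable_divide borel_measurable_add borel_measurable_abs borel_measurable_const
          unfreeze_rest_meas that jointly_meas_time_section[OF incr_jm[OF ic]])
    have "\<bar>incr e X_ext s \<omega>\<bar> + sqrt e \<noteq> 0" for s \<omega>
      using e by (smt (verit) real_sqrt_gt_zero)
    then show "continuous_on {0..T} (\<lambda>s. unfreeze_rest e s \<omega> / (\<bar>incr e X_ext s \<omega>\<bar> + sqrt e))" if "\<omega> \<in> space M" for \<omega>
      by (intro continuous_on_divide continuous_on_add continuous_on_rabs continuous_on_const unfreeze_rest_cont incr_cont ic that) auto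
  qed
  fix \<omega> and \<delta> :: real assume w: "\<omega> \<in> space M" and d: "\<delta> > 0"
  obtain e0 where e0: "e0 > 0" "\<And>e s u. 0 < e \<Longrightarrow> e < e0 \<Longrightarrow> s \<in> {0..T} \<Longrightarrow> u \<in> {0..T} \<Longrightarrow> s \<le> u \<Longrightarrow> u \<le> s + e \<Longrightarrow>
    \<bar>F u (stopped_window u u \<omega>) - F u (stopped_window u s \<omega>) - Dl s (stopped_window s s \<omega>) 0 * (X_ext u \<omega> - X_ext s \<omega>)\<bar>
      \<le> \<delta> * (\<bar>X_ext u \<omega> - X_ext s \<omega>\<bar> + sqrt e)"
    using remainder_small[OF path[OF w] d] unfolding stopped_window_def by blast
  have "\<bar>unfreeze_rest e s \<omega> / (\<bar>incr e X_ext s \<omega>\<bar> + sqrt e)\<bar> \<le> \<delta>" if e: "0 < e" "e < e0" and s: "s \<in> {0..T}" for e s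
  proof -
    \<comment> \<open>Beyond \<open>T\<close> everything is constant, so \<open>s + e\<close> may be
      replaced by its clamp, to which \<open>remainder_small\<close> applies.\<close>
    define u where "u = max 0 (min (s + e) T)"
    have u: "u \<in> {0..T}" "s \<le> u" "u \<le> s + e" using s e T_pos by (auto simp: u_def)
    have "X_ext (s + e) \<omega> = X_ext u \<omega>" using ext_adapted_clip[OF X_ext w, of "s + e"] by (simp add: u_def)
    then have i: "incr e X_ext s \<omega> = X_ext u \<omega> - X_ext s \<omega>" by (simp add: incr_def)
    have "dirac_coeff s \<omega> = Dl s (stopped_window s s \<omega>) 0" using s by (simp add: dirac_coeff_def)
    then have "\<bar>unfreeze_rest e s \<omega>\<bar> \<le> \<delta> * (\<bar>incr e X_ext s \<omega>\<bar> + sqrt e)"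
      using e0(2)[OF e s u] unfolding unfreeze_rest_def i u_def[symmetric] by simp
    moreover have "\<bar>incr e X_ext s \<omega>\<bar> + sqrt e > 0" using e by (simp add: add_nonneg_pos)
    ultimately show ?thesis by (simp add: pos_divide_le_eq)
  qed
  then show "\<forall>\<^sub>F e in at_right 0. \<forall>s\<in>{0..T}. \<bar>unfreeze_rest e s \<omega> / (\<bar>incr e X_ext s \<omega>\<bar> + sqrt e)\<bar> \<le> \<delta>"
    unfolding eventually_at_right_field using e0(1) by blast
qed

text \<open>The decomposition of \<open>X\<close> is inserted into the first-order term. The last
  summand need not vanish in the covariation; it is the one to be matched with the increment of the
  stochastic integral.\<close>

lemma increment_split:
  assumes w: "\<omega> \<in> space M" and s: "s \<in> {0..T}"
  shows "incr e (ext_proc T value_proc) s \<omega> = frozen_incr e s \<omega> + unfreeze_rest e s \<omega> + dirac_coeff s \<omega> * incr e (ext_proc T orth_part) s \<omega> + dirac_coeff s \<omega> * incr e M_ext s \<omega>"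
proof -
  have "ext_proc T value_proc (s + e) \<omega> = F (max 0 (min (s + e) T)) (stopped_window (max 0 (min (s + e) T)) (max 0 (min (s + e) T)) \<omega>)"
    by (simp add: ext_proc_def value_proc_def window_W)
  moreover have "ext_proc T value_proc s \<omega> = F s (stopped_window s s \<omega>)" using s by (simp add: ext_proc_def value_proc_def window_W)
  ultimately have "incr e (ext_proc T value_proc) s \<omega> = frozen_incr e s \<omega> + unfreeze_rest e s \<omega> + dirac_coeff s \<omega> * incr e X_ext s \<omega>"
    by (simp add: incr_def[of e "ext_proc T value_proc"] frozen_incr_def unfreeze_rest_def)
  moreover have "incr e X_ext s \<omega> = incr e (ext_proc T orth_part) s \<omega> + incr e M_ext s \<omega>" by (simp add: incr_def ext_A)
  ultimately show ?thesis by (simp add: distrib_left)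
qed

lemma functional_weak_dirichlet:
  "\<exists>I. is_stoch_integral M T (\<lambda>s \<omega>. Dl s (window \<tau> T X s \<omega>) 0) Mp I \<and>
       weak_dirichlet_mp M T Fi (\<lambda>t \<omega>. F t (window \<tau> T X t \<omega>)) (\<lambda>t \<omega>. F 0 (window \<tau> T X 0 \<omega>) + I t \<omega>)"
proof -
  obtain I r where I: "ext_adapted I" "\<And>\<omega>. I 0 \<omega> = 0" "filterlim r sequentially sequentially"
    "AE \<omega> in M. \<forall>t. (\<lambda>k. grid_sum dirac_coeff M_ext (r k) t \<omega>) \<longlonglongrightarrow> I t \<omega>"
    by (rule grid_sum_limit[OF Mp dirac_coeff_eproc]) (rule that, assumption+)
  have "is_stoch_integral M T dirac_coeff Mp I" by (rule is_stoch_integral_limit[OF Mp dirac_coeff_eproc I])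
  then have si: "is_stoch_integral M T (\<lambda>s \<omega>. Dl s (window \<tau> T X s \<omega>) 0) Mp I"
    by (rule is_stoch_integral_cong) (rule dirac_coeff_eq)
  have V0: "value_proc 0 \<in> borel_measurable (Fi 0)" by (rule value_proc_meas) (use T_pos in simp)
  have mp: "cont_local_martingale M T Fi (\<lambda>t \<omega>. value_proc 0 \<omega> + I t \<omega>)"
    by (rule integral_local_martingale[OF Mp dirac_coeff_eproc I V0])
  \<comment> \<open>The candidate for the orthogonal part; it starts at 0 because
    \<open>I 0 = 0\<close>.\<close>
  define AA where "AA t \<omega> = value_proc t \<omega> - (value_proc 0 \<omega> + I t \<omega>)" for t \<omega>
  have AA_adapted: "adapted T Fi AA"
    using mp value_proc_meas unfolding adapted_def AA_def cont_local_martingale_def local_martingale_on_def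
    by (auto intro!: borel_measurable_diff)
  have AA_cont: "cont_proc M T AA"
    using value_proc_cont mp unfolding cont_proc_def AA_def cont_local_martingale_def
    by (auto intro: continuous_on_diff)
  have EAA: "ext_adapted (ext_proc T AA)" by (rule ext_adapted_ext[OF AA_cont AA_adapted])
  have tX: "tightP (\<lambda>e. approx_qv e X_ext)" by (rule tight_qv_finite[OF finite_qv X_ext])
  have tM: "tightP (\<lambda>e. approx_qv e M_ext)" by (rule tight_qv_martingale[OF Mp])
  have tA: "tightP (\<lambda>e. approx_qv e (ext_proc T orth_part))"
    by (rule tight_qv_diff[OF ext_adapted_cproc[OF X_ext] tX ext_adapted_cproc[OF M_ext] tM ext_A])
  have "is_covariation M T AA N' (\<lambda>t \<omega>. 0)" if N': "cont_local_martingale M T Fi N'" for N'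
    unfolding is_covariation_def
  proof (intro conjI ballI)
    show "cont_proc M T (\<lambda>t \<omega>. 0)" by (simp add: cont_proc_def)
    fix t assume t: "t \<in> {0..T}"
    let ?E = "ext_proc T N'"
    have E: "ext_adapted ?E" using N' by (intro ext_adapted_ext) (auto simp: cont_local_martingale_def local_martingale_on_def)
    have tE: "tightP (\<lambda>e. approx_qv e ?E)" by (rule tight_qv_martingale[OF N'])
    note c = ext_adapted_cproc[OF E] ext_adapted_cproc[OF EA] ext_adapted_cproc[OF M_ext] ext_adapted_cproc[OF I(1)] ext_adapted_cproc[OF dirac_coeff_eproc] ext_adapted_cproc[OF X_ext]
    have 1: "smallP (\<lambda>e \<omega>. integral {0..t} (\<lambda>s. frozen_incr e s \<omega> * incr e ?E s \<omega> / e))"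
      by (rule adapted_weight_negligible[OF N' t _ frozen_incr_uoP]) (simp add: frozen_incr_meas frozen_incr_cont)
    have 2: "smallP (\<lambda>e \<omega>. integral {0..t} (\<lambda>s. unfreeze_rest e s \<omega> * incr e ?E s \<omega> / e))"
      by (rule remainder_negligible[OF c(1) c(6) t tE tX _ unfreeze_rest_uoP]) (simp add: unfreeze_rest_cont)
    have 3: "smallP (\<lambda>e \<omega>. integral {0..t} (\<lambda>s. dirac_coeff s \<omega> * incr e (ext_proc T orth_part) s \<omega> * incr e ?E s \<omega> / e))"
    proof (rule weighted_covariation_negligible[OF EA E dirac_coeff_eproc t tA tE])
      fix u assume u: "u \<in> {0..T}"
      have "tendsto_in_prob M (\<lambda>e. cov_eps T orth_part N' e u) (\<lambda>\<omega>. 0)"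
        using orth_part_orth N' u unfolding martingale_orthogonal_def is_covariation_def by blast
      from tendsto_oP[OF this] have "smallP (\<lambda>e. cov_eps T orth_part N' e u)" by simp
      then show "smallP (\<lambda>e \<omega>. integral {0..u} (\<lambda>s. incr e (ext_proc T orth_part) s \<omega> * incr e ?E s \<omega> / e))"
        by (rule smallP_mono) (use u in \<open>simp add: cov_eps_integral[OF EA E]\<close>)
    qed
    have 4: "smallP (\<lambda>e \<omega>. integral {0..t} (\<lambda>s. (incr e I s \<omega> - dirac_coeff s \<omega> * incr e M_ext s \<omega>) * incr e ?E s \<omega> / e))"
      by (rule integral_remainder_negligible[OF N' Mp t dirac_coeff_eproc I(1,3,4)])
    \<comment> \<open>The remainder of the stochastic integral enters the increment of
      \<open>AA\<close> with a minus sign.\<close>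
    have 5: "smallP (\<lambda>e \<omega>. - integral {0..t} (\<lambda>s. (incr e I s \<omega> - dirac_coeff s \<omega> * incr e M_ext s \<omega>) * incr e ?E s \<omega> / e))"
      by (rule smallP_mono[OF 4]) simp
    show "tendsto_in_prob M (\<lambda>e. cov_eps T AA N' e t) (\<lambda>\<omega>. 0)"
    proof (rule smallP_tendsto)
      show "\<forall>\<^sub>F e in at_right 0. cov_eps T AA N' e t \<in> borel_measurable M"
        using cov_eps_meas[OF EAA E, of t] t by simp
      show "smallP (\<lambda>e. cov_eps T AA N' e t)"
      proof (rule smallP_mono[OF smallP_add[OF smallP_add[OF smallP_add[OF 1 2] 3] 5]], rule always_eventually, intro allI ballI)
        fix e :: real and \<omega> assume w: "\<omega> \<in> space M"
        have sub: "{0..t} \<subseteq> {0..T}" using t by auto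
        note Zc = continuous_on_subset[OF frozen_incr_cont[OF w, of e] sub] and Rc = continuous_on_subset[OF unfreeze_rest_cont[OF w, of e] sub]
        have i1: "(\<lambda>s. frozen_incr e s \<omega> * incr e ?E s \<omega> / e) integrable_on {0..t}"
          and i2: "(\<lambda>s. unfreeze_rest e s \<omega> * incr e ?E s \<omega> / e) integrable_on {0..t}"
          and i3: "(\<lambda>s. dirac_coeff s \<omega> * incr e (ext_proc T orth_part) s \<omega> * incr e ?E s \<omega> / e) integrable_on {0..t}"
          and i4: "(\<lambda>s. (incr e I s \<omega> - dirac_coeff s \<omega> * incr e M_ext s \<omega>) * incr e ?E s \<omega> / e) integrable_on {0..t}"
          unfolding divide_inverse
          by (intro Icc_integrable continuous_on_mult continuous_on_diff incr_cont cont_adapted_cont c w Zc Rc continuous_on_const)+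
        have "cov_eps T AA N' e t \<omega> = integral {0..t} (\<lambda>s. incr e (ext_proc T AA) s \<omega> * incr e ?E s \<omega> / e)"
          using cov_eps_integral[OF EAA E w] t by simp
        also have "\<dots> = integral {0..t} (\<lambda>s. ((frozen_incr e s \<omega> * incr e ?E s \<omega> / e + unfreeze_rest e s \<omega> * incr e ?E s \<omega> / e) +
            dirac_coeff s \<omega> * incr e (ext_proc T orth_part) s \<omega> * incr e ?E s \<omega> / e) - (incr e I s \<omega> - dirac_coeff s \<omega> * incr e M_ext s \<omega>) * incr e ?E s \<omega> / e)"
        proof (rule Henstock_Kurzweil_Integration.integral_cong)
          fix s assume "s \<in> {0..t}"
          then have s: "s \<in> {0..T}" using sub by auto
          \<comment> \<open>\<open>I\<close> is already an extended process, so the extension of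
            \<open>AA\<close> acts on \<open>value_proc\<close> alone; the initial value is constant
            and cancels in increments.\<close>
          have ei: "ext_proc T AA q \<omega> = ext_proc T value_proc q \<omega> - value_proc 0 \<omega> - I q \<omega>" for q
            using ext_adapted_clip[OF I(1) w, of q] by (simp add: ext_proc_def AA_def)
          have "incr e (ext_proc T AA) s \<omega> = incr e (ext_proc T value_proc) s \<omega> - incr e I s \<omega>"
            by (simp add: incr_def ei)
          then have "incr e (ext_proc T AA) s \<omega> = frozen_incr e s \<omega> + unfreeze_rest e s \<omega> + dirac_coeff s \<omega> * incr e (ext_proc T orth_part) s \<omega> - (incr e I s \<omega> - dirac_coeff s \<omega> * incr e M_ext s \<omega>)"
            using increment_split[OF w s, of e] by simp
          then show "incr e (ext_proc T AA) s \<omega> * incr e ?E s \<omega> / e = ((frozen_incr e s \<omega> * incr e ?E s \<omega> / e + unfreeze_rest e s \<omega> * incr e ?E s \<omega> / e) +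
            dirac_coeff s \<omega> * incr e (ext_proc T orth_part) s \<omega> * incr e ?E s \<omega> / e) - (incr e I s \<omega> - dirac_coeff s \<omega> * incr e M_ext s \<omega>) * incr e ?E s \<omega> / e"
            by (simp only: distrib_right left_diff_distrib add_divide_distrib diff_divide_distrib)
        qed
        also have "\<dots> = ((integral {0..t} (\<lambda>s. frozen_incr e s \<omega> * incr e ?E s \<omega> / e) + integral {0..t} (\<lambda>s. unfreeze_rest e s \<omega> * incr e ?E s \<omega> / e))
            + integral {0..t} (\<lambda>s. dirac_coeff s \<omega> * incr e (ext_proc T orth_part) s \<omega> * incr e ?E s \<omega> / e))
            + - integral {0..t} (\<lambda>s. (incr e I s \<omega> - dirac_coeff s \<omega> * incr e M_ext s \<omega>) * incr e ?E s \<omega> / e)"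
          unfolding integral_diff[OF integrable_add[OF integrable_add[OF i1 i2] i3] i4]
            integral_add[OF integrable_add[OF i1 i2] i3] integral_add[OF i1 i2] by simp
        finally show "\<bar>cov_eps T AA N' e t \<omega>\<bar> \<le> \<bar>((integral {0..t} (\<lambda>s. frozen_incr e s \<omega> * incr e ?E s \<omega> / e) + integral {0..t} (\<lambda>s. unfreeze_rest e s \<omega> * incr e ?E s \<omega> / e))
            + integral {0..t} (\<lambda>s. dirac_coeff s \<omega> * incr e (ext_proc T orth_part) s \<omega> * incr e ?E s \<omega> / e))
            + - integral {0..t} (\<lambda>s. (incr e I s \<omega> - dirac_coeff s \<omega> * incr e M_ext s \<omega>) * incr e ?E s \<omega> / e)\<bar>"
          by simp
      qed
    qed
  qed
  then have "martingale_orthogonal M T Fi AA"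
    unfolding martingale_orthogonal_def using AA_adapted by blast
  then have "weak_dirichlet_mp M T Fi value_proc (\<lambda>t \<omega>. value_proc 0 \<omega> + I t \<omega>)"
    unfolding weak_dirichlet_mp_def using value_proc_cont mp I(2) by (simp add: AA_def[abs_def])
  then show ?thesis using si unfolding value_proc_def[abs_def] by blast
qed

end

theorem theorem5p12:
  fixes M :: "'a measure" and Fi :: "real \<Rightarrow> 'a measure" and T \<tau> :: real
    and N :: nat and a :: "nat \<Rightarrow> real"
    and X Mp :: "real \<Rightarrow> 'a \<Rightarrow> real"
    and F :: "real \<Rightarrow> (real \<Rightarrow>\<^sub>C real) \<Rightarrow> real"
    and Dl :: "real \<Rightarrow> (real \<Rightarrow>\<^sub>C real) \<Rightarrow> nat \<Rightarrow> real"
    and Dg :: "real \<Rightarrow> (real \<Rightarrow>\<^sub>C real) \<Rightarrow> real \<Rightarrow> real"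
  assumes "prob_space M"
    and "T > 0"
    and "usual_filtration M T Fi"
    and "\<tau> > 0"
    and "a 0 = 0" and "a N = - \<tau>" and "\<forall>i<N. a (Suc i) < a i"
    and "weak_dirichlet_mp M T Fi X Mp"
    and "finite_quadratic_variation M T X"
    and "continuous_on ({0..T} \<times> Cpath \<tau>) (\<lambda>(t, \<eta>). F t \<eta>)"
    and "\<forall>t\<in>{0..T}. \<forall>\<eta>\<in>Cpath \<tau>. in_L2 \<tau> (Dg t \<eta>) \<and>
           (F t has_derivative Da_L2_apply \<tau> N a (Dl t \<eta>) (Dg t \<eta>)) (at \<eta> within Cpath \<tau>)"
    and "\<forall>t\<in>{0..T}. \<forall>\<eta>\<in>Cpath \<tau>. \<forall>e>0. \<exists>d>0. \<forall>t'\<in>{0..T}. \<forall>\<eta>'\<in>Cpath \<tau>.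
           \<bar>t' - t\<bar> < d \<and> dist \<eta>' \<eta> < d \<longrightarrow>
           Da_L2_dist2 \<tau> N (Dl t' \<eta>') (Dg t' \<eta>') (Dl t \<eta>) (Dg t \<eta>) < e\<^sup>2"
  shows "\<exists>I. is_stoch_integral M T (\<lambda>s \<omega>. Dl s (window \<tau> T X s \<omega>) 0) Mp I \<and>
             weak_dirichlet_mp M T Fi (\<lambda>t \<omega>. F t (window \<tau> T X t \<omega>))
               (\<lambda>t \<omega>. F 0 (window \<tau> T X 0 \<omega>) + I t \<omega>)"
proof -
  interpret prob_space M by fact
  interpret window_functional M Fi T \<tau> N a F Dl Dg X Mp
    by unfold_locales (fact assms)+
  show ?thesis by (rule functional_weak_dirichlet)
qed

end
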